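(* Let $\mathfrak{g}$ be a finite dimensional Lie algebra over a field $K$, let $U=U(\mathfrak{g})$ be its universal enveloping algebra, and let $D=D(\mathfrak{g})=\mathrm{Frac}(U)$ be its quotient division algebra. Then $D\otimes D^o\simeq D\otimes D$ is a Noetherian domain, and so the following hold for every $\Delta=\{\delta_1,\ldots,\delta_t\}$ which is either a finite set of commuting $K$-derivations or a finite set of commuting $K$-automorphisms of $D$: 1. $D$ satisfies the ascending chain condition on division $K$-subalgebras, or equivalently, every division $K$-subalgebra of $D$ is a finitely generated division $K$-algebra. 2. The group of eigenvalues $\mathrm{Ev}(\Delta)$ is a finitely generated abelian group, and so $\mathrm{Ev}(\Delta)=\mathcal{T}\oplus\mathbb{Z}^r$, where $r$ is the rank of $\mathrm{Ev}(\Delta)$ and $\mathcal{T}$ is a finite abelian group. 3. The eigen-algebra $D(\Delta)$ is a Noetherian domain isomorphic to an iterated skew Laurent extension: $D_{\mathcal{T}}:=\bigoplus_{\lambda\in\mathcal{T}}D_\lambda$ is a division algebra of right and left dimension $|\mathcal{T}|$ over the division algebra $D_0$, and $D(\Delta)$ is isomorphic to an iterated skew Laurent extension $D_{\mathcal{T}}[x_1,x_1^{-1};\sigma_1]\cdots[x_r,x_r^{-1};\sigma_r]$. 4. For each subgroup $F$ of $\mathrm{Ev}(\Delta)$, $\mathcal{F}(F):=\bigoplus_{\lambda\in F}D_\lambda$ is a Noetherian domain whose quotient division algebra $\mathrm{Frac}(\mathcal{F}(F))$ is $\Delta$-invariant and satisfies $\mathrm{Ev}(\mathrm{Frac}(\mathcal{F}(F)))=F$;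 any $\Delta$-eigenvector $v\in\mathrm{Frac}(\mathcal{F}(F))_\lambda$ has the form $u^{-1}w$ for some $0\neq u\in D_\mu$, $w\in D_{\lambda+\mu}$, with $\lambda,\mu\in F$.
   Context: Notation: $\otimes=\otimes_K$; "Noetherian" for rings means left and right Noetherian. $A^o$ is the opposite algebra of $A$ (multiplication $a*b=ba$). For a Noetherian domain $A$, $\mathrm{Frac}(A)$ is its quotient division algebra. A division $K$-algebra $E$ is a finitely generated division algebra if there are finitely many elements $x_1,\ldots,x_n\in E$ such that $E$ is the only division $K$-subalgebra of $E$ containing $x_1,\ldots,x_n$. Eigenvalues. In the derivation case $\mathrm{Ev}(\Delta):=\{\lambda\in K^t \mid \delta_i(u)=\lambda_iu,\ i=1,\ldots,t,\ \text{for some } 0\ne u\in D\}$, an additive subgroup of $K^t$. In the automorphism case $\mathrm{Ev}(\Delta):=\{\lambda\in (K^* )^t\mid \delta_i(u)=\lambda_iu,\ i=1,\ldots,t,\ \text{for some } 0\neq u\in D\}$, a multiplicative subgroup of $(K^* )^t$, $K^*=K\setminus\{0\}$; its operation is also written additively, so $\lambda+\mu$ means the componentwise product and $0$ means $(1,\ldots,1)$. For $\lambda\in\mathrm{Ev}(\Delta)$, $D_\lambda:=\{u\in D\mid\delta_i(u)=\lambda_iu,\ i=1,\ldots,t\}$; in particular $D_0$ is the division subalgebra of $\Delta$-constants. The eigen-algebra is $D(\Delta):=\bigoplus_{\lambda\in\mathrm{Ev}(\Delta)}D_\lambda\subseteq D$. For a $\Delta$-invariant division subalgebra $E\subseteq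 D$, $\mathrm{Ev}(E)$ and $E_\lambda$ are defined in the same way with $E$ in place of $D$; $\mathrm{Frac}(\mathcal{F}(F))$ is viewed inside $D$. The rank of an abelian group $G$ is $\dim_{\mathbb{Q}}(\mathbb{Q}\otimes_{\mathbb{Z}}G)$; $\mathcal{T}$ is the torsion subgroup of $\mathrm{Ev}(\Delta)$. For a ring $\Gamma$ and an automorphism $\sigma$ of $\Gamma$, the skew Laurent extension $\Gamma[x,x^{-1};\sigma]$ is generated by $\Gamma$ and $x^{\pm1}$ subject to $x^{\pm1}a=\sigma^{\pm1}(a)x^{\pm1}$ for $a\in\Gamma$ (free as a left $\Gamma$-module on the powers of $x$). Iterated skew Laurent extensions are defined inductively by $A_n=A_{n-1}[x_n,x_n^{-1};\sigma_n]$ with $\sigma_n$ an automorphism of $A_{n-1}$, $A_0=\Gamma$. *)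

theory Defs
  imports
    "HOL-Algebra.Module"
    "HOL-Algebra.IntRing"
    "HOL-Algebra.Weak_Morphisms"
    "HOL-Algebra.Generated_Groups"
    "HOL-Algebra.Product_Groups"
begin

section \<open>Rings and algebras, not necessarily commutative\<close>

text \<open>
  The ideals of HOL-Algebra are two-sided and its domains and fields are commutative, so the
  one-sided and noncommutative notions are introduced here.
\<close>

definition ascending_chain_condition :: "('a set \<Rightarrow> bool) \<Rightarrow> bool" where
  "ascending_chain_condition P \<longleftrightarrow>
     (\<forall>C :: nat \<Rightarrow> 'a set. (\<forall>n. P (C n)) \<and> (\<forall>n. C n \<subseteq> C (Suc n)) \<longrightarrow> (\<exists>N. \<forall>n\<ge>N. C n = C N))"

definition left_ideal :: "'a set \<Rightarrow> ('a, 'b) ring_scheme \<Rightarrow> bool" where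
  "left_ideal I R \<longleftrightarrow> additive_subgroup I R \<and> (\<forall>a\<in>carrier R. \<forall>x\<in>I. a \<otimes>\<^bsub>R\<^esub> x \<in> I)"

definition right_ideal :: "'a set \<Rightarrow> ('a, 'b) ring_scheme \<Rightarrow> bool" where
  "right_ideal I R \<longleftrightarrow> additive_subgroup I R \<and> (\<forall>a\<in>carrier R. \<forall>x\<in>I. x \<otimes>\<^bsub>R\<^esub> a \<in> I)"

definition noeth_domain :: "('a, 'b) ring_scheme \<Rightarrow> bool" where
  "noeth_domain R \<longleftrightarrow> ring R \<and> \<one>\<^bsub>R\<^esub> \<noteq> \<zero>\<^bsub>R\<^esub> \<and>
     (\<forall>a\<in>carrier R. \<forall>b\<in>carrier R. a \<otimes>\<^bsub>R\<^esub> b = \<zero>\<^bsub>R\<^esub> \<longrightarrow> a = \<zero>\<^bsub>R\<^esub> \<or> b = \<zero>\<^bsub>R\<^esub>) \<and>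
     ascending_chain_condition (\<lambda>I. left_ideal I R) \<and>
     ascending_chain_condition (\<lambda>I. right_ideal I R)"

locale assoc_algebra = R?: field K + module K A + A?: ring A for K (structure) and A (structure) +
  assumes smult_mult_left: "\<lbrakk>c \<in> carrier K; x \<in> carrier A; y \<in> carrier A\<rbrakk> \<Longrightarrow>
      c \<odot>\<^bsub>A\<^esub> (x \<otimes>\<^bsub>A\<^esub> y) = (c \<odot>\<^bsub>A\<^esub> x) \<otimes>\<^bsub>A\<^esub> y"
    and smult_mult_right: "\<lbrakk>c \<in> carrier K; x \<in> carrier A; y \<in> carrier A\<rbrakk> \<Longrightarrow>
      c \<odot>\<^bsub>A\<^esub> (x \<otimes>\<^bsub>A\<^esub> y) = x \<otimes>\<^bsub>A\<^esub> (c \<odot>\<^bsub>A\<^esub> y)"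

locale division_algebra = assoc_algebra +
  assumes Units_eq: "Units A = carrier A - {\<zero>\<^bsub>A\<^esub>}"

definition alg_hom ::
    "('k, 'r) ring_scheme \<Rightarrow> ('k, 'a, 'c) module_scheme \<Rightarrow> ('k, 'b, 'd) module_scheme \<Rightarrow> ('a \<Rightarrow> 'b) set"
  where "alg_hom K A B =
     {h \<in> ring_hom A B. \<forall>c\<in>carrier K. \<forall>x\<in>carrier A. h (c \<odot>\<^bsub>A\<^esub> x) = c \<odot>\<^bsub>B\<^esub> h x}"

definition alg_iso ::
    "('k, 'r) ring_scheme \<Rightarrow> ('k, 'a, 'c) module_scheme \<Rightarrow> ('k, 'b, 'd) module_scheme \<Rightarrow> ('a \<Rightarrow> 'b) set"
  where "alg_iso K A B = alg_hom K A B \<inter> ring_iso A B"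

definition division_subalgebra ::
    "('k, 'r) ring_scheme \<Rightarrow> ('k, 'a, 'c) module_scheme \<Rightarrow> 'a set \<Rightarrow> bool"
  where "division_subalgebra K D E \<longleftrightarrow> E \<subseteq> carrier D \<and> division_algebra K (D\<lparr>carrier := E\<rparr>)"

definition fin_gen_division_algebra ::
    "('k, 'r) ring_scheme \<Rightarrow> ('k, 'a, 'c) module_scheme \<Rightarrow> bool"
  where "fin_gen_division_algebra K E \<longleftrightarrow> division_algebra K E \<and>
     (\<exists>X. finite X \<and> X \<subseteq> carrier E \<and>
       (\<forall>E'. division_subalgebra K E E' \<and> X \<subseteq> E' \<longrightarrow> E' = carrier E))"

definition opposite_algebra :: "('k, 'a, 'c) module_scheme \<Rightarrow> ('k, 'a, 'c) module_scheme" where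
  "opposite_algebra A = A\<lparr>monoid.mult := (\<lambda>a b. b \<otimes>\<^bsub>A\<^esub> a)\<rparr>"

text \<open>
  \<open>has_dim S act M n\<close>: \<open>M\<close> is free of rank \<open>n\<close> over the scalars \<open>S\<close> acting through \<open>act\<close>. Left and
  right dimensions over a division subring differ only in the choice of \<open>act\<close>.
\<close>
definition has_dim :: "'s set \<Rightarrow> ('s \<Rightarrow> 'a \<Rightarrow> 'a) \<Rightarrow> ('a, 'b) ring_scheme \<Rightarrow> nat \<Rightarrow> bool" where
  "has_dim S act M n \<longleftrightarrow> (\<exists>B. finite B \<and> card B = n \<and> B \<subseteq> carrier M \<and>
     (\<forall>x\<in>carrier M. \<exists>!c. c \<in> B \<rightarrow>\<^sub>E S \<and> x = (\<Oplus>\<^bsub>M\<^esub>b\<in>B. act (c b) b)))"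

text \<open>
  \<open>quotient_division_algebra K A Q \<iota>\<close>: the embedding \<open>\<iota>\<close> makes \<open>Q\<close> the quotient division algebra
  (two-sided ring of fractions) of \<open>A\<close>. It is unique up to isomorphism over \<open>A\<close>.
\<close>
definition quotient_division_algebra ::
    "('k, 'r) ring_scheme \<Rightarrow> ('k, 'a, 'c) module_scheme \<Rightarrow> ('k, 'q, 'd) module_scheme \<Rightarrow> ('a \<Rightarrow> 'q) \<Rightarrow> bool"
  where "quotient_division_algebra K A Q \<iota> \<longleftrightarrow>
     division_algebra K Q \<and> \<iota> \<in> alg_hom K A Q \<and> inj_on \<iota> (carrier A) \<and>
     carrier Q = {inv\<^bsub>Q\<^esub> (\<iota> u) \<otimes>\<^bsub>Q\<^esub> \<iota> w | u w. u \<in> carrier A \<and> u \<noteq> \<zero>\<^bsub>A\<^esub> \<and> w \<in> carrier A} \<and>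
     carrier Q = {\<iota> w \<otimes>\<^bsub>Q\<^esub> inv\<^bsub>Q\<^esub> (\<iota> u) | u w. u \<in> carrier A \<and> u \<noteq> \<zero>\<^bsub>A\<^esub> \<and> w \<in> carrier A}"

definition fractions_in :: "('k, 'a, 'c) module_scheme \<Rightarrow> 'a set \<Rightarrow> 'a set" where
  "fractions_in D R = {inv\<^bsub>D\<^esub> u \<otimes>\<^bsub>D\<^esub> w | u w. u \<in> R \<and> u \<noteq> \<zero>\<^bsub>D\<^esub> \<and> w \<in> R}"

section \<open>Free constructions and quotients\<close>

text \<open>
  The monoid algebra \<open>K[M]\<close>: finitely supported functions with convolution. Over the monoid of words
  it is the free algebra. Its additive structure and scalars do not depend on the operations of \<open>M\<close>
  and are those of the free \<open>K\<close>-module on \<open>carrier M\<close>.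
\<close>
definition monoid_algebra ::
    "('k, 'r) ring_scheme \<Rightarrow> ('m, 'c) monoid_scheme \<Rightarrow> ('k, 'm \<Rightarrow> 'k) module"
  where "monoid_algebra K M =
    \<lparr> carrier = {f. finite {m. f m \<noteq> \<zero>\<^bsub>K\<^esub>} \<and> (\<forall>m. f m \<in> carrier K) \<and> (\<forall>m. m \<notin> carrier M \<longrightarrow> f m = \<zero>\<^bsub>K\<^esub>)},
      monoid.mult = (\<lambda>f g m. \<Oplus>\<^bsub>K\<^esub>p\<in>{(a, b). f a \<noteq> \<zero>\<^bsub>K\<^esub> \<and> g b \<noteq> \<zero>\<^bsub>K\<^esub> \<and> a \<otimes>\<^bsub>M\<^esub> b = m}. f (fst p) \<otimes>\<^bsub>K\<^esub> g (snd p)),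
      one = (\<lambda>m. if m = \<one>\<^bsub>M\<^esub> then \<one>\<^bsub>K\<^esub> else \<zero>\<^bsub>K\<^esub>),
      zero = (\<lambda>m. \<zero>\<^bsub>K\<^esub>),
      add = (\<lambda>f g m. f m \<oplus>\<^bsub>K\<^esub> g m),
      smult = (\<lambda>c f m. c \<otimes>\<^bsub>K\<^esub> f m) \<rparr>"

definition basis_vec :: "('k, 'r) ring_scheme \<Rightarrow> 'm \<Rightarrow> 'm \<Rightarrow> 'k" where
  "basis_vec K m = (\<lambda>x. if x = m then \<one>\<^bsub>K\<^esub> else \<zero>\<^bsub>K\<^esub>)"

definition quot_algebra :: "('k, 'a, 'c) module_scheme \<Rightarrow> 'a set \<Rightarrow> ('k, 'a set) module" where
  "quot_algebra A I = ring.extend (A Quot I)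
     (module.fields (\<lambda>c X. \<Union>x\<in>X. I +>\<^bsub>A\<^esub> (c \<odot>\<^bsub>A\<^esub> x)))"

definition submodule_span :: "('k, 'r) ring_scheme \<Rightarrow> ('k, 'a, 'c) module_scheme \<Rightarrow> 'a set \<Rightarrow> 'a set" where
  "submodule_span R M S = \<Inter>{N. submodule N R M \<and> S \<subseteq> N}"

subsection \<open>Tensor products\<close>

definition tensor_relations ::
    "('k, 'r) ring_scheme \<Rightarrow> ('k, 'a, 'c) module_scheme \<Rightarrow> ('k, 'b, 'd) module_scheme \<Rightarrow> ('a \<times> 'b \<Rightarrow> 'k) set"
  where "tensor_relations R A B =
    (let F = monoid_algebra R (A \<times>\<times> B); e = basis_vec R in
       {e (a \<oplus>\<^bsub>A\<^esub> a', b) \<ominus>\<^bsub>F\<^esub> (e (a, b) \<oplus>\<^bsub>F\<^esub> e (a', b)) | a a' b.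
          a \<in> carrier A \<and> a' \<in> carrier A \<and> b \<in> carrier B} \<union>
       {e (a, b \<oplus>\<^bsub>B\<^esub> b') \<ominus>\<^bsub>F\<^esub> (e (a, b) \<oplus>\<^bsub>F\<^esub> e (a, b')) | a b b'.
          a \<in> carrier A \<and> b \<in> carrier B \<and> b' \<in> carrier B} \<union>
       {e (c \<odot>\<^bsub>A\<^esub> a, b) \<ominus>\<^bsub>F\<^esub> (c \<odot>\<^bsub>F\<^esub> e (a, b)) | c a b.
          c \<in> carrier R \<and> a \<in> carrier A \<and> b \<in> carrier B} \<union>
       {e (a, c \<odot>\<^bsub>B\<^esub> b) \<ominus>\<^bsub>F\<^esub> (c \<odot>\<^bsub>F\<^esub> e (a, b)) | c a b.
          c \<in> carrier R \<and> a \<in> carrier A \<and> b \<in> carrier B})"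

text \<open>
  The module \<open>A \<otimes>\<^sub>R B\<close>, the free module on pairs modulo bilinearity. If \<open>A\<close> and \<open>B\<close> are algebras, the
  convolution on \<open>R[A \<times> B]\<close> satisfies \<open>e(a,b) e(a',b') = e(a a', b b')\<close>, the span of the
  relations is a two-sided ideal, and \<open>tensor_product\<close> carries the usual algebra structure. If they
  are merely modules, its multiplicative fields are meaningless.
\<close>
definition tensor_product ::
    "('k, 'r) ring_scheme \<Rightarrow> ('k, 'a, 'c) module_scheme \<Rightarrow> ('k, 'b, 'd) module_scheme
       \<Rightarrow> ('k, ('a \<times> 'b \<Rightarrow> 'k) set) module"
  where "tensor_product R A B =
    quot_algebra (monoid_algebra R (A \<times>\<times> B))
      (submodule_span R (monoid_algebra R (A \<times>\<times> B)) (tensor_relations R A B))"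

subsection \<open>Universal enveloping algebras\<close>

locale lie_algebra = R?: field K + module K L for K (structure) and L (structure) +
  fixes br :: "'c \<Rightarrow> 'c \<Rightarrow> 'c"
  assumes br_closed: "\<lbrakk>x \<in> carrier L; y \<in> carrier L\<rbrakk> \<Longrightarrow> br x y \<in> carrier L"
    and br_add_left: "\<lbrakk>x \<in> carrier L; y \<in> carrier L; z \<in> carrier L\<rbrakk> \<Longrightarrow>
      br (x \<oplus>\<^bsub>L\<^esub> y) z = br x z \<oplus>\<^bsub>L\<^esub> br y z"
    and br_add_right: "\<lbrakk>x \<in> carrier L; y \<in> carrier L; z \<in> carrier L\<rbrakk> \<Longrightarrow>
      br x (y \<oplus>\<^bsub>L\<^esub> z) = br x y \<oplus>\<^bsub>L\<^esub> br x z"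
    and br_smult_left: "\<lbrakk>c \<in> carrier K; x \<in> carrier L; y \<in> carrier L\<rbrakk> \<Longrightarrow>
      br (c \<odot>\<^bsub>L\<^esub> x) y = c \<odot>\<^bsub>L\<^esub> br x y"
    and br_smult_right: "\<lbrakk>c \<in> carrier K; x \<in> carrier L; y \<in> carrier L\<rbrakk> \<Longrightarrow>
      br x (c \<odot>\<^bsub>L\<^esub> y) = c \<odot>\<^bsub>L\<^esub> br x y"
    and br_self: "x \<in> carrier L \<Longrightarrow> br x x = \<zero>\<^bsub>L\<^esub>"
    and jacobi: "\<lbrakk>x \<in> carrier L; y \<in> carrier L; z \<in> carrier L\<rbrakk> \<Longrightarrow>
      br x (br y z) \<oplus>\<^bsub>L\<^esub> br y (br z x) \<oplus>\<^bsub>L\<^esub> br z (br x y) = \<zero>\<^bsub>L\<^esub>"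

definition word_monoid :: "'a set \<Rightarrow> 'a list monoid" where
  "word_monoid S = \<lparr> carrier = lists S, monoid.mult = (@), one = [] \<rparr>"

text \<open>The tensor algebra \<open>T(V)\<close>, as the free algebra on the set \<open>V\<close> modulo the linear relations of \<open>V\<close>.\<close>
definition free_linear_relations ::
    "('k, 'r) ring_scheme \<Rightarrow> ('k, 'a, 'c) module_scheme \<Rightarrow> ('a list \<Rightarrow> 'k) set"
  where "free_linear_relations K V =
    (let F = monoid_algebra K (word_monoid (carrier V)); e = (\<lambda>x. basis_vec K [x]) in
       {e (x \<oplus>\<^bsub>V\<^esub> y) \<ominus>\<^bsub>F\<^esub> (e x \<oplus>\<^bsub>F\<^esub> e y) | x y. x \<in> carrier V \<and> y \<in> carrier V} \<union>
       {e (c \<odot>\<^bsub>V\<^esub> x) \<ominus>\<^bsub>F\<^esub> (c \<odot>\<^bsub>F\<^esub> e x) | c x. c \<in> carrier K \<and> x \<in> carrier V})"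

definition tensor_algebra ::
    "('k, 'r) ring_scheme \<Rightarrow> ('k, 'a, 'c) module_scheme \<Rightarrow> ('k, ('a list \<Rightarrow> 'k) set) module"
  where "tensor_algebra K V =
    (let F = monoid_algebra K (word_monoid (carrier V)) in
       quot_algebra F (Idl\<^bsub>F\<^esub> (free_linear_relations K V)))"

definition tensor_algebra_incl ::
    "('k, 'r) ring_scheme \<Rightarrow> ('k, 'a, 'c) module_scheme \<Rightarrow> 'a \<Rightarrow> ('a list \<Rightarrow> 'k) set"
  where "tensor_algebra_incl K V x =
    (let F = monoid_algebra K (word_monoid (carrier V)) in
       Idl\<^bsub>F\<^esub> (free_linear_relations K V) +>\<^bsub>F\<^esub> basis_vec K [x])"

definition enveloping_algebra ::
    "('k, 'r) ring_scheme \<Rightarrow> ('k, 'a, 'c) module_scheme \<Rightarrow> ('a \<Rightarrow> 'a \<Rightarrow> 'a)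
       \<Rightarrow> ('k, ('a list \<Rightarrow> 'k) set set) module"
  where "enveloping_algebra K L br =
    (let T = tensor_algebra K L; i = tensor_algebra_incl K L in
       quot_algebra T (Idl\<^bsub>T\<^esub>
         {(i x \<otimes>\<^bsub>T\<^esub> i y \<ominus>\<^bsub>T\<^esub> i y \<otimes>\<^bsub>T\<^esub> i x) \<ominus>\<^bsub>T\<^esub> i (br x y) | x y. x \<in> carrier L \<and> y \<in> carrier L}))"

section \<open>Iterated skew Laurent extensions\<close>

text \<open>Integer powers of a bijection of the set \<open>S\<close>.\<close>
definition int_funpow :: "'a set \<Rightarrow> ('a \<Rightarrow> 'a) \<Rightarrow> int \<Rightarrow> 'a \<Rightarrow> 'a" where
  "int_funpow S \<sigma> i = (if 0 \<le> i then \<sigma> ^^ nat i else inv_into S \<sigma> ^^ nat (- i))"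

text \<open>\<open>R[x, x\<^sup>-\<^sup>1; \<sigma>]\<close>; the function \<open>f\<close> stands for \<open>\<Sum>\<^sub>i f(i) x\<^sup>i\<close>, and \<open>x\<^sup>i a = \<sigma>\<^sup>i(a) x\<^sup>i\<close>.\<close>
definition skew_laurent :: "('a, 'b) ring_scheme \<Rightarrow> ('a \<Rightarrow> 'a) \<Rightarrow> (int \<Rightarrow> 'a) ring" where
  "skew_laurent R \<sigma> =
    \<lparr> carrier = {f. finite {i. f i \<noteq> \<zero>\<^bsub>R\<^esub>} \<and> (\<forall>i. f i \<in> carrier R)},
      monoid.mult = (\<lambda>f g k. \<Oplus>\<^bsub>R\<^esub>i\<in>{i. f i \<noteq> \<zero>\<^bsub>R\<^esub>}. f i \<otimes>\<^bsub>R\<^esub> int_funpow (carrier R) \<sigma> i (g (k - i))),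
      one = (\<lambda>k. if k = 0 then \<one>\<^bsub>R\<^esub> else \<zero>\<^bsub>R\<^esub>),
      zero = (\<lambda>k. \<zero>\<^bsub>R\<^esub>),
      add = (\<lambda>f g k. f k \<oplus>\<^bsub>R\<^esub> g k) \<rparr>"

text \<open>
  Uncurrying keeps all stages of the iteration in one type: an element of stage \<open>n\<close> is determined by
  its values on exponent lists of length \<open>n\<close>, the head being the exponent of the last variable.
\<close>
definition uncurry_exponent :: "(int \<Rightarrow> int list \<Rightarrow> 'a) \<Rightarrow> int list \<Rightarrow> 'a" where
  "uncurry_exponent f = (\<lambda>l. case l of [] \<Rightarrow> undefined | i # is \<Rightarrow> f i is)"

primrec iterated_skew_laurent ::
    "('a, 'b) ring_scheme \<Rightarrow> (nat \<Rightarrow> (int list \<Rightarrow> 'a) \<Rightarrow> int list \<Rightarrow> 'a) \<Rightarrow> nat \<Rightarrow> (int list \<Rightarrow> 'a) ring"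
  where
    "iterated_skew_laurent \<Gamma> \<sigma> 0 = image_ring (\<lambda>a l. a) \<Gamma>"
  | "iterated_skew_laurent \<Gamma> \<sigma> (Suc n) =
       image_ring uncurry_exponent (skew_laurent (iterated_skew_laurent \<Gamma> \<sigma> n) (\<sigma> n))"

text \<open>The embedding of the coefficient ring \<open>\<Gamma>\<close> into stage \<open>n\<close>.\<close>
primrec iterated_skew_laurent_const ::
    "('a, 'b) ring_scheme \<Rightarrow> (nat \<Rightarrow> (int list \<Rightarrow> 'a) \<Rightarrow> int list \<Rightarrow> 'a) \<Rightarrow> nat \<Rightarrow> 'a \<Rightarrow> int list \<Rightarrow> 'a"
  where
    "iterated_skew_laurent_const \<Gamma> \<sigma> 0 a = (\<lambda>l. a)"
  | "iterated_skew_laurent_const \<Gamma> \<sigma> (Suc n) a =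
       uncurry_exponent (\<lambda>k. if k = 0 then iterated_skew_laurent_const \<Gamma> \<sigma> n a
                             else \<zero>\<^bsub>iterated_skew_laurent \<Gamma> \<sigma> n\<^esub>)"

section \<open>Abelian groups\<close>

definition torsion_part :: "('a, 'b) monoid_scheme \<Rightarrow> 'a set" where
  "torsion_part G = {x \<in> carrier G. \<exists>n::nat. 0 < n \<and> x [^]\<^bsub>G\<^esub> n = \<one>\<^bsub>G\<^esub>}"

definition fin_gen_group :: "('a, 'b) monoid_scheme \<Rightarrow> bool" where
  "fin_gen_group G \<longleftrightarrow> (\<exists>X. finite X \<and> X \<subseteq> carrier G \<and> generate G X = carrier G)"

definition rat_int_module :: "(int, rat) module" where
  "rat_int_module = \<lparr> carrier = UNIV, monoid.mult = (*), one = 1, zero = 0, add = (+),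
     smult = (\<lambda>n q. of_int n * q) \<rparr>"

text \<open>An abelian group, written multiplicatively, as a \<open>\<int>\<close>-module; \<open>mult\<close> and \<open>one\<close> are irrelevant.\<close>
definition group_int_module :: "('a, 'b) monoid_scheme \<Rightarrow> (int, 'a) module" where
  "group_int_module G = \<lparr> carrier = carrier G, monoid.mult = undefined, one = undefined,
     zero = \<one>\<^bsub>G\<^esub>, add = (\<otimes>\<^bsub>G\<^esub>), smult = (\<lambda>n x. x [^]\<^bsub>G\<^esub> n) \<rparr>"

definition rationalization :: "('a, 'b) monoid_scheme \<Rightarrow> (int, (rat \<times> 'a \<Rightarrow> int) set) module" where
  "rationalization G = tensor_product int_ring rat_int_module (group_int_module G)"

text \<open>
  The scalar action of \<open>\<rat>\<close> on \<open>\<rat> \<otimes>\<^sub>\<int> G\<close>, \<open>q (p \<otimes> g) = (q p) \<otimes> g\<close>, computed on representatives; the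
  zero of the quotient is the submodule of relations.
\<close>
definition rationalization_smult ::
    "('a, 'b) monoid_scheme \<Rightarrow> rat \<Rightarrow> (rat \<times> 'a \<Rightarrow> int) set \<Rightarrow> (rat \<times> 'a \<Rightarrow> int) set"
  where "rationalization_smult G q X =
    (\<Union>f\<in>X. \<zero>\<^bsub>rationalization G\<^esub> +>\<^bsub>monoid_algebra int_ring (rat_int_module \<times>\<times> group_int_module G)\<^esub>
       (\<lambda>(p, g). \<Sum>p'\<in>{p'. q * p' = p \<and> f (p', g) \<noteq> 0}. f (p', g)))"

definition has_rank :: "('a, 'b) monoid_scheme \<Rightarrow> nat \<Rightarrow> bool" where
  "has_rank G r \<longleftrightarrow> has_dim UNIV (rationalization_smult G) (rationalization G) r"

section \<open>Derivations, automorphisms and their eigenvalues\<close>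

definition K_derivation :: "('k, 'r) ring_scheme \<Rightarrow> ('k, 'a, 'c) module_scheme \<Rightarrow> ('a \<Rightarrow> 'a) \<Rightarrow> bool" where
  "K_derivation K D d \<longleftrightarrow> d \<in> carrier D \<rightarrow> carrier D \<and>
     (\<forall>x\<in>carrier D. \<forall>y\<in>carrier D. d (x \<oplus>\<^bsub>D\<^esub> y) = d x \<oplus>\<^bsub>D\<^esub> d y) \<and>
     (\<forall>c\<in>carrier K. \<forall>x\<in>carrier D. d (c \<odot>\<^bsub>D\<^esub> x) = c \<odot>\<^bsub>D\<^esub> d x) \<and>
     (\<forall>x\<in>carrier D. \<forall>y\<in>carrier D. d (x \<otimes>\<^bsub>D\<^esub> y) = d x \<otimes>\<^bsub>D\<^esub> y \<oplus>\<^bsub>D\<^esub> x \<otimes>\<^bsub>D\<^esub> d y)"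

text \<open>
  The ambient groups \<open>K\<^sup>t\<close> and \<open>(K\<^sup>*)\<^sup>t\<close> of the eigenvalues; the indices run over \<open>{..<t}\<close> and both groups
  are written multiplicatively, as everywhere in HOL-Algebra. An eigenvalue group is one of them
  with its carrier restricted.
\<close>
definition additive_weights :: "('k, 'r) ring_scheme \<Rightarrow> nat \<Rightarrow> (nat \<Rightarrow> 'k) monoid" where
  "additive_weights K t = product_group {..<t} (\<lambda>_. add_monoid K)"

definition multiplicative_weights :: "('k, 'r) ring_scheme \<Rightarrow> nat \<Rightarrow> (nat \<Rightarrow> 'k) monoid" where
  "multiplicative_weights K t = product_group {..<t} (\<lambda>_. units_of K)"

definition eigenspace ::
    "('k, 'a, 'c) module_scheme \<Rightarrow> nat \<Rightarrow> (nat \<Rightarrow> 'a \<Rightarrow> 'a) \<Rightarrow> 'a set \<Rightarrow> (nat \<Rightarrow> 'k) \<Rightarrow> 'a set"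
  where "eigenspace D t \<delta> E \<mu> = {u \<in> E. \<forall>i<t. \<delta> i u = \<mu> i \<odot>\<^bsub>D\<^esub> u}"

definition eigenvalues ::
    "('k, 'a, 'c) module_scheme \<Rightarrow> nat \<Rightarrow> (nat \<Rightarrow> 'a \<Rightarrow> 'a) \<Rightarrow> (nat \<Rightarrow> 'k) monoid \<Rightarrow> 'a set \<Rightarrow> (nat \<Rightarrow> 'k) set"
  where "eigenvalues D t \<delta> W E = {\<mu> \<in> carrier W. \<exists>u\<in>eigenspace D t \<delta> E \<mu>. u \<noteq> \<zero>\<^bsub>D\<^esub>}"

definition eigen_sum ::
    "('k, 'a, 'c) module_scheme \<Rightarrow> nat \<Rightarrow> (nat \<Rightarrow> 'a \<Rightarrow> 'a) \<Rightarrow> (nat \<Rightarrow> 'k) set \<Rightarrow> 'a set"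
  where "eigen_sum D t \<delta> F =
    {(\<Oplus>\<^bsub>D\<^esub>\<mu>\<in>A. f \<mu>) | A f. finite A \<and> A \<subseteq> F \<and> (\<forall>\<mu>\<in>A. f \<mu> \<in> eigenspace D t \<delta> (carrier D) \<mu>)}"

definition eigen_sum_direct ::
    "('k, 'a, 'c) module_scheme \<Rightarrow> nat \<Rightarrow> (nat \<Rightarrow> 'a \<Rightarrow> 'a) \<Rightarrow> (nat \<Rightarrow> 'k) set \<Rightarrow> bool"
  where "eigen_sum_direct D t \<delta> F \<longleftrightarrow>
    (\<forall>A f. finite A \<and> A \<subseteq> F \<and> (\<forall>\<mu>\<in>A. f \<mu> \<in> eigenspace D t \<delta> (carrier D) \<mu>) \<and>
       (\<Oplus>\<^bsub>D\<^esub>\<mu>\<in>A. f \<mu>) = \<zero>\<^bsub>D\<^esub> \<longrightarrow> (\<forall>\<mu>\<in>A. f \<mu> = \<zero>\<^bsub>D\<^esub>))"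

end

theory Submission
  imports Defs "HOL-Library.Multiset_Order"
begin

text \<open>
  By the Poincare-Birkhoff-Witt theorem, \<open>T = D \<otimes> D\<^sup>o\<close> contains a filtered subring with the ordered monomials
  \<open>1 \<otimes> x\<^sup>M\<close> as a basis over the division algebra \<open>D \<otimes> 1\<close>, and \<open>1 \<otimes> u\<close> is a unit of \<open>T\<close> carrying any given
  element into this subring, for suitable \<open>u \<in> U\<close>. Leading monomials and Dickson's lemma make \<open>T\<close> a Noetherian
  domain. The antiautomorphism \<open>x \<mapsto> -x\<close> of \<open>U\<close> extends to \<open>D\<close>, so \<open>D\<^sup>o \<simeq> D\<close>.

  A division subalgebra of \<open>D\<close> is determined by the left ideal of \<open>T\<close> annihilating the maps linear over it,
  which gives the chain condition on division subalgebras. Eigenvectors with different eigenvalues are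
  independent, so the fractions of \<open>\<F>(F)\<close> have no eigenvalues outside \<open>F\<close>. Hence a strictly ascending chain of
  finitely generated groups \<open>F\<close> would yield one of division subalgebras, and \<open>Ev(\<Delta>)\<close> is finitely generated.
  Conjugation by eigenvectors for a basis of its free part provides the automorphisms of the iterated skew
  Laurent extension.
\<close>

text \<open>The Noetherian argument is made once, for a ring whose monomials multiply up to lower
  terms and normalize a division ring of coefficients. It is used twice: for the tensor product and
  for sums of eigenspaces over a finitely generated group. Invertible coefficients allow every
  leading coefficient to be made 1, so only exponents have to be controlled.

  The obstacle in Poincare-Birkhoff-Witt is that a normal form must not depend on the order of
  straightening. This is a confluence argument: disjoint descents commute, and overlapping ones are
  resolved by the Jacobi identity. The coefficient functionals so obtained live on \<open>U\<close>,
  whereas independence is needed over \<open>D \<otimes> 1\<close> inside the tensor product; they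
  are carried to \<open>D\<close> by linear projections, which exist by Zorn's lemma. The same
  projections later separate division subalgebras.

  Right-handed statements are obtained from left-handed ones, by exchanging the tensor factors or by
  passing to the opposite of a graded division algebra, which is again graded because the group of
  weights is commutative.\<close>

abbreviation (input) mem (infix ".:" 50) where "x .: A \<equiv> x \<in> carrier A"

abbreviation (input) "MA \<equiv> monoid_algebra"
abbreviation (input) "Opp \<equiv> opposite_algebra"
abbreviation (input) "ACC \<equiv> ascending_chain_condition"
abbreviation (input) "bvec \<equiv> basis_vec"

abbreviation (input) sub_structure (infix "on" 70) where "A on X \<equiv> A\<lparr>carrier := X\<rparr>"

syntax (input) "_index" :: "logic \<Rightarrow> index" ("\<^sub>_" [1000] 1000)

abbreviation (input) "car \<equiv> carrier"

section \<open>Monoid algebras and quotients\<close>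

text \<open>Each axiom of \<open>B\<close> is the image of the same axiom of \<open>A\<close>, since
  every element of \<open>B\<close> has a preimage. Nothing is presupposed about \<open>B\<close>;
  this serves for quotients and for opposite algebras.\<close>

lemma module_image:
 assumes A: "module R A"
  and onto: "h ` car A = car B"
  and zero: "h \<zero>\<^sub>A = \<zero>\<^sub>B"
  and add: "!!x y. x .: A ==> y .: A ==> h (x \<oplus>\<^sub>A y) = h x \<oplus>\<^sub>B h y"
  and smult: "!!c x. c .: R ==> x .: A ==> h (c \<odot>\<^sub>A x) = c \<odot>\<^sub>B h x"
 shows "module R B"
proof -
 interpret A: module R A by fact
 have hB: "h x .: B" if "x .: A" for x using onto that by blast
 have pre: "EX x:car A. b = h x" if "b .: B" for b using onto that by blast
 show ?thesis
 proof (rule moduleI)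
  show "cring R" ..
  show "abelian_group B"
  proof (rule abelian_groupI)
   fix x y assume "x .: B" "y .: B"
   then obtain a b where ab: "a .: A" "b .: A" "x = h a" "y = h b" using pre by metis
   show "x \<oplus>\<^sub>B y .: B" using ab by (simp add: add[symmetric] hB)
   show "x \<oplus>\<^sub>B y = y \<oplus>\<^sub>B x" using ab by (simp add: add[symmetric] A.M.a_comm)
   fix z assume "z .: B"
   then obtain c where c: "c .: A" "z = h c" using pre by metis
   show "x \<oplus>\<^sub>B y \<oplus>\<^sub>B z = x \<oplus>\<^sub>B (y \<oplus>\<^sub>B z)"
    using ab c by (simp add: add[symmetric] A.M.a_assoc)
  next
   show "\<zero>\<^sub>B .: B" using hB[of "\<zero>\<^sub>A"] by (simp add: zero)
   fix x assume "x .: B"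
   then obtain a where a: "a .: A" "x = h a" using pre by metis
   show "\<zero>\<^sub>B \<oplus>\<^sub>B x = x" using a by (simp add: zero[symmetric] add[symmetric])
   have "h (\<ominus>\<^sub>A a) \<oplus>\<^sub>B x = \<zero>\<^sub>B" using a by (simp add: zero[symmetric] add[symmetric] A.M.l_neg)
   thus "EX y:car B. y \<oplus>\<^sub>B x = \<zero>\<^sub>B" using hB a by blast
  qed
  fix a x assume a: "a .: R" and "x .: B"
  then obtain u where u: "u .: A" "x = h u" using pre by metis
  show "a \<odot>\<^sub>B x .: B" using a u by (simp add: smult[symmetric] hB)
  fix b assume b: "b .: R"
  show "(a \<oplus>\<^sub>R b) \<odot>\<^sub>B x = a \<odot>\<^sub>B x \<oplus>\<^sub>B b \<odot>\<^sub>B x"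
   using a b u by (simp add: smult[symmetric] add[symmetric] A.smult_l_distr)
  show "a \<otimes>\<^sub>R b \<odot>\<^sub>B x = a \<odot>\<^sub>B (b \<odot>\<^sub>B x)"
   using a b u by (simp add: smult[symmetric] A.smult_assoc1)
 next
  fix a x y assume a: "a .: R" and "x .: B" "y .: B"
  then obtain u v where u: "u .: A" "x = h u" "v .: A" "y = h v" using pre by metis
  show "a \<odot>\<^sub>B (x \<oplus>\<^sub>B y) = a \<odot>\<^sub>B x \<oplus>\<^sub>B a \<odot>\<^sub>B y"
   using a u by (simp add: smult[symmetric] add[symmetric] A.smult_r_distr)
 next
  fix x assume "x .: B"
  then obtain u where u: "u .: A" "x = h u" using pre by metis
  thus "\<one>\<^sub>R \<odot>\<^sub>B x = x" by (simp add: smult[symmetric])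
 qed
qed

lemma assoc_algebra_image:
 assumes A: "assoc_algebra K A"
  and onto: "h ` car A = car B"
  and zero: "h \<zero>\<^sub>A = \<zero>\<^sub>B"
  and one: "h \<one>\<^sub>A = \<one>\<^sub>B"
  and add: "!!x y. x .: A ==> y .: A ==> h (x \<oplus>\<^sub>A y) = h x \<oplus>\<^sub>B h y"
  and smult: "!!c x. c .: K ==> x .: A ==> h (c \<odot>\<^sub>A x) = c \<odot>\<^sub>B h x"
  and mult: "!!x y. x .: A ==> y .: A ==> h (x \<otimes>\<^sub>A y) = h x \<otimes>\<^sub>B h y"
 shows "assoc_algebra K B"
proof -
 interpret A: assoc_algebra K A by fact
 interpret B: module K B
  by (rule module_image[OF A.module_axioms onto zero add smult]) auto
 have hB: "h x .: B" if "x .: A" for x using onto that by blast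
 have pre: "EX x:car A. b = h x" if "b .: B" for b using onto that by blast
 have "ring B"
 proof (rule ringI)
  show "abelian_group B" ..
  show "monoid B"
  proof (rule monoidI)
   show "\<one>\<^sub>B .: B" using hB[of "\<one>\<^sub>A"] by (simp add: one)
   fix x assume "x .: B"
   then obtain a where a: "a .: A" "x = h a" using pre by metis
   show "\<one>\<^sub>B \<otimes>\<^sub>B x = x" "x \<otimes>\<^sub>B \<one>\<^sub>B = x" using a by (simp_all add: one[symmetric] mult[symmetric])
   fix y assume "y .: B"
   then obtain b where b: "b .: A" "y = h b" using pre by metis
   show "x \<otimes>\<^sub>B y .: B" using a b by (simp add: mult[symmetric] hB)
   fix z assume "z .: B"
   then obtain c where c: "c .: A" "z = h c" using pre by metis
   show "x \<otimes>\<^sub>B y \<otimes>\<^sub>B z = x \<otimes>\<^sub>B (y \<otimes>\<^sub>B z)"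
    using a b c by (simp add: mult[symmetric] A.m_assoc)
  qed
  fix x y z assume "x .: B" "y .: B" "z .: B"
  then obtain a b c where "a .: A" "x = h a" "b .: A" "y = h b" "c .: A" "z = h c"
   using pre by metis
  thus "(x \<oplus>\<^sub>B y) \<otimes>\<^sub>B z = x \<otimes>\<^sub>B z \<oplus>\<^sub>B y \<otimes>\<^sub>B z"
   "z \<otimes>\<^sub>B (x \<oplus>\<^sub>B y) = z \<otimes>\<^sub>B x \<oplus>\<^sub>B z \<otimes>\<^sub>B y"
   by (simp_all add: mult[symmetric] add[symmetric] A.A.l_distr A.A.r_distr)
 qed
 then interpret B': ring B .
 show ?thesis
 proof (unfold_locales)
  fix c x y assume c: "c .: K" and "x .: B" "y .: B"
  then obtain a b where ab: "a .: A" "x = h a" "b .: A" "y = h b"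
   using pre by metis
  show "c \<odot>\<^sub>B (x \<otimes>\<^sub>B y) = (c \<odot>\<^sub>B x) \<otimes>\<^sub>B y"
   using c ab by (simp add: mult[symmetric] smult[symmetric] A.smult_mult_left)
  show "c \<odot>\<^sub>B (x \<otimes>\<^sub>B y) = x \<otimes>\<^sub>B (c \<odot>\<^sub>B y)"
   using c ab by (simp add: mult[symmetric] smult[symmetric] A.smult_mult_right)
 qed
qed

section \<open>Free modules and linear extension from a basis\<close>

definition support :: "('k, 'r) ring_scheme => ('m => 'k) => 'm set" where
 "support R f = {m. f m ~= \<zero>\<^sub>R}"

lemma MA_carrier:
 "f .: (MA R M) \<longleftrightarrow>
  finite (support R f) & (ALL m. f m .: R) & support R f <= car M"
 by (auto simp: monoid_algebra_def support_def)

lemma MA_simps: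
 "\<zero>\<^bsub>MA R M\<^esub> = (%m. \<zero>\<^sub>R)"
 "f \<oplus>\<^bsub>MA R M\<^esub> g = (%m. f m \<oplus>\<^sub>R g m)"
 "c \<odot>\<^bsub>MA R M\<^esub> f = (%m. c \<otimes>\<^sub>R f m)"
 "\<one>\<^bsub>MA R M\<^esub> = bvec R \<one>\<^sub>M"
 by (simp_all add: monoid_algebra_def basis_vec_def)

context cring begin

lemma support_add: "f : UNIV \<rightarrow> car R ==> g : UNIV \<rightarrow> car R ==>
 support R (%m. f m \<oplus> g m) <= support R f \<union> support R g"
 by (auto simp: support_def)

lemma support_smult: "c .: R ==> f : UNIV \<rightarrow> car R ==> support R (%m. c \<otimes> f m) <= support R f"
 by (auto simp: support_def)

lemma MA_module: "module R (MA R M)"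
proof (rule moduleI)
 show "cring R" by (rule cring_axioms)
 show "abelian_group (MA R M)"
 proof (rule abelian_groupI)
  fix f g assume fg: "f .: (MA R M)" "g .: (MA R M)"
  thus "f \<oplus>\<^bsub>MA R M\<^esub> g .: (MA R M)"
   using support_add[of f g] by (auto simp: MA_carrier MA_simps dest: finite_subset)
  show "f \<oplus>\<^bsub>MA R M\<^esub> g = g \<oplus>\<^bsub>MA R M\<^esub> f"
   using fg by (auto simp: MA_carrier MA_simps a_comm)
  fix h assume "h .: (MA R M)"
  thus "f \<oplus>\<^bsub>MA R M\<^esub> g \<oplus>\<^bsub>MA R M\<^esub> h =
   f \<oplus>\<^bsub>MA R M\<^esub> (g \<oplus>\<^bsub>MA R M\<^esub> h)"
   using fg by (auto simp: MA_carrier MA_simps a_assoc)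
 next
  show "\<zero>\<^bsub>MA R M\<^esub> .: (MA R M)"
   by (auto simp: MA_carrier MA_simps support_def)
  fix f assume f: "f .: (MA R M)"
  thus "\<zero>\<^bsub>MA R M\<^esub> \<oplus>\<^bsub>MA R M\<^esub> f = f"
   by (auto simp: MA_carrier MA_simps)
  have "(%m. \<ominus> f m) .: (MA R M)"
   using f by (auto simp: MA_carrier support_def elim!: rev_finite_subset)
  moreover have "(%m. \<ominus> f m) \<oplus>\<^bsub>MA R M\<^esub> f = \<zero>\<^bsub>MA R M\<^esub>"
   using f by (auto simp: MA_carrier MA_simps l_neg)
  ultimately show "EX g:car (MA R M). g \<oplus>\<^bsub>MA R M\<^esub> f = \<zero>\<^bsub>MA R M\<^esub>"
   by blast
 qed
 fix c f assume c: "c .: R" and f: "f .: (MA R M)"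
 show "c \<odot>\<^bsub>MA R M\<^esub> f .: (MA R M)"
  using c f support_smult[of c f] by (auto simp: MA_carrier MA_simps dest: finite_subset)
 { fix d assume d: "d .: R"
 show "(c \<oplus> d) \<odot>\<^bsub>MA R M\<^esub> f = c \<odot>\<^bsub>MA R M\<^esub> f \<oplus>\<^bsub>MA R M\<^esub> d \<odot>\<^bsub>MA R M\<^esub> f"
 and "c \<otimes> d \<odot>\<^bsub>MA R M\<^esub> f = c \<odot>\<^bsub>MA R M\<^esub> (d \<odot>\<^bsub>MA R M\<^esub> f)"
  using c d f by (auto simp: MA_carrier MA_simps l_distr m_assoc) }
 { fix g assume g: "g .: (MA R M)"
 show "c \<odot>\<^bsub>MA R M\<^esub> (f \<oplus>\<^bsub>MA R M\<^esub> g) =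
  c \<odot>\<^bsub>MA R M\<^esub> f \<oplus>\<^bsub>MA R M\<^esub> c \<odot>\<^bsub>MA R M\<^esub> g"
  using c g f by (auto simp: MA_carrier MA_simps r_distr) }
next
 fix f assume f: "f .: (MA R M)"
 thus "\<one> \<odot>\<^bsub>MA R M\<^esub> f = f"
  by (auto simp: MA_carrier MA_simps)
qed

lemma bvec_closed [simp]: "m .: M ==> bvec R m .: (MA R M)"
 by (auto simp: MA_carrier support_def basis_vec_def)

text \<open>Induction over a finite set that contains the support, splitting off one point at a
  time. Identities that are linear in \<open>f\<close> thereby reduce to basis vectors.\<close>

lemma MA_induct [consumes 1, case_names zero step]:
 assumes f: "f .: (MA R M)"
  and zero: "P \<zero>\<^bsub>MA R M\<^esub>"
  and step: "!!c m f. c .: R ==> m .: M ==> f .: (MA R M) ==> P f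
   ==> P (c \<odot>\<^bsub>MA R M\<^esub> bvec R m \<oplus>\<^bsub>MA R M\<^esub> f)"
 shows "P f"
proof -
 have "finite A ==> f .: (MA R M) ==> support R f <= A ==> P f" for A f
 proof (induction A arbitrary: f rule: finite_induct)
  case empty
  hence "f = \<zero>\<^bsub>MA R M\<^esub>" by (auto simp: support_def MA_simps)
  thus ?case using zero by simp
 next
  case (insert a A)
  show ?case
  proof (cases "a : support R f")
   case False thus ?thesis using insert by blast
  next
   case True
   let ?g = "%m. if m = a then \<zero> else f m"
   have a: "a .: M" "f a .: R" using True insert.prems by (auto simp: MA_carrier)
   have g: "?g .: (MA R M)" "support R ?g <= A"
    using insert by (auto simp: MA_carrier support_def elim!: rev_finite_subset split: if_splits)
   have "f = f a \<odot>\<^bsub>MA R M\<^esub> bvec R a \<oplus>\<^bsub>MA R M\<^esub> ?g"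
    using insert.prems by (auto simp: MA_simps basis_vec_def MA_carrier)
   thus ?thesis using step[OF a(2,1) g(1) insert.IH[OF g]] by metis
  qed
 qed
 thus ?thesis using f by (auto simp: MA_carrier)
qed

end

definition lin_ext :: "('k, 'r) ring_scheme => ('k, 'a, 'c) module_scheme => ('m => 'a) => ('m => 'k) => 'a" where
 "lin_ext R M phi f = (\<Oplus>\<^sub>M m\<in>support R f. f m \<odot>\<^sub>M phi m)"

context module begin

lemma lin_ext_superset:
 assumes f: "f .: (MA R X)" and phi: "phi : car X \<rightarrow> car M"
  and A: "finite A" "support R f <= A" "A <= car X"
 shows "lin_ext R M phi f = (\<Oplus>\<^sub>M m\<in>A. f m \<odot>\<^sub>M phi m)"
 unfolding lin_ext_def
 using assms by (intro M.add.finprod_mono_neutral_cong_left)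
 (auto simp: MA_carrier Pi_def subset_iff, auto simp: support_def)

lemma lin_ext_closed [simp]:
 assumes f: "f .: (MA R X)" and phi: "phi : car X \<rightarrow> car M"
 shows "lin_ext R M phi f .: M"
 unfolding lin_ext_def using assms by (intro M.finsum_closed) (auto simp: MA_carrier Pi_def subset_iff)

lemma lin_ext_add:
 assumes f: "f .: (MA R X)" and g: "g .: (MA R X)"
  and phi: "phi : car X \<rightarrow> car M"
 shows "lin_ext R M phi (f \<oplus>\<^bsub>MA R X\<^esub> g) = lin_ext R M phi f \<oplus>\<^sub>M lin_ext R M phi g"
proof -
 interpret F: module R "MA R X" by (rule MA_module)
 let ?A = "support R f \<union> support R g"
 have A: "finite ?A" "?A <= car X" using f g by (auto simp: MA_carrier)
 have s: "support R (f \<oplus>\<^bsub>MA R X\<^esub> g) <= ?A"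
  using support_add[of f g] f g by (auto simp: MA_simps MA_carrier)
 have c: "f m .: R" "g m .: R" for m using f g by (auto simp: MA_carrier)
 have phiA: "m : ?A ==> phi m .: M" for m using phi A by blast
 have "lin_ext R M phi (f \<oplus>\<^bsub>MA R X\<^esub> g) = (\<Oplus>\<^sub>M m\<in>?A. (f m \<oplus> g m) \<odot>\<^sub>M phi m)"
  using lin_ext_superset[OF F.M.a_closed[OF f g] phi A(1) s A(2)] by (simp add: MA_simps)
 also have "... = (\<Oplus>\<^sub>M m\<in>?A. f m \<odot>\<^sub>M phi m \<oplus>\<^sub>M g m \<odot>\<^sub>M phi m)"
  using c phiA by (intro M.finsum_cong') (auto simp: smult_l_distr)
 also have "... = (\<Oplus>\<^sub>M m\<in>?A. f m \<odot>\<^sub>M phi m) \<oplus>\<^sub>M (\<Oplus>\<^sub>M m\<in>?A. g m \<odot>\<^sub>M phi m)"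
  using c phiA by (intro M.finsum_addf) auto
 finally show ?thesis using lin_ext_superset[OF f phi A(1) _ A(2)] lin_ext_superset[OF g phi A(1) _ A(2)] by simp
qed

lemma lin_ext_smult:
 assumes f: "f .: (MA R X)" and a: "a .: R"
  and phi: "phi : car X \<rightarrow> car M"
 shows "lin_ext R M phi (a \<odot>\<^bsub>MA R X\<^esub> f) = a \<odot>\<^sub>M lin_ext R M phi f"
proof -
 interpret F: module R "MA R X" by (rule MA_module)
 let ?A = "support R f"
 have A: "finite ?A" "?A <= car X" using f by (auto simp: MA_carrier)
 have s: "support R (a \<odot>\<^bsub>MA R X\<^esub> f) <= ?A"
  using support_smult[of a f] f a by (auto simp: MA_simps MA_carrier)
 have c: "f m .: R" for m using f by (auto simp: MA_carrier)
 have phiA: "m : ?A ==> phi m .: M" for m using phi A by blast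
 have "lin_ext R M phi (a \<odot>\<^bsub>MA R X\<^esub> f) = (\<Oplus>\<^sub>M m\<in>?A. (a \<otimes> f m) \<odot>\<^sub>M phi m)"
  using lin_ext_superset[OF F.smult_closed[OF a f] phi A(1) s A(2)] by (simp add: MA_simps)
 also have "... = (\<Oplus>\<^sub>M m\<in>?A. a \<odot>\<^sub>M (f m \<odot>\<^sub>M phi m))"
  using c phiA a by (intro M.finsum_cong') (auto simp: smult_assoc1)
 also have "... = a \<odot>\<^sub>M (\<Oplus>\<^sub>M m\<in>?A. f m \<odot>\<^sub>M phi m)"
  using c phiA a A(1) by (intro finsum_smult_ldistr[symmetric]) auto
 finally show ?thesis by (simp add: lin_ext_def)
qed

lemma lin_ext_basis:
 fixes X :: "('m, 'z) monoid_scheme"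
 assumes m: "m .: X" and phi: "phi : car X \<rightarrow> car M"
 shows "lin_ext R M phi (bvec R m) = phi m"
proof -
 have "lin_ext R M phi (bvec R m) = (\<Oplus>\<^sub>M k\<in>{m}. bvec R m k \<odot>\<^sub>M phi k)"
  using m phi bvec_closed[OF m] by (intro lin_ext_superset) (auto simp: support_def basis_vec_def)
 also have "... = phi m"
  using m phi M.finsum_insert[of "{}" m "%k. bvec R m k \<odot>\<^sub>M phi k"] by (auto simp: basis_vec_def Pi_def)
 finally show ?thesis .
qed

lemma lin_ext_zero: "lin_ext R M phi \<zero>\<^bsub>MA R X\<^esub> = \<zero>\<^sub>M"
 by (simp add: lin_ext_def support_def MA_simps)

end

lemma (in abelian_group) a_minus_eq_zero_iff:
 "x .: G ==> y .: G ==> x \<ominus> y = \<zero> \<longleftrightarrow> x = y"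
 by (metis a_minus_def add.inv_closed minus_equality minus_minus r_neg)

section \<open>Linear maps, kernels and spans\<close>

definition mod_hom :: "('k, 'r) ring_scheme => ('k, 'a, 'c) module_scheme => ('k, 'b, 'd) module_scheme => ('a => 'b) set"
 where "mod_hom R A B = {h : car A \<rightarrow> car B.
  (ALL x:car A. ALL y:car A. h (x \<oplus>\<^sub>A y) = h x \<oplus>\<^sub>B h y) &
  (ALL c:car R. ALL x:car A. h (c \<odot>\<^sub>A x) = c \<odot>\<^sub>B h x)}"

lemma mod_homI:
 assumes "!!x. x .: A ==> h x .: B"
  "!!x y. x .: A ==> y .: A ==> h (x \<oplus>\<^sub>A y) = h x \<oplus>\<^sub>B h y"
  "!!c x. c .: R ==> x .: A ==> h (c \<odot>\<^sub>A x) = c \<odot>\<^sub>B h x"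
 shows "h : mod_hom R A B"
 using assms by (auto simp: mod_hom_def)

lemma mod_homD:
 assumes "h : mod_hom R A B"
 shows "x .: A ==> h x .: B"
  "x .: A ==> y .: A ==> h (x \<oplus>\<^sub>A y) = h x \<oplus>\<^sub>B h y"
  "c .: R ==> x .: A ==> h (c \<odot>\<^sub>A x) = c \<odot>\<^sub>B h x"
 using assms by (auto simp: mod_hom_def)

lemma mod_hom_zero:
 assumes "module R A" "module R B" and h: "h : mod_hom R A B"
 shows "h \<zero>\<^sub>A = \<zero>\<^sub>B"
proof -
 interpret A: module R A by fact
 interpret B: module R B by fact
 have "h (\<zero>\<^sub>R \<odot>\<^sub>A \<zero>\<^sub>A) = \<zero>\<^sub>R \<odot>\<^sub>B h \<zero>\<^sub>A" by (rule mod_homD(3)[OF h]) auto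
 thus ?thesis using mod_homD(1)[OF h] by simp
qed

lemma mod_hom_minus:
 assumes "module R A" "module R B" and h: "h : mod_hom R A B" and x: "x .: A" "y .: A"
 shows "h (x \<ominus>\<^sub>A y) = h x \<ominus>\<^sub>B h y"
proof -
 interpret A: module R A by fact
 interpret B: module R B by fact
 have "h (\<ominus>\<^sub>A y) \<oplus>\<^sub>B h y = \<zero>\<^sub>B"
  using x mod_homD(2)[OF h, of "\<ominus>\<^sub>A y" y] mod_hom_zero[OF assms(1-3)] by (simp add: A.M.l_neg)
 hence "h (\<ominus>\<^sub>A y) = \<ominus>\<^sub>B h y"
  using mod_homD(1)[OF h] x by (metis A.M.a_inv_closed B.M.minus_equality)
 thus ?thesis using x mod_homD(2)[OF h, of x "\<ominus>\<^sub>A y"] by (simp add: a_minus_def)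
qed

lemma (in module) lin_ext_mod_hom:
 assumes phi: "phi : car X \<rightarrow> car M"
 shows "lin_ext R M phi : mod_hom R (MA R X) M"
 using phi by (intro mod_homI) (auto simp: lin_ext_add lin_ext_smult)

lemma submodule_kernel:
 assumes "module R A" "module R B" and h: "h : mod_hom R A B"
 shows "submodule {x : car A. h x = \<zero>\<^sub>B} R A"
proof -
 interpret A: module R A by fact
 interpret B: module R B by fact
 show ?thesis
 proof (rule A.submoduleI)
  fix a assume a: "a : {x : car A. h x = \<zero>\<^sub>B}"
  thus "\<ominus>\<^sub>A a : {x : car A. h x = \<zero>\<^sub>B}"
   using mod_hom_minus[OF assms, of "\<zero>\<^sub>A" a] mod_hom_zero[OF assms] by (simp add: a_minus_def)
 qed (use mod_homD[OF h] mod_hom_zero[OF assms] in auto)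
qed

lemma (in module) submodule_span_submodule:
 assumes "S <= car M"
 shows "submodule (submodule_span R M S) R M"
proof (rule submoduleI)
 show "submodule_span R M S <= car M"
  unfolding submodule_span_def using carrier_is_submodule assms by blast
qed (auto simp: submodule_span_def submoduleE(3,4,5) subgroup.one_closed[OF submodule.axioms(1), simplified])

lemma submodule_span_minimal: "submodule N R M ==> S <= N ==> submodule_span R M S <= N"
 by (auto simp: submodule_span_def)

lemma submodule_span_superset: "S <= submodule_span R M S"
 by (auto simp: submodule_span_def)

text \<open>Rewriting the convolution over a fixed product of finite sets, with an indicator for the
  condition on the product, frees the index set from the supports; sums for different arguments can
  then be combined termwise.\<close>

lemma (in cring) MA_mult_superset:
 assumes f: "f .: (MA R X)" and g: "g .: (MA R X)"
  and A: "finite A" "support R f <= A" and B: "finite B" "support R g <= B"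
 shows "(f \<otimes>\<^bsub>MA R X\<^esub> g) m =
  (\<Oplus>p\<in>A \<times> B. if fst p \<otimes>\<^sub>X snd p = m then f (fst p) \<otimes> g (snd p) else \<zero>)"
proof -
 have "ALL m. f m .: R" "ALL m. g m .: R" using f g by (auto simp: MA_carrier)
 hence "(\<Oplus>p\<in>{(a, b). f a ~= \<zero> & g b ~= \<zero> & a \<otimes>\<^sub>X b = m}. f (fst p) \<otimes> g (snd p)) =
  (\<Oplus>p\<in>A \<times> B. if fst p \<otimes>\<^sub>X snd p = m then f (fst p) \<otimes> g (snd p) else \<zero>)"
  using A B by (intro add.finprod_mono_neutral_cong_left) (auto simp: support_def)
 thus ?thesis by (simp add: monoid_algebra_def)
qed

section \<open>The convolution ring of a monoid\<close>

locale MA_ring = R?: cring R + X?: monoid X for R (structure) and X (structure)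
begin

abbreviation F where "F == MA R X"

sublocale FM: module R F by (rule MA_module)

lemma fun_closed: "f .: F ==> f m .: R"
 by (auto simp: MA_carrier)

lemma fin_supp: "f .: F ==> finite (support R f)"
 by (auto simp: MA_carrier)

lemma mult_closed:
 assumes f: "f .: F" and g: "g .: F"
 shows "f \<otimes>\<^sub>F g .: F"
proof -
 let ?S = "(%p. fst p \<otimes>\<^sub>X snd p) ` (support R f \<times> support R g)"
 note m = MA_mult_superset[OF f g fin_supp[OF f] subset_refl fin_supp[OF g] subset_refl]
 have "(f \<otimes>\<^sub>F g) m .: R" for m
  unfolding m using f g by (intro R.finsum_closed) (auto simp: fun_closed)
 moreover have "(f \<otimes>\<^sub>F g) m = \<zero>" if "m ~: ?S" for m
  unfolding m using that by (intro R.add.finprod_one_eqI) force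
 hence "support R (f \<otimes>\<^sub>F g) <= ?S" by (auto simp: support_def)
 moreover have "finite ?S" using f g by (auto simp: MA_carrier)
 moreover have "?S <= car X" using f g by (auto simp: MA_carrier intro!: X.m_closed)
 ultimately show ?thesis unfolding MA_carrier by (meson finite_subset order_trans)
qed

lemma mult_add_left:
 assumes f: "f .: F" and f': "f' .: F" and g: "g .: F"
 shows "(f \<oplus>\<^sub>F f') \<otimes>\<^sub>F g = f \<otimes>\<^sub>F g \<oplus>\<^sub>F f' \<otimes>\<^sub>F g"
proof (rule ext)
 fix m
 let ?A = "support R f \<union> support R f'" and ?B = "support R g"
 have A: "finite ?A" "finite ?B" using f f' g by (auto simp: fin_supp)
 have s: "support R (f \<oplus>\<^sub>F f') <= ?A"
  using support_add[of f f'] f f' by (auto simp: MA_simps MA_carrier)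
 note c = fun_closed[OF f] fun_closed[OF f'] fun_closed[OF g]
 have "((f \<oplus>\<^sub>F f') \<otimes>\<^sub>F g) m =
  (\<Oplus>p\<in>?A \<times> ?B. if fst p \<otimes>\<^sub>X snd p = m then (f \<oplus>\<^sub>F f') (fst p) \<otimes> g (snd p) else \<zero>)"
  by (rule MA_mult_superset[OF FM.M.a_closed[OF f f'] g A(1) s A(2) subset_refl])
 also have "... = (\<Oplus>p\<in>?A \<times> ?B. (if fst p \<otimes>\<^sub>X snd p = m then f (fst p) \<otimes> g (snd p) else \<zero>) \<oplus>
  (if fst p \<otimes>\<^sub>X snd p = m then f' (fst p) \<otimes> g (snd p) else \<zero>))"
  by (rule R.finsum_cong') (auto simp: MA_simps c R.l_distr)
 also have "... = (f \<otimes>\<^sub>F g) m \<oplus> (f' \<otimes>\<^sub>F g) m"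
  using MA_mult_superset[OF f g A(1) _ A(2) subset_refl, of m]
   MA_mult_superset[OF f' g A(1) _ A(2) subset_refl, of m]
  by (subst R.finsum_addf) (auto simp: c)
 finally show "((f \<oplus>\<^sub>F f') \<otimes>\<^sub>F g) m = (f \<otimes>\<^sub>F g \<oplus>\<^sub>F f' \<otimes>\<^sub>F g) m"
  by (simp add: MA_simps)
qed

lemma mult_add_right:
 assumes f: "f .: F" and f': "f' .: F" and g: "g .: F"
 shows "g \<otimes>\<^sub>F (f \<oplus>\<^sub>F f') = g \<otimes>\<^sub>F f \<oplus>\<^sub>F g \<otimes>\<^sub>F f'"
proof (rule ext)
 fix m
 let ?A = "support R f \<union> support R f'" and ?B = "support R g"
 have A: "finite ?A" "finite ?B" using f f' g by (auto simp: fin_supp)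
 have s: "support R (f \<oplus>\<^sub>F f') <= ?A"
  using support_add[of f f'] f f' by (auto simp: MA_simps MA_carrier)
 note c = fun_closed[OF f] fun_closed[OF f'] fun_closed[OF g]
 have "(g \<otimes>\<^sub>F (f \<oplus>\<^sub>F f')) m =
  (\<Oplus>p\<in>?B \<times> ?A. if fst p \<otimes>\<^sub>X snd p = m then g (fst p) \<otimes> (f \<oplus>\<^sub>F f') (snd p) else \<zero>)"
  by (rule MA_mult_superset[OF g FM.M.a_closed[OF f f'] A(2) subset_refl A(1) s])
 also have "... = (\<Oplus>p\<in>?B \<times> ?A. (if fst p \<otimes>\<^sub>X snd p = m then g (fst p) \<otimes> f (snd p) else \<zero>) \<oplus>
  (if fst p \<otimes>\<^sub>X snd p = m then g (fst p) \<otimes> f' (snd p) else \<zero>))"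
  by (rule R.finsum_cong') (auto simp: MA_simps c R.r_distr)
 also have "... = (g \<otimes>\<^sub>F f) m \<oplus> (g \<otimes>\<^sub>F f') m"
  using MA_mult_superset[OF g f A(2) subset_refl A(1), of m]
   MA_mult_superset[OF g f' A(2) subset_refl A(1), of m]
  by (subst R.finsum_addf) (auto simp: c)
 finally show "(g \<otimes>\<^sub>F (f \<oplus>\<^sub>F f')) m = (g \<otimes>\<^sub>F f \<oplus>\<^sub>F g \<otimes>\<^sub>F f') m"
  by (simp add: MA_simps)
qed

lemma mult_smult_left:
 assumes f: "f .: F" and g: "g .: F" and c: "c .: R"
 shows "(c \<odot>\<^sub>F f) \<otimes>\<^sub>F g = c \<odot>\<^sub>F (f \<otimes>\<^sub>F g)"
proof (rule ext)
 fix m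
 have s: "support R (c \<odot>\<^sub>F f) <= support R f"
  using support_smult[of c f] f c by (auto simp: MA_simps MA_carrier)
 have "((c \<odot>\<^sub>F f) \<otimes>\<^sub>F g) m = (\<Oplus>p\<in>support R f \<times> support R g.
  if fst p \<otimes>\<^sub>X snd p = m then (c \<odot>\<^sub>F f) (fst p) \<otimes> g (snd p) else \<zero>)"
  by (rule MA_mult_superset[OF FM.smult_closed[OF c f] g fin_supp[OF f] s fin_supp[OF g] subset_refl])
 also have "... = (\<Oplus>p\<in>support R f \<times> support R g.
  c \<otimes> (if fst p \<otimes>\<^sub>X snd p = m then f (fst p) \<otimes> g (snd p) else \<zero>))"
  by (rule R.finsum_cong') (auto simp: MA_simps fun_closed f g c R.m_assoc)
 also have "... = c \<otimes> (f \<otimes>\<^sub>F g) m"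
  by (subst MA_mult_superset[OF f g fin_supp[OF f] subset_refl fin_supp[OF g] subset_refl],
    rule R.finsum_rdistr[symmetric]) (auto simp: f g c fun_closed fin_supp)
 finally show "((c \<odot>\<^sub>F f) \<otimes>\<^sub>F g) m = (c \<odot>\<^sub>F (f \<otimes>\<^sub>F g)) m"
  by (simp add: MA_simps)
qed

lemma mult_smult_right:
 assumes f: "f .: F" and g: "g .: F" and c: "c .: R"
 shows "f \<otimes>\<^sub>F (c \<odot>\<^sub>F g) = c \<odot>\<^sub>F (f \<otimes>\<^sub>F g)"
proof (rule ext)
 fix m
 have s: "support R (c \<odot>\<^sub>F g) <= support R g"
  using support_smult[of c g] g c by (auto simp: MA_simps MA_carrier)
 have "(f \<otimes>\<^sub>F (c \<odot>\<^sub>F g)) m = (\<Oplus>p\<in>support R f \<times> support R g.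
  if fst p \<otimes>\<^sub>X snd p = m then f (fst p) \<otimes> (c \<odot>\<^sub>F g) (snd p) else \<zero>)"
  by (rule MA_mult_superset[OF f FM.smult_closed[OF c g] fin_supp[OF f] subset_refl fin_supp[OF g] s])
 also have "... = (\<Oplus>p\<in>support R f \<times> support R g.
  c \<otimes> (if fst p \<otimes>\<^sub>X snd p = m then f (fst p) \<otimes> g (snd p) else \<zero>))"
  by (rule R.finsum_cong') (auto simp: MA_simps fun_closed f g c R.m_lcomm)
 also have "... = c \<otimes> (f \<otimes>\<^sub>F g) m"
  by (subst MA_mult_superset[OF f g fin_supp[OF f] subset_refl fin_supp[OF g] subset_refl],
    rule R.finsum_rdistr[symmetric]) (auto simp: f g c fun_closed fin_supp)
 finally show "(f \<otimes>\<^sub>F (c \<odot>\<^sub>F g)) m = (c \<odot>\<^sub>F (f \<otimes>\<^sub>F g)) m"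
  by (simp add: MA_simps)
qed

lemma basis_mult:
 assumes a: "a .: X" and b: "b .: X"
 shows "bvec R a \<otimes>\<^sub>F bvec R b = bvec R (a \<otimes>\<^sub>X b)"
proof (rule ext)
 fix m
 have "(bvec R a \<otimes>\<^sub>F bvec R b) m = (\<Oplus>p\<in>{a} \<times> {b}.
  if fst p \<otimes>\<^sub>X snd p = m then bvec R a (fst p) \<otimes> bvec R b (snd p) else \<zero>)"
  using R.bvec_closed[OF a] R.bvec_closed[OF b]
  by (rule MA_mult_superset) (auto simp: support_def basis_vec_def)
 also have "... = bvec R (a \<otimes>\<^sub>X b) m"
  by (simp add: basis_vec_def)
 finally show "(bvec R a \<otimes>\<^sub>F bvec R b) m = bvec R (a \<otimes>\<^sub>X b) m" .
qed

lemmas mult_rules = mult_add_left mult_add_right mult_smult_left mult_smult_right mult_closed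

lemma mult_zero: "f .: F ==> \<zero>\<^sub>F \<otimes>\<^sub>F f = \<zero>\<^sub>F" "f .: F ==> f \<otimes>\<^sub>F \<zero>\<^sub>F = \<zero>\<^sub>F"
proof -
 assume f: "f .: F"
 have "(\<zero> \<odot>\<^sub>F \<zero>\<^sub>F) \<otimes>\<^sub>F f = \<zero>\<^sub>F" using f by (subst mult_smult_left) (auto simp: mult_closed)
 thus "\<zero>\<^sub>F \<otimes>\<^sub>F f = \<zero>\<^sub>F" by simp
 have "f \<otimes>\<^sub>F (\<zero> \<odot>\<^sub>F \<zero>\<^sub>F) = \<zero>\<^sub>F" using f by (subst mult_smult_right) (auto simp: mult_closed)
 thus "f \<otimes>\<^sub>F \<zero>\<^sub>F = \<zero>\<^sub>F" by simp
qed

text \<open>Both sides are linear in each of the three factors, so three nested inductions reduce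
  the claim to basis vectors, where it is associativity of the monoid.\<close>

lemma mult_assoc:
 assumes f: "f .: F" and g: "g .: F" and h: "h .: F"
 shows "(f \<otimes>\<^sub>F g) \<otimes>\<^sub>F h = f \<otimes>\<^sub>F (g \<otimes>\<^sub>F h)"
 using f
proof (induction f rule: MA_induct)
 case zero thus ?case using g h by (simp add: mult_zero mult_closed)
next
 case (step c a f)
 have "(bvec R a \<otimes>\<^sub>F g) \<otimes>\<^sub>F h = bvec R a \<otimes>\<^sub>F (g \<otimes>\<^sub>F h)"
  using g
 proof (induction g rule: MA_induct)
  case zero thus ?case using step h by (simp add: mult_zero mult_closed)
 next
  case (step d b g)
  have "(bvec R a \<otimes>\<^sub>F bvec R b) \<otimes>\<^sub>F h = bvec R a \<otimes>\<^sub>F (bvec R b \<otimes>\<^sub>F h)"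
   using h
  proof (induction h rule: MA_induct)
   case zero thus ?case using \<open>a .: X\<close> \<open>b .: X\<close> by (simp add: mult_zero mult_closed)
  next
   case (step d c h)
   thus ?case using \<open>a .: X\<close> \<open>b .: X\<close> by (simp add: mult_rules basis_mult X.m_assoc)
  qed
  thus ?case using step \<open>a .: X\<close> h by (simp add: mult_rules)
 qed
 thus ?case using step g h by (simp add: mult_rules)
qed

lemma mult_one:
 assumes "f .: F"
 shows "\<one>\<^sub>F \<otimes>\<^sub>F f = f" "f \<otimes>\<^sub>F \<one>\<^sub>F = f"
 using assms
 by (induction f rule: MA_induct)
 (simp_all add: mult_zero mult_rules basis_mult MA_simps(4))

lemma ring_F: "ring F"
 by (rule ringI, rule FM.M.abelian_group_axioms, rule monoidI)
 (auto simp: mult_rules mult_assoc mult_one[unfolded MA_simps] MA_simps(4))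

end

sublocale MA_ring \<subseteq> FR: ring "MA R X" by (rule ring_F)

lemma MA_assoc_algebra:
 assumes "field K" "monoid X"
 shows "assoc_algebra K (MA K X)"
proof -
 interpret K: field K by fact
 interpret X: monoid X by fact
 interpret MA_ring K X by unfold_locales
 show ?thesis by unfold_locales (simp_all add: mult_rules)
qed

lemma lin_ext_mult:
 assumes "assoc_algebra K A" "monoid X" and phi: "phi : hom X A" and phi1: "phi \<one>\<^sub>X = \<one>\<^sub>A"
 shows "lin_ext K A phi : alg_hom K (MA K X) A"
proof -
 interpret A: assoc_algebra K A by fact
 interpret X: monoid X by fact
 interpret MA_ring K X by unfold_locales
 have phic: "phi : car X \<rightarrow> car A" using phi by (auto simp: hom_def)
 note h = mod_homD[OF A.lin_ext_mod_hom[OF phic]]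
 let ?h = "lin_ext K A phi"
 have b: "?h (bvec K a) = phi a" if "a .: X" for a by (rule A.lin_ext_basis[OF that phic])
 have "?h (f \<otimes>\<^sub>F g) = ?h f \<otimes>\<^sub>A ?h g" if f: "f .: F" and g: "g .: F" for f g
  using f
 proof (induction f rule: A.R.MA_induct)
  case zero
  thus ?case using g h by (simp add: mult_zero A.lin_ext_zero)
 next
  case (step c a f)
  have "?h (bvec K a \<otimes>\<^sub>F g) = ?h (bvec K a) \<otimes>\<^sub>A ?h g"
   using g
  proof (induction g rule: A.R.MA_induct)
   case zero
   thus ?case using step h by (simp add: mult_zero A.lin_ext_zero)
  next
   case (step d b g)
   thus ?case using \<open>a .: X\<close> phi
    by (simp add: mult_rules basis_mult h b A.A.r_distr A.smult_mult_right[symmetric] hom_def Pi_def)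
  qed
  thus ?case using step g
   by (simp add: mult_rules h A.A.l_distr A.smult_mult_left[symmetric])
 qed
 moreover have "?h \<one>\<^sub>F = \<one>\<^sub>A" using b[of "\<one>\<^sub>X"] phi1 by (simp add: MA_simps(4))
 ultimately show ?thesis using h by (auto simp: alg_hom_def ring_hom_def)
qed

section \<open>Quotients of modules and algebras, and maps out of them\<close>

lemma quot_algebra_simps:
 "car (quot_algebra A I) = (%x. I +>\<^sub>A x) ` car A"
 "\<zero>\<^bsub>quot_algebra A I\<^esub> = I"
 "\<one>\<^bsub>quot_algebra A I\<^esub> = I +>\<^sub>A \<one>\<^sub>A"
 "X \<oplus>\<^bsub>quot_algebra A I\<^esub> Y = X <+>\<^sub>A Y"
 "X \<otimes>\<^bsub>quot_algebra A I\<^esub> Y = rcoset_mult A I X Y"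
 "c \<odot>\<^bsub>quot_algebra A I\<^esub> X = (\<Union>x\<in>X. I +>\<^sub>A (c \<odot>\<^sub>A x))"
 by (auto simp: quot_algebra_def ring.defs module.defs FactRing_def A_RCOSETS_def RCOSETS_def a_r_coset_def)

locale quot_module = module R M + I?: submodule I R M for I and R (structure) and M (structure)
begin

lemma abelian_subgroup: "abelian_subgroup I M"
 by (rule abelian_subgroupI3)
 (simp_all add: additive_subgroup.intro I.subgroup_axioms M.abelian_group_axioms)

sublocale S: abelian_subgroup I M by (rule abelian_subgroup)

abbreviation "q x == I +>\<^sub>M x"
abbreviation "Q == quot_algebra M I"

lemma q_zero: "q \<zero>\<^sub>M = \<zero>\<^sub>Q"
 by (simp add: quot_algebra_simps S.a_rcos_const)

lemma q_add: "x .: M ==> y .: M ==> q (x \<oplus>\<^sub>M y) = q x \<oplus>\<^sub>Q q y"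
 by (simp add: quot_algebra_simps S.a_rcos_sum)

lemma q_eq_iff: "x .: M ==> y .: M ==> q x = q y \<longleftrightarrow> x \<ominus>\<^sub>M y : I"
 using S.a_rcos_module[of y x] S.a_repr_independence'[of x y] S.a_rcos_self[of x]
 by (auto simp: a_minus_def)

lemma q_mem: "x .: M ==> y : q x \<longleftrightarrow> y .: M & q y = q x"
 by (metis S.a_elemrcos_carrier S.a_rcos_self S.a_repr_independence')

text \<open>Scalar multiplication of a coset is a union over its representatives. As
  \<open>I\<close> is closed under scalars, all members of the union coincide.\<close>

lemma q_smult: "c .: R ==> x .: M ==> q (c \<odot>\<^sub>M x) = c \<odot>\<^sub>Q q x"
proof -
 assume c: "c .: R" and x: "x .: M"
 have "q (c \<odot>\<^sub>M y) = q (c \<odot>\<^sub>M x)" if "y : q x" for y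
 proof -
  have y: "y .: M" "y \<ominus>\<^sub>M x : I" using that x by (auto simp: q_mem q_eq_iff)
  have "c \<odot>\<^sub>M y \<ominus>\<^sub>M c \<odot>\<^sub>M x = c \<odot>\<^sub>M (y \<ominus>\<^sub>M x)"
   using c x y by (simp add: a_minus_def smult_r_distr smult_r_minus)
  thus ?thesis using c x y by (simp add: q_eq_iff I.smult_closed)
 qed
 hence "(\<Union>y\<in>q x. q (c \<odot>\<^sub>M y)) = (\<Union>y\<in>q x. q (c \<odot>\<^sub>M x))" by (rule SUP_cong[OF refl])
 also have "... = q (c \<odot>\<^sub>M x)" using S.a_rcos_self[OF x] by auto
 finally show ?thesis by (simp only: quot_algebra_simps)
qed

lemma q_onto: "q ` car M = car Q"
 by (simp add: quot_algebra_simps)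

lemma module_Q: "module R Q"
 by (rule module_image[OF module_axioms q_onto q_zero q_add q_smult])

lemma q_mod_hom: "(%x. q x) : mod_hom R M Q"
 by (rule mod_homI) (simp_all add: q_add q_smult q_onto[symmetric])

text \<open>An arbitrary representative is taken; by \<open>lift_q\<close> the choice does not
  matter once \<open>h\<close> vanishes on \<open>I\<close>.\<close>

definition lift where "lift h X = h (SOME x. x : X)"

lemma lift_q:
 assumes "module R B" and h: "h : mod_hom R M B" and I: "!!x. x : I ==> h x = \<zero>\<^sub>B"
  and x: "x .: M"
 shows "lift h (q x) = h x"
proof -
 interpret B: module R B by fact
 have "(SOME y. y : q x) : q x" by (rule someI[of _ x]) (rule S.a_rcos_self[OF x])
 then obtain y where y': "lift h (q x) = h y" "y : q x" unfolding lift_def by blast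
 hence y: "lift h (q x) = h y" "y .: M" "y \<ominus>\<^sub>M x : I"
  using x q_mem[OF x, of y] by (auto simp: q_eq_iff)
 have "h y \<ominus>\<^sub>B h x = \<zero>\<^sub>B" using I[OF y(3)] mod_hom_minus[OF module_axioms assms(1) h y(2) x] by simp
 thus ?thesis using y x mod_homD(1)[OF h] by (simp add: B.M.a_minus_eq_zero_iff)
qed

lemma lift_mod_hom:
 assumes "module R B" and h: "h : mod_hom R M B" and I: "!!x. x : I ==> h x = \<zero>\<^sub>B"
 shows "lift h : mod_hom R Q B"
proof (rule mod_homI)
 note l = lift_q[OF assms] and hh = mod_homD[OF h]
 fix X assume "X .: Q"
 then obtain x where x: "x .: M" "X = q x" by (auto simp: q_onto[symmetric])
 show "lift h X .: B" using x by (simp add: l hh)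
 { fix c assume "c .: R"
  thus "lift h (c \<odot>\<^sub>Q X) = c \<odot>\<^sub>B lift h X" using x by (simp add: q_smult[symmetric] l hh) }
 fix Y assume "Y .: Q"
 then obtain y where y: "y .: M" "Y = q y" by (auto simp: q_onto[symmetric])
 show "lift h (X \<oplus>\<^sub>Q Y) = lift h X \<oplus>\<^sub>B lift h Y" using x y by (simp add: q_add[symmetric] l hh)
qed

end

locale quot_assoc_algebra = assoc_algebra K A + ideal I A for I and K (structure) and A (structure)

lemma (in assoc_algebra) ideal_submodule:
 assumes "ideal I A" shows "submodule I K A"
proof -
 interpret I: ideal I A by fact
 show ?thesis
 proof (rule submoduleI)
  fix c x assume c: "c .: K" and x: "x : I"
  have "c \<odot>\<^sub>A x = (c \<odot>\<^sub>A \<one>\<^sub>A) \<otimes>\<^sub>A x" using c x by (simp add: smult_mult_left[symmetric])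
  thus "c \<odot>\<^sub>A x : I" using c x by (simp add: I.I_l_closed)
 qed auto
qed

sublocale quot_assoc_algebra \<subseteq> quot_module I K A
 by (intro quot_module.intro module_axioms ideal_submodule ideal_axioms)

context quot_assoc_algebra begin

lemma q_mult: "x .: A ==> y .: A ==> q (x \<otimes>\<^sub>A y) = q x \<otimes>\<^sub>Q q y"
 by (simp add: quot_algebra_simps rcoset_mult_add)

lemma q_one: "q \<one>\<^sub>A = \<one>\<^sub>Q"
 by (simp add: quot_algebra_simps)

lemma assoc_algebra_Q: "assoc_algebra K Q"
 by (rule assoc_algebra_image[OF assoc_algebra_axioms q_onto q_zero q_one q_add q_smult q_mult])

lemma lift_alg_hom:
 assumes "assoc_algebra K B" and h: "h : alg_hom K A B" and I: "!!x. x : I ==> h x = \<zero>\<^sub>B"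
 shows "lift h : alg_hom K Q B"
proof -
 interpret B: assoc_algebra K B by fact
 have hm: "h : mod_hom K A B" using h by (auto simp: alg_hom_def mod_hom_def ring_hom_def)
 note l = lift_q[OF B.module_axioms hm I] and L = mod_homD[OF lift_mod_hom[OF B.module_axioms hm I]]
 have "lift h (X \<otimes>\<^sub>Q Y) = lift h X \<otimes>\<^sub>B lift h Y" if "X .: Q" "Y .: Q" for X Y
 proof -
  obtain x y where x: "x .: A" "X = q x" "y .: A" "Y = q y"
   using \<open>X .: Q\<close> \<open>Y .: Q\<close> by (auto simp: q_onto[symmetric])
  thus ?thesis using h by (simp add: q_mult[symmetric] l alg_hom_def ring_hom_def)
 qed
 moreover have "lift h \<one>\<^sub>Q = \<one>\<^sub>B"
  using h by (simp add: q_one[symmetric] l alg_hom_def ring_hom_def)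
 ultimately show ?thesis using L by (auto simp: alg_hom_def ring_hom_def)
qed

end

section \<open>Tensor products\<close>

definition pure_tensor ::
  "('k, 'r) ring_scheme => ('k, 'a, 'c) module_scheme => ('k, 'b, 'd) module_scheme => 'a => 'b => ('a \<times> 'b => 'k) set"
 where "pure_tensor R A B a b =
  submodule_span R (MA R (A \<times>\<times> B)) (tensor_relations R A B)
   +>\<^bsub>MA R (A \<times>\<times> B)\<^esub> bvec R (a, b)"

definition bilin ::
  "('k, 'r) ring_scheme => ('k, 'a, 'c) module_scheme => ('k, 'b, 'd) module_scheme => ('k, 'n, 'e) module_scheme => ('a => 'b => 'n) => bool"
 where "bilin R A B N beta \<longleftrightarrow> (ALL b:car B. (%a. beta a b) : mod_hom R A N) & (ALL a:car A. beta a : mod_hom R B N)"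

lemma carrier_DirProd [simp]: "car (A \<times>\<times> B) = car A \<times> car B"
 and mult_DirProd': "x \<otimes>\<^bsub>A \<times>\<times> B\<^esub> y = (fst x \<otimes>\<^sub>A fst y, snd x \<otimes>\<^sub>B snd y)"
 and one_DirProd' [simp]: "\<one>\<^bsub>A \<times>\<times> B\<^esub> = (\<one>\<^sub>A, \<one>\<^sub>B)"
 by (auto simp: DirProd_def split: prod.split)

lemma tensor_relations_cases [consumes 1, case_names add_left add_right smult_left smult_right]:
 assumes "r : tensor_relations R A B"
 obtains a a' b where "a .: A" "a' .: A" "b .: B"
   "r = bvec R (a \<oplus>\<^sub>A a', b) \<ominus>\<^bsub>MA R (A \<times>\<times> B)\<^esub>
    (bvec R (a, b) \<oplus>\<^bsub>MA R (A \<times>\<times> B)\<^esub> bvec R (a', b))"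
 | a b b' where "a .: A" "b .: B" "b' .: B"
   "r = bvec R (a, b \<oplus>\<^sub>B b') \<ominus>\<^bsub>MA R (A \<times>\<times> B)\<^esub>
    (bvec R (a, b) \<oplus>\<^bsub>MA R (A \<times>\<times> B)\<^esub> bvec R (a, b'))"
 | c a b where "c .: R" "a .: A" "b .: B"
   "r = bvec R (c \<odot>\<^sub>A a, b) \<ominus>\<^bsub>MA R (A \<times>\<times> B)\<^esub>
    (c \<odot>\<^bsub>MA R (A \<times>\<times> B)\<^esub> bvec R (a, b))"
 | c a b where "c .: R" "a .: A" "b .: B"
   "r = bvec R (a, c \<odot>\<^sub>B b) \<ominus>\<^bsub>MA R (A \<times>\<times> B)\<^esub>
    (c \<odot>\<^bsub>MA R (A \<times>\<times> B)\<^esub> bvec R (a, b))"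
 using assms unfolding tensor_relations_def Let_def by blast

lemma tensor_relationsI:
 "a .: A ==> a' .: A ==> b .: B ==>
  bvec R (a \<oplus>\<^sub>A a', b) \<ominus>\<^bsub>MA R (A \<times>\<times> B)\<^esub>
    (bvec R (a, b) \<oplus>\<^bsub>MA R (A \<times>\<times> B)\<^esub> bvec R (a', b)) : tensor_relations R A B"
 "a .: A ==> b .: B ==> b' .: B ==>
  bvec R (a, b \<oplus>\<^sub>B b') \<ominus>\<^bsub>MA R (A \<times>\<times> B)\<^esub>
    (bvec R (a, b) \<oplus>\<^bsub>MA R (A \<times>\<times> B)\<^esub> bvec R (a, b')) : tensor_relations R A B"
 "c .: R ==> a .: A ==> b .: B ==>
  bvec R (c \<odot>\<^sub>A a, b) \<ominus>\<^bsub>MA R (A \<times>\<times> B)\<^esub>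
    (c \<odot>\<^bsub>MA R (A \<times>\<times> B)\<^esub> bvec R (a, b)) : tensor_relations R A B"
 "c .: R ==> a .: A ==> b .: B ==>
  bvec R (a, c \<odot>\<^sub>B b) \<ominus>\<^bsub>MA R (A \<times>\<times> B)\<^esub>
    (c \<odot>\<^bsub>MA R (A \<times>\<times> B)\<^esub> bvec R (a, b)) : tensor_relations R A B"
 unfolding tensor_relations_def Let_def by blast+

locale tensor_modules = A: module R A + B: module R B for R (structure) and A and B
begin

abbreviation "FF == MA R (A \<times>\<times> B)"
abbreviation "Rel == tensor_relations R A B"
abbreviation "Sp == submodule_span R FF Rel"
abbreviation "T == tensor_product R A B"
abbreviation pt (infixl "\<bullet>" 75) where "pt == pure_tensor R A B"

sublocale FM: module R FF by (rule A.R.MA_module)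

lemma basis_in: "a .: A ==> b .: B ==> bvec R (a, b) .: FF"
 by (rule A.R.bvec_closed) simp

lemma Rel_subset: "Rel <= car FF"
proof
 fix r assume "r : Rel"
 thus "r .: FF"
  by (cases rule: tensor_relations_cases) (simp_all add: basis_in)
qed

sublocale QM: quot_module Sp R FF
 by (intro quot_module.intro FM.module_axioms FM.submodule_span_submodule Rel_subset)

lemma T_eq: "T = quot_algebra FF Sp" by (simp add: tensor_product_def)
lemma pt_eq: "a \<bullet> b = QM.q (bvec R (a, b))" by (simp add: pure_tensor_def)

sublocale TM: module R T
 unfolding T_eq by (rule QM.module_Q)

lemma pt_closed [simp]: "a .: A ==> b .: B ==> a \<bullet> b .: T"
 unfolding T_eq pt_eq by (rule mod_homD[OF QM.q_mod_hom]) (rule basis_in)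

lemma rel_q: "x .: FF ==> y .: FF ==> x \<ominus>\<^sub>FF y : Rel ==> QM.q x = QM.q y"
 using submodule_span_superset[of Rel R FF] QM.q_eq_iff[of x y] by blast

lemma pt_add_left: "a .: A ==> a' .: A ==> b .: B ==> (a \<oplus>\<^sub>A a') \<bullet> b = a \<bullet> b \<oplus>\<^sub>T a' \<bullet> b"
 using rel_q[OF _ _ tensor_relationsI(1)] by (simp add: T_eq pt_eq QM.q_add[symmetric] basis_in)

lemma pt_add_right: "a .: A ==> b .: B ==> b' .: B ==> a \<bullet> (b \<oplus>\<^sub>B b') = a \<bullet> b \<oplus>\<^sub>T a \<bullet> b'"
 using rel_q[OF _ _ tensor_relationsI(2)] by (simp add: T_eq pt_eq QM.q_add[symmetric] basis_in)

lemma pt_smult_left: "c .: R ==> a .: A ==> b .: B ==> (c \<odot>\<^sub>A a) \<bullet> b = c \<odot>\<^sub>T (a \<bullet> b)"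
 using rel_q[OF _ _ tensor_relationsI(3)] by (simp add: T_eq pt_eq QM.q_smult[symmetric] basis_in)

lemma pt_smult_right: "c .: R ==> a .: A ==> b .: B ==> a \<bullet> (c \<odot>\<^sub>B b) = c \<odot>\<^sub>T (a \<bullet> b)"
 using rel_q[OF _ _ tensor_relationsI(4)] by (simp add: T_eq pt_eq QM.q_smult[symmetric] basis_in)

lemma pt_hom_left: "b .: B ==> (%a. a \<bullet> b) : mod_hom R A T"
 by (rule mod_homI) (simp_all add: pt_add_left pt_smult_left)

lemma pt_hom_right: "a .: A ==> (%b. a \<bullet> b) : mod_hom R B T"
 by (rule mod_homI) (simp_all add: pt_add_right pt_smult_right)

lemmas pt_zero_left = mod_hom_zero[OF A.module_axioms TM.module_axioms pt_hom_left]
lemmas pt_zero_right = mod_hom_zero[OF B.module_axioms TM.module_axioms pt_hom_right]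

text \<open>The scalar of a summand is absorbed into its left factor, so plain sums of pure tensors
  exhaust \<open>T\<close>.\<close>

lemma tensor_induct [consumes 1, case_names zero step]:
 assumes x: "x .: T" and zero: "P \<zero>\<^sub>T"
  and step: "!!a b x. a .: A ==> b .: B ==> x .: T ==> P x ==> P (a \<bullet> b \<oplus>\<^sub>T x)"
 shows "P x"
proof -
 obtain f where f: "f .: FF" "x = QM.q f" using x by (auto simp: T_eq QM.q_onto[symmetric])
 have "P (QM.q f)" using f(1)
 proof (induction f rule: A.R.MA_induct)
  case zero thus ?case using assms(2) QM.q_zero by (simp add: T_eq)
 next
  case (step c m f)
  obtain a b where m: "m = (a, b)" "a .: A" "b .: B" using step by (cases m) auto
  have "QM.q (c \<odot>\<^sub>FF bvec R m \<oplus>\<^sub>FF f) = c \<odot>\<^sub>T (a \<bullet> b) \<oplus>\<^sub>T QM.q f"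
   using step m by (simp add: QM.q_add QM.q_smult T_eq pt_eq basis_in)
  also have "... = (c \<odot>\<^sub>A a) \<bullet> b \<oplus>\<^sub>T QM.q f" using step m by (simp add: pt_smult_left)
  finally show ?case
   using assms(3)[OF _ m(3) _ step(4), of "c \<odot>\<^sub>A a"] step m mod_homD(1)[OF QM.q_mod_hom] by (simp add: T_eq)
 qed
 thus ?thesis using f by simp
qed

definition tensor_lift where
 "tensor_lift N beta = QM.lift (lin_ext R N (%p. beta (fst p) (snd p)))"

lemma tensor_lift:
 assumes "module R N" and beta: "bilin R A B N beta"
 shows "tensor_lift N beta : mod_hom R T N"
  and "a .: A ==> b .: B ==> tensor_lift N beta (a \<bullet> b) = beta a b"
proof -
 interpret N: module R N by fact
 have bl: "beta a : mod_hom R B N" if "a .: A" for a using beta that by (auto simp: bilin_def)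
 have br: "(%a. beta a b) : mod_hom R A N" if "b .: B" for b using beta that by (auto simp: bilin_def)
 let ?h = "lin_ext R N (%p. beta (fst p) (snd p))"
 have c: "(%p. beta (fst p) (snd p)) : car (A \<times>\<times> B) \<rightarrow> car N"
  using mod_homD(1)[OF bl] by auto
 have h: "?h : mod_hom R FF N" by (rule N.lin_ext_mod_hom[OF c])
 note hD = mod_homD[OF h] mod_hom_minus[OF FM.module_axioms N.module_axioms h]
 have hb: "?h (bvec R (a, b)) = beta a b" if "a .: A" "b .: B" for a b
  using N.lin_ext_basis[OF _ c, of "(a, b)"] that by simp
 have "?h r = \<zero>\<^sub>N" if "r : Rel" for r
  using that
  by (cases rule: tensor_relations_cases)
  (simp_all add: hD hb basis_in mod_homD[OF bl] mod_homD[OF br] N.M.a_minus_eq_zero_iff)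
 hence "Rel <= {x : car FF. ?h x = \<zero>\<^sub>N}" using Rel_subset by auto
 hence Sp: "Sp <= {x : car FF. ?h x = \<zero>\<^sub>N}"
  by (rule submodule_span_minimal[OF submodule_kernel[OF FM.module_axioms N.module_axioms h]])
 show "tensor_lift N beta : mod_hom R T N"
  unfolding T_eq tensor_lift_def using Sp by (intro QM.lift_mod_hom N.module_axioms h) auto
 assume ab: "a .: A" "b .: B"
 have "QM.lift ?h (QM.q (bvec R (a, b))) = ?h (bvec R (a, b))"
  using Sp by (intro QM.lift_q[OF N.module_axioms h] basis_in ab) auto
 thus "tensor_lift N beta (a \<bullet> b) = beta a b"
  unfolding pt_eq tensor_lift_def hb[OF ab] .
qed

lemma mod_hom_tensor_eqI:
 assumes "module R N" and h: "h : mod_hom R T N" "h' : mod_hom R T N"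
  and eq: "!!a b. a .: A ==> b .: B ==> h (a \<bullet> b) = h' (a \<bullet> b)"
  and x: "x .: T"
 shows "h x = h' x"
 using x
proof (induction x rule: tensor_induct)
 case zero
 show ?case using mod_hom_zero[OF TM.module_axioms assms(1) h(1)] mod_hom_zero[OF TM.module_axioms assms(1) h(2)]
  by (rule trans[OF _ sym])
next
 case (step a b x)
 thus ?case using eq by (simp add: mod_homD[OF h(1)] mod_homD[OF h(2)])
qed

end

locale tensor_algebras = A: assoc_algebra K A + B: assoc_algebra K B for K and A and B
begin

sublocale tensor_modules K A B by unfold_locales

notation pt (infixl "\<bullet>" 75)

lemma monoid_AB: "monoid (A \<times>\<times> B)"
 by (intro DirProd_monoid A.A.monoid_axioms B.A.monoid_axioms)

sublocale FR: assoc_algebra K FF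
 by (rule MA_assoc_algebra) (simp_all add: A.R.field_axioms monoid_AB)

lemma basis_mult: "a .: A ==> b .: B ==> a' .: A ==> b' .: B ==>
 bvec K (a, b) \<otimes>\<^sub>FF bvec K (a', b') = bvec K (a \<otimes>\<^sub>A a', b \<otimes>\<^sub>B b')"
proof -
 interpret MA_ring K "A \<times>\<times> B"
  by (intro MA_ring.intro A.R.cring_axioms monoid_AB)
 show "a .: A ==> b .: B ==> a' .: A ==> b' .: B ==> ?thesis"
  using basis_mult[of "(a, b)" "(a', b')"] by (simp add: mult_DirProd')
qed

text \<open>By distributivity in the factors, a basis vector times a bilinearity relation is again a
  relation of the same kind. This is what lets the convolution descend to the tensor
  product.\<close>

lemma Rel_ideal:
 assumes r: "r : Rel" and ab: "a .: A" "b .: B"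
 shows "bvec K (a, b) \<otimes>\<^sub>FF r : Rel" "r \<otimes>\<^sub>FF bvec K (a, b) : Rel"
proof -
 note s = a_minus_def FR.A.r_distr FR.A.l_distr FR.A.r_minus FR.A.l_minus FR.smult_mult_left[symmetric]
  FR.smult_mult_right[symmetric] basis_mult basis_in A.A.r_distr B.A.r_distr A.A.l_distr B.A.l_distr
  A.smult_mult_right[symmetric] B.smult_mult_right[symmetric] A.smult_mult_left[symmetric] B.smult_mult_left[symmetric]
 from r show "bvec K (a, b) \<otimes>\<^sub>FF r : Rel"
 proof (cases rule: tensor_relations_cases)
  case (add_left u v w) thus ?thesis using ab tensor_relationsI(1)[of "a \<otimes>\<^sub>A u" A "a \<otimes>\<^sub>A v" "b \<otimes>\<^sub>B w" B K] by (simp add: s)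
 next
  case (add_right u v w) thus ?thesis using ab tensor_relationsI(2)[of "a \<otimes>\<^sub>A u" A "b \<otimes>\<^sub>B v" B "b \<otimes>\<^sub>B w" K] by (simp add: s)
 next
  case (smult_left c u v) thus ?thesis using ab tensor_relationsI(3)[of c K "a \<otimes>\<^sub>A u" A "b \<otimes>\<^sub>B v" B] by (simp add: s)
 next
  case (smult_right c u v) thus ?thesis using ab tensor_relationsI(4)[of c K "a \<otimes>\<^sub>A u" A "b \<otimes>\<^sub>B v" B] by (simp add: s)
 qed
 from r show "r \<otimes>\<^sub>FF bvec K (a, b) : Rel"
 proof (cases rule: tensor_relations_cases)
  case (add_left u v w) thus ?thesis using ab tensor_relationsI(1)[of "u \<otimes>\<^sub>A a" A "v \<otimes>\<^sub>A a" "w \<otimes>\<^sub>B b" B K] by (simp add: s)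
 next
  case (add_right u v w) thus ?thesis using ab tensor_relationsI(2)[of "u \<otimes>\<^sub>A a" A "v \<otimes>\<^sub>B b" B "w \<otimes>\<^sub>B b" K] by (simp add: s)
 next
  case (smult_left c u v) thus ?thesis using ab tensor_relationsI(3)[of c K "u \<otimes>\<^sub>A a" A "v \<otimes>\<^sub>B b" B] by (simp add: s)
 next
  case (smult_right c u v) thus ?thesis using ab tensor_relationsI(4)[of c K "u \<otimes>\<^sub>A a" A "v \<otimes>\<^sub>B b" B] by (simp add: s)
 qed
qed

lemma Sp_submod: "submodule Sp K FF" by (rule FM.submodule_span_submodule[OF Rel_subset])

lemma Sp_ideal: "ideal Sp FF"
proof -
 note Sp = FM.submoduleE[OF Sp_submod] and Sp0 = subgroup.one_closed[OF submodule.axioms(1)[OF Sp_submod], simplified]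
 have 1: "x \<otimes>\<^sub>FF r : Sp & r \<otimes>\<^sub>FF x : Sp" if x: "x .: FF" and r: "r : Rel" for x r
  using x
 proof (induction x rule: A.R.MA_induct)
  case zero thus ?case using r Rel_subset Sp0 by auto
 next
  case (step c m f)
  obtain a b where m: "m = (a, b)" "a .: A" "b .: B" using step by (cases m) auto
  have "r .: FF" using r Rel_subset by blast
  thus ?case using step m Rel_ideal[OF r m(2,3)] submodule_span_superset[of Rel K FF]
   by (auto simp: FR.A.l_distr FR.A.r_distr basis_in FR.smult_mult_left[symmetric] FR.smult_mult_right[symmetric] intro!: Sp)
 qed
 \<comment> \<open>Fact \<open>1\<close> treats the generators; the elements that all multiples keep
   inside \<open>Sp\<close> form a submodule and hence include the whole span.\<close>
 have "submodule {r : car FF. ALL x:car FF. x \<otimes>\<^sub>FF r : Sp & r \<otimes>\<^sub>FF x : Sp} K FF"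
  by (rule FM.submoduleI)
  (auto simp: Sp0 FR.A.l_distr FR.A.r_distr FR.A.l_minus FR.A.r_minus
   FR.smult_mult_left[symmetric] FR.smult_mult_right[symmetric] intro!: Sp)
 hence "Sp <= {r : car FF. ALL x:car FF. x \<otimes>\<^sub>FF r : Sp & r \<otimes>\<^sub>FF x : Sp}"
  by (rule submodule_span_minimal) (use 1 Rel_subset in auto)
 thus ?thesis
  by (intro idealI) (auto simp: FR.A.ring_axioms submodule.axioms(1)[OF Sp_submod])
qed

sublocale QA: quot_assoc_algebra Sp K FF
 by (intro quot_assoc_algebra.intro FR.assoc_algebra_axioms Sp_ideal)

sublocale TA: assoc_algebra K T
 unfolding T_eq by (rule QA.assoc_algebra_Q)

lemma pt_mult: "a .: A ==> b .: B ==> a' .: A ==> b' .: B ==>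
 (a \<bullet> b) \<otimes>\<^sub>T (a' \<bullet> b') = (a \<otimes>\<^sub>A a') \<bullet> (b \<otimes>\<^sub>B b')"
 unfolding T_eq pt_eq by (subst QA.q_mult[symmetric]) (simp_all add: basis_in basis_mult)

lemma T_one: "\<one>\<^sub>T = \<one>\<^sub>A \<bullet> \<one>\<^sub>B"
 unfolding T_eq pt_eq by (subst QA.q_one[symmetric]) (simp add: MA_simps)

text \<open>Both sides are bilinear in \<open>x\<close> and \<open>y\<close>, so pure tensors
  suffice. \<open>N\<close> may be an opposite algebra, in which case the conclusion concerns an
  antihomomorphism.\<close>

lemma mod_hom_mult_eqI:
 assumes N: "assoc_algebra K N" and h: "h : mod_hom K T N"
  and eq: "!!a b a' b'. a .: A ==> b .: B ==> a' .: A ==> b' .: B ==>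
   h ((a \<otimes>\<^sub>A a') \<bullet> (b \<otimes>\<^sub>B b')) = h (a \<bullet> b) \<otimes>\<^sub>N h (a' \<bullet> b')"
  and x: "x .: T" and y: "y .: T"
 shows "h (x \<otimes>\<^sub>T y) = h x \<otimes>\<^sub>N h y"
proof -
 interpret N: assoc_algebra K N by fact
 note hD = mod_homD[OF h] and h0 = mod_hom_zero[OF TM.module_axioms N.module_axioms h]
 show ?thesis using x
 proof (induction x rule: tensor_induct)
  case zero thus ?case using y by (simp add: h0 hD)
 next
  case (step a b x)
  have "h ((a \<bullet> b) \<otimes>\<^sub>T y) = h (a \<bullet> b) \<otimes>\<^sub>N h y" using y
  proof (induction y rule: tensor_induct)
   case zero thus ?case using step by (simp add: h0 hD)
  next
   case (step a' b' y)
   thus ?case using \<open>a .: A\<close> \<open>b .: B\<close>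
    by (simp add: TA.A.r_distr N.A.r_distr hD eq pt_mult)
  qed
  thus ?case using step y by (simp add: TA.A.l_distr N.A.l_distr hD)
 qed
qed

end

section \<open>Enveloping algebras\<close>

text \<open>The kernel of a merely linear map is not an ideal, so vanishing on the generators is not
  enough. The set \<open>?Z\<close> is an ideal inside the kernel, and whether it contains
  \<open>S\<close> can be tested on products \<open>a r b\<close> with \<open>a\<close>,
  \<open>b\<close> from a spanning set \<open>W\<close>. For algebras of words this means testing a
  relation inside every context.\<close>

lemma (in assoc_algebra) genideal_in_kernel:
 assumes N: "module K N" and h: "h : mod_hom K A N" and S: "S <= car A"
  and W: "W <= car A" "!!H. submodule H K A ==> W <= H ==> car A <= H"
  and WS: "!!a r b. a : W ==> r : S ==> b : W ==> h (a \<otimes>\<^sub>A r \<otimes>\<^sub>A b) = \<zero>\<^sub>N"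
  and x: "x : Idl\<^bsub>A\<^esub> S"
 shows "h x = \<zero>\<^sub>N"
proof -
 interpret N: module K N by fact
 note hD = mod_homD[OF h] mod_hom_minus[OF module_axioms N h] mod_hom_zero[OF module_axioms N h]
 have hneg: "h (\<ominus>\<^sub>A a) = \<ominus>\<^sub>N h a" if "a .: A" for a
  using hD(4)[of "\<zero>\<^sub>A" a] that by (simp add: hD a_minus_def)
 have 1: "h (a \<otimes>\<^sub>A r \<otimes>\<^sub>A b) = \<zero>\<^sub>N" if "a .: A" "r : S" "b : W" for a r b
 proof -
  have r: "r .: A" "b .: A" using that S W by auto
  have "submodule {a : car A. h (a \<otimes>\<^sub>A r \<otimes>\<^sub>A b) = \<zero>\<^sub>N} K A"
   using r by (intro submoduleI) (auto simp: hD A.l_minus A.l_distr hneg smult_mult_left[symmetric])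
  hence "car A <= {a : car A. h (a \<otimes>\<^sub>A r \<otimes>\<^sub>A b) = \<zero>\<^sub>N}"
   by (rule W(2)) (use WS W(1) that in auto)
  thus ?thesis using that by auto
 qed
 have 2: "h (a \<otimes>\<^sub>A r \<otimes>\<^sub>A b) = \<zero>\<^sub>N" if "a .: A" "r : S" "b .: A" for a r b
 proof -
  have r: "r .: A" using that S by auto
  have "submodule {b : car A. h (a \<otimes>\<^sub>A r \<otimes>\<^sub>A b) = \<zero>\<^sub>N} K A"
   using r that by (intro submoduleI) (auto simp: hD A.r_minus A.r_distr hneg smult_mult_right[symmetric])
  hence "car A <= {b : car A. h (a \<otimes>\<^sub>A r \<otimes>\<^sub>A b) = \<zero>\<^sub>N}"
   by (rule W(2)) (use 1 W(1) that in auto)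
  thus ?thesis using that by auto
 qed
 let ?Z = "{r : car A. ALL a:car A. ALL b:car A. h (a \<otimes>\<^sub>A r \<otimes>\<^sub>A b) = \<zero>\<^sub>N}"
 have "submodule ?Z K A"
  by (rule submoduleI) (auto simp: hD A.r_minus A.r_distr A.l_minus A.l_distr hneg smult_mult_right[symmetric]
   smult_mult_left[symmetric])
 hence "subgroup ?Z (add_monoid A)" by (rule submodule.axioms)
 hence "ideal ?Z A"
 proof (rule idealI[OF A.ring_axioms])
  fix a x assume a: "a : ?Z" and x: "x .: A"
  have "h (c \<otimes>\<^sub>A (x \<otimes>\<^sub>A a) \<otimes>\<^sub>A b) = \<zero>\<^sub>N" if "c .: A" "b .: A" for c b
  proof -
   have "h ((c \<otimes>\<^sub>A x) \<otimes>\<^sub>A a \<otimes>\<^sub>A b) = \<zero>\<^sub>N" using that a x by simp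
   thus ?thesis using that a x by (simp add: A.m_assoc)
  qed
  thus "x \<otimes>\<^sub>A a : ?Z" using a x by simp
  have "h (c \<otimes>\<^sub>A (a \<otimes>\<^sub>A x) \<otimes>\<^sub>A b) = \<zero>\<^sub>N" if "c .: A" "b .: A" for c b
  proof -
   have "h (c \<otimes>\<^sub>A a \<otimes>\<^sub>A (x \<otimes>\<^sub>A b)) = \<zero>\<^sub>N" using that a x by simp
   thus ?thesis using that a x by (simp add: A.m_assoc)
  qed
  thus "a \<otimes>\<^sub>A x : ?Z" using a x by simp
 qed
 moreover have "S <= ?Z" using 2 S by auto
 ultimately have "x : ?Z" using x by (auto simp: genideal_def)
 hence "h (\<one>\<^sub>A \<otimes>\<^sub>A x \<otimes>\<^sub>A \<one>\<^sub>A) = \<zero>\<^sub>N" by (simp only: mem_Collect_eq) (meson A.one_closed)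
 thus ?thesis using \<open>x : ?Z\<close> by simp
qed

lemma alg_homD:
 assumes "h : alg_hom K A B"
 shows "x .: A ==> h x .: B"
  "x .: A ==> y .: A ==> h (x \<oplus>\<^sub>A y) = h x \<oplus>\<^sub>B h y"
  "x .: A ==> y .: A ==> h (x \<otimes>\<^sub>A y) = h x \<otimes>\<^sub>B h y"
  "h \<one>\<^sub>A = \<one>\<^sub>B"
  "c .: K ==> x .: A ==> h (c \<odot>\<^sub>A x) = c \<odot>\<^sub>B h x"
 using assms by (auto simp: alg_hom_def ring_hom_def)

lemma alg_hom_mod_hom: "h : alg_hom K A B ==> h : mod_hom K A B"
 by (rule mod_homI) (simp_all add: alg_homD)

lemma alg_hom_genideal:
 assumes "assoc_algebra K A" "assoc_algebra K B" and h: "h : alg_hom K A B"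
  and S: "S <= car A" "!!r. r : S ==> h r = \<zero>\<^sub>B" and x: "x : Idl\<^bsub>A\<^esub> S"
 shows "h x = \<zero>\<^sub>B"
proof -
 interpret A: assoc_algebra K A by fact
 interpret B: assoc_algebra K B by fact
 show ?thesis
 proof (rule A.genideal_in_kernel[OF B.module_axioms alg_hom_mod_hom[OF h] S(1) subset_refl _ _ x])
  fix a r b assume "a .: A" "r : S" "b .: A"
  moreover have "r .: A" using \<open>r : S\<close> S by auto
  ultimately show "h (a \<otimes>\<^sub>A r \<otimes>\<^sub>A b) = \<zero>\<^sub>B" using S(2) by (simp add: alg_homD[OF h])
 qed
qed

lemma word_monoid_simps [simp]:
 "car (word_monoid S) = lists S" "u \<otimes>\<^bsub>word_monoid S\<^esub> v = u @ v" "\<one>\<^bsub>word_monoid S\<^esub> = []"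
 by (simp_all add: word_monoid_def)

lemma monoid_word_monoid: "monoid (word_monoid S)"
 by (rule monoidI) auto

context lie_algebra begin

abbreviation "FA == MA K (word_monoid (car L))"
abbreviation "I1 == Idl\<^bsub>FA\<^esub> (free_linear_relations K L)"
abbreviation "TA == tensor_algebra K L"
abbreviation "lierel == {(tensor_algebra_incl K L x \<otimes>\<^sub>TA tensor_algebra_incl K L y \<ominus>\<^sub>TA
 tensor_algebra_incl K L y \<otimes>\<^sub>TA tensor_algebra_incl K L x) \<ominus>\<^sub>TA tensor_algebra_incl K L (br x y) | x y.
 x .: L & y .: L}"
abbreviation "U == enveloping_algebra K L br"
abbreviation "I2 == Idl\<^bsub>TA\<^esub> lierel"

lemma TA_eq: "TA = quot_algebra FA I1" by (simp add: tensor_algebra_def Let_def)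
lemma U_eq: "U = quot_algebra TA I2" by (simp add: enveloping_algebra_def Let_def)

sublocale FF: assoc_algebra K FA
 by (rule MA_assoc_algebra[OF R.field_axioms monoid_word_monoid])

lemma bv_closed [simp]: "w : lists (car L) ==> bvec K w .: FA"
 by (rule R.bvec_closed) simp

lemma bv_closed' [simp]: "ALL x:set w. x .: L ==> bvec K w .: FA"
 by (rule bv_closed) auto

lemma bv_mult: "u : lists (car L) ==> v : lists (car L) ==> bvec K u \<otimes>\<^sub>FA bvec K v = bvec K (u @ v)"
proof -
 interpret MA_ring K "word_monoid (car L)"
  by (intro MA_ring.intro R.cring_axioms monoid_word_monoid)
 show "u : lists (car L) ==> v : lists (car L) ==> ?thesis" using basis_mult[of u v] by simp
qed

lemma linrel_cases [consumes 1, case_names add smult]: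
 assumes "r : free_linear_relations K L"
 obtains x y where "x .: L" "y .: L"
  "r = bvec K [x \<oplus>\<^sub>L y] \<ominus>\<^sub>FA (bvec K [x] \<oplus>\<^sub>FA bvec K [y])"
 | c x where "c .: K" "x .: L"
  "r = bvec K [c \<odot>\<^sub>L x] \<ominus>\<^sub>FA (c \<odot>\<^sub>FA bvec K [x])"
 using assms unfolding free_linear_relations_def Let_def by blast

lemma linrel_subset: "free_linear_relations K L <= car FA"
proof
 fix r assume "r : free_linear_relations K L"
 thus "r .: FA" by (cases rule: linrel_cases) simp_all
qed

sublocale Q1: quot_assoc_algebra I1 K FA
 by (intro quot_assoc_algebra.intro FF.assoc_algebra_axioms FF.genideal_ideal linrel_subset)

sublocale TT: assoc_algebra K TA
 unfolding TA_eq by (rule Q1.assoc_algebra_Q)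

abbreviation "tin == tensor_algebra_incl K L"

lemma tin_eq: "tin x = Q1.q (bvec K [x])"
 by (simp add: tensor_algebra_incl_def Let_def)

lemma tin_closed [simp]: "x .: L ==> tin x .: TA"
 unfolding tin_eq TA_eq by (rule mod_homD[OF Q1.q_mod_hom]) simp

lemma lierel_subset: "lierel <= car TA"
 by (auto simp: br_closed)

sublocale Q2: quot_assoc_algebra I2 K TA
 by (intro quot_assoc_algebra.intro TT.assoc_algebra_axioms TT.genideal_ideal lierel_subset)

sublocale UU: assoc_algebra K U
 unfolding U_eq by (rule Q2.assoc_algebra_Q)

definition uin where "uin x = Q2.q (tin x)"

definition uword where "uword w = Q2.q (Q1.q (bvec K w))"

lemma uin_closed [simp]: "x .: L ==> uin x .: U"
 unfolding uin_def U_eq by (rule mod_homD[OF Q2.q_mod_hom]) simp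

lemma uword_closed [simp]: "w : lists (car L) ==> uword w .: U"
 unfolding uword_def U_eq TA_eq
 by (intro mod_homD[OF Q2.q_mod_hom[unfolded TA_eq]] mod_homD[OF Q1.q_mod_hom]) simp

lemma uword_single: "uword [x] = uin x"
 by (simp add: uword_def uin_def tin_eq)

lemma q1c: "f .: FA ==> Q1.q f .: TA"
 using mod_homD(1)[OF Q1.q_mod_hom] by (simp add: TA_eq)

lemma uword_append: "u : lists (car L) ==> v : lists (car L) ==> uword (u @ v) = uword u \<otimes>\<^sub>U uword v"
 using Q1.q_mult[of "bvec K u" "bvec K v"]
  Q2.q_mult[of "Q1.q (bvec K u)" "Q1.q (bvec K v)"]
 by (simp add: uword_def bv_mult q1c TA_eq[symmetric] U_eq[symmetric] del: append_in_lists_conv)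

lemma uword_Nil: "uword [] = \<one>\<^sub>U"
 using Q1.q_one Q2.q_one by (simp add: uword_def TA_eq[symmetric] U_eq[symmetric] MA_simps)

lemma uword_Cons: "x .: L ==> v : lists (car L) ==> uword (x # v) = uin x \<otimes>\<^sub>U uword v"
 using uword_append[of "[x]" v] by (simp add: uword_single)

lemma span_F:
 assumes "submodule H K FA" and "bvec K ` lists (car L) <= H"
 shows "car FA <= H"
proof
 note H = FF.submoduleE[OF assms(1)] subgroup.one_closed[OF submodule.axioms(1)[OF assms(1)], simplified]
 fix f assume "f .: FA"
 thus "f : H"
  by (induction f rule: R.MA_induct) (use assms(2) in "auto intro!: H")
qed

lemma submodule_vimage:
 assumes "module K A" "module K B" and h: "h : mod_hom K A B" and H: "submodule H K B"
 shows "submodule {x : car A. h x : H} K A"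
proof -
 interpret A: module K A by fact
 interpret B: module K B by fact
 note H' = B.submoduleE[OF H] subgroup.one_closed[OF submodule.axioms(1)[OF H], simplified]
 show ?thesis
 proof (rule A.submoduleI)
  fix a assume a: "a : {x : car A. h x : H}"
  hence "h a .: B" using H' by auto
  thus "\<ominus>\<^sub>A a : {x : car A. h x : H}"
   using a mod_hom_minus[OF assms(1-3), of "\<zero>\<^sub>A" a] mod_hom_zero[OF assms(1-3)] H' by (simp add: a_minus_def)
 qed (use mod_homD[OF h] mod_hom_zero[OF assms(1-3)] H' in auto)
qed

lemma span_TA:
 assumes H: "submodule H K TA" and "(%w. Q1.q (bvec K w)) ` lists (car L) <= H"
 shows "car TA <= H"
proof -
 have "submodule {x : car FA. Q1.q x : H} K FA"
  by (rule submodule_vimage[OF FF.module_axioms TT.module_axioms Q1.q_mod_hom[folded TA_eq] H])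
 hence "car FA <= {x : car FA. Q1.q x : H}"
  by (rule span_F) (use assms(2) in auto)
 thus ?thesis unfolding Q1.q_onto[folded TA_eq, symmetric] by blast
qed

lemma span_U:
 assumes H: "submodule H K U" and "uword ` lists (car L) <= H"
 shows "car U <= H"
proof -
 have "submodule {x : car TA. Q2.q x : H} K TA"
  by (rule submodule_vimage[OF TT.module_axioms UU.module_axioms Q2.q_mod_hom[folded U_eq] H])
 hence "car TA <= {x : car TA. Q2.q x : H}"
  by (rule span_TA) (use assms(2) in "auto simp: uword_def q1c")
 thus ?thesis unfolding Q2.q_onto[folded U_eq, symmetric] by blast
qed

lemma q1_eqI: "f .: FA ==> g .: FA ==> f \<ominus>\<^sub>FA g : free_linear_relations K L ==> Q1.q f = Q1.q g"
 using FF.genideal_self[OF linrel_subset] Q1.q_eq_iff[of f g] by blast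

lemma tin_add: "x .: L ==> y .: L ==> tin (x \<oplus>\<^sub>L y) = tin x \<oplus>\<^sub>TA tin y"
proof -
 assume xy: "x .: L" "y .: L"
 have "Q1.q (bvec K [x \<oplus>\<^sub>L y]) = Q1.q (bvec K [x] \<oplus>\<^sub>FA bvec K [y])"
  by (rule q1_eqI) (use xy in "auto simp: free_linear_relations_def Let_def")
 thus ?thesis using xy by (simp add: tin_eq Q1.q_add TA_eq[symmetric])
qed

lemma tin_smult: "c .: K ==> x .: L ==> tin (c \<odot>\<^sub>L x) = c \<odot>\<^sub>TA tin x"
proof -
 assume xy: "c .: K" "x .: L"
 have "Q1.q (bvec K [c \<odot>\<^sub>L x]) = Q1.q (c \<odot>\<^sub>FA bvec K [x])"
  by (rule q1_eqI) (use xy in "auto simp: free_linear_relations_def Let_def")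
 thus ?thesis using xy by (simp add: tin_eq Q1.q_smult TA_eq[symmetric])
qed

lemma uin_add: "x .: L ==> y .: L ==> uin (x \<oplus>\<^sub>L y) = uin x \<oplus>\<^sub>U uin y"
 unfolding uin_def by (simp add: tin_add Q2.q_add U_eq[symmetric])

lemma uin_smult: "c .: K ==> x .: L ==> uin (c \<odot>\<^sub>L x) = c \<odot>\<^sub>U uin x"
 unfolding uin_def by (simp add: tin_smult Q2.q_smult U_eq[symmetric])

lemma uin_mod_hom: "uin : mod_hom K L U"
 by (rule mod_homI) (simp_all add: uin_add uin_smult)

lemma uin_br:
 assumes x: "x .: L" and y: "y .: L"
 shows "uin (br x y) = uin x \<otimes>\<^sub>U uin y \<ominus>\<^sub>U uin y \<otimes>\<^sub>U uin x"
proof -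
 have "(tin x \<otimes>\<^sub>TA tin y \<ominus>\<^sub>TA tin y \<otimes>\<^sub>TA tin x) \<ominus>\<^sub>TA tin (br x y) : I2"
  using TT.genideal_self[OF lierel_subset] x y by blast
 hence "Q2.q (tin x \<otimes>\<^sub>TA tin y \<ominus>\<^sub>TA tin y \<otimes>\<^sub>TA tin x) = Q2.q (tin (br x y))"
  using x y by (subst Q2.q_eq_iff) (simp_all add: br_closed)
 thus ?thesis unfolding uin_def using x y
  mod_hom_minus[OF TT.module_axioms UU.module_axioms Q2.q_mod_hom[folded U_eq], of "tin x \<otimes>\<^sub>TA tin y" "tin y \<otimes>\<^sub>TA tin x"]
  by (simp add: Q2.q_mult U_eq[symmetric])
qed

theorem enveloping_universal:
 assumes B: "assoc_algebra K B" and f: "f : mod_hom K L B"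
  and fbr: "!!x y. x .: L ==> y .: L ==> f (br x y) = f x \<otimes>\<^sub>B f y \<ominus>\<^sub>B f y \<otimes>\<^sub>B f x"
 obtains h where "h : alg_hom K U B" "!!x. x .: L ==> h (uin x) = f x"
proof -
 interpret B: assoc_algebra K B by fact
 note fD = mod_homD[OF f]
 define phi where "phi w = foldr (%x b. f x \<otimes>\<^sub>B b) w \<one>\<^sub>B" for w
 have phic: "phi w .: B" if "w : lists (car L)" for w
  using that by (induction w) (auto simp: phi_def fD)
 have phiapp: "phi (u @ v) = phi u \<otimes>\<^sub>B phi v" if "u : lists (car L)" "v : lists (car L)" for u v
  using that(1)
 proof (induction u)
  case Nil thus ?case using phic[OF that(2)] by (simp add: phi_def)
 next
  case (Cons x u)
  thus ?case using phic[OF that(2)] phic[of u] by (simp add: phi_def B.m_assoc fD)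
 qed
 have "phi : hom (word_monoid (car L)) B" by (auto simp: hom_def phic phiapp)
 hence h0: "lin_ext K B phi : alg_hom K FA B"
  by (rule lin_ext_mult[OF B monoid_word_monoid]) (simp add: phi_def)
 have h0b: "lin_ext K B phi (bvec K [x]) = f x" if "x .: L" for x
  using B.lin_ext_basis[of "[x]" "word_monoid (car L)" phi] phic that by (simp add: phi_def fD)
 note h0D = alg_homD[OF h0] mod_hom_minus[OF FF.module_axioms B.module_axioms alg_hom_mod_hom[OF h0]]
 have "lin_ext K B phi r = \<zero>\<^sub>B" if "r : free_linear_relations K L" for r
  using that by (cases rule: linrel_cases) (simp_all add: h0D h0b fD B.M.a_minus_eq_zero_iff)
 hence k1: "lin_ext K B phi x = \<zero>\<^sub>B" if "x : I1" for x
  using alg_hom_genideal[OF FF.assoc_algebra_axioms B h0 linrel_subset _ that] by blast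
 let ?h1 = "Q1.lift (lin_ext K B phi)"
 have h1: "?h1 : alg_hom K TA B" unfolding TA_eq by (rule Q1.lift_alg_hom[OF B h0 k1])
 have h1t: "?h1 (tin x) = f x" if "x .: L" for x
  unfolding tin_eq using that Q1.lift_q[OF B.module_axioms alg_hom_mod_hom[OF h0] k1, of "bvec K [x]"] by (simp add: h0b)
 note h1D = alg_homD[OF h1] mod_hom_minus[OF TT.module_axioms B.module_axioms alg_hom_mod_hom[OF h1]]
 have "?h1 r = \<zero>\<^sub>B" if "r : lierel" for r
  using that by (auto simp: h1D h1t fbr fD br_closed B.M.a_minus_eq_zero_iff)
 hence k2: "?h1 x = \<zero>\<^sub>B" if "x : I2" for x
  using alg_hom_genideal[OF TT.assoc_algebra_axioms B h1 lierel_subset _ that] by blast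
 have "Q2.lift ?h1 : alg_hom K U B" unfolding U_eq by (rule Q2.lift_alg_hom[OF B h1 k2])
 moreover have "Q2.lift ?h1 (uin x) = f x" if "x .: L" for x
  unfolding uin_def using that Q2.lift_q[OF B.module_axioms alg_hom_mod_hom[OF h1] k2, of "tin x"] by (simp add: h1t)
 ultimately show thesis by (rule that)
qed

text \<open>The universal property yields only algebra homomorphisms, whereas coefficient
  functionals are just linear. A function on words descends to \<open>U\<close> as soon as it
  respects the linear relations and the commutator relation in every context \<open>u\<close>,
  \<open>v\<close>; since words span, \<open>genideal_in_kernel\<close> asks for no more.\<close>

theorem enveloping_linear:
 assumes N: "module K N" and phic: "!!w. w : lists (car L) ==> phi w .: N"
  and add: "!!u x y v. u : lists (car L) ==> v : lists (car L) ==> x .: L ==> y .: L ==>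
   phi (u @ (x \<oplus>\<^sub>L y) # v) = phi (u @ x # v) \<oplus>\<^sub>N phi (u @ y # v)"
  and smult: "!!u x c v. u : lists (car L) ==> v : lists (car L) ==> x .: L ==> c .: K ==>
   phi (u @ (c \<odot>\<^sub>L x) # v) = c \<odot>\<^sub>N phi (u @ x # v)"
  and comm: "!!u x y v. u : lists (car L) ==> v : lists (car L) ==> x .: L ==> y .: L ==>
   phi (u @ x # y # v) \<ominus>\<^sub>N phi (u @ y # x # v) = phi (u @ br x y # v)"
 obtains h where "h : mod_hom K U N" "!!w. w : lists (car L) ==> h (uword w) = phi w"
proof -
 interpret N: module K N by fact
 let ?h0 = "lin_ext K N phi" and ?W = "lists (car L)"
 have c0: "phi : car (word_monoid (car L)) \<rightarrow> car N" using phic by auto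
 have h0: "?h0 : mod_hom K FA N" by (rule N.lin_ext_mod_hom[OF c0])
 have h0b: "?h0 (bvec K w) = phi w" if "w : ?W" for w
  using N.lin_ext_basis[OF _ c0, of w] that by simp
 note h0D = mod_homD[OF h0] mod_hom_minus[OF FF.module_axioms N h0]
 have k1: "?h0 x = \<zero>\<^sub>N" if "x : I1" for x
 proof (rule FF.genideal_in_kernel[OF N h0 linrel_subset _ _ _ that, where W = "bvec K ` ?W"])
  show "bvec K ` ?W <= car FA" by auto
  show "car FA <= H" if "submodule H K FA" "bvec K ` ?W <= H" for H by (rule span_F[OF that])
  fix a r b assume "a : bvec K ` ?W" "b : bvec K ` ?W" and r: "r : free_linear_relations K L"
  then obtain u v where uv: "u : ?W" "v : ?W" "a = bvec K u" "b = bvec K v" by auto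
  note s = FF.A.r_distr FF.A.l_distr FF.A.r_minus FF.A.l_minus FF.smult_mult_left[symmetric]
  FF.smult_mult_right[symmetric] bv_mult
  have abc: "a .: FA" "b .: FA" using uv by simp_all
  have m: "?h0 (a \<otimes>\<^sub>FA (x \<ominus>\<^sub>FA y) \<otimes>\<^sub>FA b) = ?h0 (a \<otimes>\<^sub>FA x \<otimes>\<^sub>FA b) \<ominus>\<^sub>N ?h0 (a \<otimes>\<^sub>FA y \<otimes>\<^sub>FA b)"
   if "x .: FA" "y .: FA" for x y
  proof -
   have "a \<otimes>\<^sub>FA (x \<ominus>\<^sub>FA y) \<otimes>\<^sub>FA b = a \<otimes>\<^sub>FA x \<otimes>\<^sub>FA b \<ominus>\<^sub>FA a \<otimes>\<^sub>FA y \<otimes>\<^sub>FA b"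
    using that abc by (simp add: a_minus_def s)
   thus ?thesis using that abc by (simp add: h0D)
  qed
  from r show "?h0 (a \<otimes>\<^sub>FA r \<otimes>\<^sub>FA b) = \<zero>\<^sub>N"
  proof (cases rule: linrel_cases)
   case (add x y)
   show ?thesis unfolding add(3) using add(1,2)
    by (subst m) (simp_all add: uv s h0D h0b N.M.a_minus_eq_zero_iff phic assms(3))
  next
   case (smult c x)
   show ?thesis unfolding smult(3) using smult(1,2)
    by (subst m) (simp_all add: uv s h0D h0b N.M.a_minus_eq_zero_iff phic assms(4))
  qed
 qed
 let ?h1 = "Q1.lift ?h0"
 have h1: "?h1 : mod_hom K TA N" unfolding TA_eq by (rule Q1.lift_mod_hom[OF N h0 k1])
 have h1b: "?h1 (Q1.q (bvec K w)) = phi w" if "w : ?W" for w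
  using that Q1.lift_q[OF N h0 k1, of "bvec K w"] by (simp add: h0b)
 note h1D = mod_homD[OF h1] mod_hom_minus[OF TT.module_axioms N h1]
 have qm: "Q1.q (bvec K u) \<otimes>\<^sub>TA Q1.q (bvec K v) = Q1.q (bvec K (u @ v))" if "u : ?W" "v : ?W" for u v
  using Q1.q_mult[of "bvec K u" "bvec K v"] that by (simp add: bv_mult TA_eq[symmetric])
 have k2: "?h1 x = \<zero>\<^sub>N" if "x : I2" for x
 proof (rule TT.genideal_in_kernel[OF N h1 lierel_subset _ _ _ that, where W = "(%w. Q1.q (bvec K w)) ` ?W"])
  show "(%w. Q1.q (bvec K w)) ` ?W <= car TA" by (auto simp: q1c)
  show "car TA <= H" if "submodule H K TA" "(%w. Q1.q (bvec K w)) ` ?W <= H" for H by (rule span_TA[OF that])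
  fix a r b assume "a : (%w. Q1.q (bvec K w)) ` ?W" "b : (%w. Q1.q (bvec K w)) ` ?W" and r: "r : lierel"
  then obtain u v x y where uv: "u : ?W" "v : ?W" "a = Q1.q (bvec K u)" "b = Q1.q (bvec K v)"
   and xy: "x .: L" "y .: L"
   "r = (tin x \<otimes>\<^sub>TA tin y \<ominus>\<^sub>TA tin y \<otimes>\<^sub>TA tin x) \<ominus>\<^sub>TA tin (br x y)" by auto
  note ac = uv(3,4)[THEN arg_cong[of _ _ "%z. z .: TA"]]
  have abc: "a .: TA" "b .: TA" using uv by (simp_all add: q1c)
  have m: "a \<otimes>\<^sub>TA (x \<ominus>\<^sub>TA y) \<otimes>\<^sub>TA b = a \<otimes>\<^sub>TA x \<otimes>\<^sub>TA b \<ominus>\<^sub>TA a \<otimes>\<^sub>TA y \<otimes>\<^sub>TA b"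
   if "x .: TA" "y .: TA" for x y
   using that abc by (simp add: a_minus_def TT.A.r_distr TT.A.l_distr TT.A.r_minus TT.A.l_minus)
  have "?h1 (a \<otimes>\<^sub>TA r \<otimes>\<^sub>TA b) = (?h1 (a \<otimes>\<^sub>TA (tin x \<otimes>\<^sub>TA tin y) \<otimes>\<^sub>TA b) \<ominus>\<^sub>N
   ?h1 (a \<otimes>\<^sub>TA (tin y \<otimes>\<^sub>TA tin x) \<otimes>\<^sub>TA b)) \<ominus>\<^sub>N ?h1 (a \<otimes>\<^sub>TA tin (br x y) \<otimes>\<^sub>TA b)"
   using xy abc by (simp add: m br_closed h1D)
  also have "... = (phi (u @ x # y # v) \<ominus>\<^sub>N phi (u @ y # x # v)) \<ominus>\<^sub>N phi (u @ br x y # v)"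
   using uv xy by (simp add: tin_eq qm h1b br_closed)
  also have "... = \<zero>\<^sub>N" using uv xy comm[of u v x y]
   by (simp add: N.M.a_minus_eq_zero_iff phic br_closed)
  finally show "?h1 (a \<otimes>\<^sub>TA r \<otimes>\<^sub>TA b) = \<zero>\<^sub>N" .
 qed
 have "Q2.lift ?h1 : mod_hom K U N" unfolding U_eq by (rule Q2.lift_mod_hom[OF N h1 k2])
 moreover have "Q2.lift ?h1 (uword w) = phi w" if "w : ?W" for w
  unfolding uword_def using that Q2.lift_q[OF N h1 k2, of "Q1.q (bvec K w)"] by (simp add: h1b q1c)
 ultimately show thesis by (rule that)
qed

end

section \<open>The Poincare-Birkhoff-Witt theorem\<close>

text \<open>Unlike the library rule, this needs no closure hypotheses, so it can serve as a recursion congruence.\<close>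
lemma foldSetD_cong:
 "(A, z) : foldSetD D f e ==> (!!x. x : A ==> f x = g x) ==> (A, z) : foldSetD D g e"
 by (induction A z rule: foldSetD.induct) (auto intro: foldSetD.intros)

lemma finsum_cong_weak [fundef_cong]:
 "A = B ==> (!!x. x : B ==> f x = g x) ==> finsum G f A = finsum G g B"
proof -
 assume A: "A = B" and eq: "!!x. x : B ==> f x = g x"
 let ?S = "%h. foldSetD (car G) (add G \<circ> h) \<zero>\<^sub>G"
 have "(B, z) : ?S f \<longleftrightarrow> (B, z) : ?S g" for z
  using eq by (auto elim!: foldSetD_cong)
 thus ?thesis unfolding A finsum_def finprod_def foldD_def by simp
qed

lemma (in abelian_monoid) finsum_swap:
 assumes "finite A" "finite B" "!!x y. x : A ==> y : B ==> f x y .: G"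
 shows "(\<Oplus>x\<in>A. \<Oplus>y\<in>B. f x y) = (\<Oplus>y\<in>B. \<Oplus>x\<in>A. f x y)"
 using assms(1,3)
proof (induction A rule: finite_induct)
 case empty thus ?case by simp
next
 case (insert a A)
 have "(\<Oplus>x\<in>insert a A. \<Oplus>y\<in>B. f x y) = (\<Oplus>y\<in>B. f a y) \<oplus> (\<Oplus>x\<in>A. \<Oplus>y\<in>B. f x y)"
  using insert by (intro finsum_insert) auto
 also have "... = (\<Oplus>y\<in>B. f a y) \<oplus> (\<Oplus>y\<in>B. \<Oplus>x\<in>A. f x y)" using insert by simp
 also have "... = (\<Oplus>y\<in>B. f a y \<oplus> (\<Oplus>x\<in>A. f x y))"
  using insert by (intro finsum_addf[symmetric]) auto
 also have "... = (\<Oplus>y\<in>B. \<Oplus>x\<in>insert a A. f x y)"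
  using insert by (intro finsum_cong_weak refl finsum_insert[symmetric]) auto
 finally show ?case .
qed

section \<open>Normal forms of words under straightening\<close>

primrec inversions :: "'a::linorder list => nat" where
 "inversions [] = 0"
| "inversions (x # xs) = length (filter (%y. y < x) xs) + inversions xs"

lemma inversions_swap: "b < a ==> inversions (u @ b # a # v) < inversions (u @ a # b # v)"
 by (induction u) auto

lemma unsorted_inversion:
 assumes "\<not> sorted w" shows "EX u a b v. w = u @ a # b # v & b < a"
 using assms
proof (induction w rule: induct_list012)
 case (3 x y zs)
 show ?case
 proof (cases "x <= y")
  case True
  hence "\<not> sorted (y # zs)" using 3(3) by (simp only: sorted2) simp
  then obtain u a b v where "y # zs = u @ a # b # v & b < a" using 3 by blast
  hence "x # y # zs = (x # u) @ a # b # v & b < a" by simp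
  thus ?thesis by blast
 next
  case False
  hence "x # y # zs = [] @ x # y # zs & y < x" by simp
  thus ?thesis by blast
 qed
qed auto

text \<open>Which descent is chosen is irrelevant: \<open>comm_at\<close> later shows that every
  descent leads to the same normal form.\<close>

definition an_inversion :: "nat list => nat list \<times> nat \<times> nat \<times> nat list" where
 "an_inversion w = (SOME (u, a, b, v). w = u @ a # b # v & b < a)"

lemma an_inversion: "\<not> sorted w ==> an_inversion w = (u, a, b, v) ==> w = u @ a # b # v & b < a"
 using unsorted_inversion[of w] someI_ex[of "%(u, a, b, v). w = u @ a # b # v & b < a"]
 by (auto simp: an_inversion_def)

text \<open>\<open>c i j k\<close> is the coordinate at \<open>k\<close> of the bracket of the basis
  vectors \<open>i\<close> and \<open>j\<close>. \<open>c_self\<close> stands beside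
  \<open>c_anti\<close> because in characteristic 2 antisymmetry does not imply it. The terms of
  \<open>c_jacobi\<close> are coordinates of left-nested brackets.\<close>

locale structure_constants = cring R for R (structure) +
 fixes n :: nat and c :: "nat => nat => nat => 'a"
 assumes c_closed [simp]: "!!i j k. i < n ==> j < n ==> k < n ==> c i j k .: R"
  and c_self: "!!i k. i < n ==> k < n ==> c i i k = \<zero>"
  and c_anti: "!!i j k. i < n ==> j < n ==> k < n ==> c j i k = \<ominus> c i j k"
  and c_jacobi: "!!i j k m. i < n ==> j < n ==> k < n ==> m < n ==>
   (\<Oplus>l\<in>{..<n}. c i j l \<otimes> c l k m) \<oplus> (\<Oplus>l\<in>{..<n}. c j k l \<otimes> c l i m) \<oplus> (\<Oplus>l\<in>{..<n}. c k i l \<otimes> c l j m) = \<zero>"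
begin

text \<open>The coefficient of the ordered monomial \<open>s\<close> in the normal form of the word \<open>w\<close>.\<close>
function nf_coeff :: "nat list => nat list => 'a" where
 "nf_coeff s w = (if sorted w then (if w = s then \<one> else \<zero>) else
  (case an_inversion w of (u, a, b, v) =>
    nf_coeff s (u @ b # a # v) \<oplus> (\<Oplus>k\<in>{..<n}. c a b k \<otimes> nf_coeff s (u @ k # v))))"
 by auto
termination
 by (relation "inv_image (less_than <*lex*> less_than) (%(s, w). (length w, inversions w))")
 (auto dest!: an_inversion[OF _ sym] simp: inversions_swap)

declare nf_coeff.simps [simp del]

abbreviation "W == lists {..<n}"

text \<open>The order under which \<open>nf_coeff\<close> terminates: an exchange keeps the length
  and lowers the inversions, a bracket term is shorter.\<close>

lemma word_induct [case_names less]: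
 assumes "!!w. (!!w'. length w' < length w ==> P w') ==>
  (!!w'. length w' = length w ==> inversions w' < inversions w ==> P w') ==> P w"
 shows "P (w :: nat list)"
proof -
 have "wf (inv_image (less_than <*lex*> less_than) (%w::nat list. (length w, inversions w)))"
  by (intro wf_inv_image wf_lex_prod wf_less_than)
 thus ?thesis
 proof (induction w rule: wf_induct_rule)
  case (less w)
  show ?case
   by (rule assms; rule less.IH) (simp_all add: in_inv_image)
 qed
qed

text \<open>The value at the vector with coordinates \<open>x\<close> of the linear function that
  takes the values \<open>f\<close> on the basis. With \<open>f\<close> the normal form of a word
  with one open letter, it inserts a vector for that letter.\<close>

definition ins :: "(nat => 'a) => (nat => 'a) => 'a" where
 "ins x f = (\<Oplus>k\<in>{..<n}. x k \<otimes> f k)"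

lemma ins_closed [simp]: "(!!k. k < n ==> x k .: R) ==> (!!k. k < n ==> f k .: R) ==> ins x f .: R"
 by (auto simp: ins_def)

lemma ins_cong: "(!!k. k < n ==> f k = g k) ==> ins x f = ins x g"
 unfolding ins_def by (rule finsum_cong_weak) auto

lemma nf_sorted: "sorted w ==> nf_coeff s w = (if w = s then \<one> else \<zero>)"
 by (subst nf_coeff.simps) simp

lemma nf_step: "\<not> sorted w ==> an_inversion w = (u, a, b, v) ==>
 nf_coeff s w = nf_coeff s (u @ b # a # v) \<oplus> ins (c a b) (%k. nf_coeff s (u @ k # v))"
 by (subst nf_coeff.simps) (simp add: ins_def)

lemma nf_closed [simp]: "w : W ==> nf_coeff s w .: R"
proof (induction w rule: word_induct)
 case (less w)
 show ?case
 proof (cases "sorted w")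
  case True thus ?thesis by (simp add: nf_sorted)
 next
  case False
  obtain u a b v where i: "an_inversion w = (u, a, b, v)" by (metis prod_cases4)
  hence w: "w = u @ a # b # v" "b < a" using an_inversion[OF False i] by auto
  have "u @ b # a # v : W" "!!k. k < n ==> u @ k # v : W" using less(3) w by auto
  hence "nf_coeff s (u @ b # a # v) .: R" "!!k. k < n ==> nf_coeff s (u @ k # v) .: R"
   using less(1,2) w inversions_swap[OF w(2), of u v] by auto
  moreover have "a < n" "b < n" using less(3) w by auto
  ultimately show ?thesis by (simp add: nf_step[OF False i])
 qed
qed

lemma nf_closed' [simp]: "ALL x:set w. x < n ==> nf_coeff s w .: R"
 by (rule nf_closed) auto

lemma ins_add:
 assumes "!!k. k < n ==> x k .: R" "!!k. k < n ==> f k .: R" "!!k. k < n ==> g k .: R"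
 shows "ins x (%k. f k \<oplus> g k) = ins x f \<oplus> ins x g"
proof -
 have "ins x (%k. f k \<oplus> g k) = (\<Oplus>k\<in>{..<n}. x k \<otimes> f k \<oplus> x k \<otimes> g k)"
  unfolding ins_def using assms by (intro finsum_cong_weak) (auto simp: r_distr)
 thus ?thesis unfolding ins_def using assms by (simp add: finsum_addf)
qed

lemma ins_swap:
 assumes "!!k. k < n ==> x k .: R" "!!k. k < n ==> y k .: R" "!!k l. k < n ==> l < n ==> f k l .: R"
 shows "ins x (%k. ins y (%l. f k l)) = ins y (%l. ins x (%k. f k l))"
proof -
 have "ins x (%k. ins y (%l. f k l)) = (\<Oplus>k\<in>{..<n}. \<Oplus>l\<in>{..<n}. x k \<otimes> (y l \<otimes> f k l))"
  unfolding ins_def using assms by (intro finsum_cong_weak refl finsum_rdistr) auto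
 also have "... = (\<Oplus>l\<in>{..<n}. \<Oplus>k\<in>{..<n}. x k \<otimes> (y l \<otimes> f k l))"
  using assms by (intro finsum_swap) auto
 also have "... = (\<Oplus>l\<in>{..<n}. \<Oplus>k\<in>{..<n}. y l \<otimes> (x k \<otimes> f k l))"
  using assms by (intro finsum_cong_weak refl) (auto simp: m_lcomm)
 also have "... = ins y (%l. ins x (%k. f k l))"
  unfolding ins_def using assms by (intro finsum_cong_weak refl finsum_rdistr[symmetric]) auto
 finally show ?thesis .
qed

abbreviation br where "br s u a b v == ins (c a b) (%k. nf_coeff s (u @ k # v))"

text \<open>The defining recursion of \<open>nf_coeff\<close> covers only the descent picked by
  \<open>an_inversion\<close>; here it is demanded at every descent of \<open>w\<close>.\<close>

definition comm_at where
 "comm_at s w \<longleftrightarrow> (ALL u a b v. w = u @ a # b # v --> b < a -->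
  nf_coeff s w = nf_coeff s (u @ b # a # v) \<oplus> br s u a b v)"

lemma ins_zero: "(!!k. k < n ==> x k = \<zero>) ==> (!!k. k < n ==> f k .: R) ==> ins x f = \<zero>"
 unfolding ins_def by (rule add.finprod_one_eqI) auto

lemma ins_neg:
 assumes "!!k. k < n ==> x k .: R" "!!k. k < n ==> y k = \<ominus> x k" "!!k. k < n ==> f k .: R"
 shows "ins y f \<oplus> ins x f = \<zero>"
proof -
 have "ins y f \<oplus> ins x f = (\<Oplus>k\<in>{..<n}. y k \<otimes> f k \<oplus> x k \<otimes> f k)"
  unfolding ins_def using assms by (intro finsum_addf[symmetric]) auto
 also have "... = \<zero>" using assms by (intro add.finprod_one_eqI) (auto simp: l_minus l_neg)
 finally show ?thesis .
qed

text \<open>An ascent is a descent of the exchanged word, and the two bracket terms cancel by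
  antisymmetry; for equal letters the bracket is zero.\<close>

lemma comm_at_all:
 assumes "!!w. length w = length u + length v + 2 ==> w : W ==> comm_at s w"
  and W: "u : W" "v : W" "a < n" "b < n"
 shows "nf_coeff s (u @ a # b # v) = nf_coeff s (u @ b # a # v) \<oplus> br s u a b v"
proof (cases a b rule: linorder_cases)
 case equal
 have "br s u a a v = \<zero>" using W by (intro ins_zero) (auto simp: c_self)
 thus ?thesis using equal W by simp
next
 case greater
 thus ?thesis using assms(1)[of "u @ a # b # v"] W by (auto simp: comm_at_def)
next
 case less
 hence "nf_coeff s (u @ b # a # v) = nf_coeff s (u @ a # b # v) \<oplus> br s u b a v"
  using assms(1)[of "u @ b # a # v"] W by (auto simp: comm_at_def)
 moreover have "br s u b a v \<oplus> br s u a b v = \<zero>"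
  using W by (intro ins_neg) (auto intro: c_anti)
 ultimately show ?thesis using W by (simp add: a_assoc)
qed

lemma ins_ins:
 assumes "!!k. k < n ==> x k .: R" "!!k l. k < n ==> l < n ==> y k l .: R" "!!l. l < n ==> f l .: R"
 shows "ins x (%k. ins (y k) f) = ins (%l. \<Oplus>k\<in>{..<n}. x k \<otimes> y k l) f"
proof -
 have "ins x (%k. ins (y k) f) = (\<Oplus>k\<in>{..<n}. \<Oplus>l\<in>{..<n}. x k \<otimes> (y k l \<otimes> f l))"
  unfolding ins_def using assms by (intro finsum_cong_weak refl finsum_rdistr) auto
 also have "... = (\<Oplus>l\<in>{..<n}. \<Oplus>k\<in>{..<n}. x k \<otimes> (y k l \<otimes> f l))"
  using assms by (intro finsum_swap) auto
 also have "... = (\<Oplus>l\<in>{..<n}. \<Oplus>k\<in>{..<n}. (x k \<otimes> y k l) \<otimes> f l)"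
  using assms by (intro finsum_cong_weak refl) (auto simp: m_assoc)
 also have "... = ins (%l. \<Oplus>k\<in>{..<n}. x k \<otimes> y k l) f"
  unfolding ins_def using assms by (intro finsum_cong_weak refl finsum_ldistr[symmetric]) auto
 finally show ?thesis .
qed

lemma jacobi_ins:
 assumes ijk: "i < n" "j < n" "k < n" and f: "!!l. l < n ==> f l .: R"
 shows "ins (c i j) (%l. ins (c l k) f) \<oplus> ins (c j k) (%l. ins (c l i) f) \<oplus> ins (c k i) (%l. ins (c l j) f) = \<zero>"
proof -
 let ?J = "%i j k m. \<Oplus>l\<in>{..<n}. c i j l \<otimes> c l k m"
 have J: "?J i j k m .: R" if "i < n" "j < n" "k < n" "m < n" for i j k m
  using that by auto
 have "ins (c i j) (%l. ins (c l k) f) \<oplus> ins (c j k) (%l. ins (c l i) f) \<oplus> ins (c k i) (%l. ins (c l j) f)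
  = (\<Oplus>m\<in>{..<n}. ?J i j k m \<otimes> f m \<oplus> ?J j k i m \<otimes> f m \<oplus> ?J k i j m \<otimes> f m)"
  using ijk f J by (subst (1 2 3) ins_ins) (simp_all add: ins_def finsum_addf)
 also have "... = \<zero>"
 proof (rule add.finprod_one_eqI)
  fix m assume m: "m : {..<n}"
  hence "?J i j k m \<otimes> f m \<oplus> ?J j k i m \<otimes> f m \<oplus> ?J k i j m \<otimes> f m = (?J i j k m \<oplus> ?J j k i m \<oplus> ?J k i j m) \<otimes> f m"
   using ijk f J[of _ _ _ m] by (simp add: l_distr)
  thus "?J i j k m \<otimes> f m \<oplus> ?J j k i m \<otimes> f m \<oplus> ?J k i j m \<otimes> f m = \<zero>"
   using m ijk f by (simp add: c_jacobi)
 qed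
 finally show ?thesis .
qed

text \<open>Bookkeeping for overlapping descents: \<open>N\<close> belongs to the common end word,
  \<open>x\<close>, \<open>y\<close>, \<open>z\<close> are single bracket terms, and
  \<open>p\<close>, \<open>q\<close> are nested ones, whose sum Jacobi turns into the nested term of
  the other route.\<close>

lemma rearrange:
 assumes "N .: R" "x .: R" "y .: R" "z .: R" "p .: R" "q .: R"
 shows "N \<oplus> (y \<oplus> q) \<oplus> x \<oplus> (z \<oplus> p) = N \<oplus> z \<oplus> (x \<oplus> (p \<oplus> q)) \<oplus> y"
 using assms by (simp add: a_ac)

text \<open>Confluence in the sense of the diamond lemma: straightening \<open>w\<close> at the
  descent \<open>a b\<close> or at a later descent \<open>d e\<close> gives the same result,
  provided that all smaller words already straighten consistently.\<close>

lemma comm_consistent: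
 assumes short: "!!w'. length w' < length w ==> w' : W ==> comm_at s w'"
  and same: "!!w'. length w' = length w ==> inversions w' < inversions w ==> w' : W ==> comm_at s w'"
  and w: "w : W" "w = u @ a # b # v" "b < a" "w = p @ d # e # q" "e < d" "length u <= length p"
 shows "nf_coeff s (u @ b # a # v) \<oplus> br s u a b v = nf_coeff s (p @ e # d # q) \<oplus> br s p d e q"
proof -
 note c_closed [simp]
 obtain r where "p = u @ r & a # b # v = r @ d # e # q"
  using w(2,4,6) by (auto simp: append_eq_append_conv2)
 hence p: "p = u @ r" and r: "a # b # v = r @ d # e # q" by auto
 have IHs: "nf_coeff s (x @ i # j # y) = nf_coeff s (x @ j # i # y) \<oplus> br s x i j y"
  if "length x + length y + 2 < length w" "x : W" "y : W" "i < n" "j < n" for x i j y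
  using that by (intro comm_at_all short) auto
 have IHi: "nf_coeff s (x @ i # j # y) = nf_coeff s (x @ j # i # y) \<oplus> br s x i j y"
  if "length x + length y + 2 = length w" "inversions (x @ i # j # y) < inversions w" "j < i" "x @ i # j # y : W" for x i j y
  using same[of "x @ i # j # y"] that by (auto simp: comm_at_def)
 \<comment> \<open>\<open>r\<close> is the gap between the starting positions: the descents
   coincide, share the letter \<open>b\<close>, or are disjoint.\<close>
 consider "r = []" | "r = [a]" | r' where "r = a # b # r'"
  using r by (cases r; cases "tl r") auto
 thus ?thesis
 proof cases
  case 1 thus ?thesis using p r by auto
 next
  case 2
  hence d: "d = b" "v = e # q" using r by auto
  note w2 = w(1)[unfolded w(2) d] and len = w(2)[unfolded d]
  have bnd: "u : W" "q : W" "a < n" "b < n" "e < n" using w2 by auto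
  have lt: "e < b" "b < a" "e < a" using w d by auto
  have i1: "inversions (u @ b # a # e # q) < inversions w"
   using inversions_swap[OF lt(2), of u "e # q"] len by simp
  have i2: "inversions (u @ b # e # a # q) < inversions (u @ b # a # e # q)"
   using inversions_swap[OF lt(3), of "u @ [b]" q] by simp
  have i3: "inversions (u @ a # e # b # q) < inversions w"
   using inversions_swap[OF lt(1), of "u @ [a]" q] len by simp
  have i4: "inversions (u @ e # a # b # q) < inversions (u @ a # e # b # q)"
   using inversions_swap[OF lt(3), of u "b # q"] by simp
  \<comment> \<open>Two routes lead from \<open>a b e\<close> to \<open>e b a\<close>: through
    \<open>b a e\<close> and \<open>b e a\<close>, or through \<open>a e b\<close> and
    \<open>e a b\<close>. All intermediate words have fewer inversions than
    \<open>w\<close>.\<close>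
  have e1: "nf_coeff s (u @ b # a # e # q) = nf_coeff s (u @ b # e # a # q) \<oplus> br s (u @ [b]) a e q"
   using IHi[of "u @ [b]" q a e] i1 bnd lt len by simp
  have e2: "nf_coeff s (u @ b # e # a # q) = nf_coeff s (u @ e # b # a # q) \<oplus> br s u b e (a # q)"
   using IHi[of u "a # q" b e] i1 i2 bnd lt len by simp
  have e3: "nf_coeff s (u @ a # e # b # q) = nf_coeff s (u @ e # a # b # q) \<oplus> br s u a e (b # q)"
   using IHi[of u "b # q" a e] i3 bnd lt len by simp
  have e4: "nf_coeff s (u @ e # a # b # q) = nf_coeff s (u @ e # b # a # q) \<oplus> br s (u @ [e]) a b q"
   using IHi[of "u @ [e]" q a b] i3 i4 bnd lt len by simp
  \<comment> \<open>Moving the bracket letter across \<open>k\<close> leaves a nested bracket. The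
    exchange is licensed because a word with a bracket letter is shorter than
    \<open>w\<close>.\<close>
  have shift: "br s u i j (k # q) = br s (u @ [k]) i j q \<oplus> ins (c i j) (%l. br s u l k q)"
   if "i < n" "j < n" "k < n" for i j k
  proof -
   have "br s u i j (k # q) = ins (c i j) (%l. nf_coeff s ((u @ [k]) @ l # q) \<oplus> br s u l k q)"
    by (rule ins_cong) (use IHs[of u q _ k] that bnd len in auto)
   also have "... = br s (u @ [k]) i j q \<oplus> ins (c i j) (%l. br s u l k q)"
    using that bnd by (intro ins_add) auto
   finally show ?thesis .
  qed
  let ?J = "%i j k. ins (c i j) (%l. br s u l k q)"
  have Jc: "?J i j k .: R" if "i < n" "j < n" "k < n" for i j k
   using that bnd by (intro ins_closed) auto
  have jac: "?J a b e \<oplus> ?J b e a \<oplus> ?J e a b = \<zero>"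
   using bnd by (intro jacobi_ins) auto
  have anti: "?J e a b \<oplus> ?J a e b = \<zero>"
   using bnd by (intro ins_neg) (auto intro: c_anti)
  have brc: "br s (u @ [k]) i j q .: R" if "i < n" "j < n" "k < n" for i j k
   using that bnd by (intro ins_closed) auto
  let ?N = "nf_coeff s (u @ e # b # a # q)"
  let ?x = "br s (u @ [b]) a e q" and ?y = "br s (u @ [a]) b e q" and ?z = "br s (u @ [e]) a b q"
  have cl: "?N .: R" "?x .: R" "?y .: R" "?z .: R"
   using bnd by (auto intro!: brc)
  note Jcc = Jc[OF bnd(3,4,5)] Jc[OF bnd(4,5,3)] Jc[OF bnd(5,3,4)] Jc[OF bnd(3,5,4)]
  \<comment> \<open>Jacobi for \<open>a\<close>, \<open>b\<close>, \<open>e\<close>, with the third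
    term changing sign when its inner pair is exchanged.\<close>
  have "?J a b e \<oplus> ?J b e a = ?J a e b"
  proof -
   have "?J a b e \<oplus> ?J b e a = \<ominus> ?J e a b" using jac Jcc by (metis a_closed minus_equality minus_minus)
   also have "... = ?J a e b" using anti Jcc by (metis a_comm minus_equality)
   finally show ?thesis .
  qed
  hence "?N \<oplus> (?y \<oplus> ?J b e a) \<oplus> ?x \<oplus> (?z \<oplus> ?J a b e) = ?N \<oplus> ?z \<oplus> (?x \<oplus> ?J a e b) \<oplus> ?y"
   using rearrange[OF cl Jcc(1,2)] by simp
  moreover have "nf_coeff s (u @ b # a # v) \<oplus> br s u a b v = ?N \<oplus> (?y \<oplus> ?J b e a) \<oplus> ?x \<oplus> (?z \<oplus> ?J a b e)"
   unfolding d e1 e2 using shift[OF bnd(4,5,3)] shift[OF bnd(3,4,5)] by simp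
  moreover have "nf_coeff s (p @ e # d # q) \<oplus> br s p d e q = ?N \<oplus> ?z \<oplus> (?x \<oplus> ?J a e b) \<oplus> ?y"
   unfolding d p 2 using e3 e4 shift[OF bnd(3,5,4)] by simp
  ultimately show ?thesis by simp
 next
  case (3 r')
  hence v: "v = r' @ d # e # q" using r by auto
  note w2 = w(1)[unfolded w(2) v] and len = w(2)[unfolded v]
  have bnd: "u : W" "q : W" "r' : W" "a < n" "b < n" "d < n" "e < n" using w2 by auto
  have i1: "inversions (u @ b # a # r' @ d # e # q) < inversions w"
   using inversions_swap[OF w(3), of u v] w(2) v by simp
  have i2: "inversions (u @ a # b # r' @ e # d # q) < inversions w"
   using inversions_swap[OF w(5), of "u @ a # b # r'" q] len by simp
  have e1: "nf_coeff s (u @ b # a # r' @ d # e # q) = nf_coeff s (u @ b # a # r' @ e # d # q) \<oplus> br s (u @ b # a # r') d e q"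
   using IHi[of "u @ b # a # r'" q d e] i1 bnd w(5) len by simp
  have e2: "nf_coeff s (u @ a # b # r' @ e # d # q) = nf_coeff s (u @ b # a # r' @ e # d # q) \<oplus> br s u a b (r' @ e # d # q)"
   using IHi[of u "r' @ e # d # q" a b] i2 bnd w(3) len by simp
  \<comment> \<open>For disjoint descents each route produces a term in which both pairs are
    bracketed; the two orders of summation agree.\<close>
  let ?D = "ins (c a b) (%k. ins (c d e) (%l. nf_coeff s (u @ k # r' @ l # q)))"
  have f1: "br s u a b (r' @ d # e # q) = br s u a b (r' @ e # d # q) \<oplus> ?D"
  proof -
   have "br s u a b (r' @ d # e # q) = ins (c a b) (%k. nf_coeff s (u @ k # r' @ e # d # q) \<oplus> br s (u @ k # r') d e q)"
   proof (rule ins_cong)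
    fix k assume "k < n"
    thus "nf_coeff s (u @ k # r' @ d # e # q) = nf_coeff s (u @ k # r' @ e # d # q) \<oplus> br s (u @ k # r') d e q"
     using IHs[of "u @ k # r'" q d e] bnd len by simp
   qed
   also have "... = br s u a b (r' @ e # d # q) \<oplus> ins (c a b) (%k. br s (u @ k # r') d e q)"
    using bnd by (intro ins_add) auto
   finally show ?thesis by simp
  qed
  have f2: "br s (u @ a # b # r') d e q = br s (u @ b # a # r') d e q \<oplus> ?D"
  proof -
   have "br s (u @ a # b # r') d e q = ins (c d e) (%k. nf_coeff s (u @ b # a # r' @ k # q) \<oplus> br s u a b (r' @ k # q))"
   proof (rule ins_cong)
    fix k assume "k < n"
    thus "nf_coeff s ((u @ a # b # r') @ k # q) = nf_coeff s (u @ b # a # r' @ k # q) \<oplus> br s u a b (r' @ k # q)"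
     using IHs[of u "r' @ k # q" a b] bnd len by simp
   qed
   also have "... = ins (c d e) (%k. nf_coeff s (u @ b # a # r' @ k # q)) \<oplus> ins (c d e) (%k. br s u a b (r' @ k # q))"
    using bnd by (intro ins_add) auto
   also have "ins (c d e) (%k. br s u a b (r' @ k # q)) = ?D"
    using bnd by (intro ins_swap) auto
   finally show ?thesis by simp
  qed
  have cl: "nf_coeff s (u @ b # a # r' @ e # d # q) .: R" "br s (u @ b # a # r') d e q .: R"
   "br s u a b (r' @ e # d # q) .: R" "?D .: R"
   using bnd by (auto intro!: ins_closed)
  show ?thesis unfolding p 3 v using e1 e2 f1 f2 cl by (simp add: a_ac)
 qed
qed

lemma comm_at: "w : W ==> comm_at s w"
proof (induction w rule: word_induct)
 case (less w)
 show ?case unfolding comm_at_def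
 proof (intro allI impI)
  fix u a b v assume w: "w = u @ a # b # v" "b < a"
  have ns: "\<not> sorted w" using w by (auto simp: sorted_append)
  obtain p d e q where i: "an_inversion w = (p, d, e, q)" by (metis prod_cases4)
  hence w': "w = p @ d # e # q" "e < d" using an_inversion[OF ns i] by auto
  have "nf_coeff s (u @ b # a # v) \<oplus> br s u a b v = nf_coeff s (p @ e # d # q) \<oplus> br s p d e q"
  proof (cases "length u <= length p")
   case True
   show ?thesis by (rule comm_consistent[OF less(1,2) less(3) w w' True])
  next
   case False
   hence "length p <= length u" by simp
   from comm_consistent[OF less(1,2) less(3) w' w this] show ?thesis by simp
  qed
  thus "nf_coeff s w = nf_coeff s (u @ b # a # v) \<oplus> br s u a b v"
   using nf_step[OF ns i] by simp
 qed
qed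

theorem nf_comm:
 assumes "u : W" "v : W" "a < n" "b < n"
 shows "nf_coeff s (u @ a # b # v) = nf_coeff s (u @ b # a # v) \<oplus> (\<Oplus>k\<in>{..<n}. c a b k \<otimes> nf_coeff s (u @ k # v))"
 using comm_at_all[OF comm_at assms] by (simp add: ins_def)

end

definition self_module :: "('k, 'r) ring_scheme => ('k, 'k) module" where
 "self_module R = \<lparr>carrier = car R, monoid.mult = (\<otimes>\<^sub>R), one = \<one>\<^sub>R, zero = \<zero>\<^sub>R, add = (\<oplus>\<^sub>R), smult = (\<otimes>\<^sub>R)\<rparr>"

lemma self_module_simps [simp]:
 "car (self_module R) = car R" "\<zero>\<^bsub>self_module R\<^esub> = \<zero>\<^sub>R"
 "x \<oplus>\<^bsub>self_module R\<^esub> y = x \<oplus>\<^sub>R y" "x \<odot>\<^bsub>self_module R\<^esub> y = x \<otimes>\<^sub>R y"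
 by (simp_all add: self_module_def)

lemma (in cring) module_self_module: "module R (self_module R)"
 by (rule moduleI[OF cring_axioms], rule abelian_groupI)
 (auto simp: a_ac l_distr r_distr m_assoc intro: exI[of _ "\<ominus> _"] bexI[of _ "\<ominus> _"] l_neg)

context structure_constants begin

lemma ins_add_left:
 assumes "!!k. k < n ==> x k .: R" "!!k. k < n ==> y k .: R" "!!k. k < n ==> f k .: R"
  "!!k. k < n ==> z k = x k \<oplus> y k"
 shows "ins z f = ins x f \<oplus> ins y f"
proof -
 have "ins z f = (\<Oplus>k\<in>{..<n}. x k \<otimes> f k \<oplus> y k \<otimes> f k)"
  unfolding ins_def using assms by (intro finsum_cong_weak) (auto simp: l_distr)
 thus ?thesis unfolding ins_def using assms by (simp add: finsum_addf)
qed

lemma ins_smult_left: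
 assumes "!!k. k < n ==> x k .: R" "a .: R" "!!k. k < n ==> f k .: R"
  "!!k. k < n ==> z k = a \<otimes> x k"
 shows "ins z f = a \<otimes> ins x f"
proof -
 have "ins z f = (\<Oplus>k\<in>{..<n}. a \<otimes> (x k \<otimes> f k))"
  unfolding ins_def using assms by (intro finsum_cong_weak) (auto simp: m_assoc)
 thus ?thesis unfolding ins_def using assms by (simp add: finsum_rdistr)
qed

lemma ins_smult:
 assumes "!!k. k < n ==> x k .: R" "a .: R" "!!k. k < n ==> f k .: R"
 shows "ins x (%k. a \<otimes> f k) = a \<otimes> ins x f"
proof -
 have "ins x (%k. a \<otimes> f k) = (\<Oplus>k\<in>{..<n}. a \<otimes> (x k \<otimes> f k))"
  unfolding ins_def using assms by (intro finsum_cong_weak) (auto simp: m_lcomm)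
 thus ?thesis unfolding ins_def using assms by (simp add: finsum_rdistr)
qed

lemma ins_single:
 assumes "i < n" "!!k. k < n ==> f k .: R" "!!k. k < n ==> x k = (if k = i then \<one> else \<zero>)"
 shows "ins x f = f i"
proof -
 have "ins x f = (\<Oplus>k\<in>{..<n}. if i = k then f k else \<zero>)"
  unfolding ins_def using assms by (intro finsum_cong_weak) auto
 also have "... = f i" using assms by (intro finsum_singleton) auto
 finally show ?thesis .
qed

end

section \<open>Coordinates of the Lie algebra and coefficient functionals\<close>

locale lie_basis = lie_algebra +
 fixes n :: nat and b :: "nat => 'c" and coord :: "'c => nat => 'a"
 assumes b_closed [simp]: "i < n ==> b i .: L"
  and coord_closed [simp]: "x .: L ==> i < n ==> coord x i .: K"
  and coord_sum: "x .: L ==> x = (\<Oplus>\<^sub>L i\<in>{..<n}. coord x i \<odot>\<^sub>L b i)"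
  and coord_unique: "(!!i. i < n ==> a i .: K) ==> i < n ==>
   coord (\<Oplus>\<^sub>L i\<in>{..<n}. a i \<odot>\<^sub>L b i) i = a i"
begin

lemma coord_add:
 assumes "x .: L" "y .: L" "i < n"
 shows "coord (x \<oplus>\<^sub>L y) i = coord x i \<oplus> coord y i"
proof -
 have "x \<oplus>\<^sub>L y = (\<Oplus>\<^sub>L i\<in>{..<n}. coord x i \<odot>\<^sub>L b i) \<oplus>\<^sub>L (\<Oplus>\<^sub>L i\<in>{..<n}. coord y i \<odot>\<^sub>L b i)"
  using assms coord_sum by metis
 also have "... = (\<Oplus>\<^sub>L i\<in>{..<n}. coord x i \<odot>\<^sub>L b i \<oplus>\<^sub>L coord y i \<odot>\<^sub>L b i)"
  using assms by (intro M.finsum_addf[symmetric]) auto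
 also have "... = (\<Oplus>\<^sub>L i\<in>{..<n}. (coord x i \<oplus> coord y i) \<odot>\<^sub>L b i)"
  using assms by (intro finsum_cong_weak) (auto simp: smult_l_distr)
 finally show ?thesis using coord_unique[of "%i. coord x i \<oplus> coord y i" i] assms by simp
qed

lemma coord_smult:
 assumes "x .: L" "a .: K" "i < n"
 shows "coord (a \<odot>\<^sub>L x) i = a \<otimes> coord x i"
proof -
 have "a \<odot>\<^sub>L x = a \<odot>\<^sub>L (\<Oplus>\<^sub>L i\<in>{..<n}. coord x i \<odot>\<^sub>L b i)"
  using assms coord_sum by metis
 also have "... = (\<Oplus>\<^sub>L i\<in>{..<n}. a \<odot>\<^sub>L (coord x i \<odot>\<^sub>L b i))"
  using assms by (intro finsum_smult_ldistr) auto
 also have "... = (\<Oplus>\<^sub>L i\<in>{..<n}. (a \<otimes> coord x i) \<odot>\<^sub>L b i)"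
  using assms by (intro finsum_cong_weak) (auto simp: smult_assoc1)
 finally show ?thesis using coord_unique[of "%i. a \<otimes> coord x i" i] assms by simp
qed

lemma coord_zero: "i < n ==> coord \<zero>\<^sub>L i = \<zero>"
 using coord_smult[of "\<zero>\<^sub>L" "\<zero>" i] by simp

lemma coord_finsum:
 assumes "finite A" "!!j. j : A ==> f j .: L" "i < n"
 shows "coord (\<Oplus>\<^sub>L j\<in>A. f j) i = (\<Oplus>j\<in>A. coord (f j) i)"
 using assms by (induction A rule: finite_induct) (auto simp: coord_zero coord_add)

lemma coord_b: "i < n ==> j < n ==> coord (b j) i = (if i = j then \<one> else \<zero>)"
proof -
 assume ij: "i < n" "j < n"
 have "(\<Oplus>\<^sub>L i\<in>{..<n}. (if i = j then \<one> else \<zero>) \<odot>\<^sub>L b i) = (\<Oplus>\<^sub>L i\<in>{..<n}. if j = i then b i else \<zero>\<^sub>L)"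
  using ij by (intro finsum_cong_weak) auto
 also have "... = b j" using ij by (intro M.finsum_singleton) auto
 finally show ?thesis using coord_unique[of "%i. if i = j then \<one> else \<zero>" i] ij by simp
qed

lemma br_zero: "x .: L ==> br \<zero>\<^sub>L x = \<zero>\<^sub>L" "x .: L ==> br x \<zero>\<^sub>L = \<zero>\<^sub>L"
 using br_smult_left[of \<zero> "\<zero>\<^sub>L" x] br_smult_right[of \<zero> x "\<zero>\<^sub>L"] by (simp_all add: br_closed)

lemma br_finsum_left:
 assumes "finite A" "!!j. j : A ==> f j .: L" "x .: L"
 shows "br (\<Oplus>\<^sub>L j\<in>A. f j) x = (\<Oplus>\<^sub>L j\<in>A. br (f j) x)"
 using assms by (induction A rule: finite_induct) (auto simp: br_zero br_add_left br_closed)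

lemma br_finsum_right:
 assumes "finite A" "!!j. j : A ==> f j .: L" "x .: L"
 shows "br x (\<Oplus>\<^sub>L j\<in>A. f j) = (\<Oplus>\<^sub>L j\<in>A. br x (f j))"
 using assms by (induction A rule: finite_induct) (auto simp: br_zero br_add_right br_closed)

lemma br_anti: "x .: L ==> y .: L ==> br y x = \<ominus>\<^sub>L br x y"
proof -
 assume xy: "x .: L" "y .: L"
 have "\<zero>\<^sub>L = br (x \<oplus>\<^sub>L y) (x \<oplus>\<^sub>L y)" using xy by (simp add: br_self)
 also have "... = br x (x \<oplus>\<^sub>L y) \<oplus>\<^sub>L br y (x \<oplus>\<^sub>L y)" using xy by (intro br_add_left) auto
 also have "... = br y x \<oplus>\<^sub>L br x y" using xy by (simp add: br_add_right br_self br_closed M.a_comm)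
 finally show ?thesis using xy by (simp add: br_closed M.minus_equality)
qed

definition c where "c i j k = coord (br (b i) (b j)) k"

lemma coord_br_left:
 assumes "x .: L" "y .: L" "m < n"
 shows "coord (br x y) m = (\<Oplus>l\<in>{..<n}. coord x l \<otimes> coord (br (b l) y) m)"
proof -
 have "coord (br x y) m = coord (br (\<Oplus>\<^sub>L i\<in>{..<n}. coord x i \<odot>\<^sub>L b i) y) m"
  using coord_sum[OF assms(1)] by simp
 also have "... = (\<Oplus>l\<in>{..<n}. coord (br (coord x l \<odot>\<^sub>L b l) y) m)"
  using assms by (subst br_finsum_left; (subst coord_finsum)?) (auto simp: br_closed)
 also have "... = (\<Oplus>l\<in>{..<n}. coord x l \<otimes> coord (br (b l) y) m)"
  using assms by (intro finsum_cong_weak) (auto simp: br_smult_left coord_smult br_closed)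
 finally show ?thesis .
qed

lemma coord_br_right:
 assumes "x .: L" "y .: L" "m < n"
 shows "coord (br x y) m = (\<Oplus>l\<in>{..<n}. coord y l \<otimes> coord (br x (b l)) m)"
proof -
 have "coord (br x y) m = coord (br x (\<Oplus>\<^sub>L i\<in>{..<n}. coord y i \<odot>\<^sub>L b i)) m"
  using coord_sum[OF assms(2)] by simp
 also have "... = (\<Oplus>l\<in>{..<n}. coord (br x (coord y l \<odot>\<^sub>L b l)) m)"
  using assms by (subst br_finsum_right; (subst coord_finsum)?) (auto simp: br_closed)
 also have "... = (\<Oplus>l\<in>{..<n}. coord y l \<otimes> coord (br x (b l)) m)"
  using assms by (intro finsum_cong_weak) (auto simp: br_smult_right coord_smult br_closed)
 finally show ?thesis .
qed

lemma coord_uminus: "x .: L ==> i < n ==> coord (\<ominus>\<^sub>L x) i = \<ominus> coord x i"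
proof -
 assume x: "x .: L" "i < n"
 have "coord (\<ominus>\<^sub>L x \<oplus>\<^sub>L x) i = coord (\<ominus>\<^sub>L x) i \<oplus> coord x i" using x by (simp add: coord_add)
 thus ?thesis using x by (simp add: M.l_neg coord_zero R.minus_equality)
qed

sublocale SC: structure_constants K n c
proof
 fix i j k assume ijk: "i < n" "j < n" "k < n"
 show "c i j k .: K" using ijk by (simp add: c_def br_closed)
 show "c j i k = \<ominus> c i j k" using ijk by (simp add: c_def br_anti[of "b i" "b j"] coord_uminus br_closed)
 fix m assume m: "m < n"
 have 1: "(\<Oplus>l\<in>{..<n}. c i j l \<otimes> c l k m) = coord (br (br (b i) (b j)) (b k)) m" if "i < n" "j < n" "k < n" for i j k
  using that m coord_br_left[of "br (b i) (b j)" "b k" m] by (simp add: c_def br_closed)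
 \<comment> \<open>The Lie axiom has right-nested brackets, \<open>c_jacobi\<close> left-nested
   ones; three applications of antisymmetry change the whole sum by a sign.\<close>
 let ?j = "br (b i) (br (b j) (b k)) \<oplus>\<^sub>L br (b j) (br (b k) (b i)) \<oplus>\<^sub>L br (b k) (br (b i) (b j))"
 have "coord (br (br (b i) (b j)) (b k)) m \<oplus> coord (br (br (b j) (b k)) (b i)) m \<oplus> coord (br (br (b k) (b i)) (b j)) m
  = \<ominus> coord ?j m"
  using ijk m by (simp add: br_anti[of "b i" "br (b j) (b k)"] br_anti[of "b j" "br (b k) (b i)"]
   br_anti[of "b k" "br (b i) (b j)"] br_closed coord_uminus coord_add R.minus_add R.a_ac)
 also have "... = \<zero>" using ijk m by (simp add: jacobi coord_zero)
 finally show "(\<Oplus>l\<in>{..<n}. c i j l \<otimes> c l k m) \<oplus> (\<Oplus>l\<in>{..<n}. c j k l \<otimes> c l i m) \<oplus>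
   (\<Oplus>l\<in>{..<n}. c k i l \<otimes> c l j m) = \<zero>"
  using ijk by (simp add: 1)
next
 fix i k assume "i < n" "k < n"
 thus "c i i k = \<zero>" by (simp add: c_def br_self coord_zero)
qed

text \<open>The multilinear extension of \<open>nf_coeff s\<close> from basis words to words over
  the Lie algebra. \<open>p\<close> collects the basis letters chosen for the vectors already
  read.\<close>

primrec mext :: "nat list => 'c list => nat list => 'a" where
 "mext s [] p = SC.nf_coeff s p"
| "mext s (x # w) p = SC.ins (coord x) (%i. mext s w (p @ [i]))"

abbreviation "LL == lists (car L)"

lemma mext_closed [simp]: "w : LL ==> ALL i:set p. i < n ==> mext s w p .: K"
proof (induction w arbitrary: p)
 case (Cons x w)
 thus ?case by (auto intro!: SC.ins_closed)
qed simp

lemma mext_closed' [simp]: "ALL x:set w. x .: L ==> ALL i:set p. i < n ==> mext s w p .: K"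
 by (rule mext_closed) auto

lemma mext_add:
 assumes "v : LL" "x .: L" "y .: L"
 shows "u : LL ==> ALL i:set p. i < n ==> mext s (u @ (x \<oplus>\<^sub>L y) # v) p = mext s (u @ x # v) p \<oplus> mext s (u @ y # v) p"
proof (induction u arbitrary: p)
 case Nil
 thus ?case using assms by (simp, intro SC.ins_add_left) (auto simp: coord_add)
next
 case (Cons z u)
 have "mext s ((z # u) @ (x \<oplus>\<^sub>L y) # v) p = SC.ins (coord z) (%i. mext s (u @ x # v) (p @ [i]) \<oplus> mext s (u @ y # v) (p @ [i]))"
  using Cons by (simp, intro SC.ins_cong) auto
 also have "... = mext s ((z # u) @ x # v) p \<oplus> mext s ((z # u) @ y # v) p"
  using Cons assms by (simp, intro SC.ins_add) auto
 finally show ?case .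
qed

lemma mext_smult:
 assumes "v : LL" "x .: L" "a .: K"
 shows "u : LL ==> ALL i:set p. i < n ==> mext s (u @ (a \<odot>\<^sub>L x) # v) p = a \<otimes> mext s (u @ x # v) p"
proof (induction u arbitrary: p)
 case Nil
 thus ?case using assms by (simp, intro SC.ins_smult_left) (auto simp: coord_smult)
next
 case (Cons z u)
 have "mext s ((z # u) @ (a \<odot>\<^sub>L x) # v) p = SC.ins (coord z) (%i. a \<otimes> mext s (u @ x # v) (p @ [i]))"
  using Cons by (simp, intro SC.ins_cong) auto
 also have "... = a \<otimes> mext s ((z # u) @ x # v) p"
  using Cons assms by (simp, intro SC.ins_smult) auto
 finally show ?case .
qed

text \<open>The vectors of \<open>v\<close> only append letters behind \<open>r\<close>, so the
  claim passes through the linear insertions down to \<open>nf_comm\<close>.\<close>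

lemma mext_swap:
 assumes "i < n" "j < n"
 shows "v : LL ==> ALL k:set p. k < n ==> ALL k:set r. k < n ==>
  mext s v (p @ i # j # r) = mext s v (p @ j # i # r) \<oplus> SC.ins (c i j) (%k. mext s v (p @ k # r))"
proof (induction v arbitrary: r)
 case Nil
 thus ?case using assms SC.nf_comm[of p r i j s] by (auto simp: SC.ins_def)
next
 case (Cons x v)
 have x: "x .: L" "v : LL" using Cons by auto
 have mc: "mext s v q .: K" if "ALL i:set q. i < n" for q by (rule mext_closed[OF x(2) that])
 have "mext s (x # v) (p @ i # j # r) = SC.ins (coord x) (%l. mext s v (p @ j # i # r @ [l]) \<oplus>
  SC.ins (c i j) (%k. mext s v (p @ k # r @ [l])))"
 proof (simp, rule SC.ins_cong)
  fix l assume "l < n"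
  thus "mext s v (p @ i # j # r @ [l]) = mext s v (p @ j # i # r @ [l]) \<oplus> SC.ins (c i j) (%k. mext s v (p @ k # r @ [l]))"
   using Cons.IH[of "r @ [l]"] Cons.prems x by simp
 qed
 also have "... = SC.ins (coord x) (%l. mext s v (p @ j # i # r @ [l])) \<oplus>
  SC.ins (coord x) (%l. SC.ins (c i j) (%k. mext s v (p @ k # r @ [l])))"
  using assms x(1) Cons.prems(2,3) by (intro SC.ins_add) (auto intro!: SC.ins_closed mc)
 also have "SC.ins (coord x) (%l. SC.ins (c i j) (%k. mext s v (p @ k # r @ [l]))) =
  SC.ins (c i j) (%k. SC.ins (coord x) (%l. mext s v (p @ k # r @ [l])))"
  using assms x(1) Cons.prems(2,3) by (intro SC.ins_swap) (auto intro!: mc)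
 finally show ?case by simp
qed

text \<open>Expanding \<open>x\<close> and \<open>y\<close> in the basis reduces the claim to
  \<open>mext_swap\<close>; summation then reassembles the structure constants into the coordinates
  of \<open>br x y\<close>.\<close>

lemma mext_comm:
 assumes "v : LL" "x .: L" "y .: L"
 shows "u : LL ==> ALL i:set p. i < n ==>
  mext s (u @ x # y # v) p = mext s (u @ y # x # v) p \<oplus> mext s (u @ br x y # v) p"
proof (induction u arbitrary: p)
 case Nil
 let ?g = "%k. mext s v (p @ [k])"
 have g: "?g k .: K" if "k < n" for k using that Nil assms by auto
 have "mext s ([] @ x # y # v) p = SC.ins (coord x) (%i. SC.ins (coord y) (%j. mext s v (p @ [j, i]) \<oplus> SC.ins (c i j) ?g))"
 proof (simp, intro SC.ins_cong)
  fix i j assume "i < n" "j < n"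
  thus "mext s v (p @ [i, j]) = mext s v (p @ [j, i]) \<oplus> SC.ins (c i j) ?g"
   using mext_swap[OF _ _ assms(1), of i j p "[]" s] Nil by simp
 qed
 also have "... = SC.ins (coord x) (%i. SC.ins (coord y) (%j. mext s v (p @ [j, i])) \<oplus> SC.ins (coord y) (%j. SC.ins (c i j) ?g))"
  using assms Nil g by (intro SC.ins_cong SC.ins_add) (auto intro!: SC.ins_closed)
 also have "... = SC.ins (coord x) (%i. SC.ins (coord y) (%j. mext s v (p @ [j, i]))) \<oplus>
   SC.ins (coord x) (%i. SC.ins (coord y) (%j. SC.ins (c i j) ?g))"
  using assms Nil g by (intro SC.ins_add) (auto intro!: SC.ins_closed)
 also have "SC.ins (coord x) (%i. SC.ins (coord y) (%j. mext s v (p @ [j, i]))) = mext s (y # x # v) p"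
  using assms Nil g by (simp, intro SC.ins_swap) auto
 also have "SC.ins (coord x) (%i. SC.ins (coord y) (%j. SC.ins (c i j) ?g)) =
  SC.ins (coord x) (%i. SC.ins (%k. \<Oplus>j\<in>{..<n}. coord y j \<otimes> c i j k) ?g)"
  using assms g by (intro SC.ins_cong SC.ins_ins) auto
 also have "... = SC.ins (%k. \<Oplus>i\<in>{..<n}. coord x i \<otimes> (\<Oplus>j\<in>{..<n}. coord y j \<otimes> c i j k)) ?g"
  using assms g by (intro SC.ins_ins) auto
 also have "... = SC.ins (coord (br x y)) ?g"
  unfolding SC.ins_def
 proof (intro finsum_cong_weak refl arg_cong2[where f = "%a b. a \<otimes> b"])
  fix k assume k: "k : {..<n}"
  have "coord (br x y) k = (\<Oplus>i\<in>{..<n}. coord x i \<otimes> coord (br (b i) y) k)"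
   using assms k by (simp add: coord_br_left)
  also have "... = (\<Oplus>i\<in>{..<n}. coord x i \<otimes> (\<Oplus>j\<in>{..<n}. coord y j \<otimes> c i j k))"
   using assms k by (intro finsum_cong_weak) (auto simp: coord_br_right[of "b _" y] c_def)
  finally show "(\<Oplus>i\<in>{..<n}. coord x i \<otimes> (\<Oplus>j\<in>{..<n}. coord y j \<otimes> c i j k)) = coord (br x y) k" by simp
 qed
 finally show ?case by simp
next
 case (Cons z u)
 have "mext s ((z # u) @ x # y # v) p = SC.ins (coord z) (%i. mext s (u @ y # x # v) (p @ [i]) \<oplus> mext s (u @ br x y # v) (p @ [i]))"
  using Cons by (simp, intro SC.ins_cong) auto
 also have "... = mext s ((z # u) @ y # x # v) p \<oplus> mext s ((z # u) @ br x y # v) p"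
  using Cons assms by (simp, intro SC.ins_add) (auto simp: br_closed)
 finally show ?case .
qed

lemma mext_basis: "ALL i:set w. i < n ==> ALL i:set p. i < n ==> mext s (map b w) p = SC.nf_coeff s (p @ w)"
proof (induction w arbitrary: p)
 case (Cons i w)
 have "mext s (map b (i # w)) p = mext s (map b w) (p @ [i])"
  using Cons.prems by (simp, intro SC.ins_single) (auto simp: coord_b)
 thus ?case using Cons by simp
qed simp

definition xw :: "nat list => ('c list => 'a) set set" where "xw w = uword (map b w)"

lemma map_b_LL [simp]: "w : lists {..<n} ==> map b w : LL" "ALL i:set w. i < n ==> map b w : LL"
 by auto

lemma xw_closed [simp]: "w : lists {..<n} ==> xw w .: U"
 by (simp add: xw_def del: in_lists_conv_set)

text \<open>Reads off the coefficient of the ordered monomial \<open>s\<close>; having one such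
  functional for every \<open>s\<close> is the independence half of Poincare-Birkhoff-Witt. It is
  \<open>mext s\<close>, which descends to \<open>U\<close> by
  \<open>enveloping_linear\<close>.\<close>

theorem pbw_functional:
 obtains h where "h : mod_hom K U (self_module K)"
  "!!w. w : lists {..<n} ==> sorted w ==> h (xw w) = (if w = s then \<one> else \<zero>)"
proof -
 obtain h where h: "h : mod_hom K U (self_module K)" "!!w. w : LL ==> h (uword w) = mext s w []"
 proof (rule enveloping_linear[OF R.module_self_module, of "%w. mext s w []"])
  fix u x y v assume a: "u : LL" "v : LL" "x .: L" "y .: L"
  show "mext s (u @ (x \<oplus>\<^sub>L y) # v) [] = mext s (u @ x # v) [] \<oplus>\<^bsub>self_module K\<^esub> mext s (u @ y # v) []"
   using a by (simp add: mext_add)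
  have "mext s (u @ x # y # v) [] \<ominus>\<^bsub>self_module K\<^esub> mext s (u @ y # x # v) [] =
   mext s (u @ x # y # v) [] \<ominus> mext s (u @ y # x # v) []"
   by (simp add: a_minus_def a_inv_def m_inv_def)
  also have "... = mext s (u @ br x y # v) []"
   using a mext_comm[of v x y u "[]" s] R.a_comm R.r_neg2 R.minus_eq
   by (simp add: br_closed) (smt (verit) R.a_assoc R.a_comm R.a_inv_closed R.l_zero R.r_neg br_closed in_lists_conv_set lists.Cons mext_closed append_in_lists_conv empty_iff list.set(1))
  finally show "mext s (u @ x # y # v) [] \<ominus>\<^bsub>self_module K\<^esub> mext s (u @ y # x # v) [] = mext s (u @ br x y # v) []" .
 qed (auto simp: mext_smult)
 show thesis
 proof (rule that[OF h(1)])
  fix w assume "w : lists {..<n}" "sorted w"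
  thus "h (xw w) = (if w = s then \<one> else \<zero>)"
   using h(2)[of "map b w"] mext_basis[of w "[]" s] by (auto simp: xw_def SC.nf_sorted)
 qed
qed

section \<open>The length filtration and straightening\<close>

definition low where "low k = submodule_span K U (xw ` {w : lists {..<n}. sorted w & length w < k})"

lemma low_sub: "xw ` {w : lists {..<n}. sorted w & length w < k} <= car U"
 using xw_closed by blast

lemma low_submodule: "submodule (low k) K U"
 unfolding low_def by (rule UU.submodule_span_submodule[OF low_sub])

lemmas lowE = UU.submoduleE[OF low_submodule]

lemma low_closed: "x : low k ==> x .: U" using lowE(1) by blast

lemma low_zero [simp]: "\<zero>\<^sub>U : low k"
 using subgroup.one_closed[OF submodule.axioms(1)[OF low_submodule]] by simp

lemma low_mono: "k <= l ==> low k <= low l"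
 unfolding low_def by (rule submodule_span_minimal[OF low_submodule[unfolded low_def]])
  (use submodule_span_superset[of "xw ` {w : lists {..<n}. sorted w & length w < l}" K U] in fastforce)

lemma low_gen: "w : lists {..<n} ==> sorted w ==> length w < k ==> xw w : low k"
 unfolding low_def using submodule_span_superset[of "xw ` {w : lists {..<n}. sorted w & length w < k}" K U] by blast

lemma low_finsum: "finite A ==> (!!i. i : A ==> f i : low k) ==> (\<Oplus>\<^sub>U i\<in>A. f i) : low k"
proof (induction A rule: finite_induct)
 case (insert x A)
 have "f : A \<rightarrow> car U" "f x .: U" using insert low_closed by blast+
 thus ?case using insert lowE(5) by simp
qed simp

lemma xw_append: "u : lists {..<n} ==> v : lists {..<n} ==> xw (u @ v) = xw u \<otimes>\<^sub>U xw v"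
 by (simp add: xw_def uword_append del: in_lists_conv_set)

lemma xw_Cons: "i < n ==> v : lists {..<n} ==> xw (i # v) = uin (b i) \<otimes>\<^sub>U xw v"
 by (simp add: xw_def uword_Cons del: in_lists_conv_set)

lemma uin_finsum:
 assumes "finite A" "!!j. j : A ==> f j .: L"
 shows "uin (\<Oplus>\<^sub>L j\<in>A. f j) = (\<Oplus>\<^sub>U j\<in>A. uin (f j))"
 using assms by (induction A rule: finite_induct) (auto simp: mod_hom_zero[OF module_axioms UU.module_axioms uin_mod_hom] uin_add)

lemma uin_coord: "x .: L ==> uin x = (\<Oplus>\<^sub>U i\<in>{..<n}. coord x i \<odot>\<^sub>U uin (b i))"
proof -
 assume x: "x .: L"
 hence "uin x = uin (\<Oplus>\<^sub>L i\<in>{..<n}. coord x i \<odot>\<^sub>L b i)" using coord_sum by simp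
 also have "... = (\<Oplus>\<^sub>U i\<in>{..<n}. uin (coord x i \<odot>\<^sub>L b i))" using x by (intro uin_finsum) auto
 also have "... = (\<Oplus>\<^sub>U i\<in>{..<n}. coord x i \<odot>\<^sub>U uin (b i))"
  using x by (intro finsum_cong_weak) (auto simp: uin_smult)
 finally show ?thesis .
qed

lemma xw_swap:
 assumes "u : lists {..<n}" "v : lists {..<n}" "i < n" "j < n"
 shows "xw (u @ i # j # v) \<ominus>\<^sub>U xw (u @ j # i # v) = (\<Oplus>\<^sub>U k\<in>{..<n}. c i j k \<odot>\<^sub>U xw (u @ k # v))"
proof -
 have cl: "xw u .: U" "xw v .: U" "uin (b i) .: U" "uin (b j) .: U"
  using assms xw_closed uin_closed by auto
 have e: "xw (u @ i # j # v) = xw u \<otimes>\<^sub>U (uin (b i) \<otimes>\<^sub>U uin (b j)) \<otimes>\<^sub>U xw v"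
  if "i < n" "j < n" for i j
  using assms(1,2) that cl(1,2) by (simp add: xw_append xw_Cons UU.m_assoc del: in_lists_conv_set)
 have "xw (u @ i # j # v) \<ominus>\<^sub>U xw (u @ j # i # v) = xw u \<otimes>\<^sub>U uin (br (b i) (b j)) \<otimes>\<^sub>U xw v"
  unfolding e[OF assms(3,4)] e[OF assms(4,3)] using assms cl
  by (simp add: uin_br a_minus_def UU.A.r_distr UU.A.l_distr UU.A.r_minus UU.A.l_minus)
 also have "... = (\<Oplus>\<^sub>U k\<in>{..<n}. xw u \<otimes>\<^sub>U (c i j k \<odot>\<^sub>U uin (b k)) \<otimes>\<^sub>U xw v)"
  using assms cl by (subst uin_coord) (auto simp: br_closed c_def[symmetric] UU.A.finsum_rdistr UU.A.finsum_ldistr)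
 also have "... = (\<Oplus>\<^sub>U k\<in>{..<n}. c i j k \<odot>\<^sub>U xw (u @ k # v))"
  using assms cl by (intro finsum_cong_weak)
  (auto simp: xw_append xw_Cons UU.smult_mult_left[symmetric] UU.smult_mult_right[symmetric] UU.m_assoc simp del: in_lists_conv_set)
 finally show ?thesis .
qed

text \<open>Exchanging a descent costs bracket terms that are one letter shorter. By induction on
  the length these lie in \<open>low (length w)\<close>, whose bound is strict, and the exchanged
  word has fewer inversions.\<close>

lemma straighten: "w : lists {..<n} ==> xw w \<ominus>\<^sub>U xw (sort w) : low (length w)"
proof (induction w rule: SC.word_induct)
 case (less w)
 show ?case
 proof (cases "sorted w")
  case True
  hence "sort w = w" by (simp add: sorted_sort_id)
  thus ?thesis using less(3) xw_closed[of w] by (simp add: a_minus_def UU.M.r_neg)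
 next
  case False
  then obtain u i j v where w: "w = u @ i # j # v" "j < i" using unsorted_inversion by blast
  let ?w = "u @ j # i # v"
  have W: "u : lists {..<n}" "v : lists {..<n}" "i < n" "j < n" "?w : lists {..<n}" using less(3) w by auto
  have s: "sort ?w = sort w" using w by (intro properties_for_sort) (auto simp: ac_simps)
  have sw: "sort w : lists {..<n}" using less(3) by auto
  have lower: "xw x : low (length w)" if "x : lists {..<n}" "length x < length w" for x
  proof -
   have "xw x \<ominus>\<^sub>U xw (sort x) : low (length w)"
    using less(1)[of x] that low_mono[of "length x" "length w"] by auto
   moreover have sx: "sort x : lists {..<n}" using that by auto
   moreover have "xw (sort x) : low (length w)" by (rule low_gen[OF sx]) (use that in auto)
   ultimately have "(xw x \<ominus>\<^sub>U xw (sort x)) \<oplus>\<^sub>U xw (sort x) : low (length w)" by (rule_tac lowE(5))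
   thus ?thesis using xw_closed[OF sx] xw_closed[OF that(1)] by (simp add: a_minus_def UU.M.a_assoc UU.M.l_neg)
  qed
  have "xw w \<ominus>\<^sub>U xw ?w : low (length w)"
   unfolding w(1) xw_swap[OF W(1-4)] using W w(1)
   by (intro low_finsum lowE(4) lower[unfolded w(1)]) auto
  moreover have "xw ?w \<ominus>\<^sub>U xw (sort w) : low (length w)"
   using less(2)[of ?w] W(5) w inversions_swap[OF w(2), of u v] s by simp
  ultimately have "(xw w \<ominus>\<^sub>U xw ?w) \<oplus>\<^sub>U (xw ?w \<ominus>\<^sub>U xw (sort w)) : low (length w)" by (rule lowE(5))
  thus ?thesis using xw_closed[OF less(3)] xw_closed[OF W(5)] xw_closed[OF sw]
   by (simp add: a_minus_def UU.M.a_assoc UU.M.r_neg1)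
 qed
qed

lemma xw_in_low: "w : lists {..<n} ==> xw w : low (Suc (length w))"
proof -
 assume w: "w : lists {..<n}"
 have s: "sort w : lists {..<n}" using w by auto
 have "xw w \<ominus>\<^sub>U xw (sort w) : low (Suc (length w))" using straighten[OF w] low_mono[of "length w" "Suc (length w)"] by auto
 moreover have "xw (sort w) : low (Suc (length w))" by (rule low_gen[OF s]) auto
 ultimately have "(xw w \<ominus>\<^sub>U xw (sort w)) \<oplus>\<^sub>U xw (sort w) : low (Suc (length w))" by (rule lowE(5))
 thus ?thesis using xw_closed[OF s] xw_closed[OF w] by (simp add: a_minus_def UU.M.a_assoc UU.M.l_neg)
qed

theorem span_monomials:
 assumes H: "submodule H K U" and gen: "!!w. w : lists {..<n} ==> sorted w ==> xw w : H"
 shows "car U <= H"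
proof -
 note HE = UU.submoduleE[OF H] subgroup.one_closed[OF submodule.axioms(1)[OF H], simplified]
 have low: "low k <= H" for k unfolding low_def by (rule submodule_span_minimal[OF H]) (use gen in auto)
 \<comment> \<open>\<open>p\<close> collects the basis letters already expanded, so the vectors of
   \<open>w\<close> are resolved into coordinates from left to right.\<close>
 have *: "xw p \<otimes>\<^sub>U uword w : H" if "w : LL" "p : lists {..<n}" for p w
  using that
 proof (induction w arbitrary: p)
  case Nil
  thus ?case using xw_in_low[of p] low xw_closed by (auto simp: uword_Nil)
 next
  case (Cons x w)
  have x: "x .: L" "w : LL" using Cons by auto
  have fin: "finite A ==> A <= {..<n} ==> (\<Oplus>\<^sub>U i\<in>A. coord x i \<odot>\<^sub>U (xw (p @ [i]) \<otimes>\<^sub>U uword w)) : H" for A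
  proof (induction A rule: finite_induct)
   case (insert i A)
   have "xw (p @ [i]) \<otimes>\<^sub>U uword w : H" if "i < n" for i using Cons.IH[of "p @ [i]"] Cons.prems x that by auto
   hence "coord x i \<odot>\<^sub>U (xw (p @ [i]) \<otimes>\<^sub>U uword w) : H" if "i < n" for i using that x HE(4) by auto
   thus ?case using insert HE(1) by (subst UU.M.finsum_insert) (auto intro!: HE(5))
  qed (use HE in simp)
  have "xw p \<otimes>\<^sub>U uword (x # w) = xw p \<otimes>\<^sub>U (\<Oplus>\<^sub>U i\<in>{..<n}. coord x i \<odot>\<^sub>U uin (b i)) \<otimes>\<^sub>U uword w"
   using x Cons.prems uin_coord[OF x(1)] xw_closed by (simp add: uword_Cons UU.m_assoc del: in_lists_conv_set)
  also have "... = (\<Oplus>\<^sub>U i\<in>{..<n}. xw p \<otimes>\<^sub>U (coord x i \<odot>\<^sub>U uin (b i)) \<otimes>\<^sub>U uword w)"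
   using x Cons.prems xw_closed[of p] uword_closed[of w] by (simp add: UU.A.finsum_rdistr UU.A.finsum_ldistr Pi_def)
  also have "... = (\<Oplus>\<^sub>U i\<in>{..<n}. coord x i \<odot>\<^sub>U (xw (p @ [i]) \<otimes>\<^sub>U uword w))"
  proof (intro finsum_cong_weak refl)
   fix i assume i: "i : {..<n}"
   have "xw (p @ [i]) = xw p \<otimes>\<^sub>U uin (b i)"
    using Cons.prems i xw_append[of p "[i]"] by (auto simp: xw_def uword_single)
   thus "xw p \<otimes>\<^sub>U (coord x i \<odot>\<^sub>U uin (b i)) \<otimes>\<^sub>U uword w = coord x i \<odot>\<^sub>U (xw (p @ [i]) \<otimes>\<^sub>U uword w)"
    using i x Cons.prems xw_closed[of p] uword_closed[of w]
    by (simp add: UU.smult_mult_left[symmetric] UU.smult_mult_right[symmetric])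
  qed
  finally show ?case using fin[of "{..<n}"] by simp
 qed
 have "uword w : H" if "w : LL" for w
  using *[OF that, of "[]"] uword_closed[OF that] by (simp add: xw_def uword_Nil)
 thus ?thesis by (intro span_U[OF H]) auto
qed

end

lemma (in lie_algebra) lie_basis_exists:
 assumes "has_dim (car K) (\<odot>\<^sub>L) L n"
 obtains b coord where "lie_basis K L br n b coord"
proof -
 obtain B where B: "finite B" "card B = n" "B <= car L"
  and ex: "!!x. x .: L ==> EX! c. c : B \<rightarrow>\<^sub>E car K & x = (\<Oplus>\<^sub>L y\<in>B. c y \<odot>\<^sub>L y)"
  using assms by (auto simp: has_dim_def)
 obtain b where b: "bij_betw b {..<n} B" using ex_bij_betw_nat_finite[OF B(1)] B(2) by (auto simp: atLeast0LessThan)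
 define cc where "cc x = (THE c. c : B \<rightarrow>\<^sub>E car K & x = (\<Oplus>\<^sub>L y\<in>B. c y \<odot>\<^sub>L y))" for x
 have cc: "cc x : B \<rightarrow>\<^sub>E car K" "x = (\<Oplus>\<^sub>L y\<in>B. cc x y \<odot>\<^sub>L y)" if "x .: L" for x
  using theI'[OF ex[OF that]] by (auto simp: cc_def)
 have reindex: "(\<Oplus>\<^sub>L y\<in>B. f y) = (\<Oplus>\<^sub>L i\<in>{..<n}. f (b i))" if "f : B \<rightarrow> car L" for f
  using M.finsum_reindex[of f b "{..<n}"] that b by (auto simp: bij_betw_def)
 have "lie_basis K L br n b (%x i. cc x (b i))"
 proof
  fix i assume i: "i < n"
  hence bi: "b i : B" using b by (auto simp: bij_betw_def)
  thus "b i .: L" using B by auto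
  { fix x assume x: "x .: L"
   show "cc x (b i) .: K" using cc(1)[OF x] bi by auto }
  fix a assume a: "!!i. i < n ==> a i .: K"
  define d where "d = (\<lambda>y\<in>B. a (inv_into {..<n} b y))"
  have db: "d (b i) = a i" if "i < n" for i
   using that b by (simp add: d_def bij_betw_def) auto
  have d: "d : B \<rightarrow>\<^sub>E car K"
   using a b by (auto simp: d_def bij_betw_def PiE_iff inv_into_f_f)
  let ?x = "\<Oplus>\<^sub>L i\<in>{..<n}. a i \<odot>\<^sub>L b i"
  have "b i .: L" if "i < n" for i using that b B by (auto simp: bij_betw_def)
  hence x: "?x .: L" using a by (intro M.finsum_closed) auto
  have "?x = (\<Oplus>\<^sub>L y\<in>B. d y \<odot>\<^sub>L y)"
   using d B by (subst reindex) (auto simp: db intro!: finsum_cong_weak)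
  hence "cc ?x = d" using ex[OF x] d cc[OF x] by blast
  thus "cc ?x (b i) = a i" using db i by simp
 next
  fix x assume x: "x .: L"
  show "x = (\<Oplus>\<^sub>L i\<in>{..<n}. cc x (b i) \<odot>\<^sub>L b i)"
   using cc[OF x] B by (subst reindex[symmetric]) (auto simp: Pi_def PiE_iff)
 qed
 thus thesis by (rule that)
qed

section \<open>Rings with a filtered monomial basis\<close>

text \<open>Choose repeatedly a position beyond the last one at which \<open>s\<close> attains its
  minimum over all later positions.\<close>

lemma nondecreasing_subsequence:
 fixes s :: "nat => nat"
 obtains f :: "nat => nat" where "strict_mono f" "!!i j. i <= j ==> s (f i) <= s (f j)"
proof -
 have ex: "EX x>=k. ALL y>=x. s x <= s y" for k
 proof -
  obtain x where "k <= x" "!!y. k <= y ==> s x <= s y"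
   using ex_has_least_nat[of "%x. k <= x" k s] by auto
  thus ?thesis by (intro exI[of _ x]) auto
 qed
 obtain f where f: "!!k. ALL y>=f k. s (f k) <= s y" "!!k. f k < f (Suc k)"
  using dependent_nat_choice[of "%_ x. ALL y>=x. s x <= s y" "%_ x y. x < y"] ex
  by (metis Suc_le_lessD)
 have m: "strict_mono f" using f(2) by (simp add: strict_mono_Suc_iff)
 show thesis using that[OF m] f(1) strict_mono_less_eq[OF m] by blast
qed

text \<open>Passing to subsequences makes the multiplicities of the elements below \<open>n\<close>
  nondecreasing one after the other; then the first two terms are already comparable.\<close>

lemma dickson:
 fixes M :: "nat => nat multiset"
 assumes "!!i. set_mset (M i) <= {..<n}"
 shows "EX i j. i < j & M i <=# M j"
proof -
 have key: "EX f :: nat => nat. strict_mono f & (ALL k<m. ALL i j. i <= j --> count (M (f i)) k <= count (M (f j)) k)" for m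
 proof (induction m)
  case 0 thus ?case by (intro exI[of _ id]) (auto simp: strict_mono_def)
 next
  case (Suc m)
  then obtain f :: "nat => nat" where f: "strict_mono f" "!!k i j. k < m ==> i <= j ==> count (M (f i)) k <= count (M (f j)) k" by blast
  obtain g :: "nat => nat" where g: "strict_mono g" "!!i j. i <= j ==> count (M (f (g i))) m <= count (M (f (g j))) m"
   using nondecreasing_subsequence[of "%i. count (M (f i)) m"] by blast
  have "strict_mono (f \<circ> g)" using f(1) g(1) by (simp add: strict_mono_def)
  moreover have "count (M ((f \<circ> g) i)) k <= count (M ((f \<circ> g) j)) k" if "k < Suc m" "i <= j" for k i j
   using that f(2)[of k "g i" "g j"] g strict_mono_less_eq[OF g(1)] by (cases "k = m") auto
  ultimately show ?case by blast
 qed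
 obtain f :: "nat => nat" where f: "strict_mono f" "!!k i j. k < n ==> i <= j ==> count (M (f i)) k <= count (M (f j)) k"
  using key[of n] by blast
 have "M (f 0) <=# M (f 1)"
 proof (rule mset_subset_eqI)
  fix k show "count (M (f 0)) k <= count (M (f 1)) k"
  proof (cases "k < n")
   case True thus ?thesis using f(2) by simp
  next
   case False
   hence "k ~: set_mset (M (f 0))" using assms by auto
   thus ?thesis by (simp add: not_in_iff)
  qed
 qed
 moreover have "f 0 < f 1" using f(1) by (simp add: strict_mono_def)
 ultimately show ?thesis by blast
qed

text \<open>A monomial order: total, well-founded and compatible with addition. Size comes first so
  that the errors of straightening, which are shorter words, lie strictly below; the multiset order
  breaks ties.\<close>

definition prec :: "nat multiset => nat multiset => bool" where
 "prec M N \<longleftrightarrow> size M < size N | size M = size N & M < N"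

lemma prec_trans: "prec M N ==> prec N P ==> prec M P" by (auto simp: prec_def)
lemma prec_total: "prec M N | M = N | prec N M" unfolding prec_def by (meson linorder_less_linear)
lemma prec_add: "prec M N ==> prec (P + M) (P + N)" "prec M N ==> prec (M + P) (N + P)" by (auto simp: prec_def)
lemma wf_prec: "wf {(M, N). prec M N}"
proof -
 have "wf (inv_image (less_than <*lex*> {(x::nat multiset, y). x < y}) (%M. (size M, M)))"
  by (intro wf_inv_image wf_lex_prod wf_less_than wf)
 thus ?thesis by (rule wf_subset) (auto simp: prec_def)
qed

text \<open>Coefficients stand on the left. \<open>e_E\<close> asks monomials to normalize
  \<open>E\<close> rather than to commute with it: in the tensor product they do commute, but
  eigenvectors act on their coefficients by conjugation. Independence of the monomials enters only
  as a hypothesis of \<open>espan_no_zero_divisors\<close>.\<close>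

locale monomials = ring Q for Q (structure) +
 fixes n :: nat and E :: "'a set" and e :: "nat multiset => 'a"
 assumes E_sub: "E <= car Q" and E_zero: "\<zero> : E" and E_one: "\<one> : E"
  and E_add: "c : E ==> d : E ==> c \<oplus> d : E" and E_mult: "c : E ==> d : E ==> c \<otimes> d : E"
  and E_neg: "c : E ==> \<ominus> c : E"
  and E_inv: "c : E ==> c ~= \<zero> ==> EX d:E. d \<otimes> c = \<one> & c \<otimes> d = \<one>"
  and e_closed: "set_mset M <= {..<n} ==> e M .: Q"
  and e_E: "set_mset M <= {..<n} ==> c : E ==> EX d:E. e M \<otimes> c = d \<otimes> e M"
begin

definition S where "S = {M. set_mset M <= {..<n}}"
definition below where "below gamma = {M : S. prec M gamma}"
definition upto where "upto gamma = insert gamma (below gamma)"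

text \<open>Terms may repeat an exponent; repeated ones are collected only when a leading term is
  extracted, in \<open>espan_upto\<close>.\<close>

inductive_set espan :: "nat multiset set => 'a set" for A where
 zero: "\<zero> : espan A"
| step: "c : E ==> M : A ==> x : espan A ==> c \<otimes> e M \<oplus> x : espan A"

lemma Ec [simp]: "c : E ==> c .: Q" using E_sub by blast
lemma eS [simp]: "M : S ==> e M .: Q" by (simp add: S_def e_closed)
lemma below_S: "below gamma <= S" by (auto simp: below_def)
lemma upto_S: "gamma : S ==> upto gamma <= S" by (auto simp: upto_def below_def)
lemma S_add: "M : S ==> N : S ==> M + N : S" by (auto simp: S_def)

lemma espan_closed: "x : espan A ==> A <= S ==> x .: Q"
 by (induction rule: espan.induct) auto

lemma espan_mono: "x : espan A ==> A <= B ==> x : espan B"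
 by (induction rule: espan.induct) (auto intro: espan.intros)

lemma espan_add: "x : espan A ==> y : espan A ==> A <= S ==> x \<oplus> y : espan A"
proof (induction rule: espan.induct)
 case zero thus ?case using espan_closed by simp
next
 case (step c M x)
 have "c \<otimes> e M \<oplus> x \<oplus> y = c \<otimes> e M \<oplus> (x \<oplus> y)"
  using step espan_closed[of _ A] by (intro a_assoc) auto
 thus ?case using step by (auto intro: espan.intros)
qed

lemma espan_smult: "x : espan A ==> c : E ==> A <= S ==> c \<otimes> x : espan A"
proof (induction rule: espan.induct)
 case zero thus ?case by (auto intro: espan.intros)
next
 case (step d M x)
 hence "c \<otimes> (d \<otimes> e M \<oplus> x) = (c \<otimes> d) \<otimes> e M \<oplus> c \<otimes> x"
  using espan_closed[of x A] by (auto simp: r_distr m_assoc subset_iff)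
 thus ?case using step by (auto intro: espan.intros E_mult)
qed

lemma espan_single: "c : E ==> M : A ==> A <= S ==> c \<otimes> e M : espan A"
 using espan.step[OF _ _ espan.zero, of c M A] by auto

lemma espan_neg: "x : espan A ==> A <= S ==> \<ominus> x : espan A"
 using espan_smult[of x A "\<ominus> \<one>"] espan_closed[of x A] by (simp add: E_neg E_one l_minus)

text \<open>Coefficients of \<open>y\<close> are moved to the left across the monomials of
  \<open>x\<close> by \<open>e_E\<close>, which leaves products of monomials.\<close>

lemma espan_mult:
 assumes x: "x : espan A" and y: "y : espan B" and AB: "A <= S" "B <= S" "C <= S"
  and m: "!!M N. M : A ==> N : B ==> e M \<otimes> e N : espan C"
 shows "x \<otimes> y : espan C"
 using x
proof (induction rule: espan.induct)
 case zero thus ?case using y AB espan_closed by (auto intro: espan.intros)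
next
 case (step c M x)
 have MS: "M : S" using step AB by auto
 have "e M \<otimes> y : espan C" using y
 proof (induction rule: espan.induct)
  case zero thus ?case using MS by (auto intro: espan.intros)
 next
  case (step d N z)
  have N: "N : S" "z .: Q" using step AB espan_closed by auto
  obtain d' where d': "d' : E" "e M \<otimes> d = d' \<otimes> e M" using e_E[of M d] MS step by (auto simp: S_def)
  have "e M \<otimes> (d \<otimes> e N \<oplus> z) = (e M \<otimes> d) \<otimes> e N \<oplus> e M \<otimes> z"
   using MS N step by (simp add: r_distr m_assoc)
  also have "... = d' \<otimes> (e M \<otimes> e N) \<oplus> e M \<otimes> z" unfolding d' using MS N d' by (simp add: m_assoc)
  finally show ?case using espan_add[OF espan_smult[OF m[OF \<open>M : A\<close> step(2)] d'(1) AB(3)] step(4) AB(3)] by simp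
 qed
 moreover have "(c \<otimes> e M \<oplus> x) \<otimes> y = c \<otimes> (e M \<otimes> y) \<oplus> x \<otimes> y"
  using step MS espan_closed[OF y AB(2)] espan_closed[OF step(3) AB(1)] by (simp add: l_distr m_assoc)
 ultimately show ?case using step AB by (auto intro: espan_add espan_smult)
qed

lemma upto_mono: "prec M N ==> M : S ==> upto M <= upto N" "prec M N ==> M : S ==> upto M <= below N"
 by (auto simp: upto_def below_def intro: prec_trans)

lemma espan_max: "x : espan A ==> A <= S ==> x = \<zero> | (EX gamma:A. x : espan (upto gamma))"
proof (induction rule: espan.induct)
 case (step c M x)
 have M: "c \<otimes> e M : espan (upto M)" using step upto_S by (intro espan_single) (auto simp: upto_def)
 consider "x = \<zero>" | gamma where "gamma : A" "x : espan (upto gamma)" using step by auto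
 thus ?case
 proof cases
  case 1 thus ?thesis using step M espan_closed[OF M] upto_S by (metis r_zero subsetD)
 next
  case 2
  have *: "c \<otimes> e M \<oplus> x : espan (upto delta)" if "delta : A" "upto M <= upto delta" "upto gamma <= upto delta" for delta
   using that 2 M step upto_S[of delta] by (intro espan_add) (auto intro: espan_mono)
  from prec_total[of M gamma] show ?thesis using *[of M] *[of gamma] upto_mono(1) 2 step by blast
 qed
qed simp

lemma espan_upto: "x : espan (upto gamma) ==> gamma : S ==> EX c:E. EX l:espan (below gamma). x = c \<otimes> e gamma \<oplus> l"
proof (induction rule: espan.induct)
 case zero
 hence "\<zero> = \<zero> \<otimes> e gamma \<oplus> \<zero>" by simp
 thus ?case using E_zero espan.zero by blast
next
 case (step c M x)
 then obtain d l where d: "d : E" "l : espan (below gamma)" "x = d \<otimes> e gamma \<oplus> l" by auto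
 have l: "l .: Q" using d espan_closed below_S by blast
 show ?case
 proof (cases "M = gamma")
  case True
  hence "c \<otimes> e M \<oplus> x = (c \<oplus> d) \<otimes> e gamma \<oplus> l" using d l step by (simp add: l_distr a_assoc)
  thus ?thesis using d step E_add by blast
 next
  case False
  hence M: "M : below gamma" "M : S" using step by (auto simp: upto_def below_def)
  hence "c \<otimes> e M \<oplus> x = d \<otimes> e gamma \<oplus> (c \<otimes> e M \<oplus> l)" using d l step by (simp add: a_lcomm)
  moreover have "c \<otimes> e M \<oplus> l : espan (below gamma)" using M step d by (auto intro: espan.intros)
  ultimately show ?thesis using d by blast
 qed
qed

text \<open>If the coefficient at the current bound \<open>gamma\<close> vanishes, the element lies
  in a span with a smaller bound; well-foundedness of \<open>prec\<close> ends this descent.\<close>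

lemma leading_term:
 assumes "x : espan S" "x ~= \<zero>"
 obtains gamma c l where "gamma : S" "c : E" "c ~= \<zero>" "l : espan (below gamma)" "x = c \<otimes> e gamma \<oplus> l"
proof -
 have "EX gamma c l. gamma : S & c : E & c ~= \<zero> & l : espan (below gamma) & x = c \<otimes> e gamma \<oplus> l"
  if "gamma : S" "x : espan (upto gamma)" for gamma
  using that
 proof (induction gamma rule: wf_induct_rule[OF wf_prec])
  case (1 gamma)
  obtain c l where c: "c : E" "l : espan (below gamma)" "x = c \<otimes> e gamma \<oplus> l" using espan_upto 1 by blast
  show ?case
  proof (cases "c = \<zero>")
   case True
   hence "x = l" using c 1 espan_closed[OF c(2) below_S] by simp
   then obtain delta where "delta : below gamma" "x : espan (upto delta)" using espan_max[OF c(2) below_S] assms by auto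
   thus ?thesis using 1(1)[of delta] by (auto simp: below_def)
  next
   case False thus ?thesis using c 1 by blast
  qed
 qed
 thus thesis using espan_max[OF assms(1)] assms(2) that by blast
qed

end

text \<open>The scalar is allowed to differ from 1 because the product of two chosen eigenvectors is
  only a unit multiple of the eigenvector chosen for the sum of their weights.\<close>

locale filtered_monomials = monomials +
 assumes e_mult: "M : S ==> N : S ==> EX c:E. c ~= \<zero> & (EX l:espan (below (M + N)). e M \<otimes> e N = c \<otimes> e (M + N) \<oplus> l)"
begin

lemma e_mult_upto: "M : S ==> N : S ==> e M \<otimes> e N : espan (upto (M + N))"
proof -
 assume MN: "M : S" "N : S"
 then obtain c l where "c : E" "l : espan (below (M + N))" "e M \<otimes> e N = c \<otimes> e (M + N) \<oplus> l" using e_mult by blast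
 thus ?thesis by (auto simp: upto_def intro: espan.intros espan_mono)
qed

lemma lower_mult:
 "M : S ==> l : espan (below gamma) ==> gamma : S ==> e M \<otimes> l : espan (below (M + gamma))"
proof -
 assume M: "M : S" and l: "l : espan (below gamma)" and g: "gamma : S"
 have "\<one> \<otimes> e M : espan {M}" by (rule espan_single) (use M E_one in auto)
 hence "e M : espan {M}" using M by simp
 thus ?thesis
 proof (rule espan_mult[OF _ l _ below_S below_S])
  fix M' N assume "M' : {M}" "N : below gamma"
  hence N: "M' = M" "N : S" "prec N gamma" by (auto simp: below_def)
  show "e M' \<otimes> e N : espan (below (M + gamma))"
   unfolding N(1) by (rule espan_mono[OF e_mult_upto upto_mono(2)]) (use N M g in "auto intro: prec_add S_add")
 qed (use M in auto)
qed

text \<open>Exponents of leading monomials. A leading coefficient 1 is no restriction for an ideal,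
  as coefficients are invertible from the left.\<close>

definition lead where "lead I = {gamma : S. EX l:espan (below gamma). e gamma \<oplus> l : I}"

lemma left_idealD:
 assumes "left_ideal I Q"
 shows "x : I ==> x .: Q" "\<zero> : I" "x : I ==> y : I ==> x \<oplus> y : I" "x : I ==> \<ominus> x : I"
  "a .: Q ==> x : I ==> a \<otimes> x : I"
proof -
 interpret additive_subgroup I Q using assms by (simp add: left_ideal_def)
 show "x : I ==> x .: Q" "\<zero> : I" "x : I ==> y : I ==> x \<oplus> y : I" "x : I ==> \<ominus> x : I"
  using a_subset by auto
 show "a .: Q ==> x : I ==> a \<otimes> x : I" using assms by (simp add: left_ideal_def)
qed

text \<open>Multiplication by \<open>e M\<close> carries the leading term from \<open>gamma\<close>
  to \<open>M + gamma\<close>, up to an invertible coefficient that is divided out.\<close>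

lemma lead_up:
 assumes I: "left_ideal I Q" and g: "gamma : lead I" and d: "delta : S" "gamma <=# delta"
 shows "delta : lead I"
proof -
 obtain l where l: "gamma : S" "l : espan (below gamma)" "e gamma \<oplus> l : I" using g by (auto simp: lead_def)
 obtain M where M: "delta = M + gamma" using d(2) by (metis add.commute mset_subset_eq_exists_conv)
 hence MS: "M : S" using d by (auto simp: S_def)
 obtain c k where c: "c : E" "c ~= \<zero>" "k : espan (below delta)" "e M \<otimes> e gamma = c \<otimes> e delta \<oplus> k"
  using e_mult[OF MS l(1)] M by auto
 obtain c' where c': "c' : E" "c' \<otimes> c = \<one>" using E_inv c by blast
 have lm: "e M \<otimes> l : espan (below delta)" using lower_mult[OF MS l(2,1)] M by simp
 have cl: "l .: Q" "k .: Q" using l c espan_closed below_S by blast+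
 have "c' \<otimes> (e M \<otimes> (e gamma \<oplus> l)) = c' \<otimes> (c \<otimes> e delta \<oplus> (k \<oplus> e M \<otimes> l))"
  using MS l(1) cl c d(1) by (simp add: r_distr c(4) a_assoc)
 also have "... = (c' \<otimes> c) \<otimes> e delta \<oplus> c' \<otimes> (k \<oplus> e M \<otimes> l)"
  using MS cl c d(1) c'(1) by (simp add: r_distr m_assoc)
 also have "... = e delta \<oplus> c' \<otimes> (k \<oplus> e M \<otimes> l)" using c' d by simp
 finally have "e delta \<oplus> c' \<otimes> (k \<oplus> e M \<otimes> l) : I"
  using left_idealD(5)[OF I] l(3) MS c' by (metis Ec eS)
 moreover have "c' \<otimes> (k \<oplus> e M \<otimes> l) : espan (below delta)"
  by (rule espan_smult[OF espan_add[OF c(3) lm below_S] c'(1) below_S])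
 ultimately show ?thesis using d by (auto simp: lead_def)
qed

text \<open>Subtracting a multiple of an element of \<open>I\<close> with the same leading exponent
  leaves an element of \<open>J\<close> that lies strictly below; induction along
  \<open>prec\<close>.\<close>

lemma lead_determines:
 assumes I: "left_ideal I Q" "left_ideal J Q" "I <= J" and le: "lead J <= lead I"
  and x: "x : J" "x : espan S"
 shows "x : I"
proof -
 have *: "x : I" if "gamma : S" "x : espan (upto gamma)" "x : J" for gamma x
  using that
 proof (induction gamma arbitrary: x rule: wf_induct_rule[OF wf_prec])
  case (1 gamma)
  have below: "y : I" if y: "y : espan (below gamma)" "y : J" for y
  proof (cases "y = \<zero>")
   case True thus ?thesis using left_idealD[OF I(1)] by simp
  next
   case False
   then obtain delta where "delta : below gamma" "y : espan (upto delta)" using espan_max[OF y(1) below_S] by auto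
   thus ?thesis using 1(1)[of delta] y by (auto simp: below_def)
  qed
  obtain c l where c: "c : E" "l : espan (below gamma)" "x = c \<otimes> e gamma \<oplus> l" using espan_upto 1 by blast
  have lc: "l .: Q" using c espan_closed below_S by blast
  show ?case
  proof (cases "c = \<zero>")
   case True
   thus ?thesis using below[of l] c 1 lc by simp
  next
   case False
   then obtain c' where c': "c' : E" "c' \<otimes> c = \<one>" "c \<otimes> c' = \<one>" using E_inv c by blast
   have "c' \<otimes> x = (c' \<otimes> c) \<otimes> e gamma \<oplus> c' \<otimes> l" unfolding c(3) using c(1) c'(1) lc 1(2) by (simp add: r_distr m_assoc)
   hence "c' \<otimes> x = e gamma \<oplus> c' \<otimes> l" using c' 1 by simp
   hence "gamma : lead J" using left_idealD(5)[OF I(2) _ 1(4), of c'] c' c 1(2) espan_smult[OF c(2) c'(1) below_S]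
    by (auto simp: lead_def)
   then obtain k where k: "k : espan (below gamma)" "e gamma \<oplus> k : I" using le by (auto simp: lead_def)
   have kc: "k .: Q" using k espan_closed below_S by blast
   have cI: "c \<otimes> (e gamma \<oplus> k) : I" using left_idealD(5)[OF I(1)] k c by simp
   have eq: "x \<oplus> \<ominus> (c \<otimes> (e gamma \<oplus> k)) = l \<oplus> \<ominus> (c \<otimes> k)"
   proof -
    have "x \<oplus> \<ominus> (c \<otimes> (e gamma \<oplus> k)) = (l \<oplus> c \<otimes> e gamma) \<oplus> (\<ominus> (c \<otimes> e gamma) \<oplus> \<ominus> (c \<otimes> k))"
     unfolding c(3) using c kc lc 1(2) by (simp add: r_distr minus_add a_comm)
    also have "... = l \<oplus> \<ominus> (c \<otimes> k)"
     using c kc lc 1(2) by (simp add: a_assoc r_neg2)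
    finally show ?thesis .
   qed
   have "x \<oplus> \<ominus> (c \<otimes> (e gamma \<oplus> k)) : J"
    using 1(4) cI I(3) left_idealD(3,4)[OF I(2)] by blast
   moreover have "l \<oplus> \<ominus> (c \<otimes> k) : espan (below gamma)"
    using c k below_S by (intro espan_add espan_neg espan_smult) auto
   ultimately have "x \<oplus> \<ominus> (c \<otimes> (e gamma \<oplus> k)) : I" using below eq by metis
   hence "x \<oplus> \<ominus> (c \<otimes> (e gamma \<oplus> k)) \<oplus> c \<otimes> (e gamma \<oplus> k) : I" using cI left_idealD(3)[OF I(1)] by blast
   moreover have "x .: Q" "c \<otimes> (e gamma \<oplus> k) .: Q" using c kc lc 1(2) by auto
   ultimately show ?thesis by (simp add: a_assoc l_neg)
  qed
 qed
 show ?thesis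
 proof (cases "x = \<zero>")
  case True thus ?thesis using left_idealD[OF I(1)] by simp
 next
  case False
  thus ?thesis using espan_max[OF x(2)] * x(1) by blast
 qed
qed

text \<open>By \<open>den\<close> every element is carried into the span of the monomials by a
  factor with a left inverse. Hence an ideal is determined by its members in the span, and within an
  ascending chain these are determined by \<open>lead\<close>.\<close>

theorem acc_left_ideals:
 assumes den: "!!x. x .: Q ==> EX s:car Q. EX s':car Q. s' \<otimes> s = \<one> & s \<otimes> x : espan S"
 shows "ACC (%I. left_ideal I Q)"
 unfolding ascending_chain_condition_def
proof (intro allI impI)
 fix C :: "nat => 'a set" assume "(ALL n. left_ideal (C n) Q) & (ALL n. C n <= C (Suc n))"
 hence C: "!!i. left_ideal (C i) Q" and "!!i. C i <= C (Suc i)" by auto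
 hence mono: "i <= j ==> C i <= C j" for i j by (rule_tac lift_Suc_mono_le) auto
 have lmono: "i <= j ==> lead (C i) <= lead (C j)" for i j using mono[of i j] by (auto simp: lead_def)
 have "EX N. ALL i>=N. lead (C i) <= lead (C N)"
 proof (rule ccontr)
  assume "\<not> ?thesis"
  hence "ALL N. EX i gamma. i >= N & gamma : lead (C i) & gamma ~: lead (C N)" by blast
  then obtain g gamma where g: "!!N. g N >= N" "!!N. gamma N : lead (C (g N))" "!!N. gamma N ~: lead (C N)" by metis
  \<comment> \<open>Along \<open>f\<close>, the exponent \<open>gamma (f i)\<close> has entered
    \<open>lead\<close> at stage \<open>f (Suc i)\<close>, whereas \<open>gamma (f j)\<close> is
    still outside at stage \<open>f j\<close>. Dickson's pair \<open>i < j\<close> then contradicts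
    upward closure.\<close>
  define f where "f k = (g ^^ k) 0" for k
  have fS: "f (Suc k) = g (f k)" for k by (simp add: f_def)
  have fm: "i <= j ==> f i <= f j" for i j by (rule lift_Suc_mono_le) (use g(1) fS in auto)
  have gS: "gamma N : S" for N using g(2) by (auto simp: lead_def)
  obtain i j where ij: "i < j" "gamma (f i) <=# gamma (f j)"
   using dickson[of "%k. gamma (f k)" n] gS by (auto simp: S_def)
  have "gamma (f i) : lead (C (f (Suc i)))" using g(2) fS by simp
  hence "gamma (f i) : lead (C (f j))" using lmono[OF fm[of "Suc i" j]] ij by auto
  hence "gamma (f j) : lead (C (f j))" using lead_up[OF C _ gS] ij by blast
  thus False using g(3) by blast
 qed
 then obtain N where N: "!!i. i >= N ==> lead (C i) <= lead (C N)" by blast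
 have "C i <= C N" if "i >= N" for i
 proof
  fix x assume x: "x : C i"
  hence xc: "x .: Q" using left_idealD(1)[OF C] by blast
  then obtain s s' where s: "s .: Q" "s' .: Q" "s' \<otimes> s = \<one>" "s \<otimes> x : espan S" using den by blast
  have "s \<otimes> x : C N"
   using lead_determines[OF C C mono[OF that] N[OF that] _ s(4)] left_idealD(5)[OF C s(1) x] by blast
  hence "s' \<otimes> (s \<otimes> x) : C N" using left_idealD(5)[OF C s(2)] by blast
  thus "x : C N" using s xc by (simp add: m_assoc[symmetric])
 qed
 thus "EX N. ALL i>=N. C i = C N" using mono by blast
qed

text \<open>The leading terms multiply to a term at \<open>gamma + delta\<close> with a nonzero
  coefficient, everything else lies below it, and \<open>ind\<close> forbids cancellation.\<close>

theorem espan_no_zero_divisors: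
 assumes ind: "!!gamma c l. gamma : S ==> c : E ==> l : espan (below gamma) ==> c \<otimes> e gamma \<oplus> l = \<zero> ==> c = \<zero>"
  and one: "\<one> ~= \<zero>"
  and x: "x : espan S" "x ~= \<zero>" and y: "y : espan S" "y ~= \<zero>"
 shows "x \<otimes> y ~= \<zero>"
proof -
 obtain gamma c l where g: "gamma : S" "c : E" "c ~= \<zero>" "l : espan (below gamma)" "x = c \<otimes> e gamma \<oplus> l"
  using leading_term[OF x] by blast
 obtain delta d k where d: "delta : S" "d : E" "d ~= \<zero>" "k : espan (below delta)" "y = d \<otimes> e delta \<oplus> k"
  using leading_term[OF y] by blast
 have nz: "a \<otimes> b ~= \<zero>" if ab: "a : E" "b : E" "a ~= \<zero>" "b ~= \<zero>" for a b
 proof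
  assume 0: "a \<otimes> b = \<zero>"
  obtain a' where "a' : E" "a' \<otimes> a = \<one>" using E_inv ab by blast
  hence "a' \<otimes> (a \<otimes> b) = b" using ab by (simp add: m_assoc[symmetric])
  thus False using 0 ab \<open>a' : E\<close> by simp
 qed
 obtain d' where d': "d' : E" "e gamma \<otimes> d = d' \<otimes> e gamma" using e_E[of gamma d] g d by (auto simp: S_def)
 \<comment> \<open>Otherwise \<open>e gamma\<close> would vanish, since \<open>d\<close> is
   invertible, and this contradicts \<open>ind\<close> with coefficient 1.\<close>
 have "d' ~= \<zero>"
 proof
  assume "d' = \<zero>"
  hence 0: "e gamma \<otimes> d = \<zero>" using d' g by simp
  obtain b where b: "b : E" "d \<otimes> b = \<one>" using E_inv d by blast
  have "e gamma = (e gamma \<otimes> d) \<otimes> b" using b d g by (simp add: m_assoc)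
  hence "\<one> \<otimes> e gamma \<oplus> \<zero> = \<zero>" using 0 b g by simp
  thus False using ind[OF g(1) E_one espan.zero] one by blast
 qed
 obtain a m where a: "a : E" "a ~= \<zero>" "m : espan (below (gamma + delta))" "e gamma \<otimes> e delta = a \<otimes> e (gamma + delta) \<oplus> m"
  using e_mult[OF g(1) d(1)] by blast
 have cl: "l .: Q" "k .: Q" "m .: Q" using g d a espan_closed below_S by blast+
 note S = S_add[OF g(1) d(1)]
 have yu: "y : espan (upto delta)" unfolding d(5)
  using d by (intro espan.step) (auto simp: upto_def intro: espan_mono)
 have ly: "l \<otimes> y : espan (below (gamma + delta))"
 proof (rule espan_mult[OF g(4) yu below_S upto_S[OF d(1)] below_S])
  fix M N assume "M : below gamma" "N : upto delta"
  hence "M : S" "N : S" "prec M gamma" "N = delta | prec N delta" using d by (auto simp: below_def upto_def)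
  moreover have "prec (M + N) (gamma + delta)" using calculation prec_add[of M gamma] prec_add[of N delta] prec_trans by metis
  ultimately show "e M \<otimes> e N : espan (below (gamma + delta))"
   by (intro espan_mono[OF e_mult_upto upto_mono(2)] S_add)
 qed
 have gk: "c \<otimes> (e gamma \<otimes> k) : espan (below (gamma + delta))"
  by (rule espan_smult[OF lower_mult[OF g(1) d(4,1)] g(2) below_S])
 have "x \<otimes> y = c \<otimes> e gamma \<otimes> y \<oplus> l \<otimes> y"
  unfolding g(5) using g cl y by (simp add: l_distr espan_closed[OF y(1)])
 also have "c \<otimes> e gamma \<otimes> y = c \<otimes> ((e gamma \<otimes> d) \<otimes> e delta) \<oplus> c \<otimes> (e gamma \<otimes> k)"
  unfolding d(5) using g d cl by (simp add: r_distr m_assoc)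
 also have "c \<otimes> ((e gamma \<otimes> d) \<otimes> e delta) = (c \<otimes> d' \<otimes> a) \<otimes> e (gamma + delta) \<oplus> c \<otimes> (d' \<otimes> m)"
  unfolding d'(2) using g d cl a d' S by (simp add: r_distr m_assoc)
 also have "(c \<otimes> d' \<otimes> a) \<otimes> e (gamma + delta) \<oplus> c \<otimes> (d' \<otimes> m) \<oplus> c \<otimes> (e gamma \<otimes> k) \<oplus> l \<otimes> y
  = (c \<otimes> d' \<otimes> a) \<otimes> e (gamma + delta) \<oplus> (c \<otimes> (d' \<otimes> m) \<oplus> c \<otimes> (e gamma \<otimes> k) \<oplus> l \<otimes> y)"
  using g d cl a d' S espan_closed[OF y(1)] by (simp add: a_assoc)
 finally have eq: "x \<otimes> y = (c \<otimes> d' \<otimes> a) \<otimes> e (gamma + delta) \<oplus> (c \<otimes> (d' \<otimes> m) \<oplus> c \<otimes> (e gamma \<otimes> k) \<oplus> l \<otimes> y)" .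
 have low: "c \<otimes> (d' \<otimes> m) \<oplus> c \<otimes> (e gamma \<otimes> k) \<oplus> l \<otimes> y : espan (below (gamma + delta))"
  by (rule espan_add[OF espan_add[OF espan_smult[OF espan_smult[OF a(3) d'(1) below_S] g(2) below_S] gk below_S] ly below_S])
 have "c \<otimes> d' \<otimes> a ~= \<zero>" "c \<otimes> d' \<otimes> a : E" using nz g d' \<open>d' ~= \<zero>\<close> a E_mult by auto
 thus ?thesis using ind[OF S _ low] eq by auto
qed

end

section \<open>Division algebras and their opposites\<close>

lemma Opp_simps [simp]:
 "car (Opp A) = car A" "\<one>\<^bsub>Opp A\<^esub> = \<one>\<^sub>A"
 "\<zero>\<^bsub>Opp A\<^esub> = \<zero>\<^sub>A" "x \<oplus>\<^bsub>Opp A\<^esub> y = x \<oplus>\<^sub>A y"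
 "x \<otimes>\<^bsub>Opp A\<^esub> y = y \<otimes>\<^sub>A x" "c \<odot>\<^bsub>Opp A\<^esub> x = c \<odot>\<^sub>A x"
 by (simp_all add: opposite_algebra_def)

lemma Opp_a_inv [simp]: "\<ominus>\<^bsub>Opp A\<^esub> x = \<ominus>\<^sub>A x"
 "x \<ominus>\<^bsub>Opp A\<^esub> y = x \<ominus>\<^sub>A y"
 by (simp_all add: a_inv_def m_inv_def a_minus_def)

lemma opposite_opposite [simp]: "Opp (Opp A) = A"
 by (simp add: opposite_algebra_def)

lemma assoc_algebra_opposite:
 assumes "assoc_algebra K A" shows "assoc_algebra K (Opp A)"
proof -
 interpret A: assoc_algebra K A by fact
 interpret O: module K "Opp A"
  by (rule module_image[OF A.module_axioms, of "%x. x"]) auto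
 have "ring (Opp A)"
  by (rule ringI, rule O.M.abelian_group_axioms, rule monoidI)
  (auto simp: A.A.l_distr A.A.r_distr A.A.m_assoc)
 then interpret R: ring "Opp A" .
 show ?thesis by unfold_locales (auto simp: A.smult_mult_left[symmetric] A.smult_mult_right[symmetric])
qed

locale skew_field = ring R for R (structure) +
 assumes skew_field_Units: "Units R = car R - {\<zero>}"
begin

lemma one_nonzero [simp]: "\<one> ~= \<zero>"
 using Units_one_closed by (auto simp: skew_field_Units)

lemma inv_nz [simp]: "x .: R ==> x ~= \<zero> ==> inv x .: R"
 "x .: R ==> x ~= \<zero> ==> inv x \<otimes> x = \<one>"
 "x .: R ==> x ~= \<zero> ==> x \<otimes> inv x = \<one>"
 "x .: R ==> x ~= \<zero> ==> inv x ~= \<zero>"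
 using Units_inv_Units[of x] by (auto simp: skew_field_Units)

lemma inv_mult_cancel [simp]:
 "x .: R ==> x ~= \<zero> ==> y .: R ==> inv x \<otimes> (x \<otimes> y) = y"
 "x .: R ==> x ~= \<zero> ==> y .: R ==> x \<otimes> (inv x \<otimes> y) = y"
 by (simp_all add: m_assoc[symmetric])

lemma no_zero_div: "x .: R ==> y .: R ==> x \<otimes> y = \<zero> \<longleftrightarrow> x = \<zero> | y = \<zero>"
 by (metis r_null l_null inv_mult_cancel(1) inv_nz(1))

lemma lcancel: "x .: R ==> x ~= \<zero> ==> y .: R ==> z .: R ==> x \<otimes> y = x \<otimes> z \<longleftrightarrow> y = z"
 by (metis inv_mult_cancel(1))

lemma rcancel: "x .: R ==> x ~= \<zero> ==> y .: R ==> z .: R ==> y \<otimes> x = z \<otimes> x \<longleftrightarrow> y = z"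
 by (metis m_assoc r_one inv_nz(1,3))

lemma inv_unique': "x .: R ==> y .: R ==> y \<otimes> x = \<one> ==> inv x = y"
 by (metis l_null r_null r_one m_assoc inv_nz(1,3) one_nonzero l_one)

end

sublocale division_algebra \<subseteq> skew_field A
 by (intro skew_field.intro A.ring_axioms skew_field_axioms.intro Units_eq)

lemma division_algebraI:
 assumes "assoc_algebra K A" and ne: "\<one>\<^sub>A ~= \<zero>\<^sub>A"
  and inv: "!!x. x .: A ==> x ~= \<zero>\<^sub>A ==> EX y:car A. y \<otimes>\<^sub>A x = \<one>\<^sub>A & x \<otimes>\<^sub>A y = \<one>\<^sub>A"
 shows "division_algebra K A"
proof -
 interpret A: assoc_algebra K A by fact
 have "Units A = car A - {\<zero>\<^sub>A}"
  using inv ne by (fastforce simp: Units_def)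
 thus ?thesis by (intro division_algebra.intro assms division_algebra_axioms.intro)
qed

lemma division_algebra_opposite:
 assumes "division_algebra K A" shows "division_algebra K (Opp A)"
proof -
 interpret A: division_algebra K A by fact
 show ?thesis
 proof (rule division_algebraI[OF assoc_algebra_opposite[OF A.assoc_algebra_axioms]])
  fix x assume "x .: (Opp A)" "x ~= \<zero>\<^bsub>Opp A\<^esub>"
  thus "EX y:car (Opp A). y \<otimes>\<^bsub>Opp A\<^esub> x = \<one>\<^bsub>Opp A\<^esub> &
    x \<otimes>\<^bsub>Opp A\<^esub> y = \<one>\<^bsub>Opp A\<^esub>"
   by (intro bexI[of _ "inv\<^bsub>A\<^esub> x"]) simp_all
 qed simp
qed

definition unital_subalgebra ::
  "('k, 'r) ring_scheme => ('k, 'a, 'c) module_scheme => 'a set => bool"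
 where "unital_subalgebra K A R \<longleftrightarrow> R <= car A & \<zero>\<^sub>A : R & \<one>\<^sub>A : R &
  (ALL c:R. ALL d:R. c \<oplus>\<^sub>A d : R & c \<otimes>\<^sub>A d : R) & (ALL c:R. \<ominus>\<^sub>A c : R) &
  (ALL c:car K. ALL x:R. c \<odot>\<^sub>A x : R)"

lemma unital_subalgebraD:
 assumes "unital_subalgebra K A R"
 shows "c : R ==> c .: A" "\<zero>\<^sub>A : R" "\<one>\<^sub>A : R" "c : R ==> d : R ==> c \<oplus>\<^sub>A d : R"
  "c : R ==> d : R ==> c \<otimes>\<^sub>A d : R" "c : R ==> \<ominus>\<^sub>A c : R"
  "k .: K ==> c : R ==> k \<odot>\<^sub>A c : R"
 using assms by (auto simp: unital_subalgebra_def)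

lemma (in assoc_algebra) unital_subalgebra_algebra:
 assumes "unital_subalgebra K A R"
 shows "assoc_algebra K (A on R)"
proof -
 note RD = unital_subalgebraD[OF assms]
 let ?B = "A on R"
 have mod: "module K ?B"
  by (rule submodule.submodule_is_module[OF submoduleI module_axioms]) (use RD in auto)
 then interpret B: module K ?B .
 have "ring ?B"
  by (rule ringI, rule B.M.abelian_group_axioms, rule monoidI) (use RD in "auto simp: A.m_assoc A.l_distr A.r_distr")
 then interpret BR: ring ?B .
 show "assoc_algebra K ?B"
  by unfold_locales (use RD in "auto simp: smult_mult_left[symmetric] smult_mult_right[symmetric]")
qed

section \<open>Subspaces over a division subring, complements and projections\<close>

definition div_subring :: "('a, 'b) ring_scheme => 'a set => bool" where
 "div_subring D E \<longleftrightarrow> E <= car D & \<zero>\<^sub>D : E & \<one>\<^sub>D : E &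
  (ALL c:E. ALL d:E. c \<oplus>\<^sub>D d : E & c \<otimes>\<^sub>D d : E) & (ALL c:E. \<ominus>\<^sub>D c : E) &
  (ALL c:E. c ~= \<zero>\<^sub>D --> (EX d:E. d \<otimes>\<^sub>D c = \<one>\<^sub>D & c \<otimes>\<^sub>D d = \<one>\<^sub>D))"

lemma div_subringD:
 assumes "div_subring D E"
 shows "c : E ==> c .: D" "\<zero>\<^sub>D : E" "\<one>\<^sub>D : E" "c : E ==> d : E ==> c \<oplus>\<^sub>D d : E"
  "c : E ==> d : E ==> c \<otimes>\<^sub>D d : E" "c : E ==> \<ominus>\<^sub>D c : E"
  "c : E ==> c ~= \<zero>\<^sub>D ==> EX d:E. d \<otimes>\<^sub>D c = \<one>\<^sub>D & c \<otimes>\<^sub>D d = \<one>\<^sub>D"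
 using assms by (auto simp: div_subring_def)

text \<open>Negatives come from the scalar -1. The scalars are also allowed to be a subring without
  inverses, as in the proof of the Ore condition.\<close>

definition left_subspace :: "('a, 'b) ring_scheme => 'a set => 'a set => bool" where
 "left_subspace D E V \<longleftrightarrow> V <= car D & \<zero>\<^sub>D : V & (ALL x:V. ALL y:V. x \<oplus>\<^sub>D y : V) &
  (ALL c:E. ALL x:V. c \<otimes>\<^sub>D x : V)"

lemma left_subspaceD:
 assumes "left_subspace D E V"
 shows "x : V ==> x .: D" "\<zero>\<^sub>D : V" "x : V ==> y : V ==> x \<oplus>\<^sub>D y : V"
  "c : E ==> x : V ==> c \<otimes>\<^sub>D x : V"
 using assms by (auto simp: left_subspace_def)

context ring begin

lemma left_subspace_neg:
 assumes E: "div_subring R E" and V: "left_subspace R E V" and x: "x : V"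
 shows "\<ominus> x : V"
proof -
 have "(\<ominus> \<one>) \<otimes> x : V" using left_subspaceD(4)[OF V _ x] div_subringD(3,6)[OF E] by blast
 thus ?thesis using left_subspaceD(1)[OF V x] by (simp add: l_minus)
qed

text \<open>Zorn's lemma gives \<open>W\<close> maximal among the subspaces that contain
  \<open>W0\<close> and meet \<open>V\<close> trivially. For \<open>x\<close> outside
  \<open>W\<close>, maximality forces \<open>W + E x\<close> to meet \<open>V\<close>; the
  coefficient of \<open>x\<close> in such a common vector is invertible, which splits
  \<open>x\<close>.\<close>

lemma complement_exists:
 assumes E: "div_subring R E" and V: "left_subspace R E V" and W0: "left_subspace R E W0" and d: "V \<inter> W0 = {\<zero>}"
 obtains W where "left_subspace R E W" "W0 <= W" "V \<inter> W = {\<zero>}"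
  "!!x. x .: R ==> EX v:V. EX w:W. x = v \<oplus> w"
proof -
 let ?A = "{W. left_subspace R E W & W0 <= W & V \<inter> W = {\<zero>}}"
 note ED = div_subringD[OF E] and VD = left_subspaceD[OF V]
 have "EX M:?A. ALL X:?A. M <= X --> X = M"
 proof (rule subset_Zorn_nonempty)
  show "?A ~= {}" using W0 d by blast
  fix C assume C: "C ~= {}" "subset.chain ?A C"
  hence CA: "C <= ?A" and tot: "!!X Y. X : C ==> Y : C ==> X <= Y | Y <= X"
   by (auto simp: subset_chain_def)
  obtain X0 where X0: "X0 : C" using C by blast
  have "left_subspace R E (\<Union>C)"
   unfolding left_subspace_def
  proof (intro conjI ballI)
   show "\<Union>C <= car R" using CA by (auto simp: left_subspace_def)
   show "\<zero> : \<Union>C" using X0 CA by (auto simp: left_subspace_def)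
   fix x assume "x : \<Union>C"
   then obtain X where X: "x : X" "X : C" by blast
   { fix c assume "c : E"
    thus "c \<otimes> x : \<Union>C" using X CA left_subspaceD(4)[of R E X c x] by blast }
   fix y assume "y : \<Union>C"
   then obtain Y where Y: "y : Y" "Y : C" by blast
   have "left_subspace R E X" "left_subspace R E Y" using X Y CA by auto
   thus "x \<oplus> y : \<Union>C" using tot[OF X(2) Y(2)] X Y left_subspaceD(3)[of R E] by blast
  qed
  moreover have "W0 <= \<Union>C" using X0 CA by blast
  moreover have "V \<inter> \<Union>C = {\<zero>}" using X0 CA VD(2) by (auto simp: left_subspace_def)
  ultimately show "\<Union>C : ?A" by blast
 qed
 then obtain W where WA: "W : ?A" and mx: "ALL X:?A. W <= X --> X = W" by (elim bexE)
 have W: "left_subspace R E W" "W0 <= W" "V \<inter> W = {\<zero>}" using WA by auto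
 have max: "X = W" if "left_subspace R E X" "W0 <= X" "V \<inter> X = {\<zero>}" "W <= X" for X
  using mx that by simp
 note WD = left_subspaceD[OF W(1)]
 have "EX v:V. EX w:W. x = v \<oplus> w" if x: "x .: R" for x
 proof (cases "x : W")
  case True thus ?thesis using VD(2) WD(1) by force
 next
  case False
  let ?X = "{w \<oplus> c \<otimes> x | w c. w : W & c : E}"
  have "left_subspace R E ?X" unfolding left_subspace_def
  proof (intro conjI ballI)
   show "?X <= car R" using WD ED x by auto
   have "\<zero> = \<zero> \<oplus> \<zero> \<otimes> x" using x by simp
   thus "\<zero> : ?X" using WD(2) ED(2) by blast
   fix y assume "y : ?X"
   then obtain w c where y: "w : W" "c : E" "y = w \<oplus> c \<otimes> x" by blast
   { fix a assume a: "a : E"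
    have "a \<otimes> y = a \<otimes> w \<oplus> (a \<otimes> c) \<otimes> x" using a y x WD(1) ED(1) by (simp add: r_distr m_assoc)
    thus "a \<otimes> y : ?X" using a y WD(4) ED(5) by blast }
   fix z assume "z : ?X"
   then obtain w' c' where z: "w' : W" "c' : E" "z = w' \<oplus> c' \<otimes> x" by blast
   have "y \<oplus> z = (w \<oplus> w') \<oplus> (c \<oplus> c') \<otimes> x" using y z x WD(1) ED(1) by (simp add: l_distr a_ac)
   thus "y \<oplus> z : ?X" using y z WD(3) ED(4) by blast
  qed
  moreover have WX: "W <= ?X"
  proof
   fix w assume "w : W"
   hence "w = w \<oplus> \<zero> \<otimes> x" using x WD by simp
   thus "w : ?X" using \<open>w : W\<close> ED(2) by blast
  qed
  moreover have "x : ?X"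
  proof -
   have "x = \<zero> \<oplus> \<one> \<otimes> x" using x by simp
   thus ?thesis using WD(2) ED(3) by blast
  qed
  ultimately have "V \<inter> ?X ~= {\<zero>}" using max[of ?X] W(2) False by blast
  moreover have "\<zero> : V \<inter> ?X" using VD(2) WD(2) WX by blast
  ultimately obtain v w c where v: "v : V" "v ~= \<zero>" "w : W" "c : E" "v = w \<oplus> c \<otimes> x" by blast
  have "c ~= \<zero>" using v W(3) x WD(1) by auto
  then obtain c' where c': "c' : E" "c' \<otimes> c = \<one>" using ED(7) v(4) by blast
  have "c' \<otimes> v = c' \<otimes> w \<oplus> x" unfolding v(5) using v c' x WD(1) ED(1) by (simp add: r_distr m_assoc[symmetric])
  hence "x = c' \<otimes> v \<oplus> \<ominus> (c' \<otimes> w)"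
   using v(1,3) c'(1) x WD(1) VD(1) ED(1) by (simp add: a_ac r_neg2 r_neg)
  thus ?thesis using VD(4)[OF c'(1) v(1)] left_subspace_neg[OF E W(1)] WD(4)[OF c'(1) v(3)] by blast
 qed
 thus thesis using that W by blast
qed

text \<open>Being able to prescribe \<open>W0\<close> inside the kernel is what makes projections
  separate given vectors.\<close>

lemma projection_exists:
 assumes E: "div_subring R E" and V: "left_subspace R E V" and W0: "left_subspace R E W0" and d: "V \<inter> W0 = {\<zero>}"
 obtains p where "!!x. x .: R ==> p x : V"
  "!!x y. x .: R ==> y .: R ==> p (x \<oplus> y) = p x \<oplus> p y"
  "!!c x. c : E ==> x .: R ==> p (c \<otimes> x) = c \<otimes> p x"
  "!!v. v : V ==> p v = v" "!!w. w : W0 ==> p w = \<zero>"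
proof -
 obtain W where W: "left_subspace R E W" "W0 <= W" "V \<inter> W = {\<zero>}"
  and dec: "!!x. x .: R ==> EX v:V. EX w:W. x = v \<oplus> w"
  using complement_exists[OF assms] by blast
 note ED = div_subringD[OF E] and VD = left_subspaceD[OF V] and WD = left_subspaceD[OF W(1)]
 define p where "p x = (THE v. v : V & (EX w:W. x = v \<oplus> w))" for x
 have p: "p (v \<oplus> w) = v" if "v : V" "w : W" for v w
  unfolding p_def
 proof (rule the_equality)
  show "v : V & (EX w':W. v \<oplus> w = v \<oplus> w')" using that by blast
  fix v' assume "v' : V & (EX w':W. v \<oplus> w = v' \<oplus> w')"
  then obtain w' where v': "v' : V" "w' : W" "v \<oplus> w = v' \<oplus> w'" by blast
  have cl: "v .: R" "v' .: R" "w .: R" "w' .: R" using v' that VD(1) WD(1) by auto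
  have "\<ominus> v' \<oplus> (v \<oplus> w) = w'" using v'(3) cl by (simp add: r_neg1)
  hence "\<ominus> v' \<oplus> v = w' \<oplus> \<ominus> w" using cl
   by (metis a_assoc a_closed a_inv_closed r_neg r_zero)
  moreover have "w' \<oplus> \<ominus> w : W" using v' that WD(3) left_subspace_neg[OF E W(1)] by blast
  moreover have "\<ominus> v' \<oplus> v : V" using v' that VD(3) left_subspace_neg[OF E V] by blast
  ultimately have "\<ominus> v' \<oplus> v = \<zero>" using W(3) by auto
  thus "v' = v" using cl by (metis minus_equality minus_minus a_inv_closed)
 qed
 show thesis
 proof (rule that[of p])
  show "p x : V" if "x .: R" for x using dec[OF that] p by auto
  show "p v = v" if "v : V" for v using p[OF that WD(2)] VD(1)[OF that] by simp
  show "p w = \<zero>" if "w : W0" for w using p[OF VD(2), of w] W(2) WD(1)[of w] that by auto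
  fix x assume "x .: R"
  then obtain v w where x: "v : V" "w : W" "x = v \<oplus> w" using dec by blast
  have cl: "v .: R" "w .: R" using x VD(1) WD(1) by auto
  { fix c assume c: "c : E"
   have "c \<otimes> x = c \<otimes> v \<oplus> c \<otimes> w" using x cl ED(1)[OF c] by (simp add: r_distr)
   thus "p (c \<otimes> x) = c \<otimes> p x" using p[OF VD(4)[OF c x(1)] WD(4)[OF c x(2)]] p[OF x(1,2)] x(3) by simp }
  fix y assume "y .: R"
  then obtain v' w' where y: "v' : V" "w' : W" "y = v' \<oplus> w'" using dec by blast
  have "v' .: R" "w' .: R" using y VD(1) WD(1) by auto
  hence "x \<oplus> y = (v \<oplus> v') \<oplus> (w \<oplus> w')" using x y cl by (simp add: a_ac)
  thus "p (x \<oplus> y) = p x \<oplus> p y"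
   using p[OF VD(3)[OF x(1) y(1)] WD(3)[OF x(2) y(2)]] p[OF x(1,2)] p[OF y(1,2)] x(3) y(3) by simp
 qed
qed

end

context division_algebra begin

text \<open>The copy of the ground field inside \<open>A\<close>. It turns subspaces over the field
  into subspaces over a division subring, to which \<open>projection_exists\<close> applies.\<close>

definition scal where "scal = (%c. c \<odot>\<^sub>A \<one>\<^sub>A) ` car K"

lemma scal_mult: "c .: K ==> x .: A ==> (c \<odot>\<^sub>A \<one>\<^sub>A) \<otimes>\<^sub>A x = c \<odot>\<^sub>A x"
 "c .: K ==> x .: A ==> x \<otimes>\<^sub>A (c \<odot>\<^sub>A \<one>\<^sub>A) = c \<odot>\<^sub>A x"
 by (simp_all add: smult_mult_left[symmetric] smult_mult_right[symmetric])

lemma div_subring_scal: "div_subring A scal"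
 unfolding div_subring_def
proof (intro conjI ballI impI)
 show "scal <= car A" by (auto simp: scal_def)
 show "\<zero>\<^sub>A : scal" using R.zero_closed by (force simp: scal_def)
 show "\<one>\<^sub>A : scal" using R.one_closed by (force simp: scal_def)
 fix x assume "x : scal"
 then obtain c where c: "c .: K" "x = c \<odot>\<^sub>A \<one>\<^sub>A" by (auto simp: scal_def)
 have "\<ominus>\<^sub>A x = (\<ominus> c) \<odot>\<^sub>A \<one>\<^sub>A" using c by (simp add: smult_l_minus)
 thus "\<ominus>\<^sub>A x : scal" using c by (auto simp: scal_def)
 { fix y assume "y : scal"
  then obtain d where d: "d .: K" "y = d \<odot>\<^sub>A \<one>\<^sub>A" by (auto simp: scal_def)
  have "x \<oplus>\<^sub>A y = (c \<oplus> d) \<odot>\<^sub>A \<one>\<^sub>A" using c d by (simp add: smult_l_distr)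
  thus "x \<oplus>\<^sub>A y : scal" using c d by (auto simp: scal_def)
  have "x \<otimes>\<^sub>A y = (c \<otimes> d) \<odot>\<^sub>A \<one>\<^sub>A" unfolding c(2) d(2) using c d
   by (simp only: scal_mult(1) smult_closed A.one_closed smult_assoc1)
  thus "x \<otimes>\<^sub>A y : scal" using c d by (auto simp: scal_def) }
 assume "x ~= \<zero>\<^sub>A"
 hence "c ~= \<zero>" using c by auto
 hence "c : Units K" using c field_Units by auto
 hence i: "inv c .: K" "inv c \<otimes> c = \<one>" "c \<otimes> inv c = \<one>" by auto
 have "(inv c \<odot>\<^sub>A \<one>\<^sub>A) \<otimes>\<^sub>A x = \<one>\<^sub>A" "x \<otimes>\<^sub>A (inv c \<odot>\<^sub>A \<one>\<^sub>A) = \<one>\<^sub>A"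
  using i c by (simp_all add: scal_mult smult_assoc1[symmetric])
 thus "EX d:scal. d \<otimes>\<^sub>A x = \<one>\<^sub>A & x \<otimes>\<^sub>A d = \<one>\<^sub>A" using i(1) by (auto simp: scal_def)
qed

lemma division_subalgebra_iff:
 "division_subalgebra K A E \<longleftrightarrow> div_subring A E & (ALL c:car K. ALL x:E. c \<odot>\<^sub>A x : E)"
proof
 assume a: "division_subalgebra K A E"
 then interpret E: division_algebra K "A on E" by (simp add: division_subalgebra_def)
 have sub: "E <= car A" using a by (simp add: division_subalgebra_def)
 have neg: "\<ominus>\<^sub>A x : E" if x: "x : E" for x
 proof -
  obtain y where "y : E" "y \<oplus>\<^sub>A x = \<zero>\<^sub>A"
   using x E.M.a_inv_closed[of x] E.M.l_neg[of x] by auto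
  thus ?thesis using x sub M.minus_equality[of y x] by auto
 qed
 show "div_subring A E & (ALL c:car K. ALL x:E. c \<odot>\<^sub>A x : E)"
  unfolding div_subring_def
  using sub E.M.zero_closed E.A.one_closed E.M.a_closed E.A.m_closed E.smult_closed neg
   E.inv_nz by (simp, metis)
next
 assume a: "div_subring A E & (ALL c:car K. ALL x:E. c \<odot>\<^sub>A x : E)"
 hence E: "div_subring A E" and sm: "!!c x. c .: K ==> x : E ==> c \<odot>\<^sub>A x : E" by auto
 note ED = div_subringD[OF E]
 have "assoc_algebra K (A on E)"
  by (rule unital_subalgebra_algebra) (use ED sm in "auto simp: unital_subalgebra_def")
 hence "division_algebra K (A on E)"
  by (rule division_algebraI) (use ED in auto)
 thus "division_subalgebra K A E" using ED by (auto simp: division_subalgebra_def)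
qed

end

section \<open>Antiautomorphisms of the enveloping algebra and of its fractions\<close>

context lie_algebra begin

text \<open>The sign compensates the reversed product: in the opposite algebra the commutator of
  \<open>-x\<close> and \<open>-y\<close> is \<open>y x - x y\<close>, which is minus the bracket of
  \<open>x\<close> and \<open>y\<close>. The square fixes the generators and preserves products,
  hence is the identity.\<close>

lemma enveloping_antiautomorphism:
 obtains s where "s : alg_hom K U (Opp U)" "!!u. u .: U ==> s (s u) = u"
proof -
 let ?f = "%x. \<ominus>\<^sub>U uin x"
 have f: "?f : mod_hom K L (Opp U)"
  by (rule mod_homI) (simp_all add: uin_add uin_smult UU.smult_r_minus UU.M.minus_add)
 have fbr: "?f (br x y) = ?f x \<otimes>\<^bsub>Opp U\<^esub> ?f y \<ominus>\<^bsub>Opp U\<^esub> ?f y \<otimes>\<^bsub>Opp U\<^esub> ?f x"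
  if "x .: L" "y .: L" for x y
  using that by (simp add: uin_br a_minus_def UU.A.l_minus UU.A.r_minus UU.M.minus_add UU.M.a_comm)
 obtain s where s: "s : alg_hom K U (Opp U)" "!!x. x .: L ==> s (uin x) = ?f x"
  using enveloping_universal[OF assoc_algebra_opposite[OF UU.assoc_algebra_axioms] f fbr] by metis
 note sD = alg_homD[OF s(1), simplified]
 have sneg: "s (\<ominus>\<^sub>U u) = \<ominus>\<^sub>U s u" if "u .: U" for u
 proof -
  have "s (\<ominus>\<^sub>U u) \<oplus>\<^sub>U s u = s \<zero>\<^sub>U" using that sD(2)[of "\<ominus>\<^sub>U u" u] by (simp add: UU.M.l_neg)
  also have "s \<zero>\<^sub>U = \<zero>\<^sub>U" using sD(5)[of \<zero> "\<zero>\<^sub>U"] sD(1)[of "\<zero>\<^sub>U"] by simp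
  finally show ?thesis using that sD(1) by (simp add: UU.M.minus_equality)
 qed
 have "submodule {u : car U. s (s u) = u} K U"
  by (rule UU.submoduleI) (use sneg[of "\<zero>\<^sub>U"] sD(5)[of \<zero> "\<zero>\<^sub>U"] sD(1)[of "\<zero>\<^sub>U"] in "auto simp: sD sneg")
 moreover have "s (s (uword w)) = uword w" if "w : lists (car L)" for w
  using that
 proof (induction w)
  case Nil thus ?case by (simp add: uword_Nil sD)
 next
  case (Cons x w)
  hence "x .: L" "w : lists (car L)" "uword w .: U" using uword_closed by auto
  thus ?case using Cons by (simp add: uword_Cons sD s(2) sneg UU.M.minus_minus del: in_lists_conv_set)
 qed
 ultimately have "car U <= {u : car U. s (s u) = u}" by (intro span_U image_subsetI CollectI conjI uword_closed)
 thus thesis using that[OF s(1)] by auto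
qed

end

locale fraction_algebra = U: assoc_algebra K U + division_algebra K D for K and U and D (structure) +
 fixes iota
 assumes quot: "quotient_division_algebra K U D iota"
begin

lemma iota_hom: "iota : alg_hom K U D" and iota_inj: "inj_on iota (car U)"
 using quot by (auto simp: quotient_division_algebra_def)

lemmas iotaD = alg_homD[OF iota_hom]

lemma iota_zero: "iota \<zero>\<^sub>U = \<zero>"
 by (rule mod_hom_zero[OF U.module_axioms module_axioms alg_hom_mod_hom[OF iota_hom]])

lemma iota_nz: "u .: U ==> iota u = \<zero> \<longleftrightarrow> u = \<zero>\<^sub>U"
 using inj_onD[OF iota_inj, of u "\<zero>\<^sub>U"] iota_zero by auto

lemma left_den:
 assumes "x .: D"
 obtains u w where "u .: U" "u ~= \<zero>\<^sub>U" "w .: U" "iota u \<otimes> x = iota w"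
proof -
 obtain u w where uw: "u .: U" "u ~= \<zero>\<^sub>U" "w .: U" "x = inv (iota u) \<otimes> iota w"
  using assms quot unfolding quotient_division_algebra_def by blast
 hence "iota u \<otimes> x = iota w" by (simp add: iota_nz iotaD)
 thus thesis using that uw by blast
qed

lemma right_den:
 assumes "x .: D"
 obtains u w where "u .: U" "u ~= \<zero>\<^sub>U" "w .: U" "x \<otimes> iota u = iota w"
proof -
 have "x : {iota w \<otimes> inv iota u |u w. u .: U & u ~= \<zero>\<^sub>U & w .: U}"
  using assms quot unfolding quotient_division_algebra_def by (elim conjE) (simp only:)
 then obtain u w where uw: "u .: U" "u ~= \<zero>\<^sub>U" "w .: U" "x = iota w \<otimes> inv (iota u)"
  by blast
 hence "x \<otimes> iota u = iota w" by (simp add: iota_nz iotaD A.m_assoc)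
 thus thesis using that uw by blast
qed

lemma U_nz_mult: "u .: U ==> v .: U ==> u \<otimes>\<^sub>U v = \<zero>\<^sub>U ==> u = \<zero>\<^sub>U | v = \<zero>\<^sub>U"
 by (metis iotaD(1,3) iota_nz iota_zero no_zero_div)

text \<open>The right fraction \<open>a u^-1\<close> is also a left fraction, because
  \<open>D\<close> consists of the fractions of either kind.\<close>

lemma left_ore:
 assumes "a .: U" "u .: U" "u ~= \<zero>\<^sub>U"
 obtains a' b where "a' .: U" "a' ~= \<zero>\<^sub>U" "b .: U" "a' \<otimes>\<^sub>U a = b \<otimes>\<^sub>U u"
proof -
 have nz: "iota u ~= \<zero>" using assms by (simp add: iota_nz)
 obtain a' b where a': "a' .: U" "a' ~= \<zero>\<^sub>U" "b .: U" "iota a' \<otimes> (iota a \<otimes> inv (iota u)) = iota b"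
  by (rule left_den[of "iota a \<otimes> inv (iota u)"]) (use nz assms in "auto simp: iotaD")
 have "iota b \<otimes> iota u = iota a' \<otimes> iota a"
  unfolding a'(4)[symmetric] using a'(1-3) assms nz by (simp add: iotaD A.m_assoc)
 hence "iota (a' \<otimes>\<^sub>U a) = iota (b \<otimes>\<^sub>U u)" using a' assms by (simp add: iotaD)
 hence "a' \<otimes>\<^sub>U a = b \<otimes>\<^sub>U u" using inj_onD[OF iota_inj] a' assms by simp
 thus thesis using that a' by blast
qed

text \<open>An antiautomorphism must send the left fraction \<open>u^-1 w\<close> to the right
  fraction \<open>s(w) s(u)^-1\<close>; the Ore condition makes this independent of the
  representation and compatible with the operations.\<close>

lemma opposite_extension:
 assumes s: "s : alg_hom K U (Opp U)" and ss: "!!u. u .: U ==> s (s u) = u"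
 obtains theta where "theta : alg_hom K D (Opp D)" "!!x. x .: D ==> theta (theta x) = x"
proof -
 note sD = alg_homD[OF s, simplified]
 have s0: "s \<zero>\<^sub>U = \<zero>\<^sub>U" using sD(5)[of "\<zero>\<^sub>K" "\<zero>\<^sub>U"] sD(1)[of "\<zero>\<^sub>U"] by simp
 have snz: "s u ~= \<zero>\<^sub>U" if "u .: U" "u ~= \<zero>\<^sub>U" for u using ss[OF that(1)] s0 that by metis
 \<comment> \<open>The value is pinned down by equations free of inverses, so that it can be tested
   against any other denominator of \<open>x\<close>.\<close>
 define P where "P x y \<longleftrightarrow> y .: D & (EX u:car U. EX w:car U. u ~= \<zero>\<^sub>U &
  iota u \<otimes> x = iota w & y \<otimes> iota (s u) = iota (s w))" for x y
 have ex: "EX y. P x y" if x: "x .: D" for x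
 proof -
  obtain u w where uw: "u .: U" "u ~= \<zero>\<^sub>U" "w .: U" "iota u \<otimes> x = iota w" using left_den[OF x] .
  have "iota (s u) ~= \<zero>" using uw snz by (simp add: iota_nz sD)
  hence "P x (iota (s w) \<otimes> inv (iota (s u)))" unfolding P_def using uw
   by (intro conjI bexI[of _ u] bexI[of _ w]) (simp_all add: sD iotaD A.m_assoc)
  thus ?thesis ..
 qed
 text \<open>A second pair with the same denominator can always be used instead.\<close>
 have gen: "y \<otimes> iota (s u) = iota (s w)"
  if x: "x .: D" and P: "P x y" and u: "u .: U" "w .: U" "iota u \<otimes> x = iota w" for x y u w
 proof -
  obtain u' w' where u': "y .: D" "u' .: U" "w' .: U" "u' ~= \<zero>\<^sub>U"
   "iota u' \<otimes> x = iota w'" "y \<otimes> iota (s u') = iota (s w')" using P by (auto simp: P_def)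
  obtain a b where ab: "a .: U" "a ~= \<zero>\<^sub>U" "b .: U" "a \<otimes>\<^sub>U u = b \<otimes>\<^sub>U u'"
   using left_ore[OF u(1) u'(2,4)] .
  have "iota (a \<otimes>\<^sub>U w) = iota (a \<otimes>\<^sub>U u) \<otimes> x" using ab(1) u x by (simp add: iotaD A.m_assoc)
  also have "... = iota (b \<otimes>\<^sub>U w')" unfolding ab(4) using ab u' x by (simp add: iotaD A.m_assoc)
  finally have aw: "a \<otimes>\<^sub>U w = b \<otimes>\<^sub>U w'" using inj_onD[OF iota_inj] ab u u' by simp
  have "y \<otimes> iota (s u) \<otimes> iota (s a) = y \<otimes> iota (s (a \<otimes>\<^sub>U u))"
   using ab(1) u(1) u'(1) by (simp add: sD iotaD A.m_assoc)
  also have "... = (y \<otimes> iota (s u')) \<otimes> iota (s b)" unfolding ab(4) using ab(3) u'(1,2) by (simp add: sD iotaD A.m_assoc)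
  also have "... = iota (s (b \<otimes>\<^sub>U w'))" unfolding u'(6) using ab(3) u'(3) by (simp add: sD iotaD)
  also have "... = iota (s w) \<otimes> iota (s a)" unfolding aw[symmetric] using ab(1) u(1,2) by (simp add: sD iotaD)
  finally show ?thesis
   using rcancel[of "iota (s a)"] snz[OF ab(1,2)] ab u u'(1) by (simp add: iota_nz sD iotaD)
 qed
 have uniq: "y = y'" if x: "x .: D" and P: "P x y" "P x y'" for x y y'
 proof -
  obtain u w where u: "y' .: D" "u .: U" "w .: U" "u ~= \<zero>\<^sub>U"
   "iota u \<otimes> x = iota w" "y' \<otimes> iota (s u) = iota (s w)" using P(2) by (auto simp: P_def)
  have "y \<otimes> iota (s u) = y' \<otimes> iota (s u)" using gen[OF x P(1) u(2,3,5)] u(6) by simp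
  moreover have "y .: D" using P(1) by (simp add: P_def)
  ultimately show ?thesis using rcancel[of "iota (s u)" y y'] snz[OF u(2,4)] u by (simp add: iota_nz sD iotaD)
 qed
 define theta where "theta x = (SOME y. P x y)" for x
 have thetaP: "P x (theta x)" if "x .: D" for x unfolding theta_def using ex[OF that] by (rule someI_ex)
 have thetaI: "theta x = y" if "x .: D" "y .: D" "u .: U" "w .: U" "u ~= \<zero>\<^sub>U"
   "iota u \<otimes> x = iota w" "y \<otimes> iota (s u) = iota (s w)" for x y u w
  using uniq[OF that(1) thetaP[OF that(1)], of y] that by (auto simp: P_def)
 have thetac: "theta x .: D" if "x .: D" for x using thetaP[OF that] by (simp add: P_def)
 note thetae = gen[OF _ thetaP]
 have thetaiota: "theta (iota w) = iota (s w)" if "w .: U" for w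
  by (rule thetaI[of _ _ "\<one>\<^sub>U" w])
  (use that U_nz_mult iota_nz[of "\<one>\<^sub>U"] in "auto simp: iotaD sD")
 have thetamult: "theta (x \<otimes> x') = theta x' \<otimes> theta x" if x: "x .: D" "x' .: D" for x x'
 proof -
  obtain u w where u: "u .: U" "u ~= \<zero>\<^sub>U" "w .: U" "iota u \<otimes> x = iota w" using left_den[OF x(1)] .
  obtain u' w' where u': "u' .: U" "u' ~= \<zero>\<^sub>U" "w' .: U" "iota u' \<otimes> x' = iota w'" using left_den[OF x(2)] .
  \<comment> \<open>With \<open>a w = b u'\<close>, the product \<open>u^-1 w u'^-1 w'\<close>
    becomes the single left fraction with denominator \<open>a u\<close> and numerator
    \<open>b w'\<close>.\<close>
  obtain a b where ab: "a .: U" "a ~= \<zero>\<^sub>U" "b .: U" "a \<otimes>\<^sub>U w = b \<otimes>\<^sub>U u'"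
   using left_ore[OF u(3) u'(1,2)] .
  show ?thesis
  proof (rule thetaI[of _ _ "a \<otimes>\<^sub>U u" "b \<otimes>\<^sub>U w'"])
   show "a \<otimes>\<^sub>U u ~= \<zero>\<^sub>U" using U_nz_mult ab u by blast
   have "iota (a \<otimes>\<^sub>U u) \<otimes> (x \<otimes> x') = iota a \<otimes> (iota u \<otimes> x) \<otimes> x'"
    using ab(1) u(1) x by (simp add: iotaD A.m_assoc)
   also have "... = iota (a \<otimes>\<^sub>U w) \<otimes> x'" unfolding u(4) using ab(1) u(1,3) by (simp add: iotaD)
   also have "... = iota b \<otimes> (iota u' \<otimes> x')" unfolding ab(4) using ab(3) u'(1) x by (simp add: iotaD A.m_assoc)
   also have "... = iota (b \<otimes>\<^sub>U w')" unfolding u'(4) using ab(3) u'(3) by (simp add: iotaD)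
   finally show "iota (a \<otimes>\<^sub>U u) \<otimes> (x \<otimes> x') = iota (b \<otimes>\<^sub>U w')" .
   have "theta x' \<otimes> theta x \<otimes> iota (s (a \<otimes>\<^sub>U u)) = theta x' \<otimes> (theta x \<otimes> iota (s u)) \<otimes> iota (s a)"
    using ab(1) u(1) x by (simp add: iotaD A.m_assoc sD thetac)
   also have "... = theta x' \<otimes> iota (s (a \<otimes>\<^sub>U w))" unfolding thetae[OF x(1) x(1) u(1,3,4)]
    using ab(1) u(1,3) x by (simp add: iotaD A.m_assoc sD thetac)
   also have "... = (theta x' \<otimes> iota (s u')) \<otimes> iota (s b)" unfolding ab(4)
    using ab(3) u'(1) x by (simp add: iotaD A.m_assoc sD thetac)
   also have "... = iota (s (b \<otimes>\<^sub>U w'))" unfolding thetae[OF x(2) x(2) u'(1,3,4)] using ab(3) u'(3) by (simp add: iotaD sD)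
   finally show "theta x' \<otimes> theta x \<otimes> iota (s (a \<otimes>\<^sub>U u)) = iota (s (b \<otimes>\<^sub>U w'))" .
  qed (use x ab u u' thetac in auto)
 qed
 have thetaadd: "theta (x \<oplus> x') = theta x \<oplus> theta x'" if x: "x .: D" "x' .: D" for x x'
 proof -
  obtain u w where u: "u .: U" "u ~= \<zero>\<^sub>U" "w .: U" "iota u \<otimes> x = iota w" using left_den[OF x(1)] .
  have ux: "iota u \<otimes> x' .: D" using u x iotaD by simp
  \<comment> \<open>A denominator of \<open>u x'\<close> rather than of \<open>x'\<close> makes
    \<open>v u\<close> a common denominator of \<open>x\<close> and \<open>x'\<close>.\<close>
  obtain v w' where v: "v .: U" "v ~= \<zero>\<^sub>U" "w' .: U" "iota v \<otimes> (iota u \<otimes> x') = iota w'" using left_den[OF ux] .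
  have e1: "iota (v \<otimes>\<^sub>U u) \<otimes> x = iota (v \<otimes>\<^sub>U w)" using u v x by (simp add: iotaD A.m_assoc)
  have e2: "iota (v \<otimes>\<^sub>U u) \<otimes> x' = iota w'" using u v x by (simp add: iotaD A.m_assoc)
  have vu: "v \<otimes>\<^sub>U u .: U" using u v by simp
  have vw: "v \<otimes>\<^sub>U w .: U" using u v by simp
  have t1: "theta x \<otimes> iota (s (v \<otimes>\<^sub>U u)) = iota (s (v \<otimes>\<^sub>U w))" by (rule thetae[OF x(1) x(1) vu vw e1])
  have t2: "theta x' \<otimes> iota (s (v \<otimes>\<^sub>U u)) = iota (s w')" by (rule thetae[OF x(2) x(2) vu v(3) e2])
  show ?thesis
  proof (rule thetaI[of _ _ "v \<otimes>\<^sub>U u" "v \<otimes>\<^sub>U w \<oplus>\<^sub>U w'"])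
   show "v \<otimes>\<^sub>U u ~= \<zero>\<^sub>U" using U_nz_mult u v by blast
   show "iota (v \<otimes>\<^sub>U u) \<otimes> (x \<oplus> x') = iota (v \<otimes>\<^sub>U w \<oplus>\<^sub>U w')"
    using vu vw v(3) x e1 e2 by (simp add: A.r_distr iotaD(1,2))
   show "(theta x \<oplus> theta x') \<otimes> iota (s (v \<otimes>\<^sub>U u)) = iota (s (v \<otimes>\<^sub>U w \<oplus>\<^sub>U w'))"
    using vu vw v(3) x t1 t2 by (simp add: A.l_distr iotaD(1,2) thetac sD(1,2))
  qed (use x vu vw v thetac in auto)
 qed
 have thetaone: "theta \<one> = \<one>" using thetaiota[of "\<one>\<^sub>U"] by (simp add: iotaD sD)
 have thetascal: "theta (c \<odot> x) = c \<odot> theta x" if c: "c .: K" "x .: D" for c x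
 proof -
  have "theta (c \<odot> \<one>) = c \<odot> \<one>" using thetaiota[of "c \<odot>\<^sub>U \<one>\<^sub>U"] c by (simp add: iotaD sD)
  thus ?thesis using thetamult[of "c \<odot> \<one>" x] c thetac by (simp add: scal_mult)
 qed
 have "theta (theta x) = x" if x: "x .: D" for x
 proof -
  obtain u w where u: "u .: U" "u ~= \<zero>\<^sub>U" "w .: U" "iota u \<otimes> x = iota w" using left_den[OF x(1)] .
  have "theta (theta x \<otimes> iota (s u)) = theta (iota (s w))" using thetae[OF x x u(1,3,4)] by simp
  hence "iota u \<otimes> theta (theta x) = iota w" using u x by (simp add: thetamult thetac iotaD sD thetaiota ss)
  hence "iota u \<otimes> theta (theta x) = iota u \<otimes> x" using u(4) by simp
  moreover have "iota u ~= \<zero>" "iota u .: D" "theta (theta x) .: D" using u x by (simp_all add: iota_nz thetac iotaD)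
  ultimately show ?thesis using lcancel x by blast
 qed
 moreover have "theta : alg_hom K D (Opp D)"
  by (auto simp: alg_hom_def ring_hom_def thetac thetamult thetaadd thetaone thetascal)
 ultimately show thesis by (rule that[rotated])
qed

end

text \<open>Applying \<open>theta\<close> to the right factor works in both directions, and the two
  maps are mutually inverse because \<open>theta\<close> is an involution.\<close>

lemma tensor_opposite_iso:
 assumes D: "assoc_algebra K D" and theta: "theta : alg_hom K D (Opp D)"
  and inv: "!!x. x .: D ==> theta (theta x) = x"
 shows "alg_iso K (tensor_product K D (Opp D)) (tensor_product K D D) ~= {}"
proof -
 note Dop = assoc_algebra_opposite[OF D]
 interpret A: tensor_algebras K D "Opp D" using D Dop by (rule tensor_algebras.intro)
 interpret B: tensor_algebras K D D using D D by (rule tensor_algebras.intro)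
 note thetaD = alg_homD[OF theta, simplified]
 have b1: "bilin K D (Opp D) B.T (%a b. B.pt a (theta b))"
  unfolding bilin_def by (auto intro!: mod_homI simp: thetaD B.pt_add_left B.pt_add_right B.pt_smult_left B.pt_smult_right)
 have b2: "bilin K D D A.T (%a b. A.pt a (theta b))"
  unfolding bilin_def using A.pt_closed A.pt_add_left A.pt_add_right A.pt_smult_left A.pt_smult_right
  by (auto intro!: mod_homI simp: thetaD)
 obtain f where f: "f : mod_hom K A.T B.T" "!!a b. a .: D ==> b .: D ==> f (A.pt a b) = B.pt a (theta b)"
  using A.tensor_lift[OF B.TM.module_axioms b1] by auto
 obtain g where g: "g : mod_hom K B.T A.T" "!!a b. a .: D ==> b .: D ==> g (B.pt a b) = A.pt a (theta b)"
  using B.tensor_lift[OF A.TM.module_axioms b2] by auto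
 note fD = mod_homD[OF f(1)] and gD = mod_homD[OF g(1)]
 have gf: "g (f x) = x" if "x .: A.T" for x
  by (rule A.mod_hom_tensor_eqI[OF A.TM.module_axioms _ _ _ that, of "%x. g (f x)" "%x. x"])
  (auto intro!: mod_homI simp: fD gD f(2) g(2) thetaD inv)
 have fg: "f (g x) = x" if "x .: B.T" for x
  by (rule B.mod_hom_tensor_eqI[OF B.TM.module_axioms _ _ _ that, of "%x. f (g x)" "%x. x"])
  (auto intro!: mod_homI simp: fD gD f(2) g(2) thetaD inv)
 have fm: "f (x \<otimes>\<^bsub>A.T\<^esub> y) = f x \<otimes>\<^bsub>B.T\<^esub> f y" if "x .: A.T" "y .: A.T" for x y
  by (rule A.mod_hom_mult_eqI[OF B.TA.assoc_algebra_axioms f(1) _ that]) (simp add: f(2) thetaD B.pt_mult)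
 have "f \<one>\<^bsub>A.T\<^esub> = \<one>\<^bsub>B.T\<^esub>" by (simp add: A.T_one B.T_one f(2) thetaD)
 moreover have "bij_betw f (car A.T) (car B.T)"
  by (rule bij_betwI[of f _ _ g]) (auto simp: fD gD gf fg)
 ultimately have "f : alg_iso K A.T B.T"
  by (auto simp: alg_iso_def alg_hom_def ring_iso_def ring_hom_def fD fm)
 thus ?thesis by blast
qed

section \<open>The tensor product of a division algebra with its opposite\<close>

locale env_fractions = LB: lie_basis K L br n b coord +
 FD: fraction_algebra K "enveloping_algebra K L br" D iota for K L br n b coord and D (structure) and iota
begin

abbreviation "U == enveloping_algebra K L br"
abbreviation "Dop == Opp D"
abbreviation "T == tensor_product K D Dop"

sublocale TD: tensor_algebras K D Dop
 by (intro tensor_algebras.intro FD.assoc_algebra_axioms assoc_algebra_opposite)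

abbreviation "pt == TD.pt"
abbreviation "rt u == pt \<one> (iota u)"

lemma pt_c [simp]: "x .: D ==> y .: D ==> pt x y .: T"
 by (rule TD.pt_closed) simp_all

lemma pt_m: "x .: D ==> y .: D ==> x' .: D ==> y' .: D ==>
 pt x y \<otimes>\<^sub>T pt x' y' = pt (x \<otimes> x') (y' \<otimes> y)"
 using TD.pt_mult[of x y x' y'] by simp

lemma pt_1: "\<one>\<^sub>T = pt \<one> \<one>" using TD.T_one by simp

lemma pt_add_r: "x .: D ==> y .: D ==> y' .: D ==> pt x (y \<oplus> y') = pt x y \<oplus>\<^sub>T pt x y'"
 using TD.pt_add_right[of x y y'] by simp

lemma pt_hom_r: "x .: D ==> (%y. pt x y) : mod_hom K D T"
 by (rule mod_homI) (use TD.pt_add_right TD.pt_smult_right in auto)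

lemma pt_zero_r: "x .: D ==> pt x \<zero> = \<zero>\<^sub>T"
 using mod_hom_zero[OF FD.module_axioms TD.TM.module_axioms pt_hom_r] by blast

lemma pt_zero_l: "x .: D ==> pt \<zero> x = \<zero>\<^sub>T"
 using TD.pt_zero_left[of x] by simp

lemma T_induct [consumes 1, case_names zero step]:
 assumes "x .: T" "P \<zero>\<^sub>T"
  and "!!a b x. a .: D ==> b .: D ==> x .: T ==> P x ==> P (pt a b \<oplus>\<^sub>T x)"
 shows "P x"
 using assms(1) by (rule TD.tensor_induct) (use assms in auto)

abbreviation "sl == sorted_list_of_multiset"

definition X where "X w = iota (LB.xw w)"
definition e where "e M = pt \<one> (X (sl M))"
definition E where "E = (%d. pt d \<one>) ` car D"

lemma X_closed [simp]: "w : lists {..<n} ==> X w .: D"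
 unfolding X_def by (rule FD.iotaD(1)) (rule LB.xw_closed)

lemma sl_lists: "set_mset M <= {..<n} ==> sl M : lists {..<n}"
 by auto

lemma T_pt_neg: "d .: D ==> x .: D ==> \<ominus>\<^sub>T pt d x = pt (\<ominus> d) x"
proof -
 assume d: "d .: D" "x .: D"
 have "pt (\<ominus> d) x \<oplus>\<^sub>T pt d x = pt (\<ominus> d \<oplus> d) x"
  using d by (subst TD.pt_add_left) auto
 also have "... = \<zero>\<^sub>T" using d by (simp add: FD.M.l_neg pt_zero_l)
 finally show ?thesis using d by (simp add: TD.TM.M.minus_equality)
qed

sublocale MO: monomials T n E e
proof (intro monomials.intro monomials_axioms.intro TD.TA.A.ring_axioms)
 show "E <= car T" by (auto simp: E_def)
 show "\<zero>\<^sub>T : E" unfolding E_def by (rule image_eqI[of _ _ "\<zero>"]) (simp_all add: pt_zero_l)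
 show "\<one>\<^sub>T : E" unfolding E_def by (rule image_eqI[of _ _ "\<one>"]) (simp_all add: pt_1)
 fix c assume "c : E"
 then obtain x where x: "x .: D" "c = pt x \<one>" by (auto simp: E_def)
 show "\<ominus>\<^sub>T c : E" using x by (auto simp: T_pt_neg E_def)
 { fix d assume "d : E"
  then obtain y where y: "y .: D" "d = pt y \<one>" by (auto simp: E_def)
  have "c \<oplus>\<^sub>T d = pt (x \<oplus> y) \<one>" using x y TD.pt_add_left[of x y "\<one>"] by simp
  thus "c \<oplus>\<^sub>T d : E" using x y by (auto simp: E_def)
  have "c \<otimes>\<^sub>T d = pt (x \<otimes> y) \<one>" using x y by (simp add: pt_m)
  thus "c \<otimes>\<^sub>T d : E" using x y by (auto simp: E_def) }
 { assume "c ~= \<zero>\<^sub>T"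
  hence nz: "x ~= \<zero>" using x pt_zero_l by auto
  thus "EX d:E. d \<otimes>\<^sub>T c = \<one>\<^sub>T & c \<otimes>\<^sub>T d = \<one>\<^sub>T"
   using x by (intro bexI[of _ "pt (inv x) \<one>"]) (auto simp: E_def pt_m pt_1) }
 fix M assume "set_mset M <= {..<n}"
 hence M: "X (sl M) .: D" by (intro X_closed sl_lists)
 have "e M \<otimes>\<^sub>T c = c \<otimes>\<^sub>T e M" using M x by (simp add: e_def pt_m)
 thus "EX d:E. e M \<otimes>\<^sub>T c = d \<otimes>\<^sub>T e M" using \<open>c : E\<close> by blast
next
 fix M assume "set_mset M <= {..<n}"
 hence M: "X (sl M) .: D" by (intro X_closed sl_lists)
 thus "e M .: T" by (simp add: e_def)
qed

lemma S_lists: "M : MO.S ==> sl M : lists {..<n}"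
 by (auto simp: MO.S_def)

abbreviation "uspan A == {u : car U. rt u : MO.espan A}"

text \<open>Pulling the span back to \<open>U\<close> makes the spanning statements about
  \<open>low\<close> and about ordered monomials available in \<open>T\<close>.\<close>

lemma espan_submodule:
 assumes A: "A <= MO.S"
 shows "submodule (uspan A) K U"
proof (rule LB.UU.submoduleI)
 \<comment> \<open>A scalar in the right factor is moved to the left one, where it is a coefficient
   in \<open>E\<close>.\<close>
 have m: "pt \<one> (c \<odot> x) = pt (c \<odot> \<one>) \<one> \<otimes>\<^sub>T pt \<one> x" if "c .: K" "x .: D" for c x
  using that TD.pt_smult_left[of c "\<one>" x] TD.pt_smult_right[of c "\<one>" x] by (simp add: pt_m)
 have sm: "pt \<one> (c \<odot> x) : MO.espan A" if "c .: K" "x .: D" "pt \<one> x : MO.espan A" for c x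
  unfolding m[OF that(1,2)] by (rule MO.espan_smult[OF that(3) _ A]) (use that in "auto simp: E_def")
 show "\<zero>\<^sub>U : uspan A"
  by (simp add: FD.iota_zero pt_zero_r MO.espan.zero)
 fix u assume u: "u : uspan A"
 { fix c assume "c .: K"
  thus "c \<odot>\<^sub>U u : uspan A"
   using u sm FD.iotaD by auto }
 from this[of "\<ominus>\<^sub>K \<one>\<^sub>K"] u show "\<ominus>\<^sub>U u : uspan A"
  by (simp add: LB.UU.smult_l_minus)
 fix v assume "v : uspan A"
 thus "u \<oplus>\<^sub>U v : uspan A"
  using u by (auto simp: FD.iotaD pt_add_r intro: MO.espan_add[OF _ _ A])
qed auto

lemma e_single: "M : A ==> A <= MO.S ==> e M : MO.espan A"
 using MO.espan_single[OF MO.E_one, of M A] MO.eS[of M] by auto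

lemma low_espan:
 assumes "u : LB.low (size M)"
 shows "rt u : MO.espan (MO.below M)"
proof -
 have "LB.low (size M) <= uspan (MO.below M)"
  unfolding LB.low_def
 proof (rule submodule_span_minimal[OF espan_submodule[OF MO.below_S]], rule image_subsetI)
  fix w assume "w : {w : lists {..<n}. sorted w & length w < size M}"
  hence w: "w : lists {..<n}" "sorted w" "length w < size M" by auto
  have "mset w : MO.below M" using w by (auto simp: MO.below_def MO.S_def prec_def)
  hence "e (mset w) : MO.espan (MO.below M)" by (rule e_single[OF _ MO.below_S])
  moreover have "e (mset w) = rt (LB.xw w)"
   using w by (simp add: e_def X_def sorted_list_of_multiset_mset sorted_sort_id)
  ultimately show "LB.xw w : uspan (MO.below M)"
   using LB.xw_closed[OF w(1)] by simp
 qed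
 thus ?thesis using assms by auto
qed

text \<open>The functional \<open>h\<close> exists on \<open>U\<close> only. Its kernel, embedded in
  \<open>D\<close>, meets the line through \<open>X s\<close> in 0, so there is a linear projection
  \<open>p\<close> of \<open>D\<close> onto this line that kills the kernel, and \<open>psi\<close>
  is induced by \<open>a \<otimes> b \<mapsto> a p(b)\<close>. The values \<open>a X s\<close> are
  as good as \<open>a\<close>, since \<open>X s\<close> is nonzero.\<close>

lemma coefficient:
 assumes sl: "s : lists {..<n}" "sorted s"
 obtains psi where "psi : mod_hom K T D" "X s ~= \<zero>"
  "!!a. a .: D ==> psi (pt a (X s)) = a \<otimes> X s"
  "!!a w. a .: D ==> w : lists {..<n} ==> sorted w ==> w ~= s ==> psi (pt a (X w)) = \<zero>"
proof -
 obtain h where h: "h : mod_hom K U (self_module K)"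
  "!!w. w : lists {..<n} ==> sorted w ==> h (LB.xw w) = (if w = s then \<one>\<^sub>K else \<zero>\<^sub>K)"
  using LB.pbw_functional by blast
 note hD = mod_homD[OF h(1), simplified]
 have h0: "h \<zero>\<^sub>U = \<zero>\<^sub>K" using mod_hom_zero[OF LB.UU.module_axioms LB.R.module_self_module h(1)] by simp
 have xs: "LB.xw s .: U" by (rule LB.xw_closed[OF sl(1)])
 have "h (LB.xw s) = \<one>\<^sub>K" using h(2) sl by simp
 hence "LB.xw s ~= \<zero>\<^sub>U" using h0 LB.R.one_not_zero by metis
 hence Xnz: "X s ~= \<zero>" using xs by (simp add: X_def FD.iota_nz)
 let ?V = "(%c. c \<odot> X s) ` car K" and ?W = "iota ` {u : car U. h u = \<zero>\<^sub>K}"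
 have Xc: "X s .: D" by (rule X_closed[OF sl(1)])
 have V: "left_subspace D FD.scal ?V" unfolding left_subspace_def
 proof (intro conjI ballI)
  show "?V <= car D" using Xc by auto
  show "\<zero> : ?V" using Xc by (intro image_eqI[of _ _ "\<zero>\<^sub>K"]) auto
  fix x assume "x : ?V" then obtain c where c: "c .: K" "x = c \<odot> X s" by auto
  { fix y assume "y : ?V" then obtain d where d: "d .: K" "y = d \<odot> X s" by auto
   show "x \<oplus> y : ?V" using c d Xc by (intro image_eqI[of _ _ "c \<oplus>\<^sub>K d"]) (auto simp: FD.smult_l_distr) }
  fix y assume "y : FD.scal" then obtain d where d: "d .: K" "y = d \<odot> \<one>" by (auto simp: FD.scal_def)
  show "y \<otimes> x : ?V" using c d Xc by (intro image_eqI[of _ _ "d \<otimes>\<^sub>K c"]) (auto simp: FD.scal_mult FD.smult_assoc1)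
 qed
 have W: "left_subspace D FD.scal ?W" unfolding left_subspace_def
 proof (intro conjI ballI)
  show "?W <= car D" using FD.iotaD by auto
  show "\<zero> : ?W" using h0 FD.iota_zero by (intro image_eqI[of _ _ "\<zero>\<^sub>U"]) auto
  fix x assume "x : ?W" then obtain u where u: "u .: U" "h u = \<zero>\<^sub>K" "x = iota u" by auto
  { fix y assume "y : ?W" then obtain v where v: "v .: U" "h v = \<zero>\<^sub>K" "y = iota v" by auto
   show "x \<oplus> y : ?W" using u v by (intro image_eqI[of _ _ "u \<oplus>\<^sub>U v"]) (auto simp: FD.iotaD hD) }
  fix y assume "y : FD.scal" then obtain d where d: "d .: K" "y = d \<odot> \<one>" by (auto simp: FD.scal_def)
  show "y \<otimes> x : ?W" using u d by (intro image_eqI[of _ _ "d \<odot>\<^sub>U u"]) (auto simp: FD.scal_mult FD.iotaD hD)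
 qed
 have VW: "?V \<inter> ?W = {\<zero>}"
 proof (intro equalityI subsetI)
  fix x assume "x : ?V \<inter> ?W"
  then obtain c u where c: "c .: K" "x = c \<odot> X s" "u .: U" "h u = \<zero>\<^sub>K" "x = iota u" by blast
  have "iota (c \<odot>\<^sub>U LB.xw s) = iota u" using c xs by (simp add: FD.iotaD X_def)
  hence "c \<odot>\<^sub>U LB.xw s = u" using inj_onD[OF FD.iota_inj] c xs by simp
  hence "c = \<zero>\<^sub>K" using hD(3)[OF c(1) xs] c(1,4) \<open>h (LB.xw s) = \<one>\<^sub>K\<close> by simp
  thus "x : {\<zero>}" using c Xc by simp
 next
  fix x assume "x : {\<zero>}"
  thus "x : ?V \<inter> ?W" using left_subspaceD(2)[OF V] left_subspaceD(2)[OF W] by blast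
 qed
 obtain p where p: "!!x. x .: D ==> p x : ?V"
  "!!x y. x .: D ==> y .: D ==> p (x \<oplus> y) = p x \<oplus> p y"
  "!!c x. c : FD.scal ==> x .: D ==> p (c \<otimes> x) = c \<otimes> p x"
  "!!v. v : ?V ==> p v = v" "!!w. w : ?W ==> p w = \<zero>"
  by (rule FD.A.projection_exists[OF FD.div_subring_scal V W VW]) blast
 have pc: "p x .: D" if "x .: D" for x using p(1)[OF that] left_subspaceD(1)[OF V] by blast
 have ps: "p (c \<odot> x) = c \<odot> p x" if "c .: K" "x .: D" for c x
  using p(3)[of "c \<odot> \<one>" x] that pc by (simp add: FD.scal_def FD.scal_mult)
 have bl: "bilin K D Dop D (%a b. a \<otimes> p b)"
  unfolding bilin_def
  by (auto intro!: mod_homI simp: p(2) pc ps FD.A.l_distr FD.A.r_distr FD.smult_mult_left[symmetric] FD.smult_mult_right[symmetric])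
 obtain psi where psi: "psi : mod_hom K T D" "!!a b. a .: D ==> b .: D ==> psi (pt a b) = a \<otimes> p b"
  using TD.tensor_lift[OF FD.module_axioms bl] by auto
 show thesis
 proof (rule that[OF psi(1) Xnz])
  fix a assume a: "a .: D"
  have "X s = \<one>\<^sub>K \<odot> X s" using Xc by simp
  hence "X s : ?V" by blast
  thus "psi (pt a (X s)) = a \<otimes> X s" using psi(2) a Xc p(4) by simp
  fix w assume w: "w : lists {..<n}" "sorted w" "w ~= s"
  have "X w : ?W" unfolding X_def using h(2)[OF w(1,2)] w LB.xw_closed[OF w(1)] by auto
  thus "psi (pt a (X w)) = \<zero>" using psi(2)[OF a X_closed[OF w(1)]] p(5) a by simp
 qed
qed

lemma T_one_nz: "\<one>\<^sub>T ~= \<zero>\<^sub>T"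
proof
 assume 0: "\<one>\<^sub>T = \<zero>\<^sub>T"
 obtain psi where psi: "psi : mod_hom K T D" "X [] ~= \<zero>" "!!a. a .: D ==> psi (pt a (X [])) = a \<otimes> X []"
  by (rule coefficient[of "[]"]) auto
 have X1: "X [] = \<one>" by (simp add: X_def LB.xw_def LB.uword_Nil FD.iotaD)
 have "psi \<zero>\<^sub>T = \<zero>" by (rule mod_hom_zero[OF TD.TM.module_axioms FD.module_axioms psi(1)])
 thus False using psi(3)[of "\<one>"] 0 FD.one_nonzero[symmetric] by (simp add: X1 pt_1 del: FD.one_nonzero)
qed

sublocale FM: filtered_monomials T n E e
proof
 fix M N assume M: "M : MO.S" and N: "N : MO.S"
 let ?m = "sl M" and ?n = "sl N"
 let ?s = "sl (M + N)"
 \<comment> \<open>The right factor is multiplied in reverse order, so the product of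
   \<open>e M\<close> and \<open>e N\<close> belongs to the word \<open>?n @ ?m\<close>; sorting it
   gives \<open>?s\<close> up to shorter words.\<close>
 have l: "?m : lists {..<n}" "?n : lists {..<n}" "?n @ ?m : lists {..<n}" "?s : lists {..<n}"
  using S_lists[OF M] S_lists[OF N] S_lists[OF MO.S_add[OF M N]] by auto
 have s: "sort (?n @ ?m) = ?s"
  by (metis mset_append mset_sorted_list_of_multiset sorted_list_of_multiset_mset union_commute)
 have len: "length (?n @ ?m) = size (M + N)" by (metis add.commute mset_append mset_sorted_list_of_multiset size_mset)
 define d where "d = LB.xw (?n @ ?m) \<ominus>\<^sub>U LB.xw ?s"
 have d: "d : LB.low (size (M + N))" using LB.straighten[OF l(3)] unfolding s len d_def .
 have xc: "LB.xw (?n @ ?m) .: U" "LB.xw ?s .: U" "d .: U"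
  using LB.xw_closed l LB.low_closed[OF d] by blast+
 have "LB.xw (?n @ ?m) = LB.xw ?s \<oplus>\<^sub>U d"
  unfolding d_def using xc by (simp add: a_minus_def LB.UU.M.a_lcomm[of "LB.xw ?s" "LB.xw (?n @ ?m)"] LB.UU.M.r_neg)
 hence "iota (LB.xw ?n) \<otimes> iota (LB.xw ?m) = iota (LB.xw ?s) \<oplus> iota d"
  using LB.xw_append[OF l(2,1)] FD.iotaD(2,3) xc LB.xw_closed l by metis
 hence "e M \<otimes>\<^sub>T e N = pt \<one> (iota (LB.xw ?s) \<oplus> iota d)"
  using X_closed[OF l(1)] X_closed[OF l(2)] by (simp add: e_def pt_m X_def)
 also have "... = e (M + N) \<oplus>\<^sub>T rt d"
  using xc by (simp add: pt_add_r e_def X_def FD.iotaD(1))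
 finally have "e M \<otimes>\<^sub>T e N = \<one>\<^sub>T \<otimes>\<^sub>T e (M + N) \<oplus>\<^sub>T rt d"
  using MO.eS[OF MO.S_add[OF M N]] by simp
 moreover note T_one_nz
 ultimately show "EX c:E. c ~= \<zero>\<^sub>T & (EX l:MO.espan (MO.below (M + N)). e M \<otimes>\<^sub>T e N = c \<otimes>\<^sub>T e (M + N) \<oplus>\<^sub>T l)"
  using MO.E_one low_espan[OF d] by blast
qed

section \<open>Denominators and the Noetherian domain property of the tensor product\<close>

lemma espan_S_mult: "x : MO.espan MO.S ==> y : MO.espan MO.S ==> x \<otimes>\<^sub>T y : MO.espan MO.S"
 by (rule MO.espan_mult[of _ MO.S _ MO.S])
 (auto intro: MO.espan_mono[OF FM.e_mult_upto MO.upto_S] MO.S_add)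

lemma pt_espan: "a .: D ==> u .: U ==> pt a (iota u) : MO.espan MO.S"
proof -
 assume a: "a .: D" and u: "u .: U"
 have "car U <= uspan MO.S"
 proof (rule LB.span_monomials[OF espan_submodule[OF subset_refl]])
  fix w assume w: "w : lists {..<n}" "sorted w"
  have "e (mset w) = rt (LB.xw w)"
   using w by (simp add: e_def X_def sorted_list_of_multiset_mset sorted_sort_id)
  moreover have "mset w : MO.S" using w by (auto simp: MO.S_def)
  ultimately show "LB.xw w : uspan MO.S"
   using LB.xw_closed[OF w(1)] e_single[OF _ subset_refl] by (metis (no_types, lifting) mem_Collect_eq)
 qed
 hence "rt u : MO.espan MO.S" using u by blast
 hence "pt a \<one> \<otimes>\<^sub>T rt u : MO.espan MO.S"
  by (rule MO.espan_smult) (use a in "auto simp: E_def")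
 thus ?thesis using a u FD.iotaD(1) by (simp add: pt_m)
qed

text \<open>Left multiplication by \<open>1 \<otimes> u\<close> multiplies right factors by
  \<open>u\<close> from the right. They are therefore cleared by \<open>right_den\<close>, one
  summand after the other, and the denominators already used keep the earlier summands in the
  span.\<close>

lemma left_denominator:
 "x .: T ==> EX u:car U. u ~= \<zero>\<^sub>U & rt u \<otimes>\<^sub>T x : MO.espan MO.S"
proof (induction x rule: T_induct)
 case zero
 have "\<one>\<^sub>U ~= \<zero>\<^sub>U" using FD.iota_nz[of "\<one>\<^sub>U"] FD.iotaD(4) by auto
 moreover have "rt \<one>\<^sub>U \<otimes>\<^sub>T \<zero>\<^sub>T = \<zero>\<^sub>T" by (rule TD.TA.r_null) (simp add: FD.iotaD)
 ultimately show ?case using MO.espan.zero by (metis LB.UU.A.one_closed)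
next
 case (step a b x)
 then obtain u where u: "u .: U" "u ~= \<zero>\<^sub>U" "rt u \<otimes>\<^sub>T x : MO.espan MO.S" by blast
 have bu: "b \<otimes> iota u .: D" using step u FD.iotaD(1) by simp
 obtain v w where v: "v .: U" "v ~= \<zero>\<^sub>U" "w .: U" "(b \<otimes> iota u) \<otimes> iota v = iota w"
  using FD.right_den[OF bu] .
 have c: "iota u .: D" "iota v .: D" using u v FD.iotaD(1) by auto
 have s: "rt (u \<otimes>\<^sub>U v) = rt v \<otimes>\<^sub>T rt u"
  using u v c by (simp add: FD.iotaD pt_m)
 have "rt (u \<otimes>\<^sub>U v) \<otimes>\<^sub>T (pt a b \<oplus>\<^sub>T x) =
  pt a (iota w) \<oplus>\<^sub>T rt v \<otimes>\<^sub>T (rt u \<otimes>\<^sub>T x)"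
 proof -
  have "rt v \<otimes>\<^sub>T (rt u \<otimes>\<^sub>T pt a b) = pt a (iota w)"
   using step(1,2) c by (simp add: pt_m v(4))
  thus ?thesis unfolding s using step(1-3) c by (simp add: TD.TA.A.r_distr TD.TA.A.m_assoc)
 qed
 moreover have "pt a (iota w) : MO.espan MO.S" using step v by (intro pt_espan)
 moreover have "rt v \<otimes>\<^sub>T (rt u \<otimes>\<^sub>T x) : MO.espan MO.S"
  by (rule espan_S_mult[OF pt_espan[OF _ v(1)] u(3)]) simp
 ultimately have "rt (u \<otimes>\<^sub>U v) \<otimes>\<^sub>T (pt a b \<oplus>\<^sub>T x) : MO.espan MO.S"
  using MO.espan_add by simp
 moreover have "u \<otimes>\<^sub>U v ~= \<zero>\<^sub>U" "u \<otimes>\<^sub>U v .: U" using u v FD.U_nz_mult by blast+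
 ultimately show ?case by blast
qed

lemma right_denominator:
 "x .: T ==> EX u:car U. u ~= \<zero>\<^sub>U & x \<otimes>\<^sub>T rt u : MO.espan MO.S"
proof (induction x rule: T_induct)
 case zero
 have "\<one>\<^sub>U ~= \<zero>\<^sub>U" using FD.iota_nz[of "\<one>\<^sub>U"] FD.iotaD(4) by auto
 moreover have "\<zero>\<^sub>T \<otimes>\<^sub>T rt \<one>\<^sub>U = \<zero>\<^sub>T" by (rule TD.TA.l_null) (simp add: FD.iotaD)
 ultimately show ?case using MO.espan.zero by (metis LB.UU.A.one_closed)
next
 case (step a b x)
 then obtain u where u: "u .: U" "u ~= \<zero>\<^sub>U" "x \<otimes>\<^sub>T rt u : MO.espan MO.S" by blast
 have bu: "iota u \<otimes> b .: D" using step u FD.iotaD(1) by simp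
 obtain v w where v: "v .: U" "v ~= \<zero>\<^sub>U" "w .: U" "iota v \<otimes> (iota u \<otimes> b) = iota w"
  using FD.left_den[OF bu] .
 have c: "iota u .: D" "iota v .: D" using u v FD.iotaD(1) by auto
 have s: "rt (v \<otimes>\<^sub>U u) = rt u \<otimes>\<^sub>T rt v"
  using u v c by (simp add: FD.iotaD pt_m)
 have "(pt a b \<oplus>\<^sub>T x) \<otimes>\<^sub>T rt (v \<otimes>\<^sub>U u) =
  pt a (iota w) \<oplus>\<^sub>T (x \<otimes>\<^sub>T rt u) \<otimes>\<^sub>T rt v"
 proof -
  have "pt a b \<otimes>\<^sub>T rt u \<otimes>\<^sub>T rt v = pt a (iota w)"
   using step(1,2) c by (simp add: pt_m v(4))
  thus ?thesis unfolding s using step(1-3) c by (simp add: TD.TA.A.l_distr TD.TA.A.m_assoc[symmetric])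
 qed
 moreover have "pt a (iota w) : MO.espan MO.S" using step v by (intro pt_espan)
 moreover have "(x \<otimes>\<^sub>T rt u) \<otimes>\<^sub>T rt v : MO.espan MO.S"
  by (rule espan_S_mult[OF u(3) pt_espan[OF _ v(1)]]) simp
 ultimately have "(pt a b \<oplus>\<^sub>T x) \<otimes>\<^sub>T rt (v \<otimes>\<^sub>U u) : MO.espan MO.S"
  using MO.espan_add by simp
 moreover have "v \<otimes>\<^sub>U u ~= \<zero>\<^sub>U" "v \<otimes>\<^sub>U u .: U" using u v FD.U_nz_mult by blast+
 ultimately show ?case by blast
qed

lemma pt_unit:
 assumes "u .: U" "u ~= \<zero>\<^sub>U"
 shows "pt \<one> (inv (iota u)) .: T" "rt u .: T"
  "pt \<one> (inv (iota u)) \<otimes>\<^sub>T rt u = \<one>\<^sub>T"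
  "rt u \<otimes>\<^sub>T pt \<one> (inv (iota u)) = \<one>\<^sub>T"
 using assms FD.iotaD(1) by (simp_all add: pt_m pt_1 FD.iota_nz)

lemma acc_left: "ACC (%I. left_ideal I T)"
proof (rule FM.acc_left_ideals)
 fix x assume "x .: T"
 then obtain u where "u .: U" "u ~= \<zero>\<^sub>U" "rt u \<otimes>\<^sub>T x : MO.espan MO.S"
  using left_denominator by blast
 thus "EX s:car T. EX s':car T. s' \<otimes>\<^sub>T s = \<one>\<^sub>T & s \<otimes>\<^sub>T x : MO.espan MO.S"
  using pt_unit by blast
qed

text \<open>The map \<open>psi\<close> belonging to the monomial \<open>gamma\<close> kills every
  other monomial, so it kills \<open>l\<close> and leaves \<open>a X\<close> for the coefficient
  \<open>a\<close>, with \<open>X\<close> nonzero in a division algebra.\<close>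

lemma leading_independent:
 assumes g: "gamma : MO.S" "c : E" "l : MO.espan (MO.below gamma)" "c \<otimes>\<^sub>T e gamma \<oplus>\<^sub>T l = \<zero>\<^sub>T"
 shows "c = \<zero>\<^sub>T"
proof -
 let ?s = "sl gamma"
 have s: "?s : lists {..<n}" by (rule S_lists[OF g(1)])
 obtain psi where psi: "psi : mod_hom K T D" "X ?s ~= \<zero>"
  "!!a. a .: D ==> psi (pt a (X ?s)) = a \<otimes> X ?s"
  "!!a w. a .: D ==> w : lists {..<n} ==> sorted w ==> w ~= ?s ==> psi (pt a (X w)) = \<zero>"
  using coefficient[OF s] by auto
 have psi0: "psi \<zero>\<^sub>T = \<zero>" by (rule mod_hom_zero[OF TD.TM.module_axioms FD.module_axioms psi(1)])
 have "psi l = \<zero>" using g(3)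
 proof (induction rule: MO.espan.induct)
  case zero thus ?case by (rule psi0)
 next
  case (step d M x)
  obtain a where a: "a .: D" "d = pt a \<one>" using step by (auto simp: E_def)
  have M: "M : MO.S" "M ~= gamma" using step by (auto simp: MO.below_def prec_def)
  have ml: "sl M : lists {..<n}" by (rule S_lists[OF M(1)])
  have ne: "sl M ~= ?s" using M(2) by (metis mset_sorted_list_of_multiset)
  have "d \<otimes>\<^sub>T e M = pt a (X (sl M))" using a X_closed[OF ml] by (simp add: e_def pt_m)
  hence "psi (d \<otimes>\<^sub>T e M) = \<zero>" using psi(4)[OF a(1) ml _ ne] by simp
  thus ?case using step MO.espan_closed[OF step(3) MO.below_S] M by (simp add: mod_homD[OF psi(1)])
 qed
 moreover obtain a where a: "a .: D" "c = pt a \<one>" using g by (auto simp: E_def)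
 moreover have "c \<otimes>\<^sub>T e gamma = pt a (X ?s)" using a X_closed[OF s] by (simp add: e_def pt_m)
 ultimately have "a \<otimes> X ?s = \<zero>"
  using g(4) mod_homD(2)[OF psi(1), of "pt a (X ?s)" l] MO.espan_closed[OF g(3) MO.below_S] X_closed[OF s] psi(3)[OF a(1)] psi0
  by simp
 thus ?thesis using FD.no_zero_div[OF a(1) X_closed[OF s]] psi(2) a pt_zero_l by simp
qed

text \<open>A unit on the left of \<open>x\<close> and one on the right of \<open>y\<close> move
  both into the span of the monomials without affecting whether the product vanishes.\<close>

lemma T_domain:
 assumes x: "x .: T" "x ~= \<zero>\<^sub>T" and y: "y .: T" "y ~= \<zero>\<^sub>T"
 shows "x \<otimes>\<^sub>T y ~= \<zero>\<^sub>T"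
proof
 assume 0: "x \<otimes>\<^sub>T y = \<zero>\<^sub>T"
 obtain u where u: "u .: U" "u ~= \<zero>\<^sub>U" "rt u \<otimes>\<^sub>T x : MO.espan MO.S" using left_denominator[OF x(1)] by blast
 obtain v where v: "v .: U" "v ~= \<zero>\<^sub>U" "y \<otimes>\<^sub>T rt v : MO.espan MO.S" using right_denominator[OF y(1)] by blast
 note pu = pt_unit[OF u(1,2)] and pv = pt_unit[OF v(1,2)]
 let ?a = "rt u \<otimes>\<^sub>T x" and ?b = "y \<otimes>\<^sub>T rt v"
 have "pt \<one> (inv (iota u)) \<otimes>\<^sub>T ?a = x" using pu x by (simp add: TD.TA.A.m_assoc[symmetric])
 hence a: "?a ~= \<zero>\<^sub>T" using pu x by auto
 have "?b \<otimes>\<^sub>T pt \<one> (inv (iota v)) = y" using pv y by (simp add: TD.TA.A.m_assoc)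
 hence b: "?b ~= \<zero>\<^sub>T" using pv y by auto
 have "?a \<otimes>\<^sub>T ?b = rt u \<otimes>\<^sub>T (x \<otimes>\<^sub>T y) \<otimes>\<^sub>T rt v"
  using pu pv x y by (simp add: TD.TA.A.m_assoc)
 also have "... = \<zero>\<^sub>T" unfolding 0 using pu pv by simp
 finally have "?a \<otimes>\<^sub>T ?b = \<zero>\<^sub>T" .
 moreover have "?a \<otimes>\<^sub>T ?b ~= \<zero>\<^sub>T"
  by (rule FM.espan_no_zero_divisors[OF _ T_one_nz u(3) a v(3) b]) (rule leading_independent)
 ultimately show False by simp
qed

text \<open>Exchanging the factors reverses products because exactly one factor is opposite. It
  carries right ideals to left ideals.\<close>

lemma swap_exists:
 obtains sigma where "sigma : mod_hom K T T" "!!x. x .: T ==> sigma (sigma x) = x"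
  "!!x y. x .: T ==> y .: T ==> sigma (x \<otimes>\<^sub>T y) = sigma y \<otimes>\<^sub>T sigma x"
proof -
 have bl: "bilin K D Dop T (%a b. pt b a)"
  unfolding bilin_def using TD.pt_add_left TD.pt_add_right TD.pt_smult_left TD.pt_smult_right
  by (auto intro!: mod_homI)
 obtain sigma where sigma: "sigma : mod_hom K T T" "!!a b. a .: D ==> b .: D ==> sigma (pt a b) = pt b a"
  using TD.tensor_lift[OF TD.TM.module_axioms bl] by auto
 note sigmaD = mod_homD[OF sigma(1)]
 have "sigma (sigma x) = x" if "x .: T" for x
  by (rule TD.mod_hom_tensor_eqI[OF TD.TM.module_axioms _ _ _ that, of "%x. sigma (sigma x)" "%x. x"])
  (auto intro!: mod_homI simp: sigmaD sigma(2))
 moreover have "sigma (x \<otimes>\<^sub>T y) = sigma y \<otimes>\<^sub>T sigma x" if "x .: T" "y .: T" for x y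
  using TD.mod_hom_mult_eqI[OF assoc_algebra_opposite[OF TD.TA.assoc_algebra_axioms], of sigma x y] that
  by (auto simp: mod_hom_def sigmaD sigma(2) pt_m)
 ultimately show thesis using that sigma(1) by blast
qed

lemma acc_right: "ACC (%I. right_ideal I T)"
 unfolding ascending_chain_condition_def
proof (intro allI impI)
 fix C assume "(ALL n::nat. right_ideal (C n) T) & (ALL n. C n <= C (Suc n))"
 hence C: "!!i. right_ideal (C i) T" and inc: "!!i. C i <= C (Suc i)" by auto
 obtain sigma where sigma: "sigma : mod_hom K T T" "!!x. x .: T ==> sigma (sigma x) = x"
  "!!x y. x .: T ==> y .: T ==> sigma (x \<otimes>\<^sub>T y) = sigma y \<otimes>\<^sub>T sigma x"
  by (rule swap_exists) blast
 note sigmaD = mod_homD[OF sigma(1)]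
 define B where "B i = {x : car T. sigma x : C i}" for i
 have sub: "subgroup (C i) (add_monoid T)" "C i <= car T" for i
  using C[of i] additive_subgroup.a_subset by (auto simp: right_ideal_def additive_subgroup_def)
 have "left_ideal (B i) T" for i
 proof -
  have neg: "sigma (\<ominus>\<^sub>T x) = \<ominus>\<^sub>T sigma x" if "x .: T" for x
   using that mod_hom_minus[OF TD.TM.module_axioms TD.TM.module_axioms sigma(1), of "\<zero>\<^sub>T" x]
    mod_hom_zero[OF TD.TM.module_axioms TD.TM.module_axioms sigma(1)] by (simp add: a_minus_def sigmaD)
  have "subgroup (B i) (add_monoid T)"
   by (rule TD.TM.M.add.subgroupI)
   (auto simp: B_def sigmaD neg mod_hom_zero[OF TD.TM.module_axioms TD.TM.module_axioms sigma(1)]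
     subgroup.one_closed[OF sub(1), simplified] subgroup.m_closed[OF sub(1), simplified]
     subgroup.m_inv_closed[OF sub(1), folded a_inv_def] intro!: exI[of _ "\<zero>\<^sub>T"])
  moreover have "a \<otimes>\<^sub>T x : B i" if "a .: T" "x : B i" for a x
   using that C[of i] by (auto simp: B_def sigma(3) right_ideal_def sigmaD)
  ultimately show ?thesis by (auto simp: left_ideal_def additive_subgroup_def)
 qed
 moreover have "B i <= B (Suc i)" for i using inc[of i] by (auto simp: B_def)
 ultimately obtain N where N: "!!i. i >= N ==> B i = B N"
  using acc_left unfolding ascending_chain_condition_def by (metis (no_types, lifting))
 have CB: "C i = sigma ` B i" for i
 proof
  show "C i <= sigma ` B i"
  proof
   fix x assume "x : C i"
   hence "x .: T" using sub(2) by blast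
   hence "x .: T" "sigma x : B i" using \<open>x : C i\<close> sigma(2) by (simp_all add: B_def sigmaD)
   thus "x : sigma ` B i" using sigma(2) by (metis image_eqI)
  qed
 qed (auto simp: B_def)
 show "EX N. ALL n>=N. C n = C N" using N CB by metis
qed

theorem noeth_domain_tensor: "noeth_domain T"
 unfolding noeth_domain_def
 using TD.TA.A.ring_axioms T_one_nz T_domain acc_left acc_right by blast

theorem tensor_iso: "alg_iso K T (tensor_product K D D) ~= {}"
proof -
 obtain s where s: "s : alg_hom K U (Opp U)" "!!u. u .: U ==> s (s u) = u"
  using LB.enveloping_antiautomorphism by blast
 obtain theta where "theta : alg_hom K D Dop" "!!x. x .: D ==> theta (theta x) = x"
  using FD.opposite_extension[OF s(1) s(2)] by metis
 thus ?thesis by (rule tensor_opposite_iso[OF FD.assoc_algebra_axioms])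
qed

text \<open>Division subalgebras \<open>E\<close> are separated by the left ideals annihilating the left \<open>E\<close>-linear maps \<open>D \<rightarrow> D\<close>,
 on which \<open>a \<otimes> b\<close> acts by \<open>f \<mapsto> (x \<mapsto> a f(b x))\<close>.\<close>
theorem acc_division_subalgebras: "ACC (division_subalgebra K D)"
 unfolding ascending_chain_condition_def
proof (intro allI impI)
 fix C assume "(ALL n::nat. division_subalgebra K D (C n)) & (ALL n. C n <= C (Suc n))"
 hence C: "!!i. division_subalgebra K D (C i)" and inc: "!!i. C i <= C (Suc i)" by auto
 have mono: "i <= j ==> C i <= C j" for i j by (rule lift_Suc_mono_le[of C]) (use inc in auto)
 define LM where "LM E = {f. f : car D \<rightarrow> car D &
  (ALL x:car D. ALL y:car D. f (x \<oplus> y) = f x \<oplus> f y) &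
  (ALL c:E. ALL x:car D. f (c \<otimes> x) = c \<otimes> f x)}" for E
 \<comment> \<open>\<open>psi f x z\<close> is the value at \<open>x\<close> of the map that results
   when \<open>z\<close> acts on \<open>f\<close>.\<close>
 define psi where "psi f x = TD.tensor_lift D (%a b. a \<otimes> f (b \<otimes> x))" for f x
 have CD: "div_subring D (C i)" "!!c x. c .: K ==> x : C i ==> c \<odot> x : C i" for i
  using C[of i] unfolding FD.division_subalgebra_iff by auto
 have psi: "psi f x : mod_hom K T D" "!!a b. a .: D ==> b .: D ==> psi f x (pt a b) = a \<otimes> f (b \<otimes> x)"
  if f: "f : LM (C i)" and x: "x .: D" for f i x
 proof -
  have fD: "y .: D ==> f y .: D" "y .: D ==> z .: D ==> f (y \<oplus> z) = f y \<oplus> f z"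
   "c : C i ==> y .: D ==> f (c \<otimes> y) = c \<otimes> f y" for c y z
   using f by (auto simp: LM_def)
  have fs: "f (c \<odot> y) = c \<odot> f y" if "c .: K" "y .: D" for c y
   using fD(3)[of "c \<odot> \<one>" y] CD(2)[OF that(1) div_subringD(3)[OF CD(1)]] that fD(1) by (simp add: FD.scal_mult)
  have bl: "bilin K D Dop D (%a b. a \<otimes> f (b \<otimes> x))"
   unfolding bilin_def using x
   by (auto intro!: mod_homI simp: fD(1,2) fs FD.A.l_distr FD.A.r_distr FD.smult_mult_left[symmetric] FD.smult_mult_right[symmetric])
  show "psi f x : mod_hom K T D" "!!a b. a .: D ==> b .: D ==> psi f x (pt a b) = a \<otimes> f (b \<otimes> x)"
   using TD.tensor_lift[OF FD.module_axioms bl] by (auto simp: psi_def)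
 qed
 define I where "I i = {z : car T. ALL f:LM (C i). ALL x:car D. psi f x z = \<zero>}" for i
 \<comment> \<open>Left multiplication by \<open>a \<otimes> b\<close> moves the point of evaluation
   from \<open>x\<close> to \<open>b x\<close>. Demanding annihilation at all points therefore makes
   \<open>I i\<close> a left ideal.\<close>
 have act: "psi f x (pt a b \<otimes>\<^sub>T z) = a \<otimes> psi f (b \<otimes> x) z"
  if f: "f : LM (C i)" and x: "x .: D" and ab: "a .: D" "b .: D" and z: "z .: T" for f i x a b z
  using z
 proof (induction z rule: T_induct)
  case zero
  show ?case using ab x mod_hom_zero[OF TD.TM.module_axioms FD.module_axioms psi(1)[OF f]] by simp
 next
  case (step a' b' z)
  have "f (b' \<otimes> b \<otimes> x) .: D" using f x ab step by (auto simp: LM_def)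
  thus ?case using step ab x
   by (simp add: TD.TA.A.r_distr mod_homD[OF psi(1)[OF f]] pt_m psi(2)[OF f] FD.A.r_distr FD.A.m_assoc)
 qed
 have "left_ideal (I i) T" for i
 proof -
  have z: "psi f x \<zero>\<^sub>T = \<zero>" if "f : LM (C i)" "x .: D" for f x
   by (rule mod_hom_zero[OF TD.TM.module_axioms FD.module_axioms psi(1)[OF that]])
  have neg: "psi f x (\<ominus>\<^sub>T y) = \<ominus> psi f x y" if "f : LM (C i)" "x .: D" "y .: T" for f x y
   using that mod_hom_minus[OF TD.TM.module_axioms FD.module_axioms psi(1)[OF that(1,2)], of "\<zero>\<^sub>T" y] z[OF that(1,2)]
    mod_homD(1)[OF psi(1)[OF that(1,2)]] by (simp add: a_minus_def)
  have "subgroup (I i) (add_monoid T)"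
   by (rule TD.TM.M.add.subgroupI) (auto simp: I_def z neg mod_homD[OF psi(1)] intro!: exI[of _ "\<zero>\<^sub>T"])
  moreover have "a \<otimes>\<^sub>T y : I i" if "a .: T" "y : I i" for a y
   using that(1)
  proof (induction a rule: T_induct)
   case zero
   thus ?case using that(2) z by (auto simp: I_def)
  next
   case (step a b x)
   thus ?case using that(2)
    by (auto simp: I_def TD.TA.A.l_distr mod_homD[OF psi(1)] act)
  qed
  ultimately show ?thesis by (auto simp: left_ideal_def additive_subgroup_def)
 qed
 \<comment> \<open>A larger subalgebra has fewer linear maps and hence a larger annihilator, so the
   ideals ascend with the chain.\<close>
 moreover have LMm: "LM (C (Suc i)) <= LM (C i)" for i using inc[of i] by (auto simp: LM_def)
 hence "I i <= I (Suc i)" for i using LMm[of i] by (auto simp: I_def)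
 ultimately obtain N where N: "!!i. i >= N ==> I i = I N"
  using acc_left unfolding ascending_chain_condition_def by (metis (no_types, lifting))
 have "C i <= C N" if "i >= N" for i
 proof (rule ccontr)
  assume "\<not> C i <= C N"
  then obtain y where y: "y : C i" "y ~: C N" by blast
  note CN = div_subringD[OF CD(1)[of N]]
  have yc: "y .: D" using div_subringD(1)[OF CD(1)] y by blast
  \<comment> \<open>This element measures how far \<open>f\<close> is from commuting with left
    multiplication by \<open>y\<close>; it annihilates all maps that are linear over
    \<open>C i\<close>.\<close>
  let ?z = "pt y \<one> \<ominus>\<^sub>T pt \<one> y"
  have zc: "pt y \<one> .: T" "pt \<one> y .: T" using yc by auto
  have ev: "psi f x ?z = y \<otimes> f x \<ominus> f (y \<otimes> x)" if f: "f : LM (C j)" and x: "x .: D" for f x j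
  proof -
   have "f (y \<otimes> x) .: D" using f x yc by (auto simp: LM_def)
   thus ?thesis
   using yc x mod_hom_minus[OF TD.TM.module_axioms FD.module_axioms psi(1)[OF f x] zc] by (simp add: psi(2)[OF f])
  qed
  have "?z : I i" unfolding I_def
  proof (intro CollectI conjI ballI)
   show "?z .: T" using zc by simp
   fix f x assume f: "f : LM (C i)" and x: "x .: D"
   hence "f (y \<otimes> x) = y \<otimes> f x" "f x .: D" using y by (auto simp: LM_def)
   thus "psi f x ?z = \<zero>" using ev[OF f x] yc by (simp add: a_minus_def FD.M.r_neg)
  qed
  hence zN: "?z : I N" using N[OF that] by simp
  \<comment> \<open>As \<open>y\<close> is outside \<open>C N\<close>, the lines \<open>C N\<close>
    and \<open>C N y\<close> meet in 0. A projection onto the first that kills the second is linear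
    over \<open>C N\<close>, yet sends 1 to 1 and \<open>y\<close> to 0, so \<open>?z\<close> does
    not annihilate it.\<close>
  let ?V = "C N" and ?W = "(%c. c \<otimes> y) ` C N"
  have V: "left_subspace D (C N) ?V" using CN by (auto simp: left_subspace_def)
  have W: "left_subspace D (C N) ?W" unfolding left_subspace_def
  proof (intro conjI ballI)
   show "?W <= car D" using CN yc by auto
   show "\<zero> : ?W" using CN yc by (intro image_eqI[of _ _ "\<zero>"]) auto
   fix a assume "a : ?W" then obtain c where c: "c : C N" "a = c \<otimes> y" by auto
   { fix b assume "b : ?W" then obtain d where d: "d : C N" "b = d \<otimes> y" by auto
    show "a \<oplus> b : ?W" using c d CN yc by (intro image_eqI[of _ _ "c \<oplus> d"]) (auto simp: FD.A.l_distr) }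
   fix d assume d: "d : C N"
   show "d \<otimes> a : ?W" using c d CN yc by (intro image_eqI[of _ _ "d \<otimes> c"]) (auto simp: FD.A.m_assoc)
  qed
  have VW: "?V \<inter> ?W = {\<zero>}"
  proof (intro equalityI subsetI)
   fix a assume "a : ?V \<inter> ?W"
   then obtain c where c: "a : C N" "c : C N" "a = c \<otimes> y" by blast
   show "a : {\<zero>}"
   proof (rule ccontr)
    assume "a ~: {\<zero>}"
    hence "c ~= \<zero>" using c yc by auto
    then obtain d where d: "d : C N" "d \<otimes> c = \<one>" using CN(7) c by blast
    have "d \<otimes> a = y" unfolding c(3) using d c(2) CN(1) yc by (simp add: FD.A.m_assoc[symmetric])
    thus False using CN(5)[OF d(1) c(1)] y by simp
   qed
  next
   fix a assume "a : {\<zero>}"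
   thus "a : ?V \<inter> ?W" using left_subspaceD(2)[OF V] left_subspaceD(2)[OF W] by blast
  qed
  obtain p where p: "!!x. x .: D ==> p x : ?V"
   "!!x y. x .: D ==> y .: D ==> p (x \<oplus> y) = p x \<oplus> p y"
   "!!c x. c : C N ==> x .: D ==> p (c \<otimes> x) = c \<otimes> p x"
   "!!v. v : ?V ==> p v = v" "!!w. w : ?W ==> p w = \<zero>"
   by (rule FD.A.projection_exists[OF CD(1) V W VW]) blast
  have pL: "p : LM (C N)" using p(1-3) CN(1) by (auto simp: LM_def)
  have "p \<one> = \<one>" by (rule p(4)[OF CN(3)])
  moreover have "y : ?W" using CN(3) yc by (intro image_eqI[of _ _ "\<one>"]) auto
  hence "p y = \<zero>" by (rule p(5))
  ultimately have "psi p \<one> ?z = y" using ev[OF pL] yc by (simp add: a_minus_def)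
  moreover have "psi p \<one> ?z = \<zero>" using zN pL by (simp add: I_def)
  ultimately show False using y(2) CN(2) by simp
 qed
 thus "EX N. ALL n>=N. C n = C N" using mono by blast
qed

end

section \<open>Finitely generated abelian groups\<close>

context comm_group begin

definition gprod :: "nat set => (nat => 'a) => (nat => int) => 'a" where
 "gprod I g k = (\<Otimes>i\<in>I. g i [^] k i)"

lemma gprod_closed [simp]: "(!!i. i : I ==> g i .: G) ==> gprod I g k .: G"
 unfolding gprod_def by (rule finprod_closed) auto

lemma gprod_cong: "(!!i. i : I ==> g i .: G) ==> (!!i. i : I ==> g i [^] k i = g' i [^] k' i) ==> gprod I g k = gprod I g' k'"
 unfolding gprod_def by (rule finprod_cong') (auto, metis int_pow_closed)

lemma gprod_add: "(!!i. i : I ==> g i .: G) ==> gprod I g (%i. k i + l i) = gprod I g k \<otimes> gprod I g l"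
proof -
 assume g: "!!i. i : I ==> g i .: G"
 have "gprod I g (%i. k i + l i) = (\<Otimes>i\<in>I. g i [^] k i \<otimes> g i [^] l i)"
  unfolding gprod_def by (rule finprod_cong') (auto simp: g int_pow_mult)
 thus ?thesis unfolding gprod_def using g by (simp add: finprod_multf)
qed

lemma gprod_zero: "(!!i. i : I ==> k i = 0) ==> gprod I g k = \<one>"
 unfolding gprod_def by (rule finprod_one_eqI) simp

lemma gprod_neg: "(!!i. i : I ==> g i .: G) ==> gprod I g (%i. - k i) = inv gprod I g k"
proof -
 assume g: "!!i. i : I ==> g i .: G"
 have "gprod I g (%i. - k i) \<otimes> gprod I g k = \<one>"
  using gprod_add[of I g "%i. - k i" k] g gprod_zero[of I "%i. 0" g] by simp
 thus ?thesis using g by (simp add: inv_equality)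
qed

lemma gprod_remove: "finite I ==> i : I ==> (!!i. i : I ==> g i .: G) ==> gprod I g k = g i [^] k i \<otimes> gprod (I - {i}) g k"
 unfolding gprod_def using finprod_insert[of "I - {i}" i "%i. g i [^] k i"] by (auto simp: insert_absorb)

lemma gprod_single: "finite I ==> i : I ==> (!!i. i : I ==> g i .: G) ==> gprod I g (%j. if j = i then a else 0) = g i [^] a"
 by (subst gprod_remove[of I i], simp_all, subst gprod_zero) auto

abbreviation "TT == torsion_part G"

lemma torsion_subset: "TT <= car G" by (auto simp: torsion_part_def)

lemma torsion_mult: "x : TT ==> y : TT ==> x \<otimes> y : TT"
proof -
 assume "x : TT" "y : TT"
 then obtain m n :: nat where m: "x .: G" "y .: G" "0 < m" "0 < n" "x [^] m = \<one>" "y [^] n = \<one>"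
  by (auto simp: torsion_part_def)
 have "(x \<otimes> y) [^] (m * n) = (x [^] m) [^] n \<otimes> (y [^] n) [^] m"
  using m(1,2) by (simp add: nat_pow_distrib nat_pow_pow mult.commute)
 hence "(x \<otimes> y) [^] (m * n) = \<one>" using m by simp
 thus ?thesis using m by (auto simp: torsion_part_def intro!: exI[of _ "m * n"])
qed

lemma torsion_inv: "x : TT ==> inv x : TT"
 by (auto simp: torsion_part_def nat_pow_inv)

lemma torsion_one: "\<one> : TT" by (auto simp: torsion_part_def intro: exI[of _ 1])

lemma subgroup_torsion: "subgroup TT G"
 by (rule subgroupI) (use torsion_subset torsion_mult torsion_inv torsion_one in auto)

lemma torsion_pow: "x .: G ==> x [^] (k::int) : TT ==> k ~= 0 ==> x : TT"
proof -
 assume x: "x .: G" "x [^] k : TT" "k ~= 0"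
 then obtain m :: nat where m: "0 < m" "(x [^] k) [^] m = \<one>" by (auto simp: torsion_part_def)
 have "x [^] (k * int m) = \<one>" using m x int_pow_pow[of x k "int m"] by (simp add: int_pow_int)
 moreover have "x [^] (- (k * int m)) = inv (x [^] (k * int m))" using x by (simp add: int_pow_neg)
 ultimately have "x [^] \<bar>k * int m\<bar> = \<one>" by (auto simp: abs_if)
 hence "x [^] nat \<bar>k * int m\<bar> = \<one>" using int_pow_int[of G x "nat \<bar>k * int m\<bar>"] by simp
 moreover have "0 < nat \<bar>k * int m\<bar>" using m x by simp
 ultimately show ?thesis using x unfolding torsion_part_def by blast
qed

text \<open>Generation modulo torsion; a family of least size with this property is a basis of the
  free part.\<close>

definition spans_mod :: "nat set => (nat => 'a) => bool" where
 "spans_mod I g \<longleftrightarrow> finite I & (ALL i:I. g i .: G) & (ALL x:car G. EX tau:TT. EX k. x = tau \<otimes> gprod I g k)"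

lemma spans_modI:
 assumes "finite X" "X <= car G" "generate G X = car G"
 shows "EX I g. spans_mod I g & g ` I = X & (ALL x:car G. EX k. x = gprod I g k)"
proof -
 obtain g where g: "bij_betw g {0..<card X} X" using ex_bij_betw_nat_finite[OF assms(1)] by blast
 let ?I = "{0..<card X}"
 have gc: "i : ?I ==> g i .: G" for i using g assms(2) by (auto simp: bij_betw_def)
 have "subgroup (range (gprod ?I g)) G"
 proof (rule subgroupI)
  show "range (gprod ?I g) <= car G" by (auto intro!: gprod_closed gc)
  fix a assume "a : range (gprod ?I g)" then obtain k where k: "a = gprod ?I g k" by auto
  have "inv a = gprod ?I g (%i. - k i)" unfolding k by (rule gprod_neg[symmetric]) (rule gc)
  thus "inv a : range (gprod ?I g)" by blast
  fix b assume "b : range (gprod ?I g)" then obtain l where l: "b = gprod ?I g l" by auto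
  have "a \<otimes> b = gprod ?I g (%i. k i + l i)" unfolding k l by (rule gprod_add[symmetric]) (rule gc)
  thus "a \<otimes> b : range (gprod ?I g)" by blast
 qed auto
 moreover have "X <= range (gprod ?I g)"
 proof
  fix x assume "x : X"
  then obtain i where i: "i : ?I" "x = g i" using g unfolding bij_betw_def by blast
  have "x = gprod ?I g (%j. if j = i then 1 else 0)"
   by (subst gprod_single) (use i gc in auto)
  thus "x : range (gprod ?I g)" by blast
 qed
 ultimately have "car G <= range (gprod ?I g)" using generate_subgroup_incl[of X] assms(3) by metis
 hence "ALL x:car G. EX k. x = gprod ?I g k" by blast
 moreover have "spans_mod ?I g" unfolding spans_mod_def
 proof (intro conjI ballI)
  fix x assume "x .: G"
  then obtain k where "x = gprod ?I g k" using calculation by blast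
  hence "x = \<one> \<otimes> gprod ?I g k" using l_one[OF gprod_closed[of ?I g k, OF gc]] by simp
  thus "EX tau:TT. EX k. x = tau \<otimes> gprod ?I g k" using torsion_one by blast
 qed (use gc in auto)
 moreover have "g ` ?I = X" using g by (simp add: bij_betw_def)
 ultimately show ?thesis by blast
qed

text \<open>Replacing \<open>g\<^sub>j\<close> by \<open>g\<^sub>j g\<^sub>i\<^sup>s\<close> changes the exponent of \<open>g\<^sub>i\<close> only.\<close>
lemma gprod_change:
 assumes I: "finite I" "i : I" "j : I" "i ~= j" and g: "!!i. i : I ==> g i .: G"
 shows "gprod I g k = gprod I (g(j := g j \<otimes> g i [^] (s::int))) (k(i := k i - s * k j))"
proof -
 let ?g = "g(j := g j \<otimes> g i [^] s)" and ?k = "k(i := k i - s * k j)"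
 have g': "!!l. l : I ==> ?g l .: G" using g I by auto
 have e: "gprod I h l = h i [^] l i \<otimes> (h j [^] l j \<otimes> gprod (I - {i} - {j}) h l)"
  if "!!i. i : I ==> h i .: G" for h l
  using that I by (subst gprod_remove[of I i], simp_all, subst gprod_remove[of "I - {i}" j], simp_all)
 have r: "gprod (I - {i} - {j}) ?g ?k = gprod (I - {i} - {j}) g k"
  by (rule gprod_cong) (use g in auto)
 have cl: "g i .: G" "g j .: G" using I g by auto
 let ?R = "gprod (I - {i} - {j}) g k"
 have R: "?R .: G" using g by (intro gprod_closed) auto
 have "gprod I ?g ?k = g i [^] (k i - s * k j) \<otimes> ((g j \<otimes> g i [^] s) [^] k j \<otimes> ?R)"
  using e[of ?g ?k, OF g'] I r by simp
 also have "(g j \<otimes> g i [^] s) [^] k j = g j [^] k j \<otimes> g i [^] (s * k j)"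
  using cl by (simp add: int_pow_distrib int_pow_pow)
 also have "g i [^] (k i - s * k j) \<otimes> (g j [^] k j \<otimes> g i [^] (s * k j) \<otimes> ?R) =
  (g i [^] (k i - s * k j) \<otimes> g i [^] (s * k j)) \<otimes> (g j [^] k j \<otimes> ?R)"
  using cl R by (simp add: m_ac)
 also have "g i [^] (k i - s * k j) \<otimes> g i [^] (s * k j) = g i [^] k i"
  using cl by (simp add: int_pow_mult[symmetric])
 also have "g i [^] k i \<otimes> (g j [^] k j \<otimes> ?R) = gprod I g k" using e[of g k, OF g] by simp
 finally show ?thesis by (rule sym)
qed

text \<open>A Euclidean descent on the sum of the absolute exponents. With two nonzero exponents, a
  change of generators lowers the sum; with a single one, its generator is torsion and could be
  dropped, against minimality.\<close>

lemma minimal_spans_independent: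
 assumes min: "!!J h. spans_mod J h ==> card I <= card J"
 shows "spans_mod I g ==> gprod I g k : TT ==> i : I ==> k i = 0"
proof (induction "nat (\<Sum>i\<in>I. \<bar>k i\<bar>)" arbitrary: g k i rule: less_induct)
 case less
 have I: "finite I" "!!i. i : I ==> g i .: G" using less.prems by (auto simp: spans_mod_def)
 show ?case
 proof (rule ccontr)
  assume ki: "k i ~= 0"
  show False
  proof (cases "EX j:I. j ~= i & k j ~= 0")
   case True
   then obtain j where j: "j : I" "j ~= i" "k j ~= 0" by blast
   obtain a b where ab: "a : I" "b : I" "a ~= b" "k a ~= 0" "k b ~= 0" "\<bar>k b\<bar> <= \<bar>k a\<bar>"
    using j ki less.prems(3) by (metis linear)
   \<comment> \<open>With this sign, \<open>k a - s * k b\<close> has absolute value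
     \<open>\<bar>k a\<bar> - \<bar>k b\<bar>\<close>, while the exponent at \<open>b\<close> stays
     nonzero.\<close>
   define s where "s = sgn (k a) * sgn (k b)"
   let ?g = "g(b := g b \<otimes> g a [^] s)" and ?k = "%k. k(a := k a - s * k b)"
   have ch: "gprod I g k = gprod I ?g (?k k)" for k
    by (rule gprod_change) (use I ab in auto)
   have sp: "spans_mod I ?g" unfolding spans_mod_def
   proof (intro conjI ballI)
    show "finite I" by (rule I)
    show "?g i .: G" if "i : I" for i using that I ab by auto
    fix x assume "x .: G"
    then obtain tau l where "tau : TT" "x = tau \<otimes> gprod I g l" using less.prems(1) by (auto simp: spans_mod_def)
    thus "EX tau:TT. EX l. x = tau \<otimes> gprod I ?g l" unfolding ch by blast
   qed
   have ka: "\<bar>k a - s * k b\<bar> < \<bar>k a\<bar>" using ab unfolding s_def by (auto simp: sgn_if abs_if split: if_splits)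
   have "(\<Sum>i\<in>I. \<bar>?k k i\<bar>) < (\<Sum>i\<in>I. \<bar>k i\<bar>)"
    by (rule sum_strict_mono_ex1) (use I ab ka in auto)
   moreover have "0 <= (\<Sum>i\<in>I. \<bar>?k k i\<bar>)" by (rule sum_nonneg) simp
   ultimately have "nat (\<Sum>i\<in>I. \<bar>?k k i\<bar>) < nat (\<Sum>i\<in>I. \<bar>k i\<bar>)" by linarith
   moreover have "gprod I ?g (?k k) : TT" using less.prems(2) unfolding ch[of k] .
   ultimately have "?k k b = 0" using less.hyps[of "?k k" ?g b] sp ab(2) by blast
   thus False using ab by simp
  next
   case False
   have "gprod I g k = g i [^] k i \<otimes> gprod (I - {i}) g k" using I less.prems(3) by (intro gprod_remove) auto
   also have "gprod (I - {i}) g k = \<one>" using False by (intro gprod_zero) auto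
   finally have gi: "g i : TT" using less.prems(2,3) I ki torsion_pow[of "g i" "k i"] by simp
   have "spans_mod (I - {i}) g" unfolding spans_mod_def
   proof (intro conjI ballI)
    fix x assume "x .: G"
    then obtain tau l where x: "tau : TT" "x = tau \<otimes> gprod I g l" using less.prems(1) by (auto simp: spans_mod_def)
    have c: "g i .: G" "gprod (I - {i}) g l .: G" "tau .: G" using I less.prems(3) x torsion_subset by (auto intro!: gprod_closed)
    have "x = (tau \<otimes> g i [^] l i) \<otimes> gprod (I - {i}) g l"
     unfolding x(2) using I less.prems(3) c by (subst gprod_remove[of I i]) (auto simp: m_assoc)
    moreover have "tau \<otimes> g i [^] l i : TT"
     using torsion_mult[OF x(1)] subgroup_int_pow_closed[OF subgroup_torsion gi] by blast
    ultimately show "EX tau:TT. EX l. x = tau \<otimes> gprod (I - {i}) g l" by blast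
   qed (use I in auto)
   hence "card I <= card (I - {i})" by (rule min)
   thus False using I(1) less.prems(3) by (metis card_Diff1_less not_le)
  qed
 qed
qed

lemma gprod_reindex:
 assumes "bij_betw b J I" "!!i. i : I ==> g i .: G"
 shows "gprod I g k = gprod J (g \<circ> b) (k \<circ> b)"
 unfolding gprod_def using finprod_reindex[of "%i. g i [^] k i" b J] assms by (auto simp: bij_betw_def)

text \<open>A minimal family modulo torsion has no relations modulo torsion, so the exponents
  \<open>kappa\<close> of an element are well determined.\<close>

theorem fin_gen_structure:
 assumes X: "finite X" "X <= car G" "generate G X = car G"
 obtains r :: nat and g kappa where "finite TT" "!!i. i < r ==> g i .: G"
  "!!x. x .: G ==> EX tau:TT. x = tau \<otimes> gprod {..<r} g (kappa x)"
  "!!tau k i. tau : TT ==> i < r ==> kappa (tau \<otimes> gprod {..<r} g k) i = k i"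
proof -
 obtain I0 g0 where I0: "spans_mod I0 g0" "!!x. x .: G ==> EX k. x = gprod I0 g0 k" using spans_modI[OF X] by blast
 obtain I h where I: "spans_mod I h" "!!J h. spans_mod J h ==> card I <= card J"
  using ex_has_least_nat[of "%p. spans_mod (fst p) (snd p)" "(I0, g0)" "%p. card (fst p)"] I0(1) by auto
 have Ic: "finite I" "!!i. i : I ==> h i .: G" using I by (auto simp: spans_mod_def)
 define r where "r = card I"
 obtain b where b: "bij_betw b {..<r} I" using ex_bij_betw_nat_finite[OF Ic(1)] by (auto simp: r_def atLeast0LessThan)
 define g where "g = h \<circ> b"
 have gc: "g i .: G" if "i < r" for i using that b Ic by (auto simp: g_def bij_betw_def)
 have P: "gprod I h k = gprod {..<r} g (k \<circ> b)" for k
  unfolding g_def by (rule gprod_reindex[OF b Ic(2)])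
 have ind: "k i = 0" if k: "gprod {..<r} g k : TT" and i: "i < r" for k i
 proof -
  let ?k = "k \<circ> inv_into {..<r} b"
  have "gprod I h ?k = gprod {..<r} g k" unfolding P
   by (rule gprod_cong) (use gc b in "auto simp: bij_betw_def")
  hence "?k (b i) = 0" using minimal_spans_independent[OF I(2,1), where k = ?k and i = "b i"] k i b by (auto simp: bij_betw_def)
  thus ?thesis using b i by (auto simp: bij_betw_def)
 qed
 have ex: "EX k. EX tau:TT. x = tau \<otimes> gprod {..<r} g k" if "x .: G" for x
  using I(1) that unfolding spans_mod_def P by blast
 define kappa where "kappa x = (SOME k. EX tau:TT. x = tau \<otimes> gprod {..<r} g k)" for x
 have kappa: "EX tau:TT. x = tau \<otimes> gprod {..<r} g (kappa x)" if "x .: G" for x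
  unfolding kappa_def by (rule someI_ex[OF ex[OF that]])
 have gp: "gprod {..<r} g k .: G" for k using gc by (intro gprod_closed) auto
 have kappau: "kappa (tau \<otimes> gprod {..<r} g k) i = k i" if t: "tau : TT" and i: "i < r" for tau k i
 proof -
  let ?x = "tau \<otimes> gprod {..<r} g k"
  have tc: "tau .: G" using t torsion_subset by auto
  then obtain sigma where sigma: "sigma : TT" "?x = sigma \<otimes> gprod {..<r} g (kappa ?x)" using kappa[of ?x] gp by blast
  have sc: "sigma .: G" using sigma torsion_subset by auto
  have "gprod {..<r} g (%i. kappa ?x i + - k i) = gprod {..<r} g (kappa ?x) \<otimes> inv gprod {..<r} g k"
   using gprod_add[of "{..<r}" g "kappa ?x" "%i. - k i"] gprod_neg[of "{..<r}" g k] gc by simp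
  also have "... = inv sigma \<otimes> (sigma \<otimes> gprod {..<r} g (kappa ?x)) \<otimes> inv gprod {..<r} g k"
   using sc gp by (simp add: m_assoc[symmetric])
  also have "... = inv sigma \<otimes> (tau \<otimes> gprod {..<r} g k) \<otimes> inv gprod {..<r} g k" using sigma(2) by simp
  also have "... = inv sigma \<otimes> tau" using sc tc gp by (simp add: m_assoc)
  finally have "gprod {..<r} g (%i. kappa ?x i + - k i) : TT" using torsion_mult[OF torsion_inv[OF sigma(1)] t] by simp
  thus ?thesis using ind[of "%i. kappa ?x i + - k i" i] i by simp
 qed
 have "finite TT"
 proof -
  \<comment> \<open>Projection onto the torsion subgroup along the free part. It maps the finitely
    many generators \<open>g0\<close> of the whole group to elements of finite order that generate
    the torsion subgroup, which is therefore finite.\<close>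
  define pi where "pi x = x \<otimes> inv gprod {..<r} g (kappa x)" for x
  have piT: "pi x : TT" "pi x .: G" if x: "x .: G" for x
  proof -
   obtain tau where t: "tau : TT" "x = tau \<otimes> gprod {..<r} g (kappa x)" using kappa[OF x] by blast
   have "pi x = tau \<otimes> gprod {..<r} g (kappa x) \<otimes> inv gprod {..<r} g (kappa x)" unfolding pi_def using t(2) by simp
   hence "pi x = tau" using subsetD[OF torsion_subset t(1)] gp by (simp add: m_assoc)
   thus "pi x : TT" "pi x .: G" using t torsion_subset by auto
  qed
  have hom: "pi : hom G G"
  proof (rule homI)
   fix x y assume x: "x .: G" and y: "y .: G"
   obtain tau where t: "tau : TT" "x = tau \<otimes> gprod {..<r} g (kappa x)" using kappa[OF x] by blast
   obtain sigma where s: "sigma : TT" "y = sigma \<otimes> gprod {..<r} g (kappa y)" using kappa[OF y] by blast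
   have tc: "tau .: G" "sigma .: G" using t s torsion_subset by auto
   have "(tau \<otimes> gprod {..<r} g (kappa x)) \<otimes> (sigma \<otimes> gprod {..<r} g (kappa y)) = (tau \<otimes> sigma) \<otimes> gprod {..<r} g (%i. kappa x i + kappa y i)"
    using gc gp tc by (subst gprod_add) (auto simp: m_ac)
   hence "x \<otimes> y = (tau \<otimes> sigma) \<otimes> gprod {..<r} g (%i. kappa x i + kappa y i)" using t(2) s(2) by simp
   hence "kappa (x \<otimes> y) i = kappa x i + kappa y i" if "i < r" for i using kappau[OF torsion_mult[OF t(1) s(1)] that] by simp
   hence "gprod {..<r} g (kappa (x \<otimes> y)) = gprod {..<r} g (kappa x) \<otimes> gprod {..<r} g (kappa y)"
    using gc gprod_cong[of "{..<r}" g "kappa (x \<otimes> y)" g "%i. kappa x i + kappa y i"] gprod_add[of "{..<r}" g "kappa x" "kappa y"] by simp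
   thus "pi (x \<otimes> y) = pi x \<otimes> pi y" unfolding pi_def using x y gp by (simp add: inv_mult m_ac)
  qed (rule piT)
  interpret pi: group_hom G G pi by (rule group_hom.intro[OF group_axioms group_axioms]) (simp add: group_hom_axioms_def hom)
  have piid: "pi tau = tau" if "tau : TT" for tau
  proof -
   have t: "tau = tau \<otimes> gprod {..<r} g (%i. 0)" using that torsion_subset by (auto simp: gprod_zero)
   have "kappa tau i = 0" if "i < r" for i using kappau[OF \<open>tau : TT\<close> that, of "%i. 0"] t by simp
   hence "gprod {..<r} g (kappa tau) = \<one>" by (intro gprod_zero) auto
   thus ?thesis using that torsion_subset by (auto simp: pi_def)
  qed
  have I0c: "finite I0" "!!i. i : I0 ==> g0 i .: G" using I0(1) by (auto simp: spans_mod_def)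
  have "ALL i:I0. EX m::nat. 0 < m & pi (g0 i) [^] m = \<one>"
   using piT(1)[OF I0c(2)] unfolding torsion_part_def by blast
  then obtain m :: "nat => nat" where m: "!!i. i : I0 ==> 0 < m i" "!!i. i : I0 ==> pi (g0 i) [^] m i = \<one>"
   by (metis)
  have pig: "pi (gprod I0 g0 k) = gprod I0 (pi \<circ> g0) k" for k
  proof -
   have "pi (\<Otimes>i\<in>A. g0 i [^] k i) = (\<Otimes>i\<in>A. pi (g0 i) [^] k i)" if "finite A" "A <= I0" for A
    using that
   proof (induction A rule: finite_induct)
    case (insert i A)
    thus ?case using I0c piT by (subst (1 2) finprod_insert) (auto simp: pi.hom_int_pow Pi_def subset_iff)
   qed simp
   thus ?thesis using I0c by (simp add: gprod_def)
  qed
  have "TT <= gprod I0 (pi \<circ> g0) ` (PiE I0 (%i. {0..<int (m i)}))"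
  proof
   fix tau assume t: "tau : TT"
   then obtain k where k: "tau = gprod I0 g0 k" using I0(2) torsion_subset by blast
   define l where "l = (\<lambda>i\<in>I0. k i mod int (m i))"
   have "tau = gprod I0 (pi \<circ> g0) k" using piid[OF t] pig[of k] k by simp
   also have "... = gprod I0 (pi \<circ> g0) l"
   proof (rule gprod_cong)
    fix i assume i: "i : I0"
    have c: "pi (g0 i) .: G" using i I0c piT by auto
    have "k i = int (m i) * (k i div int (m i)) + k i mod int (m i)" by simp
    hence "pi (g0 i) [^] k i = (pi (g0 i) [^] int (m i)) [^] (k i div int (m i)) \<otimes> pi (g0 i) [^] (k i mod int (m i))"
     using c by (metis int_pow_mult int_pow_pow)
    also have "pi (g0 i) [^] int (m i) = \<one>" using m(2)[OF i] by (simp add: int_pow_int)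
    finally show "(pi \<circ> g0) i [^] k i = (pi \<circ> g0) i [^] l i" using c i by (simp add: l_def)
   qed (use I0c piT in auto)
   finally show "tau : gprod I0 (pi \<circ> g0) ` (PiE I0 (%i. {0..<int (m i)}))"
    using m(1) by (auto simp: l_def intro!: image_eqI[of _ _ l])
  qed
  moreover have "finite (gprod I0 (pi \<circ> g0) ` (PiE I0 (%i. {0..<int (m i)})))"
   using I0c by (intro finite_imageI finite_PiE) auto
  ultimately show ?thesis by (rule finite_subset)
 qed
 thus thesis using that gc kappa kappau by blast
qed

end

section \<open>The rank as the dimension of the rationalization\<close>

lemma module_rat_int: "module int_ring rat_int_module"
proof (rule moduleI[OF int_is_cring])
 show "abelian_group rat_int_module"
 proof (rule abelian_groupI)
  fix x assume "x .: rat_int_module"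
  show "EX y:car rat_int_module. y \<oplus>\<^sub>rat_int_module x = \<zero>\<^sub>rat_int_module"
   by (rule bexI[of _ "- x"]) (auto simp: rat_int_module_def)
 qed (auto simp: rat_int_module_def)
qed (auto simp: rat_int_module_def algebra_simps)

lemma (in comm_group) module_group_int: "module int_ring (group_int_module G)"
proof (rule moduleI[OF int_is_cring])
 show "abelian_group (group_int_module G)"
 proof (rule abelian_groupI)
  fix x assume "x .: (group_int_module G)"
  thus "EX y:car (group_int_module G). y \<oplus>\<^bsub>group_int_module G\<^esub> x = \<zero>\<^bsub>group_int_module G\<^esub>"
   by (intro bexI[of _ "inv x"]) (auto simp: group_int_module_def)
 qed (auto simp: group_int_module_def m_ac)
qed (auto simp: group_int_module_def int_pow_mult int_pow_distrib int_pow_pow mult.commute)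

locale rational_span = comm_group G + tensor_modules int_ring rat_int_module "group_int_module G" for G (structure)
begin

abbreviation tp (infixl "\<bullet>" 75) where "tp == pure_tensor int_ring rat_int_module (group_int_module G)"

lemma RM_simps [simp]: "car rat_int_module = UNIV" "x \<oplus>\<^sub>rat_int_module y = x + y" "\<zero>\<^sub>rat_int_module = 0"
  "n \<odot>\<^sub>rat_int_module x = of_int n * x" "car (group_int_module G) = car G"
  "u \<oplus>\<^bsub>group_int_module G\<^esub> v = u \<otimes> v" "\<zero>\<^bsub>group_int_module G\<^esub> = \<one>" "n \<odot>\<^bsub>group_int_module G\<^esub> u = u [^] n"
 by (simp_all add: rat_int_module_def group_int_module_def)

text \<open>Pushforward of a formal sum along multiplication of the rational entries by
  \<open>q\<close>, as in \<open>rationalization_smult\<close>. For \<open>q = 0\<close> a fibre is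
  infinite, so only points with nonzero coefficient are summed.\<close>

definition push :: "rat => (rat \<times> 'a => int) => rat \<times> 'a => int" where
 "push q f = (%(p, g). \<Sum>p'\<in>{p'. q * p' = p & f (p', g) ~= 0}. f (p', g))"

lemma FF_carrier: "f .: FF \<longleftrightarrow> finite {m. f m ~= 0} & (ALL m. m ~: UNIV \<times> car G --> f m = 0)"
 by (simp add: monoid_algebra_def)

lemma FF_fin: "f .: FF ==> finite {p. f (p, g) ~= 0}"
proof -
 assume "f .: FF"
 hence "finite (fst ` {m. f m ~= 0})" by (simp add: FF_carrier)
 moreover have "{p. f (p, g) ~= 0} <= fst ` {m. f m ~= 0}"
 proof
  fix p assume "p : {p. f (p, g) ~= 0}"
  thus "p : fst ` {m. f m ~= 0}" by (intro image_eqI[of _ _ "(p, g)"]) simp_all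
 qed
 ultimately show ?thesis by (rule finite_subset[rotated])
qed

lemma push_sum:
 assumes "finite A" "{p. f (p, g) ~= 0} <= A"
 shows "push q f (p, g) = (\<Sum>p'\<in>A. if q * p' = p then f (p', g) else 0)"
proof -
 have "push q f (p, g) = (\<Sum>p'\<in>{p'. q * p' = p & f (p', g) ~= 0}. if q * p' = p then f (p', g) else 0)"
  unfolding push_def by (auto intro: sum.cong)
 also have "... = (\<Sum>p'\<in>A. if q * p' = p then f (p', g) else 0)"
  by (rule sum.mono_neutral_left) (use assms in auto)
 finally show ?thesis .
qed

lemma push_mod_hom: "push q : mod_hom int_ring FF FF"
proof (rule mod_homI)
 fix f assume f: "f .: FF"
 have "{m. push q f m ~= 0} <= (%(p, g). (q * p, g)) ` {m. f m ~= 0}"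
 proof
  fix m assume "m : {m. push q f m ~= 0}"
  moreover obtain p g where m: "m = (p, g)" by (cases m)
  ultimately have "push q f (p, g) ~= 0" by simp
  hence "{p'. q * p' = p & f (p', g) ~= 0} ~= {}" unfolding push_def case_prod_conv using sum.empty by fastforce
  thus "m : (%(p, g). (q * p, g)) ` {m. f m ~= 0}" using m by force
 qed
 hence "finite {m. push q f m ~= 0}" using f finite_surj unfolding FF_carrier by blast
 moreover have "push q f m = 0" if "m ~: UNIV \<times> car G" for m
  using f that unfolding FF_carrier push_def by (cases m) auto
 ultimately show "push q f .: FF" by (auto simp: FF_carrier)
next
 fix f f' assume f: "f .: FF" "f' .: FF"
 show "push q (f \<oplus>\<^sub>FF f') = push q f \<oplus>\<^sub>FF push q f'"
 proof
  fix m :: "rat \<times> 'a" obtain p g where m: "m = (p, g)" by (cases m)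
  let ?A = "{p. f (p, g) ~= 0} \<union> {p. f' (p, g) ~= 0}"
  have A: "finite ?A" using f FF_fin by auto
  have S: "{p. (f \<oplus>\<^sub>FF f') (p, g) ~= 0} <= ?A" by (auto simp: MA_simps)
  have "push q (f \<oplus>\<^sub>FF f') (p, g) = (\<Sum>p'\<in>?A. (if q * p' = p then f (p', g) else 0) + (if q * p' = p then f' (p', g) else 0))"
   unfolding push_sum[OF A S] by (rule sum.cong) (simp_all add: MA_simps)
  also have "... = push q f (p, g) + push q f' (p, g)"
   unfolding sum.distrib using push_sum[OF A, of f g q p] push_sum[OF A, of f' g q p] by auto
  finally show "push q (f \<oplus>\<^sub>FF f') m = (push q f \<oplus>\<^sub>FF push q f') m" by (simp add: m MA_simps)
 qed
next
 fix c f assume f: "f .: FF"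
 show "push q (c \<odot>\<^sub>FF f) = c \<odot>\<^sub>FF push q f"
 proof
  fix m :: "rat \<times> 'a" obtain p g where m: "m = (p, g)" by (cases m)
  let ?A = "{p. f (p, g) ~= 0}"
  have A: "finite ?A" using f FF_fin by auto
  have "push q (c \<odot>\<^sub>FF f) (p, g) = (\<Sum>p'\<in>?A. c * (if q * p' = p then f (p', g) else 0))"
   by (subst push_sum[OF A]) (auto simp: MA_simps intro!: sum.cong)
  also have "... = c * push q f (p, g)"
   unfolding sum_distrib_left[symmetric] using push_sum[OF A, of f g q p] by auto
  finally show "push q (c \<odot>\<^sub>FF f) m = (c \<odot>\<^sub>FF push q f) m" by (simp add: m MA_simps)
 qed
qed

lemma push_basis: "push q (bvec int_ring (p, g)) = bvec int_ring (q * p, g)"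
proof
 fix m :: "rat \<times> 'a" obtain p' g' where m: "m = (p', g')" by (cases m)
 show "push q (bvec int_ring (p, g)) m = bvec int_ring (q * p, g) m"
  unfolding m by (subst push_sum[of "{p}"]) (auto simp: basis_vec_def)
qed

definition rscale where "rscale q = tensor_lift T (%p g. (q * p) \<bullet> g)"

lemma rscale: "rscale q : mod_hom int_ring T T" "g .: G ==> rscale q (p \<bullet> g) = (q * p) \<bullet> g"
proof -
 have "bilin int_ring rat_int_module (group_int_module G) T (%p g. (q * p) \<bullet> g)"
  unfolding bilin_def
 proof (intro conjI ballI)
  fix a show "(%b. (q * a) \<bullet> b) : mod_hom int_ring (group_int_module G) T" by (rule pt_hom_right) simp
 next
  fix b assume b: "b .: (group_int_module G)"
  have s: "(q * (of_int c * x)) \<bullet> b = (of_int c * (q * x)) \<bullet> b" for c x by (simp add: mult.left_commute)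
  show "(%a. (q * a) \<bullet> b) : mod_hom int_ring rat_int_module T"
   using b mod_homD[OF pt_hom_left[OF b]] by (intro mod_homI) (simp_all add: distrib_left s)
 qed
 from tensor_lift[OF TM.module_axioms this] show "rscale q : mod_hom int_ring T T" "g .: G ==> rscale q (p \<bullet> g) = (q * p) \<bullet> g"
  by (simp_all add: rscale_def)
qed

text \<open>Compares the formula on representatives with \<open>rscale\<close>, which is well
  defined by the universal property. Both are linear, so basis vectors suffice, and the formula is
  thereby independent of the representative.\<close>

lemma push_rscale: "f .: FF ==> QM.q (push q f) = rscale q (QM.q f)"
proof (induction f rule: A.R.MA_induct)
 case zero
 have "push q \<zero>\<^sub>FF = \<zero>\<^sub>FF" by (rule mod_hom_zero[OF FM.module_axioms FM.module_axioms push_mod_hom])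
 thus ?case using mod_hom_zero[OF TM.module_axioms TM.module_axioms rscale(1)] QM.q_zero by (simp add: T_eq)
next
 case (step c m f)
 obtain p g where m: "m = (p, g)" "g .: G" using step by (cases m) auto
 have b: "bvec int_ring m .: FF" using step basis_in[of p g] m by simp
 note D = mod_homD[OF QM.q_mod_hom[folded T_eq]] mod_homD[OF push_mod_hom] mod_homD[OF rscale(1)]
 have "QM.q (push q (bvec int_ring m)) = rscale q (QM.q (bvec int_ring m))"
  using m rscale(2)[of g q p] by (simp add: push_basis pt_eq)
 thus ?case using step b by (simp add: D)
qed

lemma rationalization_smult: "X .: T ==> rationalization_smult G q X = rscale q X"
proof -
 assume "X .: T"
 then obtain f where f: "f .: FF" "X = QM.q f" by (auto simp: T_eq QM.q_onto[symmetric])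
 have "rationalization_smult G q X = (\<Union>f\<in>X. QM.q (push q f))"
  by (simp add: rationalization_smult_def rationalization_def T_eq quot_algebra_simps push_def)
 also have "... = (\<Union>f\<in>X. rscale q X)"
 proof (rule SUP_cong[OF refl])
  fix f' assume "f' : X"
  hence "f' .: FF" "QM.q f' = X" using f QM.q_mem by auto
  thus "QM.q (push q f') = rscale q X" using push_rscale by simp
 qed
 also have "... = rscale q X" using QM.S.a_rcos_self[OF f(1)] f(2) by auto
 finally show ?thesis .
qed

text \<open>If \<open>m\<close> kills \<open>tau\<close>, then \<open>q \<otimes> tau\<close> equals
  \<open>(q / m) \<otimes> tau^m\<close>.\<close>

lemma pt_torsion: "tau : TT ==> q \<bullet> tau = \<zero>\<^sub>T"
proof -
 assume "tau : TT"
 then obtain m :: nat where m: "tau .: G" "0 < m" "tau [^] m = \<one>" by (auto simp: torsion_part_def)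
 have "q \<bullet> tau = (int m \<odot>\<^sub>rat_int_module (q / of_nat m)) \<bullet> tau" using m by simp
 also have "... = (q / of_nat m) \<bullet> (int m \<odot>\<^bsub>group_int_module G\<^esub> tau)" using m(1) pt_smult_left[of "int m" "q / of_nat m" tau] pt_smult_right[of "int m" "q / of_nat m" tau] by simp
 also have "... = \<zero>\<^sub>T" using m pt_zero_right[of "q / of_nat m"] by (simp add: int_pow_int)
 finally show ?thesis .
qed

lemma pt_gprod: "finite I ==> (!!i. i : I ==> g i .: G) ==> q \<bullet> gprod I g k = (\<Oplus>\<^sub>T i\<in>I. (q * of_int (k i)) \<bullet> g i)"
proof (induction I rule: finite_induct)
 case empty thus ?case using pt_zero_right[of q] by (simp add: gprod_def)
next
 case (insert i I)
 have g: "g i .: G" "gprod I g k .: G" using insert by auto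
 have "gprod (insert i I) g k = g i [^] k i \<otimes> gprod I g k"
  using insert gprod_remove[of "insert i I" i g k] by simp
 hence "q \<bullet> gprod (insert i I) g k = q \<bullet> (g i [^] k i) \<oplus>\<^sub>T q \<bullet> gprod I g k"
  using pt_add_right[of q "g i [^] k i" "gprod I g k"] g by simp
 also have "q \<bullet> (g i [^] k i) = (q * of_int (k i)) \<bullet> g i"
  using pt_smult_left[of "k i" q "g i"] pt_smult_right[of "k i" q "g i"] g by (simp add: mult.commute)
 finally show ?case using insert by (subst TM.M.finsum_insert) (auto simp: Pi_def)
qed

text \<open>The elements \<open>1 \<otimes> g i\<close> form a basis. Its coordinate functions are
  the rational extensions \<open>F i\<close> of the exponents \<open>kappa\<close>, which are
  additive by their uniqueness.\<close>

theorem has_rank_independent: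
 assumes g: "!!i. i < r ==> g i .: G"
  and kappa: "!!x. x .: G ==> EX tau:TT. x = tau \<otimes> gprod {..<r} g (kappa x)"
  and kappau: "!!tau k i. tau : TT ==> i < r ==> kappa (tau \<otimes> gprod {..<r} g k) i = k i"
 shows "has_rank G r"
proof -
 have gp: "gprod {..<r} g k .: G" for k using g by (intro gprod_closed) auto
 have hom: "(%x. kappa x i) : hom G integer_group" if i: "i < r" for i
 proof (rule homI)
  fix x y assume x: "x .: G" and y: "y .: G"
  obtain tau sigma where t: "tau : TT" "sigma : TT" "x = tau \<otimes> gprod {..<r} g (kappa x)" "y = sigma \<otimes> gprod {..<r} g (kappa y)"
   using kappa[OF x] kappa[OF y] by blast
  have tc: "tau .: G" "sigma .: G" using t torsion_subset by auto
  have "x \<otimes> y = (tau \<otimes> gprod {..<r} g (kappa x)) \<otimes> (sigma \<otimes> gprod {..<r} g (kappa y))" using t(3,4) by simp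
  also have "... = (tau \<otimes> sigma) \<otimes> gprod {..<r} g (%i. kappa x i + kappa y i)"
   using g gp tc by (subst gprod_add) (auto simp: m_ac)
  finally have e: "x \<otimes> y = (tau \<otimes> sigma) \<otimes> gprod {..<r} g (%i. kappa x i + kappa y i)" .
  show "kappa (x \<otimes> y) i = kappa x i \<otimes>\<^sub>integer_group kappa y i" unfolding e kappau[OF torsion_mult[OF t(1,2)] i] by simp
 qed simp
 have kappag: "kappa (g j) i = (if j = i then 1 else 0)" if "i < r" "j < r" for i j
  using kappau[OF torsion_one that(1), of "%i. if i = j then 1 else 0"] gprod_single[of "{..<r}" j g 1] g that by (simp add: int_pow_1)
 define F where "F i = tensor_lift rat_int_module (%q x. q * of_int (kappa x i))" for i
 have F: "F i : mod_hom int_ring T rat_int_module" "!!q x. x .: G ==> F i (q \<bullet> x) = q * of_int (kappa x i)" if i: "i < r" for i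
 proof -
  have "kappa (x \<otimes> y) i = kappa x i + kappa y i" if "x .: G" "y .: G" for x y using hom[OF i] that by (auto simp: hom_def)
  moreover have "kappa (x [^] c) i = c * kappa x i" if "x .: G" for x and c :: int
   using hom_int_pow[OF hom[OF i] that is_group group_integer_group] by simp
  ultimately have "bilin int_ring rat_int_module (group_int_module G) rat_int_module (%q x. q * of_int (kappa x i))"
   unfolding bilin_def by (auto intro!: mod_homI simp: algebra_simps)
  from tensor_lift[OF module_rat_int this] show "F i : mod_hom int_ring T rat_int_module"
   "!!q x. x .: G ==> F i (q \<bullet> x) = q * of_int (kappa x i)" by (simp_all add: F_def)
 qed
 have F0: "F i \<zero>\<^sub>T = 0" if "i < r" for i using mod_hom_zero[OF TM.module_axioms module_rat_int F(1)[OF that]] by simp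
 have Fs: "F j (\<Oplus>\<^sub>T i\<in>A. a i \<bullet> g i) = (if j : A then a j else 0)" if "finite A" "A <= {..<r}" "j < r" for A a j
  using that
 proof (induction A rule: finite_induct)
  case (insert i A)
  hence "(\<Oplus>\<^sub>T i\<in>insert i A. a i \<bullet> g i) = a i \<bullet> g i \<oplus>\<^sub>T (\<Oplus>\<^sub>T i\<in>A. a i \<bullet> g i)" "(\<Oplus>\<^sub>T i\<in>A. a i \<bullet> g i) .: T" "a i \<bullet> g i .: T"
   using g by (auto simp: Pi_def subset_iff intro!: TM.M.finsum_insert TM.M.finsum_closed)
  thus ?case using insert g by (auto simp: mod_homD(2)[OF F(1)] F(2) kappag)
 qed (simp add: F0)
 have ex: "x = (\<Oplus>\<^sub>T i\<in>{..<r}. F i x \<bullet> g i)" if "x .: T" for x using that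
 proof (induction x rule: tensor_induct)
  case zero
  have "(\<Oplus>\<^sub>T i\<in>{..<r}. F i \<zero>\<^sub>T \<bullet> g i) = (\<Oplus>\<^sub>T i\<in>{..<r}. \<zero>\<^sub>T)"
   using g pt_zero_left by (intro TM.M.finsum_cong') (auto simp: F0)
  thus ?case by (simp add: TM.M.finsum_zero)
 next
  case (step q y x)
  obtain tau where t: "tau : TT" "y = tau \<otimes> gprod {..<r} g (kappa y)" using kappa[of y] step by auto
  have "q \<bullet> y = q \<bullet> (tau \<otimes> gprod {..<r} g (kappa y))" using t(2) by simp
  also have "... = q \<bullet> tau \<oplus>\<^sub>T q \<bullet> gprod {..<r} g (kappa y)" using pt_add_right[of q tau "gprod {..<r} g (kappa y)"] t torsion_subset gp by auto
  also have "... = (\<Oplus>\<^sub>T i\<in>{..<r}. (q * of_int (kappa y i)) \<bullet> g i)"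
   using pt_torsion[OF t(1), of q] pt_gprod[of "{..<r}" g q "kappa y"] g pt_closed[of q "gprod {..<r} g (kappa y)"] gp by simp
  finally have 1: "q \<bullet> y = (\<Oplus>\<^sub>T i\<in>{..<r}. (q * of_int (kappa y i)) \<bullet> g i)" .
  have "q \<bullet> y \<oplus>\<^sub>T x = (\<Oplus>\<^sub>T i\<in>{..<r}. (q * of_int (kappa y i)) \<bullet> g i \<oplus>\<^sub>T F i x \<bullet> g i)"
   using g by (subst TM.M.finsum_addf) (auto simp: 1[symmetric] step(4)[symmetric])
  also have "... = (\<Oplus>\<^sub>T i\<in>{..<r}. F i (q \<bullet> y \<oplus>\<^sub>T x) \<bullet> g i)"
  proof (rule TM.M.finsum_cong')
   fix i assume "i : {..<r}"
   thus "(q * of_int (kappa y i)) \<bullet> g i \<oplus>\<^sub>T F i x \<bullet> g i = F i (q \<bullet> y \<oplus>\<^sub>T x) \<bullet> g i"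
    using step g pt_add_left[of "q * of_int (kappa y i)" "F i x" "g i"] by (simp add: mod_homD(2)[OF F(1)] F(2))
  qed (use g in auto)
  finally show ?case .
 qed
 let ?b = "%i. 1 \<bullet> g i"
 have b: "inj_on ?b {..<r}"
 proof (rule inj_onI)
  fix i j assume ij: "i : {..<r}" "j : {..<r}" "?b i = ?b j"
  have "F i (?b i) = 1" "F i (?b j) = (if j = i then 1 else 0)" using ij(1,2) g F(2)[of i "g i" 1] F(2)[of i "g j" 1] kappag by auto
  thus "i = j" using ij(3) by (metis zero_neq_one)
 qed
 have bc: "?b i .: T" if "i < r" for i using g[OF that] by simp
 have sum: "(\<Oplus>\<^sub>T b\<in>?b ` {..<r}. rationalization_smult G (c b) b) = (\<Oplus>\<^sub>T i\<in>{..<r}. c (?b i) \<bullet> g i)" for c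
 proof -
  have e: "rationalization_smult G (c (?b i)) (?b i) = c (?b i) \<bullet> g i" if "i < r" for i
   using g[OF that] rscale(2)[of "g i" "c (?b i)" 1] by (simp add: rationalization_smult)
  have "(\<Oplus>\<^sub>T b\<in>?b ` {..<r}. rationalization_smult G (c b) b) = (\<Oplus>\<^sub>T i\<in>{..<r}. rationalization_smult G (c (?b i)) (?b i))"
   using g e by (intro TM.M.finsum_reindex[OF _ b]) auto
  also have "... = (\<Oplus>\<^sub>T i\<in>{..<r}. c (?b i) \<bullet> g i)" using g e by (intro TM.M.finsum_cong') auto
  finally show ?thesis .
 qed
 have "EX! c. c : ?b ` {..<r} \<rightarrow>\<^sub>E UNIV & x = (\<Oplus>\<^sub>T b\<in>?b ` {..<r}. rationalization_smult G (c b) b)" if x: "x .: T" for x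
 proof (rule ex_ex1I)
  let ?c = "\<lambda>b\<in>?b ` {..<r}. F (inv_into {..<r} ?b b) x"
  have "(\<Oplus>\<^sub>T i\<in>{..<r}. ?c (?b i) \<bullet> g i) = (\<Oplus>\<^sub>T i\<in>{..<r}. F i x \<bullet> g i)"
   using g by (intro TM.M.finsum_cong') (auto simp: inv_into_f_f[OF b])
  thus "EX c. c : ?b ` {..<r} \<rightarrow>\<^sub>E UNIV & x = (\<Oplus>\<^sub>T b\<in>?b ` {..<r}. rationalization_smult G (c b) b)"
   using ex[OF x] unfolding sum by (intro exI[of _ ?c]) simp
 next
  fix c c' assume c: "c : ?b ` {..<r} \<rightarrow>\<^sub>E UNIV & x = (\<Oplus>\<^sub>T b\<in>?b ` {..<r}. rationalization_smult G (c b) b)"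
   "c' : ?b ` {..<r} \<rightarrow>\<^sub>E UNIV & x = (\<Oplus>\<^sub>T b\<in>?b ` {..<r}. rationalization_smult G (c' b) b)"
  have "c (?b i) = F i x" "c' (?b i) = F i x" if i: "i < r" for i
   using Fs[of "{..<r}" i "%i. c (?b i)"] Fs[of "{..<r}" i "%i. c' (?b i)"] c i unfolding sum by auto
  thus "c = c'" using c by (intro PiE_ext[of c "?b ` {..<r}" "%_. UNIV" c']) auto
 qed
 thus ?thesis unfolding has_rank_def has_dim_def rationalization_def
  using bc card_image[OF b] by (intro exI[of _ "?b ` {..<r}"]) auto
qed

end

theorem (in comm_group) fin_gen_decomposition:
 assumes "fin_gen_group G"
 shows "EX r g kappa. finite TT & (ALL i<r. g i .: G) &
  (ALL x:car G. EX tau:TT. x = tau \<otimes> gprod {..<r} g (kappa x)) &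
  (ALL tau:TT. ALL k. ALL i<r. kappa (tau \<otimes> gprod {..<r} g k) i = k i) & has_rank G r &
  (EX phi:iso ((G on TT) \<times>\<times> product_group {..<r} (%_. integer_group)) G.
   ALL tau:TT. phi (tau, \<one>\<^bsub>product_group {..<r} (%_. integer_group)\<^esub>) = tau)"
proof -
 obtain r g kappa where fin: "finite TT" and g: "!!i. i < r ==> g i .: G"
  and kappa: "!!x. x .: G ==> EX tau:TT. x = tau \<otimes> gprod {..<r} g (kappa x)"
  and kappau: "!!tau k i. tau : TT ==> i < r ==> kappa (tau \<otimes> gprod {..<r} g k) i = k i"
  using assms fin_gen_structure unfolding fin_gen_group_def by metis
 have gp: "gprod {..<r} g k .: G" for k using g by (intro gprod_closed) auto
 interpret rational_span G
  by (intro rational_span.intro tensor_modules.intro comm_group_axioms module_rat_int module_group_int)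
 let ?phi = "%(tau, k). tau \<otimes> gprod {..<r} g k"
 let ?P = "(G on TT) \<times>\<times> product_group {..<r} (%_. integer_group)"
 have "?phi : iso ?P G"
 proof (rule isoI)
  show "?phi : hom ?P G"
  proof (rule homI)
   fix x assume "x .: ?P" thus "?phi x .: G" using torsion_subset gp by auto
  next
   fix x y assume x: "x .: ?P" and y: "y .: ?P"
   obtain tau k sigma l where xy: "x = (tau, k)" "y = (sigma, l)" by (cases x, cases y) auto
   have c: "tau .: G" "sigma .: G" using x y xy torsion_subset by auto
   have "gprod {..<r} g (\<lambda>i\<in>{..<r}. k i + l i) = gprod {..<r} g k \<otimes> gprod {..<r} g l"
    using g gprod_cong[of "{..<r}" g "\<lambda>i\<in>{..<r}. k i + l i" g "%i. k i + l i"] gprod_add[of "{..<r}" g k l] by simp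
   thus "?phi (x \<otimes>\<^sub>?P y) = ?phi x \<otimes> ?phi y" using c gp by (simp add: xy mult_DirProd' m_ac)
  qed
  show "bij_betw ?phi (car ?P) (car G)"
  proof (rule bij_betw_imageI)
   show "inj_on ?phi (car ?P)"
   proof (rule inj_onI)
    fix x y assume x: "x .: ?P" and y: "y .: ?P" and e: "?phi x = ?phi y"
    obtain tau k sigma l where xy: "x = (tau, k)" "y = (sigma, l)" by (cases x, cases y) auto
    have c: "tau : TT" "sigma : TT" using x y xy by auto
    have e': "tau \<otimes> gprod {..<r} g k = sigma \<otimes> gprod {..<r} g l" using e xy by simp
    have "k i = l i" if "i < r" for i using kappau[OF c(1) that, of k] kappau[OF c(2) that, of l] e' by simp
    hence kl: "k = l" using x y xy by (intro PiE_ext[of k "{..<r}" "%_. UNIV" l]) auto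
    hence "tau = sigma" using e' subsetD[OF torsion_subset c(1)] subsetD[OF torsion_subset c(2)] gp[of l] by simp
    thus "x = y" using kl xy by simp
   qed
   show "?phi ` car ?P = car G"
   proof (intro subset_antisym subsetI)
    fix x assume x: "x .: G"
    then obtain tau where t: "tau : TT" "x = tau \<otimes> gprod {..<r} g (kappa x)" using kappa by blast
    have "gprod {..<r} g (restrict (kappa x) {..<r}) = gprod {..<r} g (kappa x)" using g by (intro gprod_cong) auto
    hence "x = ?phi (tau, restrict (kappa x) {..<r})" using t by simp
    moreover have "(tau, restrict (kappa x) {..<r}) .: ?P" using t by auto
    ultimately show "x : ?phi ` car ?P" by blast
   qed (use torsion_subset gp in auto)
  qed
 qed
 moreover have "?phi (tau, \<one>\<^bsub>product_group {..<r} (%_. integer_group)\<^esub>) = tau" if "tau : TT" for tau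
  using that torsion_subset gprod_zero[of "{..<r}" "\<lambda>i\<in>{..<r}. 0" g] by auto
 ultimately have iso: "EX phi:iso ?P G. ALL tau:TT. phi (tau, \<one>\<^bsub>product_group {..<r} (%_. integer_group)\<^esub>) = tau" by blast
 have "has_rank G r" by (rule has_rank_independent[OF g kappa kappau])
 thus ?thesis
  by (intro exI[of _ r] exI[of _ g] exI[of _ kappa] conjI ballI allI impI)
   (rule fin, erule g, erule kappa, rule kappau, assumption, assumption, assumption, rule iso)
qed

section \<open>Ore conditions and fractions\<close>

text \<open>Horner's scheme for the sum of the \<open>c_i b a^i\<close>; the head of the list is the
  constant coefficient.\<close>

primrec (in ring) horner :: "'a => 'a => 'a list => 'a" where
 "horner b a [] = \<zero>"
| "horner b a (c # cs) = horner b a cs \<otimes> a \<oplus> c \<otimes> b"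

context ring begin

lemma horner_closed [simp]: "a .: R ==> b .: R ==> set cs <= car R ==> horner b a cs .: R"
 by (induction cs) auto

lemma horner_snoc_zero: "a .: R ==> b .: R ==> set cs <= car R ==> horner b a (cs @ [\<zero>]) = horner b a cs"
 by (induction cs) auto

lemma horner_zeros: "a .: R ==> b .: R ==> horner b a (replicate n \<zero>) = \<zero>"
 by (induction n) auto

lemma horner_add: "length cs = length ds ==> a .: R ==> b .: R ==> set cs <= car R ==> set ds <= car R ==>
  horner b a (map2 (\<oplus>) cs ds) = horner b a cs \<oplus> horner b a ds"
 by (induction cs ds rule: list_induct2) (auto simp: l_distr a_ac)

lemma horner_mult: "e .: R ==> a .: R ==> b .: R ==> set cs <= car R ==>
  horner b a (map ((\<otimes>) e) cs) = e \<otimes> horner b a cs"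
 by (induction cs) (auto simp: r_distr m_assoc)

end

text \<open>Vanishing constant coefficients are removed by cancelling \<open>a\<close> on the right;
  at the first nonzero one the remaining terms form a left multiple of \<open>a\<close>. The set
  \<open>S\<close> is kept apart from the coefficients \<open>C\<close>: for the Ore condition the
  two agree, for inverting elements of a finite-dimensional algebra \<open>C\<close> is the ground
  division ring and \<open>S\<close> the algebra.\<close>

lemma (in skew_field) horner_relation:
 assumes ab: "a .: R" "b .: R" "a ~= \<zero>" "b ~= \<zero>" and C: "C <= car R"
  and S: "S <= car R" "\<zero> : S" "!!s. s : S ==> s \<otimes> a : S" "!!s t. s : S ==> t : S ==> s \<oplus> t : S"
   "!!s. s : S ==> \<ominus> s : S" "!!c. c : C ==> c \<otimes> b : S"
 shows "set cs <= C ==> horner b a cs = \<zero> ==> EX c:set cs. c ~= \<zero> ==> EX c:C. c ~= \<zero> & (EX s:S. c \<otimes> b = s \<otimes> a)"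
proof (induction cs)
 case (Cons c cs)
 have "horner b a ds : S" if "set ds <= C" for ds using that by (induction ds) (auto simp: S)
 hence h: "horner b a cs : S" using Cons.prems by simp
 hence hc: "horner b a cs .: R" "c .: R" using S C Cons.prems by auto
 show ?case
 proof (cases "c = \<zero>")
  case True
  hence "horner b a cs = \<zero>" using Cons.prems hc ab by (simp add: no_zero_div)
  thus ?thesis using Cons True by auto
 next
  case False
  have "c \<otimes> b = \<ominus> (horner b a cs \<otimes> a)" using Cons.prems(2) hc ab by (metis add.inv_equality horner.simps(2) m_closed a_comm)
  hence "c \<otimes> b = (\<ominus> horner b a cs) \<otimes> a" using hc ab by (simp add: l_minus)
  thus ?thesis using False Cons.prems S(5)[OF h] by auto
 qed
qed simp

text \<open>If \<open>\<Sum>\<^sub>i\<^sub><\<^sub>n C b a\<^sup>i\<close> stabilizes, a relation \<open>\<Sum>\<^sub>i c\<^sub>i b a\<^sup>i = 0\<close> exists, and cancelling powers of \<open>a\<close>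
 on the right makes its constant coefficient nonzero.\<close>
lemma (in skew_field) acc_relation:
 assumes ab: "a .: R" "b .: R" "a ~= \<zero>" "b ~= \<zero>"
  and C: "C <= car R" "\<zero> : C" "\<one> : C" "!!c d. c : C ==> d : C ==> c \<oplus> d : C" "!!c. c : C ==> \<ominus> c : C"
   "!!c d. c : C ==> d : C ==> c \<otimes> d : C"
  and S: "S <= car R" "\<zero> : S" "!!s. s : S ==> s \<otimes> a : S" "!!s t. s : S ==> t : S ==> s \<oplus> t : S"
   "!!s. s : S ==> \<ominus> s : S" "!!c. c : C ==> c \<otimes> b : S"
  and acc: "ACC P"
  and P: "!!V. V <= S ==> left_subspace R C V ==> P V"
 shows "EX c:C. c ~= \<zero> & (EX s:S. c \<otimes> b = s \<otimes> a)"
proof -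
 define I where "I n = {horner b a cs | cs. set cs <= C & length cs = n}" for n :: nat
 have cC: "set cs <= C ==> set cs <= car R" for cs using C by blast
 have hS: "horner b a ds : S" if "set ds <= C" for ds using that by (induction ds) (auto simp: S)
 have sub: "left_subspace R C (I n)" for n unfolding left_subspace_def
 proof (intro conjI ballI)
  show "I n <= car R" using cC ab by (auto simp: I_def)
  show "\<zero> : I n" using C ab unfolding I_def by (intro CollectI exI[of _ "replicate n \<zero>"]) (auto simp: horner_zeros)
 next
  fix x y assume "x : I n" "y : I n"
  then obtain cs ds where cd: "set cs <= C" "set ds <= C" "length cs = n" "length ds = n" "x = horner b a cs" "y = horner b a ds"
   by (auto simp: I_def)
  moreover have "set (map2 (\<oplus>) cs ds) <= C" using cd C(4) by (auto simp: set_zip subset_iff in_set_conv_nth)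
  ultimately show "x \<oplus> y : I n" unfolding I_def
   using ab cC by (intro CollectI exI[of _ "map2 (\<oplus>) cs ds"]) (auto simp: horner_add)
 next
  fix c x assume c: "c : C" and "x : I n"
  then obtain cs where cs: "set cs <= C" "length cs = n" "x = horner b a cs" by (auto simp: I_def)
  hence "c \<otimes> x = horner b a (map ((\<otimes>) c) cs)" using horner_mult[of c a b cs] c C(1) cC ab by auto
  moreover have "set (map ((\<otimes>) c) cs) <= C" using c cs(1) C(6) by auto
  ultimately show "c \<otimes> x : I n" unfolding I_def using cs(2) by (intro CollectI exI[of _ "map ((\<otimes>) c) cs"]) simp
 qed
 have "P (I n)" for n by (rule P[OF _ sub]) (use hS in "auto simp: I_def")
 moreover have "I n <= I (Suc n)" for n
 proof
  fix x assume "x : I n"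
  then obtain cs where "set cs <= C" "length cs = n" "x = horner b a cs" by (auto simp: I_def)
  thus "x : I (Suc n)" unfolding I_def using ab cC C
   by (intro CollectI exI[of _ "cs @ [\<zero>]"]) (auto simp: horner_snoc_zero)
 qed
 ultimately obtain N where N: "ALL n>=N. I n = I N" using acc unfolding ascending_chain_condition_def by blast
 \<comment> \<open>\<open>?e\<close> encodes \<open>b a^N\<close>, which by stabilization equals an
   element of \<open>I N\<close> with coefficients \<open>cs\<close>. The difference of the two
   lists is a relation whose last coefficient is 1.\<close>
 let ?e = "replicate N \<zero> @ [\<one>]"
 have e: "set ?e <= C" using C by auto
 hence "horner b a ?e : I (Suc N)" unfolding I_def by (intro CollectI exI[of _ ?e]) simp
 moreover have "I (Suc N) = I N" by (rule N[rule_format]) simp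
 ultimately have "horner b a ?e : I N" by (simp only:)
 then obtain cs where cs: "set cs <= C" "length cs = N" "horner b a ?e = horner b a cs" by (auto simp: I_def)
 let ?d = "map ((\<otimes>) (\<ominus> \<one>)) (cs @ [\<zero>])"
 have m1: "\<ominus> \<one> : C" using C by blast
 have d: "set ?d <= C" using m1 cs(1) C by (auto simp: subset_iff)
 have "horner b a (map2 (\<oplus>) ?e ?d) = horner b a ?e \<oplus> horner b a ?d"
  by (rule horner_add) (use ab cC e d cs in auto)
 also have "horner b a ?d = (\<ominus> \<one>) \<otimes> horner b a (cs @ [\<zero>])" by (rule horner_mult) (use ab cC[OF cs(1)] in auto)
 also have "horner b a (cs @ [\<zero>]) = horner b a ?e" using horner_snoc_zero[OF ab(1,2) cC[OF cs(1)]] cs(3) by simp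
 also have "horner b a ?e \<oplus> (\<ominus> \<one>) \<otimes> horner b a ?e = \<zero>" using horner_closed[OF ab(1,2) cC[OF e]] by (simp add: l_minus r_neg)
 finally have 0: "horner b a (map2 (\<oplus>) ?e ?d) = \<zero>" .
 have s: "set (map2 (\<oplus>) ?e ?d) <= C"
 proof
  fix z assume "z : set (map2 (\<oplus>) ?e ?d)"
  then obtain x y where "z = x \<oplus> y" "(x, y) : set (zip ?e ?d)" by auto
  thus "z : C" using set_zip_leftD set_zip_rightD e d C(4) by (metis subsetD)
 qed
 have "map2 (\<oplus>) ?e ?d = map2 (\<oplus>) (replicate N \<zero>) (map ((\<otimes>) (\<ominus> \<one>)) cs) @ [\<one>]" using cs(2) by simp
 hence "\<one> : set (map2 (\<oplus>) ?e ?d)" by (metis in_set_conv_decomp)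
 hence "EX c:set (map2 (\<oplus>) ?e ?d). c ~= \<zero>" using one_nonzero by blast
 from horner_relation[OF ab C(1) S s 0 this] show ?thesis .
qed

section \<open>Finite-dimensional subspaces and algebras\<close>

primrec (in ring) fspan :: "'a set => (nat => 'a) => nat => 'a set" where
 "fspan E v 0 = {\<zero>}"
| "fspan E v (Suc n) = {x \<oplus> c \<otimes> v n | x c. x : fspan E v n & c : E}"

lemma (in ring) fspan_SucI: "x : fspan E v n ==> c : E ==> x \<oplus> c \<otimes> v n : fspan E v (Suc n)"
 by auto

lemma (in ring) fspan_closed:
 assumes "E <= car R" "!!i. v i .: R"
 shows "fspan E v n <= car R"
 using assms by (induction n) (auto simp: subset_iff)

lemma (in ring) fspan_subspace:
 assumes E: "div_subring R E" and v: "!!i. v i .: R"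
 shows "left_subspace R E (fspan E v n)"
proof (induction n)
 case 0 thus ?case using div_subringD(1)[OF E] by (auto simp: left_subspace_def)
next
 case (Suc n)
 note FD = left_subspaceD[OF Suc] and ED = div_subringD[OF E]
 show ?case unfolding left_subspace_def
 proof (intro conjI ballI)
  show "fspan E v (Suc n) <= car R" using fspan_closed[of E v "Suc n"] ED(1) v by blast
  have "\<zero> = \<zero> \<oplus> \<zero> \<otimes> v n" using v by simp
  thus "\<zero> : fspan E v (Suc n)" using FD(2) ED(2) by auto
 next
  fix x y assume "x : fspan E v (Suc n)" "y : fspan E v (Suc n)"
  then obtain x' c y' d where x: "x = x' \<oplus> c \<otimes> v n" "y = y' \<oplus> d \<otimes> v n" "x' : fspan E v n" "y' : fspan E v n" "c : E" "d : E"
   by auto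
  have "x \<oplus> y = (x' \<oplus> y') \<oplus> (c \<oplus> d) \<otimes> v n" using x FD(1) ED(1) v by (simp add: l_distr a_ac)
  thus "x \<oplus> y : fspan E v (Suc n)" using fspan_SucI[OF FD(3)[OF x(3,4)] ED(4)[OF x(5,6)]] by simp
 next
  fix e x assume e: "e : E" and "x : fspan E v (Suc n)"
  then obtain x' c where x: "x = x' \<oplus> c \<otimes> v n" "x' : fspan E v n" "c : E" by auto
  have "e \<otimes> x = e \<otimes> x' \<oplus> (e \<otimes> c) \<otimes> v n" using x e FD(1) ED(1) v by (simp add: r_distr m_assoc)
  thus "e \<otimes> x : fspan E v (Suc n)" using fspan_SucI[OF FD(4)[OF e x(2)] ED(5)[OF e x(3)]] by simp
 qed
qed

lemma (in ring) fspan_single: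
 assumes E: "div_subring R E" and v: "!!i. v i .: R"
 shows "i < n ==> c : E ==> c \<otimes> v i : fspan E v n"
proof (induction n)
 case (Suc n)
 note ED = div_subringD[OF E]
 have cv: "c \<otimes> v i .: R" using ED Suc v by auto
 show ?case
 proof (cases "i = n")
  case True
  have "c \<otimes> v n = \<zero> \<oplus> c \<otimes> v n" using cv True by simp
  thus ?thesis using True fspan_SucI[OF left_subspaceD(2)[OF fspan_subspace[of E v n, OF E v]] Suc.prems(2)] by simp
 next
  case False
  have "c \<otimes> v i = c \<otimes> v i \<oplus> \<zero> \<otimes> v n" using cv v by simp
  thus ?thesis using False Suc fspan_SucI[OF _ ED(2), of "c \<otimes> v i" v n] by simp
 qed
qed simp

text \<open>Once the intersections with the span of the first \<open>n\<close> vectors are constant,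
  the chain can grow only in the direction of \<open>v n\<close>, hence at most once more.\<close>

lemma (in ring) acc_fspan:
 assumes E: "div_subring R E" and v: "!!i. v i .: R"
 shows "ACC (%V. V <= fspan E v n & left_subspace R E V)"
proof (induction n)
 case 0
 show ?case unfolding ascending_chain_condition_def
 proof (intro allI impI)
  fix C :: "nat => 'a set" assume C: "(ALL n. C n <= fspan E v 0 & left_subspace R E (C n)) & (ALL n. C n <= C (Suc n))"
  hence "C n = {\<zero>}" for n using left_subspaceD(2)[of R E "C n"] by auto
  thus "EX N. ALL n>=N. C n = C N" by simp
 qed
next
 case (Suc n)
 note ED = div_subringD[OF E]
 show ?case unfolding ascending_chain_condition_def
 proof (intro allI impI)
  fix C :: "nat => 'a set" assume C0: "(ALL k. C k <= fspan E v (Suc n) & left_subspace R E (C k)) & (ALL k. C k <= C (Suc k))"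
  hence C: "!!k. C k <= fspan E v (Suc n)" "!!k. left_subspace R E (C k)" "!!i j. i <= j ==> C i <= C j"
   using lift_Suc_mono_le[of C] by blast+
  let ?F = "fspan E v n"
  have Fc: "?F <= car R" using fspan_closed[of E v n] ED(1) v by blast
  note F = fspan_subspace[of E v n, OF E v]
  have "left_subspace R E (C k \<inter> ?F)" for k using C(2)[of k] F by (auto simp: left_subspace_def)
  hence "(ALL k. C k \<inter> ?F <= ?F & left_subspace R E (C k \<inter> ?F)) & (ALL k. C k \<inter> ?F <= C (Suc k) \<inter> ?F)"
   using C0 by blast
  hence "EX N. ALL k>=N. C k \<inter> ?F = C N \<inter> ?F"
   using Suc.IH[unfolded ascending_chain_condition_def, rule_format, of "%k. C k \<inter> ?F"] by blast
  then obtain N where N: "!!k. k >= N ==> C k \<inter> ?F = C N \<inter> ?F" by blast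
  show "EX N. ALL k>=N. C k = C N"
  proof (cases "EX M. \<not> C M <= ?F")
   case False
   hence "C k = C N" if "k >= N" for k using N[OF that] by blast
   thus ?thesis by blast
  next
   case True
   then obtain M x where x: "x : C M" "x ~: ?F" by blast
   then obtain y a where y: "x = y \<oplus> a \<otimes> v n" "y : ?F" "a : E" using C(1)[of M] by auto
   have "a ~= \<zero>" using x y Fc v by auto
   then obtain a' where a': "a' : E" "a' \<otimes> a = \<one>" using ED(7) y by blast
   have "C k <= C (max N M)" if k: "k >= max N M" for k
   proof
    fix z assume z: "z : C k"
    then obtain w b where w: "z = w \<oplus> b \<otimes> v n" "w : ?F" "b : E" using C(1)[of k] by auto
    \<comment> \<open>Chosen so that adding \<open>?c x\<close> cancels the
      \<open>v n\<close>-component of \<open>z\<close>; the result lies in the smaller span, where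
      the chain is already constant.\<close>
    let ?c = "\<ominus> (b \<otimes> a')"
    have c: "?c : E" by (rule ED(6)[OF ED(5)[OF w(3) a'(1)]])
    have m: "?c \<otimes> x : C (max N M)" using left_subspaceD(4)[OF C(2) c] x(1) C(3)[of M "max N M"] by auto
    have cc: "w .: R" "y .: R" "a .: R" "a' .: R" "b .: R" "v n .: R"
     using w y a' Fc ED(1) v by auto
    have "?c \<otimes> (a \<otimes> v n) = \<ominus> (b \<otimes> ((a' \<otimes> a) \<otimes> v n))" using cc by (simp add: l_minus m_assoc)
    hence e: "?c \<otimes> (a \<otimes> v n) = \<ominus> (b \<otimes> v n)" using a' cc by simp
    have "z \<oplus> ?c \<otimes> x = w \<oplus> ?c \<otimes> y \<oplus> (b \<otimes> v n \<oplus> ?c \<otimes> (a \<otimes> v n))" unfolding w(1) y(1) using cc by (simp add: r_distr a_ac)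
    hence "z \<oplus> ?c \<otimes> x = w \<oplus> ?c \<otimes> y" unfolding e using cc by (simp add: r_neg)
    hence "z \<oplus> ?c \<otimes> x : ?F" using left_subspaceD(3)[OF F w(2) left_subspaceD(4)[OF F c y(2)]] by simp
    moreover have "z \<oplus> ?c \<otimes> x : C k" using left_subspaceD(3)[OF C(2) z] m C(3)[OF k] by blast
    ultimately have "z \<oplus> ?c \<otimes> x : C (max N M)" using N[of k] N[of "max N M"] k by auto
    hence "(z \<oplus> ?c \<otimes> x) \<oplus> \<ominus> (?c \<otimes> x) : C (max N M)"
     using left_subspaceD(3)[OF C(2)] left_subspace_neg[OF E C(2) m] by blast
    moreover have "(z \<oplus> ?c \<otimes> x) \<oplus> \<ominus> (?c \<otimes> x) = z" using left_subspaceD(1)[OF C(2)] z m by (simp add: a_assoc r_neg)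
    ultimately show "z : C (max N M)" by simp
   qed
   hence "C k = C (max N M)" if "k >= max N M" for k using C(3)[OF that] that by blast
   thus ?thesis by blast
  qed
 qed
qed

text \<open>With \<open>b = 1\<close> and \<open>a = x\<close>, the relation from
  \<open>acc_relation\<close> says that some nonzero element of \<open>E\<close> has the form
  \<open>s x\<close> with \<open>s\<close> in \<open>A\<close>; dividing by it gives the
  inverse.\<close>

lemma (in skew_field) fspan_left_inverse:
 assumes E: "div_subring R E" and v: "!!i. v i .: R"
  and A: "A <= fspan E v n" "E <= A" "!!x y. x : A ==> y : A ==> x \<oplus> y : A & x \<otimes> y : A" "!!x. x : A ==> \<ominus> x : A"
  and x: "x : A" "x ~= \<zero>"
 shows "inv x : A"
proof -
 note ED = div_subringD[OF E]
 have Ac: "A <= car R" using A(1) fspan_closed[of E v n] ED(1) v by blast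
 have "EX c:E. c ~= \<zero> & (EX s:A. c \<otimes> \<one> = s \<otimes> x)"
  by (rule acc_relation[OF _ _ _ _ _ _ _ _ _ _ _ _ _ _ _ _ acc_fspan[of E v n, OF E v]])
   (use x Ac A ED in "auto simp: subset_iff")
 then obtain c s where c: "c : E" "c ~= \<zero>" "s : A" "c = s \<otimes> x" using ED(1) by auto
 obtain d where d: "d : E" "d \<otimes> c = \<one>" using ED(7)[OF c(1,2)] by blast
 have k: "d .: R" "s .: R" "x .: R" using c d ED(1) Ac x by auto
 have "(d \<otimes> s) \<otimes> x = \<one>" using d(2) unfolding c(4) using k by (simp add: m_assoc)
 hence "inv x = d \<otimes> s" using inv_unique'[of x "d \<otimes> s"] k by simp
 moreover have "d \<otimes> s : A" using A d c by blast
 ultimately show ?thesis by simp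
qed

section \<open>Ore localization inside a division algebra\<close>

context division_algebra begin

lemma left_ideal_subspace:
 assumes R: "unital_subalgebra K A R" and V: "V <= R" "left_subspace A R V"
 shows "left_ideal V (A on R)"
proof -
 note RD = unital_subalgebraD[OF R] and VD = left_subspaceD[OF V(2)]
 interpret B: assoc_algebra K "A on R" by (rule unital_subalgebra_algebra[OF R])
 have neg: "\<ominus>\<^sub>A x : V" if "x : V" for x
  using VD(4)[OF RD(6)[OF RD(3)] that] VD(1)[OF that] by (simp add: A.l_minus)
 have ai: "\<ominus>\<^bsub>A on R\<^esub> x = \<ominus>\<^sub>A x" if "x : R" for x
  by (rule B.M.minus_equality) (use that RD in "auto simp: M.l_neg")
 have i: "inv\<^bsub>add_monoid (A on R)\<^esub> x : V" if "x : V" for x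
  using neg[OF that] ai[OF subsetD[OF V(1) that]] unfolding a_inv_def by simp
 have "additive_subgroup V (A on R)"
  by (intro additive_subgroup.intro subgroup.intro)
   (use V VD i in auto)
 thus ?thesis using VD(4) by (auto simp: left_ideal_def)
qed

lemma left_ore:
 assumes R: "unital_subalgebra K A R" and acc: "ACC (%I. left_ideal I (A on R))"
  and ab: "a : R" "b : R" "a ~= \<zero>\<^sub>A" "b ~= \<zero>\<^sub>A"
 shows "EX c:R. c ~= \<zero>\<^sub>A & (EX s:R. c \<otimes>\<^sub>A b = s \<otimes>\<^sub>A a)"
 by (rule acc_relation[OF _ _ _ _ _ _ _ _ _ _ _ _ _ _ _ _ acc])
  (use unital_subalgebraD[OF R] ab left_ideal_subspace[OF R] in "auto simp: subset_iff")

end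

lemma left_ideal_opposite: "left_ideal I (Opp A) \<longleftrightarrow> right_ideal I A"
 by (simp add: left_ideal_def right_ideal_def additive_subgroup_def opposite_algebra_def)

lemma opposite_carrier: "((Opp A) on R) = Opp (A on R)"
 by (simp add: opposite_algebra_def)

lemma finsum_opposite [simp]: "finsum (Opp A) f I = finsum A f I"
 by (simp add: finsum_def opposite_algebra_def)

lemma unital_subalgebra_opposite: "unital_subalgebra K A R ==> unital_subalgebra K (Opp A) R"
 by (auto simp: unital_subalgebra_def)

lemma inv_opposite [simp]: "inv\<^bsub>Opp A\<^esub> x = inv\<^bsub>A\<^esub> x"
 unfolding m_inv_def by (simp add: conj_commute)

context division_algebra begin

lemma right_ore:
 assumes R: "unital_subalgebra K A R" and acc: "ACC (%I. right_ideal I (A on R))"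
  and ab: "a : R" "b : R" "a ~= \<zero>\<^sub>A" "b ~= \<zero>\<^sub>A"
 shows "EX c:R. c ~= \<zero>\<^sub>A & (EX s:R. b \<otimes>\<^sub>A c = a \<otimes>\<^sub>A s)"
 using division_algebra.left_ore[OF division_algebra_opposite[OF division_algebra_axioms] unital_subalgebra_opposite[OF R], of a b]
  acc ab by (simp add: opposite_carrier left_ideal_opposite)

lemma noeth_domain_iff:
 assumes R: "unital_subalgebra K A R"
 shows "noeth_domain (A on R) \<longleftrightarrow> ACC (%I. left_ideal I (A on R)) &
  ACC (%I. right_ideal I (A on R))"
proof -
 interpret B: assoc_algebra K "A on R" by (rule unital_subalgebra_algebra[OF R])
 show ?thesis using unital_subalgebraD(1)[OF R] B.A.ring_axioms no_zero_div by (auto simp: noeth_domain_def)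
qed

lemma common_denominator:
 assumes R: "unital_subalgebra K A R" and noeth: "noeth_domain (A on R)"
  and m: "u : R" "u ~= \<zero>\<^sub>A" "v : R" "v ~= \<zero>\<^sub>A"
 obtains c s where "c : R" "s : R" "c \<otimes>\<^sub>A u = s \<otimes>\<^sub>A v" "c \<otimes>\<^sub>A u ~= \<zero>\<^sub>A"
proof -
 have "EX c:R. c ~= \<zero>\<^sub>A & (EX s:R. c \<otimes>\<^sub>A u = s \<otimes>\<^sub>A v)"
  by (rule left_ore[OF R _ m(3,1,4,2)]) (use noeth noeth_domain_iff[OF R] in blast)
 thus thesis using that m unital_subalgebraD(1)[OF R] by (metis no_zero_div)
qed

text \<open>Describing a fraction by a denominator that clears it turns the closure properties into
  questions about common denominators, without inverses.\<close>

lemma fractions_in_iff: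
 assumes R: "unital_subalgebra K A R"
 shows "q : fractions_in A R \<longleftrightarrow> q .: A & (EX u:R. u ~= \<zero>\<^sub>A & u \<otimes>\<^sub>A q : R)"
proof
 note RD = unital_subalgebraD[OF R]
 assume "q : fractions_in A R"
 thus "q .: A & (EX u:R. u ~= \<zero>\<^sub>A & u \<otimes>\<^sub>A q : R)"
  using RD(1) by (auto simp: fractions_in_def intro!: bexI)
next
 assume "q .: A & (EX u:R. u ~= \<zero>\<^sub>A & u \<otimes>\<^sub>A q : R)"
 then obtain u where u: "q .: A" "u : R" "u ~= \<zero>\<^sub>A" "u \<otimes>\<^sub>A q : R" by blast
 hence "q = inv\<^bsub>A\<^esub> u \<otimes>\<^sub>A (u \<otimes>\<^sub>A q)" using unital_subalgebraD(1)[OF R] by simp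
 thus "q : fractions_in A R" using u unfolding fractions_in_def by blast
qed

lemma unital_subset_fractions: "unital_subalgebra K A R ==> R <= fractions_in A R"
 using unital_subalgebraD[of K A R] by (auto simp: fractions_in_iff intro!: bexI[of _ "\<one>\<^sub>A"])

lemma fractions_division_subalgebra:
 assumes R: "unital_subalgebra K A R" and noeth: "noeth_domain (A on R)"
 shows "division_subalgebra K A (fractions_in A R)"
proof -
 note RD = unital_subalgebraD[OF R] and iff = fractions_in_iff[OF R]
 let ?Q = "fractions_in A R"
 have add: "p \<oplus>\<^sub>A q : ?Q" if pq: "p : ?Q" "q : ?Q" for p q
 proof -
  obtain u v where u: "p .: A" "q .: A" "u : R" "u ~= \<zero>\<^sub>A" "u \<otimes>\<^sub>A p : R" "v : R" "v ~= \<zero>\<^sub>A" "v \<otimes>\<^sub>A q : R"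
   using pq unfolding iff by blast
  obtain c s where c: "c : R" "s : R" "c \<otimes>\<^sub>A u = s \<otimes>\<^sub>A v" "c \<otimes>\<^sub>A u ~= \<zero>\<^sub>A"
   using common_denominator[OF R noeth u(3,4,6,7)] .
  have "(c \<otimes>\<^sub>A u) \<otimes>\<^sub>A q = s \<otimes>\<^sub>A (v \<otimes>\<^sub>A q)" unfolding c(3) using u c(1,2) RD(1) by (simp add: A.m_assoc)
  hence "(c \<otimes>\<^sub>A u) \<otimes>\<^sub>A (p \<oplus>\<^sub>A q) = c \<otimes>\<^sub>A (u \<otimes>\<^sub>A p) \<oplus>\<^sub>A s \<otimes>\<^sub>A (v \<otimes>\<^sub>A q)"
   using u c(1,2) RD(1) A.r_distr[of p q "c \<otimes>\<^sub>A u"] by (simp add: A.m_assoc)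
  also have "... : R" by (rule RD(4)[OF RD(5)[OF c(1) u(5)] RD(5)[OF c(2) u(8)]])
  finally show ?thesis using u c RD(5)[OF c(1) u(3)] unfolding iff by auto
 qed
 have mult: "p \<otimes>\<^sub>A q : ?Q" if pq: "p : ?Q" "q : ?Q" for p q
 proof -
  obtain u v where u: "p .: A" "q .: A" "u : R" "u ~= \<zero>\<^sub>A" "u \<otimes>\<^sub>A p : R" "v : R" "v ~= \<zero>\<^sub>A" "v \<otimes>\<^sub>A q : R"
   using pq unfolding iff by blast
  show ?thesis
  proof (cases "p = \<zero>\<^sub>A")
   case True
   thus ?thesis using u RD unfolding iff by (auto intro!: bexI[of _ "\<one>\<^sub>A"])
  next
   case False
   hence "u \<otimes>\<^sub>A p ~= \<zero>\<^sub>A" using u RD(1) by (simp add: no_zero_div)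
   \<comment> \<open>The numerator of \<open>p\<close> and the denominator of \<open>q\<close> are
     given a common left multiple, so that the middle of \<open>u^-1 (u p) v^-1 (v q)\<close> can be
     cancelled.\<close>
   then obtain c s where c: "c : R" "s : R" "c \<otimes>\<^sub>A (u \<otimes>\<^sub>A p) = s \<otimes>\<^sub>A v" "c \<otimes>\<^sub>A (u \<otimes>\<^sub>A p) ~= \<zero>\<^sub>A"
    using common_denominator[OF R noeth u(5) _ u(6,7)] by blast
   have "(c \<otimes>\<^sub>A u) \<otimes>\<^sub>A (p \<otimes>\<^sub>A q) = (c \<otimes>\<^sub>A (u \<otimes>\<^sub>A p)) \<otimes>\<^sub>A q" using u c(1) RD(1) by (simp add: A.m_assoc)
   also have "... = s \<otimes>\<^sub>A (v \<otimes>\<^sub>A q)" unfolding c(3) using u c(2) RD(1) by (simp add: A.m_assoc)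
   also have "... : R" by (rule RD(5)[OF c(2) u(8)])
   finally have 1: "(c \<otimes>\<^sub>A u) \<otimes>\<^sub>A (p \<otimes>\<^sub>A q) : R" .
   have "c ~= \<zero>\<^sub>A"
   proof
    assume "c = \<zero>\<^sub>A"
    hence "c \<otimes>\<^sub>A (u \<otimes>\<^sub>A p) = \<zero>\<^sub>A" using RD(1)[OF u(5)] by simp
    thus False using c(4) by simp
   qed
   hence "c \<otimes>\<^sub>A u ~= \<zero>\<^sub>A" using RD(1)[OF c(1)] RD(1)[OF u(3)] u(4) by (simp add: no_zero_div)
   with 1 show ?thesis using u RD(5)[OF c(1) u(3)] unfolding iff by auto
  qed
 qed
 have sub: "R <= ?Q" by (rule unital_subset_fractions[OF R])
 have neg: "\<ominus>\<^sub>A q : ?Q" if "q : ?Q" for q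
  using mult[OF subsetD[OF sub RD(6)[OF RD(3)]] that] that unfolding iff by (simp add: A.l_minus)
 have scal: "c \<odot>\<^sub>A q : ?Q" if "c .: K" "q : ?Q" for c q
  using mult[OF subsetD[OF sub RD(7)[OF that(1) RD(3)]] that(2)] that unfolding iff by (simp add: scal_mult)
 have inv: "inv\<^bsub>A\<^esub> q : ?Q" if q: "q : ?Q" "q ~= \<zero>\<^sub>A" for q
 proof -
  obtain u where u: "q .: A" "u : R" "u ~= \<zero>\<^sub>A" "u \<otimes>\<^sub>A q : R" using q unfolding iff by blast
  have "(u \<otimes>\<^sub>A q) \<otimes>\<^sub>A inv\<^bsub>A\<^esub> q = u" using u q RD(1) by (simp add: A.m_assoc)
  moreover have "u \<otimes>\<^sub>A q ~= \<zero>\<^sub>A" using u q RD(1) by (simp add: no_zero_div)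
  ultimately show ?thesis using u q unfolding iff by (metis inv_nz(1))
 qed
 have "div_subring A ?Q" unfolding div_subring_def
 proof (intro conjI ballI impI)
  fix c assume c: "c : ?Q" "c ~= \<zero>\<^sub>A"
  hence "c .: A" unfolding iff by blast
  thus "EX d:?Q. d \<otimes>\<^sub>A c = \<one>\<^sub>A & c \<otimes>\<^sub>A d = \<one>\<^sub>A" using inv[OF c] c(2) by (intro bexI[of _ "inv\<^bsub>A\<^esub> c"]) auto
 qed (use sub RD add mult neg iff in auto)
 thus ?thesis using scal by (simp add: division_subalgebra_iff)
qed

lemma division_subalgebra_inv:
 assumes "division_subalgebra K A E" "x : E" "x ~= \<zero>\<^sub>A"
 shows "inv\<^bsub>A\<^esub> x : E" "inv\<^bsub>A on E\<^esub> x = inv\<^bsub>A\<^esub> x"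
proof -
 interpret E: division_algebra K "A on E" using assms(1) by (simp add: division_subalgebra_def)
 have d: "div_subring A E" using assms(1) by (simp add: division_subalgebra_iff)
 note ED = div_subringD[OF d]
 obtain d where d: "d : E" "d \<otimes>\<^sub>A x = \<one>\<^sub>A" using ED(7) assms by blast
 hence i: "inv\<^bsub>A\<^esub> x = d" using inv_unique'[of x d] ED(1) assms(2) by blast
 thus "inv\<^bsub>A\<^esub> x : E" using d by simp
 show "inv\<^bsub>A on E\<^esub> x = inv\<^bsub>A\<^esub> x" using E.inv_unique'[of x d] d i assms(2) by simp
qed

text \<open>\<open>fractions_in\<close> provides left fractions. To rewrite \<open>q\<close> as a
  right fraction, the right Ore condition is applied to a denominator \<open>u\<close> and the
  numerator \<open>u q\<close>, and \<open>u\<close> is cancelled.\<close>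

lemma fractions_quotient:
 assumes R: "unital_subalgebra K A R" and noeth: "noeth_domain (A on R)"
 shows "quotient_division_algebra K (A on R) (A on fractions_in A R) id"
proof -
 note RD = unital_subalgebraD[OF R] and iff = fractions_in_iff[OF R]
 let ?Q = "fractions_in A R"
 note Q = fractions_division_subalgebra[OF R noeth]
 note QD = div_subringD[OF conjunct1[OF Q[unfolded division_subalgebra_iff]]]
 have sub: "R <= ?Q" by (rule unital_subset_fractions[OF R])
 have i: "inv\<^bsub>A on ?Q\<^esub> u = inv\<^bsub>A\<^esub> u" "inv\<^bsub>A\<^esub> u : ?Q" if "u : R" "u ~= \<zero>\<^sub>A" for u
  using division_subalgebra_inv[OF Q subsetD[OF sub that(1)] that(2)] by simp_all
 have "EX u w. q = w \<otimes>\<^sub>A inv\<^bsub>A\<^esub> u & u : R & u ~= \<zero>\<^sub>A & w : R" if q: "q : ?Q" for q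
 proof (cases "q = \<zero>\<^sub>A")
  case True thus ?thesis using RD(2,3) by (intro exI[of _ "\<one>\<^sub>A"] exI[of _ "\<zero>\<^sub>A"]) auto
 next
  case False
  obtain u where u: "q .: A" "u : R" "u ~= \<zero>\<^sub>A" "u \<otimes>\<^sub>A q : R" using q unfolding iff by blast
  have nz: "u \<otimes>\<^sub>A q ~= \<zero>\<^sub>A" using u RD(1) False by (simp add: no_zero_div)
  obtain c s where c: "c : R" "c ~= \<zero>\<^sub>A" "s : R" "(u \<otimes>\<^sub>A q) \<otimes>\<^sub>A c = u \<otimes>\<^sub>A s"
   using right_ore[OF R _ u(2,4,3) nz] noeth noeth_domain_iff[OF R] by blast
  hence "q \<otimes>\<^sub>A c = s" using u RD(1) lcancel[of u "q \<otimes>\<^sub>A c" s] by (simp add: A.m_assoc)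
  moreover have "q = (q \<otimes>\<^sub>A c) \<otimes>\<^sub>A inv\<^bsub>A\<^esub> c" using c u RD(1) by (simp add: A.m_assoc)
  ultimately show ?thesis using c by auto
 qed
 hence "?Q = {w \<otimes>\<^sub>A inv\<^bsub>A\<^esub> u | u w. u : R & u ~= \<zero>\<^sub>A & w : R}" using i(2) QD(5) sub by blast
 also have "... = {w \<otimes>\<^sub>A inv\<^bsub>A on ?Q\<^esub> u | u w. u : R & u ~= \<zero>\<^sub>A & w : R}" by (intro Collect_cong ex_cong1) (use i(1) in auto)
 finally have r: "?Q = ..." .
 have "?Q = {inv\<^bsub>A\<^esub> u \<otimes>\<^sub>A w | u w. u : R & u ~= \<zero>\<^sub>A & w : R}" by (simp add: fractions_in_def)
 also have "... = {inv\<^bsub>A on ?Q\<^esub> u \<otimes>\<^sub>A w | u w. u : R & u ~= \<zero>\<^sub>A & w : R}" by (intro Collect_cong ex_cong1) (use i(1) in auto)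
 finally have l: "?Q = ..." .
 have "id : alg_hom K (A on R) (A on ?Q)"
  using sub by (auto simp: alg_hom_def ring_hom_def)
 thus ?thesis unfolding quotient_division_algebra_def
  using Q l r by (simp add: division_subalgebra_def)
qed

lemma division_subalgebra_Inter:
 "\<C> ~= {} ==> (!!E. E : \<C> ==> division_subalgebra K A E) ==> division_subalgebra K A (\<Inter>\<C>)"
proof -
 assume ne: "\<C> ~= {}" and C: "!!E. E : \<C> ==> division_subalgebra K A E"
 have D: "div_subring A E" "c .: K ==> x : E ==> c \<odot>\<^sub>A x : E" if "E : \<C>" for E c x
  using C[OF that] by (auto simp: division_subalgebra_iff)
 note DD = div_subringD[OF D(1)]
 have sub: "\<Inter>\<C> <= car A" using ne DD(1) by blast
 show ?thesis unfolding division_subalgebra_iff div_subring_def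
 proof (intro conjI ballI impI)
  fix c assume c: "c : \<Inter>\<C>" "c ~= \<zero>\<^sub>A"
  hence "inv\<^bsub>A\<^esub> c : \<Inter>\<C>" using division_subalgebra_inv(1)[OF C _ c(2)] by blast
  thus "EX d:\<Inter>\<C>. d \<otimes>\<^sub>A c = \<one>\<^sub>A & c \<otimes>\<^sub>A d = \<one>\<^sub>A"
   using c sub by (intro bexI[of _ "inv\<^bsub>A\<^esub> c"]) auto
 qed (use sub D DD in auto)
qed

text \<open>If no finite subset generated \<open>E\<close>, adjoining again and again an element
  outside the division subalgebra generated so far would give a strictly ascending chain.\<close>

lemma acc_imp_fin_gen:
 assumes acc: "ACC (division_subalgebra K A)" and E: "division_subalgebra K A E"
 shows "fin_gen_division_algebra K (A on E)"
proof (rule ccontr)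
 assume no: "\<not> ?thesis"
 define cl where "cl X = \<Inter>{F. division_subalgebra K A F & X <= F}" for X
 have cl: "division_subalgebra K A (cl X)" "X <= cl X" "cl X <= E" if "X <= E" for X
  unfolding cl_def using E that by (auto intro!: division_subalgebra_Inter)
 have "EX x:E. x ~: cl X" if X: "finite X" "X <= E" for X
 proof (rule ccontr)
  assume "\<not> (EX x:E. x ~: cl X)"
  hence "E <= cl X" by blast
  have eq: "F = E" if F: "division_subalgebra K (A on E) F" "X <= F" for F
  proof -
   have "F <= E" "division_subalgebra K A F" using F(1) E by (auto simp: division_subalgebra_def)
   thus ?thesis using F(2) \<open>E <= cl X\<close> unfolding cl_def by blast
  qed
  have "division_algebra K (A on E)" using E by (simp add: division_subalgebra_def)
  hence "fin_gen_division_algebra K (A on E)"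
   unfolding fin_gen_division_algebra_def by (intro conjI exI[of _ X]) (use X eq in simp_all)
  thus False using no by blast
 qed
 hence "EX x. ALL X. finite X & X <= E --> x X : E & x X ~: cl X" by metis
 then obtain x where x: "!!X. finite X ==> X <= E ==> x X : E & x X ~: cl X" by blast
 define X where "X n = ((%Y. insert (x Y) Y) ^^ n) {}" for n
 have X: "finite (X n)" "X n <= E" for n by (induction n) (auto simp: X_def x)
 have s: "X (Suc n) = insert (x (X n)) (X n)" for n by (simp add: X_def)
 have "cl (X n) <= cl (X (Suc n))" for n unfolding cl_def s by blast
 then obtain N where N: "!!n. n >= N ==> cl (X n) = cl (X N)"
  using acc cl(1)[OF X(2)] unfolding ascending_chain_condition_def by (elim allE[of _ "%n. cl (X n)"]) blast
 have "x (X N) : cl (X (Suc N))" using cl(2)[OF X(2)[of "Suc N"]] s by blast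
 thus False using N[of "Suc N"] x[OF X] by auto
qed

end

section \<open>Graded division algebras\<close>

text \<open>What commuting derivations and commuting automorphisms have in common. \<open>V\<close>
  is indexed by all weights of the ambient group, including those with zero eigenspace; the group
  operation is written multiplicatively, so the constants are \<open>V \<one>\<close>.\<close>

locale graded = division_algebra K D + W: comm_group W
 for D :: "('k, 'd, 'e) module_scheme" (structure) and K :: "('k, 'r) ring_scheme" and W :: "('w, 'x) monoid_scheme" +
 fixes V :: "'w => 'd set"
 assumes V_sub: "V mu <= car D"
  and V_zero: "mu .: W ==> \<zero> : V mu"
  and V_add: "mu .: W ==> x : V mu ==> y : V mu ==> x \<oplus> y : V mu"
  and V_neg: "mu .: W ==> x : V mu ==> \<ominus> x : V mu"
  and V_smult: "mu .: W ==> c .: K ==> x : V mu ==> c \<odot> x : V mu"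
  and V_one: "\<one> : V \<one>\<^sub>W"
  and V_mult: "mu .: W ==> nu .: W ==> x : V mu ==> y : V nu ==> x \<otimes> y : V (mu \<otimes>\<^sub>W nu)"
  and V_inv: "mu .: W ==> x : V mu ==> x ~= \<zero> ==> inv x : V (inv\<^bsub>W\<^esub> mu)"
  and V_direct: "finite A ==> A <= car W ==> (!!mu. mu : A ==> f mu : V mu) ==> (\<Oplus>mu\<in>A. f mu) = \<zero> ==> mu : A ==> f mu = \<zero>"
begin

lemma Vc: "x : V mu ==> x .: D" using V_sub by blast

definition Ev where "Ev = {mu : car W. EX u:V mu. u ~= \<zero>}"

definition gsum where "gsum F = {(\<Oplus>mu\<in>A. f mu) | A f. finite A & A <= F & (ALL mu:A. f mu : V mu)}"

lemma subgroup_Ev: "subgroup Ev W"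
proof (rule W.subgroupI)
 show "Ev ~= {}" using V_one one_nonzero unfolding Ev_def by blast
 fix mu assume m: "mu : Ev"
 then obtain u where u: "mu .: W" "u : V mu" "u ~= \<zero>" by (auto simp: Ev_def)
 thus "inv\<^bsub>W\<^esub> mu : Ev" using V_inv[OF u] inv_nz(4)[OF Vc[OF u(2)] u(3)] u(1) unfolding Ev_def by auto
 fix nu assume "nu : Ev"
 then obtain v where v: "nu .: W" "v : V nu" "v ~= \<zero>" by (auto simp: Ev_def)
 have "u \<otimes> v ~= \<zero>" using u v Vc by (simp add: no_zero_div)
 thus "mu \<otimes>\<^sub>W nu : Ev" using V_mult[OF u(1) v(1) u(2) v(2)] u v unfolding Ev_def by auto
qed (auto simp: Ev_def)

lemma gsum_induct [consumes 2, case_names zero step]: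
 assumes F: "F <= car W" and x: "x : gsum F" and zero: "P \<zero>"
  and step: "!!mu v x. mu : F ==> v : V mu ==> x : gsum F ==> P x ==> P (v \<oplus> x)"
 shows "P x"
proof -
 obtain A f where A: "finite A" "A <= F" "ALL mu:A. f mu : V mu" "x = (\<Oplus>mu\<in>A. f mu)" using x by (auto simp: gsum_def)
 have "P (\<Oplus>mu\<in>A. f mu)" using A(1-3)
 proof (induction A rule: finite_induct)
  case (insert mu A)
  hence "(\<Oplus>mu\<in>insert mu A. f mu) = f mu \<oplus> (\<Oplus>mu\<in>A. f mu)"
   by (intro M.finsum_insert) (auto intro: Vc)
  moreover have "(\<Oplus>mu\<in>A. f mu) : gsum F" using insert by (auto simp: gsum_def)
  ultimately show ?case using insert step[of mu "f mu" "\<Oplus>mu\<in>A. f mu"] by auto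
 qed (simp add: zero)
 thus ?thesis using A by simp
qed

lemma gsum_zero: "\<zero> : gsum F"
 unfolding gsum_def by (intro CollectI exI[of _ "{}"]) simp

lemma gsum_step:
 assumes F: "F <= car W" and v: "mu : F" "v : V mu" and x: "x : gsum F"
 shows "v \<oplus> x : gsum F"
proof -
 obtain A f where A: "finite A" "A <= F" "!!mu. mu : A ==> f mu : V mu" "x = (\<Oplus>mu\<in>A. f mu)" using x by (auto simp: gsum_def)
 note Ac = Vc[OF A(3)]
 define g where "g = (%nu. if nu : A then f nu else \<zero>)"
 have g: "g nu : V nu" if "nu : F" for nu using that A(3) V_zero F by (auto simp: g_def)
 have gc: "g : B \<rightarrow> car D" for B using Ac by (auto simp: g_def)
 have "x = (\<Oplus>mu\<in>A. g mu)" unfolding A(4) using Ac by (intro M.finsum_cong') (auto simp: g_def)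
 also have "... = (\<Oplus>mu\<in>insert mu A. g mu)" using A(1) gc
  by (cases "mu : A") (auto simp: insert_absorb g_def Ac Pi_def)
 also have "... = g mu \<oplus> (\<Oplus>mu\<in>A - {mu}. g mu)"
  using M.finsum_insert[of "A - {mu}" mu g] A(1) gc[of UNIV] by (simp add: Pi_def)
 finally have vx: "v \<oplus> x = (v \<oplus> g mu) \<oplus> (\<Oplus>mu\<in>A - {mu}. g mu)"
  using Vc[OF v(2)] gc[of UNIV] by (simp add: M.a_assoc Pi_def M.finsum_closed)
 \<comment> \<open>\<open>k\<close> adds \<open>v\<close> to the component of weight
   \<open>mu\<close>, which may or may not be present already.\<close>
 define k where "k = g(mu := v \<oplus> g mu)"
 have k: "k mu = v \<oplus> g mu" "nu ~= mu ==> k nu = g nu" "k nu .: D" for nu using gc[of UNIV] Vc[OF v(2)] by (auto simp: k_def Pi_def)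
 have "(\<Oplus>mu\<in>A - {mu}. g mu) = (\<Oplus>nu\<in>A - {mu}. k nu)"
  using k by (intro M.finsum_cong') auto
 moreover have "k mu \<oplus> (\<Oplus>nu\<in>A - {mu}. k nu) = (\<Oplus>nu\<in>insert mu (A - {mu}). k nu)"
  by (rule M.finsum_insert[symmetric]) (use A(1) k(3) in auto)
 ultimately have e: "v \<oplus> x = (\<Oplus>nu\<in>insert mu (A - {mu}). k nu)" using vx k(1) by simp
 have "k nu : V nu" if "nu : F" for nu using that v g[OF that] V_add[of mu v "g mu"] g[OF v(1)] F k by (cases "nu = mu") auto
 thus ?thesis unfolding gsum_def e using A(1,2) v(1)
  by (intro CollectI exI[of _ "insert mu (A - {mu})"] exI[of _ k]) auto
qed

lemma gsum_V: "F <= car W ==> mu : F ==> v : V mu ==> v : gsum F"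
 using gsum_step[of F mu v \<zero>] gsum_zero Vc by simp

lemma gsum_closed: "F <= car W ==> x : gsum F ==> x .: D"
 by (induction rule: gsum_induct) (auto simp: Vc)

lemma gsum_mono: "x : gsum F ==> F <= F' ==> x : gsum F'"
 unfolding gsum_def by blast

lemma gsum_add:
 assumes F: "F <= car W" and x: "x : gsum F" and y: "y : gsum F"
 shows "x \<oplus> y : gsum F"
 using F x by (induction rule: gsum_induct) (use y gsum_step[OF F] gsum_closed[OF F] in "auto simp: Vc M.a_assoc")

lemma gsum_neg:
 assumes F: "F <= car W" and x: "x : gsum F"
 shows "\<ominus> x : gsum F"
 using F x
 by (induction rule: gsum_induct)
  (use F gsum_step[OF F] gsum_closed[OF F] gsum_zero V_neg in "auto simp: Vc M.minus_add subset_iff")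

lemma gsum_smult:
 assumes F: "F <= car W" and x: "x : gsum F" and c: "c .: K"
 shows "c \<odot> x : gsum F"
 using F x
 by (induction rule: gsum_induct)
  (use F c gsum_step[OF F] gsum_closed[OF F] gsum_zero V_smult in "auto simp: Vc smult_r_distr subset_iff")

lemma gsum_mult:
 assumes F: "subgroup F W" and x: "x : gsum F" and y: "y : gsum F"
 shows "x \<otimes> y : gsum F"
proof -
 note Fc = subgroup.subset[OF F]
 have 1: "v \<otimes> y : gsum F" if v: "mu : F" "v : V mu" for mu v
  using Fc y
 proof (induction rule: gsum_induct)
  case zero thus ?case using v Vc gsum_zero by simp
 next
  case (step nu w x)
  have "v \<otimes> w : V (mu \<otimes>\<^sub>W nu)" using V_mult v step Fc by blast
  thus ?case using step v Vc gsum_closed[OF Fc] subgroup.m_closed[OF F v(1) step(1)]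
   by (simp add: A.r_distr gsum_step[OF Fc])
 qed
 show ?thesis using Fc x
 proof (induction rule: gsum_induct)
  case zero thus ?case using gsum_closed[OF Fc y] gsum_zero by simp
 next
  case (step mu v x)
  thus ?case using Vc gsum_closed[OF Fc] y 1 gsum_add[OF Fc] by (simp add: A.l_distr)
 qed
qed

lemma gsum_subalgebra: "subgroup F W ==> unital_subalgebra K D (gsum F)"
 unfolding unital_subalgebra_def
 using subgroup.subset[of F W] subgroup.one_closed[of F W] gsum_closed[of F] gsum_zero[of F] gsum_V[OF _ _ V_one] gsum_add gsum_mult gsum_neg gsum_smult
 by auto

text \<open>The homogeneous component of weight \<open>mu\<close>. Presentations of \<open>x\<close>
  may differ in zero summands, hence the description through all of them; \<open>comp_finsum\<close>
  shows that they agree.\<close>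

definition comp where
 "comp mu x = (THE y. EX A f. finite A & A <= car W & (ALL nu:A. f nu : V nu) & x = (\<Oplus>nu\<in>A. f nu) & y = (if mu : A then f mu else \<zero>))"

lemma comp_finsum:
 assumes A: "finite A" "A <= car W" "!!nu. nu : A ==> f nu : V nu"
 shows "comp mu (\<Oplus>nu\<in>A. f nu) = (if mu : A then f mu else \<zero>)"
 unfolding comp_def
proof (rule the_equality)
 show "EX A' f'. finite A' & A' <= car W & (ALL nu:A'. f' nu : V nu) & (\<Oplus>nu\<in>A. f nu) = (\<Oplus>nu\<in>A'. f' nu) &
   (if mu : A then f mu else \<zero>) = (if mu : A' then f' mu else \<zero>)" using A by blast
 fix y assume "EX A' f'. finite A' & A' <= car W & (ALL nu:A'. f' nu : V nu) & (\<Oplus>nu\<in>A. f nu) = (\<Oplus>nu\<in>A'. f' nu) &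
   y = (if mu : A' then f' mu else \<zero>)"
 then obtain B g where B: "finite B" "B <= car W" "!!nu. nu : B ==> g nu : V nu" "(\<Oplus>nu\<in>A. f nu) = (\<Oplus>nu\<in>B. g nu)"
  "y = (if mu : B then g mu else \<zero>)" by blast
 \<comment> \<open>Both presentations are padded with zeros to the union of their index sets, where
   \<open>V_direct\<close> applies to the difference.\<close>
 let ?f = "%nu. if nu : A then f nu else \<zero>" and ?g = "%nu. if nu : B then g nu else \<zero>"
 have c: "?f nu .: D" "?g nu .: D" for nu using Vc[OF A(3)] Vc[OF B(3)] by auto
 have "(\<Oplus>nu\<in>A. f nu) = (\<Oplus>nu\<in>A \<union> B. ?f nu)"
  using A(1) B(1) Vc[OF A(3)] by (intro M.add.finprod_mono_neutral_cong_left) auto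
 moreover have "(\<Oplus>nu\<in>B. g nu) = (\<Oplus>nu\<in>A \<union> B. ?g nu)"
  using A(1) B(1) Vc[OF B(3)] by (intro M.add.finprod_mono_neutral_cong_left) auto
 moreover have "(\<Oplus>nu\<in>A \<union> B. \<ominus> ?g nu) = \<ominus> (\<Oplus>nu\<in>A \<union> B. ?g nu)"
 proof (rule M.minus_equality[symmetric])
  have "(\<Oplus>nu\<in>A \<union> B. \<ominus> ?g nu \<oplus> ?g nu) = (\<Oplus>nu\<in>A \<union> B. \<zero>)" using c by (intro M.finsum_cong') (auto simp: M.l_neg)
  moreover have "(\<Oplus>nu\<in>A \<union> B. \<ominus> ?g nu \<oplus> ?g nu) = (\<Oplus>nu\<in>A \<union> B. \<ominus> ?g nu) \<oplus> (\<Oplus>nu\<in>A \<union> B. ?g nu)"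
   by (rule M.finsum_addf) (use c in auto)
  ultimately show "(\<Oplus>nu\<in>A \<union> B. \<ominus> ?g nu) \<oplus> (\<Oplus>nu\<in>A \<union> B. ?g nu) = \<zero>" by simp
 qed ((rule M.finsum_closed, use c in auto)+)
 moreover have "(\<Oplus>nu\<in>A \<union> B. ?f nu \<oplus> \<ominus> ?g nu) = (\<Oplus>nu\<in>A \<union> B. ?f nu) \<oplus> (\<Oplus>nu\<in>A \<union> B. \<ominus> ?g nu)"
  by (rule M.finsum_addf) (use c in auto)
 moreover have "(\<Oplus>nu\<in>A \<union> B. ?g nu) .: D" by (rule M.finsum_closed) (use c in auto)
 ultimately have "(\<Oplus>nu\<in>A \<union> B. ?f nu \<oplus> \<ominus> ?g nu) = \<zero>" using B(4) by (simp add: M.r_neg)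
 moreover have fg: "?f nu \<oplus> \<ominus> ?g nu : V nu" if "nu : A \<union> B" for nu
 proof -
  have n: "nu .: W" using that A(2) B(2) by blast
  hence "?f nu : V nu" "?g nu : V nu" using A(3) B(3) V_zero by auto
  thus ?thesis using V_add[OF n] V_neg[OF n] by blast
 qed
 ultimately have "?f mu \<oplus> \<ominus> ?g mu = \<zero>" if "mu : A \<union> B"
  using V_direct[of "A \<union> B" "%nu. ?f nu \<oplus> \<ominus> ?g nu" mu, OF _ _ fg _ that] A(1,2) B(1,2) by simp
 hence "?f mu = ?g mu" using c[of mu] M.r_neg1 M.a_minus_eq_zero_iff[of "?f mu" "?g mu"]
  unfolding a_minus_def by (cases "mu : A \<union> B") auto
 thus "y = (if mu : A then f mu else \<zero>)" using B(5) by simp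
qed

lemma comp_V: "nu .: W ==> v : V nu ==> comp mu v = (if mu = nu then v else \<zero>)"
 using comp_finsum[of "{nu}" "%_. v" mu] M.finsum_insert[of "{}" nu "%_. v"] Vc[of v nu] by simp

lemma comp_rep:
 assumes "F <= car W" "x : gsum F"
 obtains A where "finite A" "A <= F" "x = (\<Oplus>mu\<in>A. comp mu x)" "!!mu. mu : A ==> comp mu x : V mu"
  "!!mu. mu ~: A ==> comp mu x = \<zero>"
proof -
 obtain A f where A: "finite A" "A <= F" "!!mu. mu : A ==> f mu : V mu" "x = (\<Oplus>mu\<in>A. f mu)" using assms unfolding gsum_def by blast
 have c: "comp mu x = (if mu : A then f mu else \<zero>)" for mu
  unfolding A(4) by (rule comp_finsum) (use A assms in auto)
 have "(\<Oplus>mu\<in>A. f mu) = (\<Oplus>mu\<in>A. comp mu x)" using Vc[OF A(3)] by (intro M.finsum_cong') (auto simp: c)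
 thus thesis using that[of A] A c by auto
qed

lemma comp_closed: "x : gsum (car W) ==> mu .: W ==> comp mu x : V mu"
 using comp_rep[of "car W" x] V_zero by (metis subset_refl)

lemma comp_outside: "F <= car W ==> x : gsum F ==> mu ~: F ==> comp mu x = \<zero>"
 by (metis comp_rep subsetD)

lemma comp_eq_zero: "x : gsum (car W) ==> (!!mu. mu .: W ==> comp mu x = \<zero>) ==> x = \<zero>"
proof -
 assume x: "x : gsum (car W)" and 0: "!!mu. mu .: W ==> comp mu x = \<zero>"
 obtain A where A: "A <= car W" "x = (\<Oplus>mu\<in>A. comp mu x)" by (rule comp_rep[OF subset_refl x]) blast
 have "(\<Oplus>mu\<in>A. comp mu x) = (\<Oplus>mu\<in>A. \<zero>)" using A(1) by (intro M.finsum_cong') (auto simp: 0 subset_iff)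
 thus ?thesis using A by simp
qed

lemma comp_add:
 assumes "x : gsum (car W)" "y : gsum (car W)" "mu .: W"
 shows "comp mu (x \<oplus> y) = comp mu x \<oplus> comp mu y"
proof -
 obtain A where A: "finite A" "A <= car W" "x = (\<Oplus>mu\<in>A. comp mu x)" "!!mu. mu : A ==> comp mu x : V mu" "!!mu. mu ~: A ==> comp mu x = \<zero>"
  by (rule comp_rep[OF subset_refl assms(1)]) blast
 obtain B where B: "finite B" "B <= car W" "y = (\<Oplus>mu\<in>B. comp mu y)" "!!mu. mu : B ==> comp mu y : V mu" "!!mu. mu ~: B ==> comp mu y = \<zero>"
  by (rule comp_rep[OF subset_refl assms(2)]) blast
 let ?C = "insert mu (A \<union> B)"
 have c: "comp nu x : V nu" "comp nu y : V nu" if "nu .: W" for nu using comp_closed assms that by auto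
 have cc: "comp nu x .: D" "comp nu y .: D" for nu
  using Vc[OF A(4), of nu] A(5)[of nu] Vc[OF B(4), of nu] B(5)[of nu] by (metis M.zero_closed)+
 have "x = (\<Oplus>nu\<in>?C. comp nu x)"
  by (rule trans[OF A(3)], rule M.add.finprod_mono_neutral_cong_left) (use A(1,2,5) B(1) cc in auto)
 moreover have "y = (\<Oplus>nu\<in>?C. comp nu y)"
  by (rule trans[OF B(3)], rule M.add.finprod_mono_neutral_cong_left) (use B(1,2,5) A(1) cc in auto)
 moreover have "(\<Oplus>nu\<in>?C. comp nu x \<oplus> comp nu y) = (\<Oplus>nu\<in>?C. comp nu x) \<oplus> (\<Oplus>nu\<in>?C. comp nu y)"
  by (rule M.finsum_addf) (use A(2) B(2) c Vc assms(3) in blast)+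
 ultimately have "x \<oplus> y = (\<Oplus>nu\<in>?C. comp nu x \<oplus> comp nu y)" by simp
 moreover have "comp mu (\<Oplus>nu\<in>?C. comp nu x \<oplus> comp nu y) = comp mu x \<oplus> comp mu y"
 proof (subst comp_finsum)
  show C: "?C <= car W" using A(2) B(2) assms(3) by blast
  show "comp nu x \<oplus> comp nu y : V nu" if "nu : ?C" for nu using c[of nu] V_add[of nu] that C by blast
 qed (use A(1) B(1) in auto)
 ultimately show ?thesis by simp
qed

lemma comp_rmult:
 assumes v: "nu .: W" "v : V nu" and m: "mu .: W" and x: "x : gsum (car W)"
 shows "comp (mu \<otimes>\<^sub>W nu) (x \<otimes> v) = comp mu x \<otimes> v"
 using subset_refl x
proof (induction rule: gsum_induct)
 case zero
 have "comp mu \<zero> = \<zero>" for mu using comp_finsum[of "{}" _ mu] by simp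
 thus ?case using v Vc by simp
next
 case (step kappa w x)
 have wv: "w \<otimes> v : V (kappa \<otimes>\<^sub>W nu)" using V_mult v step by blast
 have "x \<otimes> v : gsum (car W)" using gsum_mult[OF W.subgroup_self] gsum_V[OF subset_refl v] step by blast
 moreover have "w \<otimes> v : gsum (car W)" using gsum_V[OF subset_refl _ wv] v step by simp
 ultimately have "comp (mu \<otimes>\<^sub>W nu) (w \<otimes> v \<oplus> x \<otimes> v) = comp (mu \<otimes>\<^sub>W nu) (w \<otimes> v) \<oplus> comp mu x \<otimes> v"
  using comp_add v m step(4) by simp
 also have "comp (mu \<otimes>\<^sub>W nu) (w \<otimes> v) = comp mu w \<otimes> v"
  using comp_V[OF _ wv] comp_V[OF step(1,2)] v m step(1) Vc by simp
 finally show ?case using comp_add[OF gsum_V[OF subset_refl step(1,2)] step(3) m] step v Vc gsum_closed[OF subset_refl] Vc[OF comp_closed]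
   gsum_V[OF subset_refl step(1,2)] m by (simp add: A.l_distr)
qed

end

text \<open>Commutativity of \<open>W\<close> keeps the grading valid when products are reversed;
  right-handed results then follow from left-handed ones.\<close>

lemma (in graded) graded_opposite: "graded (Opp D) K W V"
proof -
 have m: "y \<otimes> x : V (mu \<otimes>\<^sub>W nu)" if "mu .: W" "nu .: W" "x : V mu" "y : V nu" for mu nu x y
  using V_mult[OF that(2,1,4,3)] that(1,2) by (simp add: W.m_comm)
 show ?thesis
 proof (intro graded.intro division_algebra_opposite division_algebra_axioms W.comm_group_axioms graded_axioms.intro)
  show "f mu = \<zero>\<^bsub>Opp D\<^esub>" if "finite A" "A <= car W" "!!mu. mu : A ==> f mu : V mu"
   "(\<Oplus>\<^bsub>Opp D\<^esub>mu\<in>A. f mu) = \<zero>\<^bsub>Opp D\<^esub>" "mu : A" for A f mu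
   using V_direct[OF that(1-3) _ that(5)] that(4) by simp
 qed (simp_all add: V_sub V_zero V_add V_neg V_smult V_one V_inv m)
qed

lemma (in assoc_algebra) finsum_subalgebra:
 assumes R: "unital_subalgebra K A R" and f: "f : I \<rightarrow> R"
 shows "finsum (A on R) f I = finsum A f I"
proof -
 note RD = unital_subalgebraD[OF R]
 interpret B: assoc_algebra K "A on R" by (rule unital_subalgebra_algebra[OF R])
 show ?thesis
 proof (cases "finite I")
  case True
  thus ?thesis using f
  proof (induction I rule: finite_induct)
   case (insert i I)
   thus ?case
    using B.M.finsum_insert[of I i f] M.finsum_insert[of I i f] RD(1) by (auto simp: Pi_def)
  qed simp
 next
  case False thus ?thesis using M.finsum_infinite[of I f] B.M.finsum_infinite[of I f] by simp
 qed
qed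

lemma has_dim_opposite [simp]: "has_dim S act (Opp M) n = has_dim S act M n"
 by (simp add: has_dim_def)

lemma (in comm_group) comm_subgroup: "subgroup H G ==> comm_group (G on H)"
 by (rule group.group_comm_groupI[OF subgroup_imp_group]) (auto simp: m_comm subgroup.mem_carrier)

section \<open>Finite torsion, the Noetherian property and finite generation\<close>

context graded begin

lemma V_one_div_subring: "div_subring D (V \<one>\<^sub>W)"
 unfolding div_subring_def
proof (intro conjI ballI impI)
 fix c assume c: "c : V \<one>\<^sub>W" "c ~= \<zero>"
 thus "EX d:V \<one>\<^sub>W . d \<otimes> c = \<one> & c \<otimes> d = \<one>"
  using V_inv[OF W.one_closed c] Vc[OF c(1)] by (intro bexI[of _ "inv c"]) auto
qed (use V_sub V_zero V_one V_add V_mult[OF W.one_closed W.one_closed] V_neg in auto)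

lemma V_one_division_subalgebra: "division_subalgebra K D (V \<one>\<^sub>W)"
 using V_one_div_subring V_smult by (simp add: division_subalgebra_iff)

definition ev where "ev mu = (SOME v. v : V mu & v ~= \<zero>)"

lemma ev: assumes "mu : Ev" shows "ev mu : V mu" "ev mu ~= \<zero>" "ev mu .: D"
 using someI_ex[of "%v. v : V mu & v ~= \<zero>"] assms Vc unfolding ev_def Ev_def by blast+

text \<open>Dividing by a homogeneous unit shifts weights. In particular each nonzero eigenspace is
  one-dimensional over the constants, spanned by \<open>ev mu\<close>.\<close>

lemma V_quotient: "mu : Ev ==> nu .: W ==> x : V (nu \<otimes>\<^sub>W mu) ==> x \<otimes> inv (ev mu) : V nu"
proof -
 assume m: "mu : Ev" and n: "nu .: W" and x: "x : V (nu \<otimes>\<^sub>W mu)"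
 hence mc: "mu .: W" by (simp add: Ev_def)
 have "x \<otimes> inv (ev mu) : V ((nu \<otimes>\<^sub>W mu) \<otimes>\<^sub>W inv\<^bsub>W\<^esub> mu)"
  using V_mult[OF _ _ x V_inv[OF mc ev(1,2)[OF m]]] n mc by simp
 thus ?thesis using n mc by (simp add: W.m_assoc)
qed

lemma gsum_conj:
 assumes F: "F <= car W" and v: "nu .: W" "v : V nu" "v ~= \<zero>" and x: "x : gsum F"
 shows "v \<otimes> x \<otimes> inv v : gsum F"
 using F x
proof (induction rule: gsum_induct)
 case zero thus ?case using v Vc gsum_zero by simp
next
 case (step mu w x)
 have m: "mu .: W" using step F by auto
 have "v \<otimes> w \<otimes> inv v : V ((nu \<otimes>\<^sub>W mu) \<otimes>\<^sub>W inv\<^bsub>W\<^esub> nu)" using V_mult V_inv v m step by simp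
 also have "(nu \<otimes>\<^sub>W mu) \<otimes>\<^sub>W inv\<^bsub>W\<^esub> nu = mu" using v m by (simp add: W.m_comm[of nu mu] W.m_assoc)
 finally have "v \<otimes> w \<otimes> inv v \<oplus> v \<otimes> x \<otimes> inv v : gsum F" using gsum_step[OF F step(1)] step(4) by blast
 thus ?case using v Vc[OF v(2)] Vc[OF step(2)] gsum_closed[OF F step(3)] by (simp add: A.r_distr A.l_distr)
qed

text \<open>The sum is a subalgebra of finite left dimension over the division algebra of constants,
  so \<open>fspan_left_inverse\<close> puts the inverses of its nonzero elements into it.\<close>

lemma finite_sum_division:
 assumes T: "subgroup T W" "finite T" "T <= Ev"
 shows "division_subalgebra K D (gsum T)"
proof -
 note Tc = subgroup.subset[OF T(1)] and RD = unital_subalgebraD[OF gsum_subalgebra[OF T(1)]]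
 obtain b where b: "bij_betw b {0..<card T} T" using ex_bij_betw_nat_finite[OF T(2)] by blast
 define v where "v i = (if i < card T then ev (b i) else \<one>)" for i
 have bT: "b i : T" if "i < card T" for i using b that by (auto simp: bij_betw_def)
 have v: "v i .: D" for i using ev(3) bT T(3) by (auto simp: v_def)
 note FD = left_subspaceD[OF fspan_subspace[of "V \<one>\<^sub>W" v "card T", OF V_one_div_subring v]]
 have sub: "gsum T <= fspan (V \<one>\<^sub>W) v (card T)"
 proof
  fix x assume "x : gsum T"
  with Tc show "x : fspan (V \<one>\<^sub>W) v (card T)"
  proof (induction rule: gsum_induct)
   case (step mu w x)
   hence "mu : b ` {0..<card T}" using b by (simp add: bij_betw_def)
   then obtain i where i: "i < card T" "mu = b i" by auto
   have m: "mu : Ev" "mu .: W" using step T Tc by auto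
   have "w \<otimes> inv (ev mu) : V \<one>\<^sub>W" using V_quotient[OF m(1) W.one_closed] step m by simp
   hence "(w \<otimes> inv (ev mu)) \<otimes> v i : fspan (V \<one>\<^sub>W) v (card T)" by (intro fspan_single V_one_div_subring v i)
   moreover have "(w \<otimes> inv (ev mu)) \<otimes> v i = w" using i m ev[OF m(1)] Vc[OF step(2)] by (simp add: v_def A.m_assoc)
   ultimately show ?case using FD(3) step by simp
  qed (rule FD(2))
 qed
 have inv: "inv x : gsum T" if "x : gsum T" "x ~= \<zero>" for x
  by (rule fspan_left_inverse[OF V_one_div_subring v sub])
   (use RD that gsum_V[OF Tc subgroup.one_closed[OF T(1)]] in auto)
 have "div_subring D (gsum T)" unfolding div_subring_def
 proof (intro conjI ballI impI)
  fix c assume "c : gsum T" "c ~= \<zero>"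
  thus "EX d:gsum T. d \<otimes> c = \<one> & c \<otimes> d = \<one>" using inv RD(1) by (intro bexI[of _ "inv c"]) auto
 qed (use RD in auto)
 thus ?thesis using RD(7) by (simp add: division_subalgebra_iff)
qed

lemma finite_sum_dim:
 assumes T: "subgroup T W" "finite T" "T <= Ev"
 shows "has_dim (V \<one>\<^sub>W) (%a x. a \<otimes> x) (D on gsum T) (card T)"
proof -
 note Tc = subgroup.subset[OF T(1)] and R = gsum_subalgebra[OF T(1)]
 note RD = unital_subalgebraD[OF R]
 have e: "ev mu : V mu" "ev mu ~= \<zero>" "ev mu .: D" "mu .: W" if "mu : T" for mu using ev T that Tc by auto
 have inj: "inj_on ev T"
 proof (rule inj_onI)
  fix mu nu assume m: "mu : T" "nu : T" "ev mu = ev nu"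
  have "comp mu (ev mu) = ev mu" using comp_V[OF e(4,1)[OF m(1)]] by simp
  moreover have "comp mu (ev nu) = (if mu = nu then ev nu else \<zero>)" by (rule comp_V[OF e(4,1)[OF m(2)]])
  ultimately show "mu = nu" using m(3) e(2)[OF m(2)] by (auto split: if_splits)
 qed
 have V1: "c \<otimes> ev mu : V mu" if "c : V \<one>\<^sub>W" "mu : T" for c mu using V_mult[OF W.one_closed e(4) that(1) e(1)] that e by simp
 have sum: "(\<Oplus>\<^bsub>D on gsum T\<^esub>b\<in>ev ` T. c b \<otimes> b) = (\<Oplus>mu\<in>T. c (ev mu) \<otimes> ev mu)" if c: "c : ev ` T \<rightarrow>\<^sub>E V \<one>\<^sub>W" for c
 proof -
  have c': "c (ev mu) : V \<one>\<^sub>W" if "mu : T" for mu using c that by auto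
  have "(\<Oplus>\<^bsub>D on gsum T\<^esub>b\<in>ev ` T. c b \<otimes> b) = (\<Oplus>b\<in>ev ` T. c b \<otimes> b)"
   by (rule finsum_subalgebra[OF R]) (use gsum_V[OF Tc _ V1] c' in auto)
  also have "... = (\<Oplus>mu\<in>T. c (ev mu) \<otimes> ev mu)"
   by (rule M.finsum_reindex[OF _ inj]) (use c' Vc[OF V1] in auto)
  finally show ?thesis .
 qed
 have "EX! c. c : ev ` T \<rightarrow>\<^sub>E V \<one>\<^sub>W & x = (\<Oplus>\<^bsub>D on gsum T\<^esub>b\<in>ev ` T. c b \<otimes> b)" if x: "x : gsum T" for x
 proof (rule ex_ex1I)
  \<comment> \<open>The coefficient at \<open>ev mu\<close> is the component of \<open>x\<close>
    divided by \<open>ev mu\<close>, a constant by \<open>V_quotient\<close>.\<close>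
  let ?c = "\<lambda>b\<in>ev ` T. comp (inv_into T ev b) x \<otimes> inv b"
  obtain A where A: "finite A" "A <= T" "x = (\<Oplus>mu\<in>A. comp mu x)" "!!mu. mu : A ==> comp mu x : V mu" "!!mu. mu ~: A ==> comp mu x = \<zero>"
  by (rule comp_rep[OF Tc x]) blast
  have cV: "comp mu x : V mu" if "mu : T" for mu using comp_closed[OF gsum_mono[OF x Tc] e(4)[OF that]] .
  have ce: "?c (ev mu) = comp mu x \<otimes> inv (ev mu)" if "mu : T" for mu using that inv_into_f_f[OF inj that] by simp
  have cE: "?c : ev ` T \<rightarrow>\<^sub>E V \<one>\<^sub>W"
  proof (rule PiE_I)
   fix b assume "b : ev ` T"
   then obtain mu where m: "mu : T" "b = ev mu" by blast
   show "?c b : V \<one>\<^sub>W" unfolding m(2) ce[OF m(1)]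
    by (rule V_quotient) (use m T cV e in auto)
  qed auto
  have "x = (\<Oplus>mu\<in>T. comp mu x)"
   by (rule trans[OF A(3)], rule M.add.finprod_mono_neutral_cong_left) (use A T(2) Vc[OF cV] in auto)
  also have "... = (\<Oplus>mu\<in>T. ?c (ev mu) \<otimes> ev mu)"
  proof (rule M.finsum_cong')
   fix mu assume m: "mu : T"
   show "comp mu x = ?c (ev mu) \<otimes> ev mu" unfolding ce[OF m] using e[OF m] Vc[OF cV[OF m]] by (simp add: A.m_assoc)
  next
   show "(%mu. ?c (ev mu) \<otimes> ev mu) : T \<rightarrow> car D" using cE e Vc by (auto simp: PiE_iff simp del: restrict_apply)
  qed simp
  finally show "EX c. c : ev ` T \<rightarrow>\<^sub>E V \<one>\<^sub>W & x = (\<Oplus>\<^bsub>D on gsum T\<^esub>b\<in>ev ` T. c b \<otimes> b)"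
   using cE sum[OF cE] by (intro exI[of _ ?c] conjI) simp_all
 next
  have u: "c (ev mu) = comp mu x \<otimes> inv (ev mu)" if c: "c : ev ` T \<rightarrow>\<^sub>E V \<one>\<^sub>W" "x = (\<Oplus>\<^bsub>D on gsum T\<^esub>b\<in>ev ` T. c b \<otimes> b)" and m: "mu : T" for c mu
  proof -
   have c': "c (ev mu) : V \<one>\<^sub>W" if "mu : T" for mu using c that by auto
   have "comp mu x = c (ev mu) \<otimes> ev mu" unfolding c(2) sum[OF c(1)]
    by (subst comp_finsum) (use T(2) Tc V1 c' m in auto)
   thus ?thesis using e[OF m] Vc[OF c'[OF m]] by (simp add: A.m_assoc)
  qed
  fix c c' assume c: "c : ev ` T \<rightarrow>\<^sub>E V \<one>\<^sub>W & x = (\<Oplus>\<^bsub>D on gsum T\<^esub>b\<in>ev ` T. c b \<otimes> b)"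
   "c' : ev ` T \<rightarrow>\<^sub>E V \<one>\<^sub>W & x = (\<Oplus>\<^bsub>D on gsum T\<^esub>b\<in>ev ` T. c' b \<otimes> b)"
  hence "c b = c' b" if "b : ev ` T" for b using u[of c] u[of c'] that by auto
  thus "c = c'" using c by (intro PiE_ext[of c "ev ` T" "%_. V \<one>\<^sub>W" c']) auto
 qed
 thus ?thesis unfolding has_dim_def
  using card_image[OF inj] T(2) gsum_V[OF Tc] e(1) by (intro exI[of _ "ev ` T"]) auto
qed

lemma gsum_opposite: "graded.gsum (Opp D) V F = gsum F"
proof -
 interpret O: graded "Opp D" K W V by (rule graded_opposite)
 show ?thesis by (simp add: O.gsum_def gsum_def)
qed

lemma Ev_opposite: "graded.Ev (Opp D) W V = Ev"
proof -
 interpret O: graded "Opp D" K W V by (rule graded_opposite)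
 show ?thesis by (simp add: O.Ev_def Ev_def)
qed

lemma finite_sum_dim_right:
 assumes T: "subgroup T W" "finite T" "T <= Ev"
 shows "has_dim (V \<one>\<^sub>W) (%a x. x \<otimes> a) (D on gsum T) (card T)"
proof -
 have "has_dim (V \<one>\<^sub>W) (%a x. a \<otimes>\<^bsub>Opp D\<^esub> x) ((Opp D) on graded.gsum (Opp D) V T) (card T)"
  by (rule graded.finite_sum_dim[OF graded_opposite T(1,2)]) (simp only: Ev_opposite T(3))
 thus ?thesis by (simp only: gsum_opposite opposite_carrier has_dim_opposite Opp_simps)
qed

text \<open>Over the division algebra \<open>E\<close> of the torsion part, the eigenvectors of a basis of the free part
 behave like commuting variables up to units of \<open>E\<close>, and every element becomes a polynomial after
 multiplication by a homogeneous unit.\<close>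
lemma acc_left:
 assumes F: "subgroup F W" "F <= Ev" "fin_gen_group (W on F)"
 shows "ACC (%I. left_ideal I (D on gsum F))"
proof -
 note Fc = subgroup.subset[OF F(1)] and R = gsum_subalgebra[OF F(1)]
 note RD = unital_subalgebraD[OF R]
 let ?R = "D on gsum F"
 interpret B: assoc_algebra K ?R by (rule unital_subalgebra_algebra[OF R])
 interpret F: comm_group "W on F" by (rule W.comm_subgroup[OF F(1)])
 obtain r g kappa where fin: "finite F.TT" and g': "ALL i<r. g i .: (W on F)"
  and kappa': "ALL x:car (W on F). EX tau:F.TT. x = tau \<otimes>\<^bsub>W on F\<^esub> F.gprod {..<r} g (kappa x)"
  using F.fin_gen_decomposition[OF F(3)] by blast
 have g: "g i : F" if "i < r" for i using g' that by simp
 have kappa: "EX tau:F.TT. x = tau \<otimes>\<^sub>W F.gprod {..<r} g (kappa x)" if "x : F" for x using kappa' that by simp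
 have T: "subgroup F.TT W" by (rule W.incl_subgroup[OF F(1) F.subgroup_torsion])
 have TF: "F.TT <= F" using F.torsion_subset by simp
 hence TE: "F.TT <= Ev" and Tc: "F.TT <= car W" using F(2) Fc by auto
 let ?E = "gsum F.TT"
 have E: "div_subring D ?E" using finite_sum_division[OF T fin TE] by (simp add: division_subalgebra_iff)
 note ED = div_subringD[OF E]
 have EF: "?E <= gsum F" using gsum_mono[OF _ TF] by blast
 define wt where "wt k = F.gprod {..<r} g k" for k
 have wt: "wt k : F" for k unfolding wt_def using F.gprod_closed[of "{..<r}" g k] g by simp
 have wt': "wt k .: W" "wt k : Ev" for k using wt Fc F(2) by auto
 have wt_add: "wt (%i. k i + l i) = wt k \<otimes>\<^sub>W wt l" for k l
  unfolding wt_def using F.gprod_add[of "{..<r}" g k l] g by simp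
 \<comment> \<open>One eigenvector for each monomial in the free generators. Torsion is absorbed
   into the coefficients \<open>?E\<close>, and negative exponents are dealt with by
   \<open>poly\<close>.\<close>
 define e where "e M = ev (wt (%i. int (count M i)))" for M :: "nat multiset"
 have e: "e M : V (wt (%i. int (count M i)))" "e M ~= \<zero>" "e M .: D" "e M : gsum F" for M
  unfolding e_def using ev[OF wt'(2)] gsum_V[OF Fc wt ev(1)[OF wt'(2)]] by auto
 have conj: "e M \<otimes> c \<otimes> inv (e M) : ?E" if "c : ?E" for M c by (rule gsum_conj[OF Tc wt'(1) e(1,2) that])
 have ai: "\<ominus>\<^sub>?R x = \<ominus> x" if "x : gsum F" for x
  by (rule B.M.minus_equality) (use that RD in "auto simp: M.l_neg")
 interpret MO: monomials ?R r ?E e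
 proof
  fix c assume c: "c : ?E"
  thus "\<ominus>\<^sub>?R c : ?E" using ai EF ED(6) by (simp add: subset_iff)
  show "EX d:?E. e M \<otimes>\<^sub>?R c = d \<otimes>\<^sub>?R e M" for M
   using conj[OF c] e ED(1)[OF c] by (intro bexI[of _ "e M \<otimes> c \<otimes> inv (e M)"]) (auto simp: A.m_assoc)
 qed (use EF ED e in auto)
 interpret FM: filtered_monomials ?R r ?E e
 proof
  fix M N assume "M : MO.S" "N : MO.S"
  \<comment> \<open>The product of two chosen eigenvectors is a constant times the one chosen for
    the sum of their weights, with no lower terms at all.\<close>
  let ?c = "e M \<otimes> e N \<otimes> inv (e (M + N))"
  have "wt (%i. int (count (M + N) i)) = wt (%i. int (count M i)) \<otimes>\<^sub>W wt (%i. int (count N i))"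
   using wt_add[of "%i. int (count M i)" "%i. int (count N i)"] by simp
  hence "e M \<otimes> e N : V (\<one>\<^sub>W \<otimes>\<^sub>W wt (%i. int (count (M + N) i)))" using V_mult[OF wt'(1) wt'(1) e(1) e(1), of M N] wt' by simp
  hence "?c : V \<one>\<^sub>W" unfolding e_def[of "M + N"] by (rule V_quotient[OF wt'(2) W.one_closed])
  hence "?c : ?E" using gsum_V[OF Tc subgroup.one_closed[OF T]] by blast
  moreover have "?c ~= \<zero>" using e by (simp add: no_zero_div)
  moreover have "e M \<otimes> e N = ?c \<otimes> e (M + N) \<oplus> \<zero>" using e by (simp add: A.m_assoc)
  ultimately show "EX c:?E. c ~= \<zero>\<^sub>?R & (EX l:MO.espan (MO.below (M + N)). e M \<otimes>\<^sub>?R e N = c \<otimes>\<^sub>?R e (M + N) \<oplus>\<^sub>?R l)"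
   using MO.espan.zero[of "MO.below (M + N)"] by auto
 qed
 \<comment> \<open>An eigenvector in which all free generators have a large exponent
   \<open>m\<close> makes the exponents of \<open>x\<close> nonnegative. The claim is made for all
   large \<open>m\<close>, so that one \<open>m\<close> serves all summands.\<close>
 have poly: "EX n. ALL m>=n. ALL s:V (wt (%i. int m)). s \<otimes> x : MO.espan MO.S" if "x : gsum F" for x
  using Fc that
 proof (induction rule: gsum_induct)
  case zero
  have "s \<otimes> \<zero> : MO.espan MO.S" if "s : V mu" for s mu using Vc[OF that] MO.espan.zero[of MO.S] by simp
  thus ?case by blast
 next
  case (step mu v x)
  then obtain n where n: "!!m s. m >= n ==> s : V (wt (%i. int m)) ==> s \<otimes> x : MO.espan MO.S" by blast
  obtain tau where t: "tau : F.TT" "mu = tau \<otimes>\<^sub>W wt (kappa mu)" using kappa[OF step(1)] by (auto simp: wt_def)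
  have mc: "mu .: W" "tau .: W" using step(1) Fc t Tc by auto
  define n' where "n' = (\<Sum>i<r. nat \<bar>kappa mu i\<bar>)"
  have n': "\<bar>kappa mu i\<bar> <= int n'" if "i < r" for i
  proof -
   have "nat \<bar>kappa mu i\<bar> <= n'" unfolding n'_def by (rule member_le_sum) (use that in auto)
   thus ?thesis by (simp only: nat_le_iff)
  qed
  have "s \<otimes> (v \<oplus> x) : MO.espan MO.S" if m: "m >= max n n'" and s: "s : V (wt (%i. int m))" for m s
  proof -
   define M where "M = (\<Sum>i<r. replicate_mset (nat (int m + kappa mu i)) i)"
   have cM: "int (count M i) = int m + kappa mu i" if "i < r" for i
   proof -
    have "count M i = nat (int m + kappa mu i)" using that unfolding M_def by (simp add: count_sum)
    moreover have "0 <= int m + kappa mu i" using n'[OF that] m by linarith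
    ultimately show ?thesis by simp
   qed
   have "count M i = 0" if "\<not> i < r" for i
    unfolding M_def count_sum using that by (intro sum.neutral) auto
   hence MS: "M : MO.S" unfolding MO.S_def by (metis count_eq_zero_iff lessThan_iff mem_Collect_eq subsetI)
   have "wt (%i. int (count M i)) = wt (%i. int m + kappa mu i)"
    unfolding wt_def using cM g by (intro F.gprod_cong) auto
   hence w: "wt (%i. int (count M i)) = wt (%i. int m) \<otimes>\<^sub>W wt (kappa mu)" using wt_add[of "%i. int m" "kappa mu"] by simp
   have "s \<otimes> v : V (wt (%i. int m) \<otimes>\<^sub>W mu)" by (rule V_mult[OF wt'(1) mc(1) s step(2)])
   also have "wt (%i. int m) \<otimes>\<^sub>W mu = wt (%i. int m) \<otimes>\<^sub>W (tau \<otimes>\<^sub>W wt (kappa mu))" using t(2) by simp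
   also have "... = tau \<otimes>\<^sub>W wt (%i. int (count M i))" unfolding w using mc wt' by (simp add: W.m_lcomm)
   finally have "s \<otimes> v \<otimes> inv (e M) : V tau" unfolding e_def by (rule V_quotient[OF wt'(2) mc(2)])
   hence c: "s \<otimes> v \<otimes> inv (e M) : ?E" by (rule gsum_V[OF Tc t(1)])
   have sv: "s .: D" "v .: D" "x .: D" using s step gsum_closed[OF Fc] Vc by auto
   have "s \<otimes> (v \<oplus> x) = (s \<otimes> v \<otimes> inv (e M)) \<otimes> e M \<oplus> s \<otimes> x" using sv e[of M] by (simp add: A.r_distr A.m_assoc)
   also have "... : MO.espan MO.S" using MO.espan.step[OF c MS n[OF _ s]] m by simp
   finally show ?thesis .
  qed
  thus ?case by blast
 qed
 have "EX s:car ?R. EX s':car ?R. s' \<otimes>\<^sub>?R s = \<one>\<^sub>?R & s \<otimes>\<^sub>?R x : MO.espan MO.S" if x: "x .: ?R" for x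
 proof -
  obtain m where m: "ALL s:V (wt (%i. int m)). s \<otimes> x : MO.espan MO.S" using poly[of x] x by auto
  let ?s = "ev (wt (%i. int m))"
  note s = ev[OF wt'(2), of "%i. int m"]
  have "inv ?s : gsum F" by (rule gsum_V[OF Fc subgroup.m_inv_closed[OF F(1) wt] V_inv[OF wt'(1) s(1,2)]])
  moreover have "?s : gsum F" by (rule gsum_V[OF Fc wt s(1)])
  ultimately show ?thesis using s m by (intro bexI[of _ ?s] bexI[of _ "inv ?s"]) auto
 qed
 thus ?thesis by (rule FM.acc_left_ideals)
qed

lemma gsum_noeth:
 assumes F: "subgroup F W" "F <= Ev" "fin_gen_group (W on F)"
 shows "noeth_domain (D on gsum F)"
proof -
 have "ACC (%I. left_ideal I ((Opp D) on graded.gsum (Opp D) V F))"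
  by (rule graded.acc_left[OF graded_opposite F(1) _ F(3)]) (simp only: Ev_opposite F(2))
 thus ?thesis unfolding noeth_domain_iff[OF gsum_subalgebra[OF F(1)]]
  using acc_left[OF F] by (simp only: gsum_opposite opposite_carrier left_ideal_opposite simp_thms)
qed

text \<open>Let \<open>u\<close> be a denominator of \<open>v\<close> and \<open>mu\<close> the
  weight of a nonzero component of \<open>u\<close>. That component times \<open>v\<close> is a
  component of \<open>u v\<close>, so both \<open>mu\<close> and its product with \<open>nu\<close>
  lie in \<open>F\<close>.\<close>

lemma fraction_eigenvalue:
 assumes F: "subgroup F W" and v: "v : fractions_in D (gsum F)" "v : V nu" "nu .: W" "v ~= \<zero>"
 shows "nu : F"
proof -
 note Fc = subgroup.subset[OF F]
 obtain u where u: "u : gsum F" "u ~= \<zero>" "u \<otimes> v : gsum F"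
  using v(1) unfolding fractions_in_iff[OF gsum_subalgebra[OF F]] by blast
 have uW: "u : gsum (car W)" using gsum_mono[OF u(1) Fc] .
 then obtain mu where m: "mu .: W" "comp mu u ~= \<zero>" using comp_eq_zero u(2) by blast
 have "comp (mu \<otimes>\<^sub>W nu) (u \<otimes> v) = comp mu u \<otimes> v" by (rule comp_rmult[OF v(3,2) m(1) uW])
 also have "... ~= \<zero>" using m v Vc[OF comp_closed[OF uW m(1)]] Vc by (simp add: no_zero_div)
 finally have "mu \<otimes>\<^sub>W nu : F" using comp_outside[OF Fc u(3)] by blast
 moreover have "mu : F" using comp_outside[OF Fc u(1)] m(2) by blast
 ultimately have "inv\<^bsub>W\<^esub> mu \<otimes>\<^sub>W (mu \<otimes>\<^sub>W nu) : F" using subgroup.m_closed[OF F] subgroup.m_inv_closed[OF F] by blast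
 thus ?thesis using m v by (simp add: W.m_assoc[symmetric])
qed

text \<open>Fractions are available only where \<open>gsum_noeth\<close> applies, and this
  presupposes finite generation. The chain therefore runs through the finitely generated subgroups
  \<open>H n\<close>; \<open>fraction_eigenvalue\<close> keeps it strictly ascending.\<close>

lemma subgroup_fin_gen:
 assumes acc: "ACC (division_subalgebra K D)" and F: "subgroup F W" "F <= Ev"
 shows "fin_gen_group (W on F)"
proof (rule ccontr)
 note Fc = subgroup.subset[OF F(1)]
 assume no: "\<not> ?thesis"
 have G: "subgroup (generate W X) W" "X <= generate W X" "generate W X <= F" if "X <= F" for X
  using W.generate_is_subgroup[of X] generate.incl[of _ X W] W.generate_subgroup_incl[OF that F(1)] that Fc by auto
 have "EX x:F. x ~: generate W X" if X: "finite X" "X <= F" for X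
 proof (rule ccontr)
  assume "\<not> (EX x:F. x ~: generate W X)"
  hence "generate (W on F) X = F" using G(3)[OF X(2)] W.generate_consistent[OF X(2) F(1)] by auto
  thus False using no X by (auto simp: fin_gen_group_def)
 qed
 then obtain x where x: "!!X. finite X ==> X <= F ==> x X : F & x X ~: generate W X" by metis
 define X where "X n = ((%Y. insert (x Y) Y) ^^ n) {}" for n
 have X: "finite (X n)" "X n <= F" for n by (induction n) (auto simp: X_def x)
 have s: "X (Suc n) = insert (x (X n)) (X n)" for n by (simp add: X_def)
 define H where "H n = generate W (X n)" for n
 have H: "subgroup (H n) W" "H n <= Ev" for n using G(1,3)[OF X(2), of n] F(2) unfolding H_def by blast+
 have Hfg: "fin_gen_group (W on H n)" for n unfolding fin_gen_group_def
  using W.generate_consistent[OF G(2)[OF X(2)] G(1)[OF X(2)], of n] G(2)[OF X(2)] X(1) unfolding H_def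
  by (intro exI[of _ "X n"]) auto
 let ?Q = "%n. fractions_in D (gsum (H n))"
 have "division_subalgebra K D (?Q n)" for n
  by (rule fractions_division_subalgebra[OF gsum_subalgebra[OF H(1)] gsum_noeth[OF H Hfg]])
 moreover have "?Q n <= ?Q (Suc n)" for n
 proof -
  have "H n <= H (Suc n)" unfolding H_def using s W.mono_generate by blast
  hence "gsum (H n) <= gsum (H (Suc n))" using gsum_mono by blast
  thus ?thesis unfolding fractions_in_def by blast
 qed
 ultimately obtain N where N: "!!n. n >= N ==> ?Q n = ?Q N"
  using acc[unfolded ascending_chain_condition_def, rule_format, of ?Q] by blast
 let ?x = "x (X N)"
 have xF: "?x : F" "?x ~: H N" using x[OF X] by (auto simp: H_def)
 hence xE: "?x : Ev" "?x .: W" using F(2) Fc by auto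
 have "?x : H (Suc N)" using G(2)[OF X(2)[of "Suc N"]] s[of N] by (auto simp: H_def)
 hence "ev ?x : ?Q (Suc N)"
  using gsum_V[OF subgroup.subset[OF H(1)] _ ev(1)[OF xE(1)]] unital_subset_fractions[OF gsum_subalgebra[OF H(1)]] by blast
 hence "ev ?x : ?Q N" using N[of "Suc N"] by simp
 thus False using fraction_eigenvalue[OF H(1) _ ev(1)[OF xE(1)] xE(2) ev(2)[OF xE(1)]] xF by blast
qed

end

section \<open>Skew Laurent extensions\<close>

lemma int_funpow_simps:
 "bij_betw sigma S S ==> x : S ==> int_funpow S sigma i x : S"
 "int_funpow S sigma 0 x = x"
proof -
 assume b: "bij_betw sigma S S" and x: "x : S"
 have "(sigma ^^ n) x : S" "(inv_into S sigma ^^ n) x : S" for n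
  using x b bij_betw_inv_into[OF b] by (induction n) (auto simp: bij_betw_def)
 thus "int_funpow S sigma i x : S" by (auto simp: int_funpow_def)
qed (simp add: int_funpow_def)

lemma skew_laurent_simps:
 "car (skew_laurent R sigma) = {f. finite {i. f i ~= \<zero>\<^sub>R} & (ALL i. f i .: R)}"
 "\<zero>\<^bsub>skew_laurent R sigma\<^esub> = (%k. \<zero>\<^sub>R)" "f \<oplus>\<^bsub>skew_laurent R sigma\<^esub> g = (%k. f k \<oplus>\<^sub>R g k)"
 "\<one>\<^bsub>skew_laurent R sigma\<^esub> = (%k. if k = 0 then \<one>\<^sub>R else \<zero>\<^sub>R)"
 "f \<otimes>\<^bsub>skew_laurent R sigma\<^esub> g = (%k. \<Oplus>\<^sub>R i\<in>{i. f i ~= \<zero>\<^sub>R}. f i \<otimes>\<^sub>R int_funpow (car R) sigma i (g (k - i)))"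
 by (simp_all add: skew_laurent_def)

text \<open>Lets the ring axioms of skew Laurent extensions be read off from subrings of
  \<open>D\<close>, instead of being checked on twisted convolutions.\<close>

lemma ring_of_bij_hom:
 assumes "ring B" and h: "bij_betw h (car A) (car B)"
  and cl: "!!x y. x .: A ==> y .: A ==> x \<oplus>\<^sub>A y .: A & h (x \<oplus>\<^sub>A y) = h x \<oplus>\<^sub>B h y"
   "!!x y. x .: A ==> y .: A ==> x \<otimes>\<^sub>A y .: A & h (x \<otimes>\<^sub>A y) = h x \<otimes>\<^sub>B h y"
   "\<zero>\<^sub>A .: A & h \<zero>\<^sub>A = \<zero>\<^sub>B" "\<one>\<^sub>A .: A & h \<one>\<^sub>A = \<one>\<^sub>B"
 shows "ring A" "h : ring_iso A B"
proof -
 interpret B: ring B by fact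
 have i: "x = y" if "h x = h y" "x .: A" "y .: A" for x y using h that by (auto simp: bij_betw_def inj_on_def)
 have hc: "h x .: B" if "x .: A" for x using h that by (auto simp: bij_betw_def)
 have neg: "EX y:car A. y \<oplus>\<^sub>A x = \<zero>\<^sub>A" if x: "x .: A" for x
 proof -
  have "\<ominus>\<^sub>B h x : h ` car A" using hc[OF x] h by (simp add: bij_betw_def)
  then obtain y where y: "y .: A" "h y = \<ominus>\<^sub>B h x" by auto
  hence "y \<oplus>\<^sub>A x = \<zero>\<^sub>A" using x cl(1)[OF y(1) x] cl(3) hc[OF x] by (intro i) (auto simp: B.l_neg)
  thus ?thesis using y by blast
 qed
 have "abelian_group A"
  by (rule abelian_groupI) (use cl neg hc in "auto intro!: i simp: B.a_ac")
 moreover have "monoid A" by (rule monoidI) (use cl hc in "auto intro!: i simp: B.m_assoc")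
 ultimately show "ring A" by (rule ringI) (use cl hc in "auto intro!: i simp: B.l_distr B.r_distr")
 show "h : ring_iso A B" by (rule ring_iso_memI) (use cl hc h in auto)
qed

text \<open>\<open>P\<close> is a coefficient ring inside \<open>D\<close>, \<open>u\<close>
  normalizes it, and \<open>P'\<close> is to become the ring of Laurent polynomials in
  \<open>u\<close>: \<open>P'_step\<close> and \<open>P'_least\<close> say that the
  \<open>a u^i\<close> generate it additively, \<open>direct\<close> that the powers of
  \<open>u\<close> are independent over \<open>P\<close>. \<open>R\<close> is an abstract copy of
  \<open>P\<close>, in the iteration the preceding stage.\<close>

locale skew_laurent_model = skew_field D + R: ring R
 for D :: "('d, 'e) ring_scheme" (structure) and R :: "('a, 'b) ring_scheme" +
 fixes P P' :: "'d set" and h :: "'a => 'd" and u :: 'd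
 assumes u: "u .: D" "u ~= \<zero>" and P_sub: "P <= car D"
  and h: "h : ring_iso R (D on P)"
  and conj: "a : P ==> u \<otimes> a \<otimes> inv u : P" "a : P ==> inv u \<otimes> a \<otimes> u : P"
  and P'_ring: "ring (D on P')"
  and P'_sub: "P' <= car D"
  and P'_step: "a : P ==> x : P' ==> a \<otimes> (u [^]\<^bsub>units_of D\<^esub> (i::int)) \<oplus> x : P'"
  and P'_least: "\<zero> : Z ==> (!!a i x. a : P ==> x : Z ==> a \<otimes> (u [^]\<^bsub>units_of D\<^esub> (i::int)) \<oplus> x : Z) ==> P' <= Z"
  and direct: "finite I ==> (!!i. i : I ==> f i : P) ==> (\<Oplus>i\<in>I. f i \<otimes> (u [^]\<^bsub>units_of D\<^esub> (i::int))) = \<zero> ==> j : I ==> f j = \<zero>"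
begin

definition up :: "int => 'd" where "up i = u [^]\<^bsub>units_of D\<^esub> i"
definition tw where "tw x = inv_into (car R) h (u \<otimes> h x \<otimes> inv u)"

abbreviation "L == skew_laurent R tw"

lemma up_closed [simp]: "up i .: D" and up_zero [simp]: "up 0 = \<one>" and up_add: "up (i + j) = up i \<otimes> up j"
 and up_one: "up 1 = u" and up_m1: "up (-1) = inv u"
proof -
 interpret U: group "units_of D" by (rule units_group)
 have uU: "u .: (units_of D)" using u by (simp add: units_of_carrier skew_field_Units)
 show "up i .: D" using U.int_pow_closed[OF uU, of i] by (simp add: up_def units_of_carrier Units_closed)
 show "up 0 = \<one>" by (simp add: up_def units_of_one)
 show "up (i + j) = up i \<otimes> up j" using U.int_pow_mult[OF uU, of i j] by (simp add: up_def units_of_mult)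
 show "up 1 = u" using U.int_pow_1[OF uU] by (simp add: up_def)
 show "up (-1) = inv u" using U.int_pow_neg[OF uU, of 1] U.int_pow_1[OF uU] units_of_inv[of u] uU by (simp add: up_def units_of_carrier)
qed

lemma up_neg [simp]: "up i \<otimes> up (- i) = \<one>" "up (- i) \<otimes> up i = \<one>"
 using up_add[of i "- i"] up_add[of "- i" i] by simp_all

lemma h_simps: "x .: R ==> h x : P" "x .: R ==> y .: R ==> h (x \<otimes>\<^sub>R y) = h x \<otimes> h y"
 "x .: R ==> y .: R ==> h (x \<oplus>\<^sub>R y) = h x \<oplus> h y" "h \<one>\<^sub>R = \<one>" "bij_betw h (car R) P"
 using ring_iso_memE[OF h] by auto

lemma hc [simp]: "x .: R ==> h x .: D" using h_simps(1) P_sub by blast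

lemma h_zero [simp]: "h \<zero>\<^sub>R = \<zero>"
 using h_simps(3)[of "\<zero>\<^sub>R" "\<zero>\<^sub>R"] hc[of "\<zero>\<^sub>R"] add.l_cancel_one by simp

lemma h_inj: "x .: R ==> y .: R ==> h x = h y \<longleftrightarrow> x = y"
 using h_simps(5) by (auto simp: bij_betw_def inj_on_def)

lemma h_surj: "a : P ==> inv_into (car R) h a .: R" "a : P ==> h (inv_into (car R) h a) = a"
 using h_simps(5) by (auto simp: bij_betw_def inv_into_into f_inv_into_f)

lemma h_finsum: "finite I ==> (!!i. i : I ==> f i .: R) ==> h (\<Oplus>\<^sub>R i\<in>I. f i) = (\<Oplus>i\<in>I. h (f i))"
 by (induction I rule: finite_induct) (auto simp: Pi_def h_simps R.finsum_closed)

lemma tw: "x .: R ==> tw x .: R" "x .: R ==> h (tw x) = u \<otimes> h x \<otimes> inv u"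
 using h_surj[OF conj(1)[OF h_simps(1)]] by (simp_all add: tw_def)

lemma inv_u [simp]: "inv u .: D" "inv u \<otimes> u = \<one>" "u \<otimes> inv u = \<one>" using u by auto

lemma tw_bij: "bij_betw tw (car R) (car R)"
proof (rule bij_betw_imageI)
 show "inj_on tw (car R)"
 proof (rule inj_onI)
  fix x y assume xy: "x .: R" "y .: R" "tw x = tw y"
  have "inv u \<otimes> (u \<otimes> h x \<otimes> inv u) \<otimes> u = inv u \<otimes> (u \<otimes> h y \<otimes> inv u) \<otimes> u" using tw(2) xy by metis
  hence "h x = h y" using xy u by (simp add: m_assoc)
  thus "x = y" using h_inj xy by blast
 qed
 show "tw ` car R = car R"
 proof (intro subset_antisym subsetI)
  fix y assume y: "y .: R"
  let ?x = "inv_into (car R) h (inv u \<otimes> h y \<otimes> u)"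
  note x = h_surj[OF conj(2)[OF h_simps(1)[OF y]]]
  have "h (tw ?x) = h y" using tw(2)[OF x(1)] x(2) y u by (simp add: m_assoc)
  hence "tw ?x = y" using h_inj tw(1)[OF x(1)] y by blast
  thus "y : tw ` car R" using x(1) by (intro image_eqI[of y tw ?x]) simp_all
 qed (use tw in auto)
qed

lemma tw_iso: "tw : ring_iso R R"
proof (rule ring_iso_memI)
 fix x y assume xy: "x .: R" "y .: R"
 have "h (tw (x \<otimes>\<^sub>R y)) = h (tw x \<otimes>\<^sub>R tw y)" using xy u tw by (simp add: h_simps m_assoc)
 thus "tw (x \<otimes>\<^sub>R y) = tw x \<otimes>\<^sub>R tw y" using h_inj tw(1) xy by simp
 have "h (tw (x \<oplus>\<^sub>R y)) = h (tw x \<oplus>\<^sub>R tw y)" using xy u tw by (simp add: h_simps l_distr r_distr)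
 thus "tw (x \<oplus>\<^sub>R y) = tw x \<oplus>\<^sub>R tw y" using h_inj tw(1) xy by simp
next
 have "h (tw \<one>\<^sub>R) = h \<one>\<^sub>R" using tw(2)[of "\<one>\<^sub>R"] u by (simp add: h_simps)
 thus "tw \<one>\<^sub>R = \<one>\<^sub>R" using h_inj tw(1) by simp
qed (use tw tw_bij in auto)

lemma h_int_funpow: "x .: R ==> h (int_funpow (car R) tw i x) = up i \<otimes> h x \<otimes> up (- i)"
proof -
 assume x: "x .: R"
 let ?rho = "inv_into (car R) tw"
 have rho: "?rho y .: R" "h (?rho y) = inv u \<otimes> h y \<otimes> u" if y: "y .: R" for y
 proof -
  show c: "?rho y .: R" using bij_betw_inv_into[OF tw_bij] y by (auto simp: bij_betw_def)
  have "h y = h (tw (?rho y))" using bij_betw_inv_into_right[OF tw_bij y] by simp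
  also have "... = u \<otimes> h (?rho y) \<otimes> inv u" by (rule tw(2)[OF c])
  finally show "h (?rho y) = inv u \<otimes> h y \<otimes> u" using c u by (simp add: m_assoc)
 qed
 have 1: "(tw ^^ n) x .: R & h ((tw ^^ n) x) = up (int n) \<otimes> h x \<otimes> up (- int n)" for n
 proof (induction n)
  case (Suc n)
  have e: "up (int (Suc n)) = u \<otimes> up (int n)" "up (- int (Suc n)) = up (- int n) \<otimes> inv u"
   using up_add[of 1 "int n"] up_add[of "- int n" "-1"] by (simp_all add: up_one up_m1 add.commute)
  show ?case unfolding e using Suc tw[of "(tw ^^ n) x"] x u by (simp add: m_assoc)
 qed (use x in simp)
 have 2: "(?rho ^^ n) x .: R & h ((?rho ^^ n) x) = up (- int n) \<otimes> h x \<otimes> up (int n)" for n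
 proof (induction n)
  case (Suc n)
  have e: "up (int (Suc n)) = up (int n) \<otimes> u" "up (- int (Suc n)) = inv u \<otimes> up (- int n)"
   using up_add[of "int n" 1] up_add[of "-1" "- int n"] by (simp_all add: up_one up_m1 add.commute)
  show ?case unfolding e using Suc rho[of "(?rho ^^ n) x"] x u by (simp add: m_assoc)
 qed (use x in simp)
 show ?thesis using 1[of "nat i"] 2[of "nat (- i)"] by (auto simp: int_funpow_def)
qed

definition H where "H f = (\<Oplus>i\<in>{i. f i ~= \<zero>\<^sub>R}. h (f i) \<otimes> up i)"

lemma H_eq: "f .: L ==> finite S ==> {i. f i ~= \<zero>\<^sub>R} <= S ==> H f = (\<Oplus>i\<in>S. h (f i) \<otimes> up i)"
 unfolding H_def by (rule add.finprod_mono_neutral_cong_left) (auto simp: skew_laurent_simps)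

lemma L_add: assumes f: "f .: L" and g: "g .: L"
 shows "f \<oplus>\<^sub>L g .: L & H (f \<oplus>\<^sub>L g) = H f \<oplus> H g"
proof -
 let ?S = "{i. f i ~= \<zero>\<^sub>R} \<union> {i. g i ~= \<zero>\<^sub>R}"
 have c: "!!i. f i .: R" "!!i. g i .: R" and S: "finite ?S" using f g by (auto simp: skew_laurent_simps)
 have sub: "{i. (f \<oplus>\<^sub>L g) i ~= \<zero>\<^sub>R} <= ?S" by (auto simp: skew_laurent_simps)
 hence "finite {i. (f \<oplus>\<^sub>L g) i ~= \<zero>\<^sub>R}" using S finite_subset by blast
 hence fg: "f \<oplus>\<^sub>L g .: L" using c by (simp add: skew_laurent_simps)
 have "H (f \<oplus>\<^sub>L g) = (\<Oplus>i\<in>?S. h (f i) \<otimes> up i \<oplus> h (g i) \<otimes> up i)"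
  unfolding H_eq[OF fg S sub] using c by (intro add.finprod_cong') (auto simp: skew_laurent_simps h_simps l_distr)
 also have "... = H f \<oplus> H g"
  unfolding H_eq[OF f S Un_upper1] H_eq[OF g S Un_upper2] by (rule finsum_addf) (use c in auto)
 finally show ?thesis using fg by simp
qed

text \<open>The power of the twist becomes conjugation by \<open>u^i\<close>, which cancels against
  \<open>u^k\<close>. The twisted convolution thus turns into the double sum of the products
  \<open>h (f i) u^i h (g j) u^j\<close> with \<open>j = k - i\<close>.\<close>

lemma L_mult: assumes f: "f .: L" and g: "g .: L"
 shows "f \<otimes>\<^sub>L g .: L & H (f \<otimes>\<^sub>L g) = H f \<otimes> H g"
proof -
 let ?A = "{i. f i ~= \<zero>\<^sub>R}" and ?B = "{i. g i ~= \<zero>\<^sub>R}"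
 let ?C = "(%(i, j). i + j) ` (?A \<times> ?B)"
 have c: "!!i. f i .: R" "!!i. g i .: R" and fin: "finite ?A" "finite ?B" using f g by (auto simp: skew_laurent_simps)
 have C: "finite ?C" using fin by blast
 let ?s = "%i. int_funpow (car R) tw i"
 have s: "?s i x .: R" if "x .: R" for i x by (rule int_funpow_simps(1)[OF tw_bij that])
 have s0: "?s i \<zero>\<^sub>R = \<zero>\<^sub>R" for i
 proof -
  have "h (?s i \<zero>\<^sub>R) = h \<zero>\<^sub>R" by (simp add: h_int_funpow)
  thus ?thesis by (rule iffD1[OF h_inj[OF s[OF R.zero_closed] R.zero_closed]])
 qed
 have fgc: "(f \<otimes>\<^sub>L g) k .: R" for k unfolding skew_laurent_simps by (rule R.finsum_closed) (use c s in auto)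
 have sub: "{k. (f \<otimes>\<^sub>L g) k ~= \<zero>\<^sub>R} <= ?C"
 proof (rule subsetI, rule ccontr)
  fix k assume k: "k : {k. (f \<otimes>\<^sub>L g) k ~= \<zero>\<^sub>R}" "k ~: ?C"
  have "g (k - i) = \<zero>\<^sub>R" if "i : ?A" for i
  proof (rule ccontr)
   assume "g (k - i) ~= \<zero>\<^sub>R"
   hence "(i, k - i) : ?A \<times> ?B" using that by simp
   hence "k : ?C" by (rule image_eqI[rotated]) simp
   thus False using k by simp
  qed
  hence "(\<Oplus>\<^sub>R i\<in>?A. f i \<otimes>\<^sub>R ?s i (g (k - i))) = (\<Oplus>\<^sub>R i\<in>?A. \<zero>\<^sub>R)"
   using c by (intro R.add.finprod_cong') (auto simp: s0)
  thus False using k by (simp add: skew_laurent_simps)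
 qed
 hence "finite {k. (f \<otimes>\<^sub>L g) k ~= \<zero>\<^sub>R}" using C finite_subset by blast
 hence fg: "f \<otimes>\<^sub>L g .: L" using fgc by (simp add: skew_laurent_simps(1))
 let ?t = "%i k. h (f i) \<otimes> up i \<otimes> (h (g (k - i)) \<otimes> up (k - i))"
 have "H (f \<otimes>\<^sub>L g) = (\<Oplus>k\<in>?C. \<Oplus>i\<in>?A. ?t i k)" unfolding H_eq[OF fg C sub]
 proof (rule finsum_cong', rule refl)
  fix k
  have e: "up k = up i \<otimes> up (k - i)" for i using up_add[of i "k - i"] by simp
  have "h ((f \<otimes>\<^sub>L g) k) = (\<Oplus>i\<in>?A. h (f i \<otimes>\<^sub>R ?s i (g (k - i))))"
   unfolding skew_laurent_simps by (rule h_finsum) (use fin c s in auto)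
  hence "h ((f \<otimes>\<^sub>L g) k) \<otimes> up k = (\<Oplus>i\<in>?A. h (f i \<otimes>\<^sub>R ?s i (g (k - i))) \<otimes> up k)"
   using fin c s by (simp add: finsum_ldistr Pi_def)
  also have "... = (\<Oplus>i\<in>?A. ?t i k)"
  proof (rule finsum_cong')
   fix i
   have "up (- i) \<otimes> up k = up (k - i)" using up_add[of "- i" k] by (simp add: add.commute)
   hence "up i \<otimes> h (g (k - i)) \<otimes> up (- i) \<otimes> up k = up i \<otimes> (h (g (k - i)) \<otimes> up (k - i))"
    using c by (simp add: m_assoc)
   thus "h (f i \<otimes>\<^sub>R ?s i (g (k - i))) \<otimes> up k = ?t i k"
    using c s by (simp add: h_simps h_int_funpow m_assoc)
  qed (use c in auto)
  finally show "h ((f \<otimes>\<^sub>L g) k) \<otimes> up k = (\<Oplus>i\<in>?A. ?t i k)" .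
 qed (use c in auto)
 also have "... = (\<Oplus>i\<in>?A. \<Oplus>k\<in>?C. ?t i k)" by (rule finsum_swap) (use C fin c in auto)
 also have "... = (\<Oplus>i\<in>?A. h (f i) \<otimes> up i \<otimes> H g)"
 proof (rule finsum_cong')
  fix i assume i: "i : ?A"
  have inj: "inj_on (%k. k - i) ?C" by (simp add: inj_on_def)
  have "(\<Oplus>k\<in>?C. h (g (k - i)) \<otimes> up (k - i)) = (\<Oplus>j\<in>(%k. k - i) ` ?C. h (g j) \<otimes> up j)"
   by (rule finsum_reindex[OF _ inj, symmetric]) (use c in auto)
  also have "... = H g"
  proof (rule H_eq[OF g, symmetric])
   show "?B <= (%k. k - i) ` ?C"
   proof
    fix j assume "j : ?B"
    hence "i + j : ?C" using i by (intro image_eqI[of _ _ "(i, j)"]) auto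
    thus "j : (%k. k - i) ` ?C" by (rule image_eqI[rotated]) simp
   qed
  qed (use C in blast)
  finally show "(\<Oplus>k\<in>?C. ?t i k) = h (f i) \<otimes> up i \<otimes> H g"
   using C c by (subst finsum_rdistr[symmetric]) auto
 qed (use c in "auto simp: H_def intro!: finsum_closed")
 also have "... = H f \<otimes> H g" unfolding H_def[of f]
  using fin c by (intro finsum_ldistr[symmetric]) (auto simp: H_def intro!: finsum_closed)
 finally show ?thesis using fg by simp
qed

lemma H_single: "x .: R ==> (%k. if k = i then x else \<zero>\<^sub>R) .: L"
 "x .: R ==> H (%k. if k = i then x else \<zero>\<^sub>R) = h x \<otimes> up i"
proof -
 let ?f = "%k. if k = i then x else \<zero>\<^sub>R"
 assume x: "x .: R"
 have s: "{k. ?f k ~= \<zero>\<^sub>R} <= {i}" by auto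
 hence "finite {k. ?f k ~= \<zero>\<^sub>R}" by (rule finite_subset) simp
 thus f: "?f .: L" unfolding skew_laurent_simps using x by simp
 show "H ?f = h x \<otimes> up i" using H_eq[OF f _ s] x finsum_insert[of "{}" i "%k. h (?f k) \<otimes> up k"] by simp
qed

lemma H_zero: "\<zero>\<^sub>L .: L" "H \<zero>\<^sub>L = \<zero>"
 by (simp_all add: skew_laurent_simps H_def)

lemma H_P': "f .: L ==> H f : P'"
proof -
 assume f: "f .: L"
 have z: "\<zero> : P'" using ring.ring_simprules(2)[OF P'_ring] by simp
 have "(\<Oplus>i\<in>I. h (f i) \<otimes> up i) : P'" if "finite I" for I using that
 proof (induction I rule: finite_induct)
  case (insert i I)
  thus ?case using P'_step[OF h_simps(1), of "f i" _ i] f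
   by (subst finsum_insert) (auto simp: skew_laurent_simps up_def[symmetric])
 qed (simp add: z)
 thus ?thesis using f by (simp add: H_def skew_laurent_simps)
qed

lemma H_bij: "bij_betw H (car L) P'"
proof (rule bij_betw_imageI)
 show "inj_on H (car L)"
 proof (rule inj_onI)
  fix f g assume f: "f .: L" and g: "g .: L" and e: "H f = H g"
  let ?S = "{i. f i ~= \<zero>\<^sub>R} \<union> {i. g i ~= \<zero>\<^sub>R}"
  let ?d = "%i. f i \<oplus>\<^sub>R \<ominus>\<^sub>R g i"
  have c: "!!i. f i .: R" "!!i. g i .: R" and S: "finite ?S" using f g by (auto simp: skew_laurent_simps)
  have "(\<Oplus>i\<in>?S. h (?d i) \<otimes> up i) \<oplus> (\<Oplus>i\<in>?S. h (g i) \<otimes> up i) = (\<Oplus>i\<in>?S. h (?d i) \<otimes> up i \<oplus> h (g i) \<otimes> up i)"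
   by (rule finsum_addf[symmetric]) (use c in auto)
  also have "... = (\<Oplus>i\<in>?S. h (f i) \<otimes> up i)"
  proof (rule finsum_cong')
   fix i
   have "h (?d i) \<oplus> h (g i) = h (f i)" using c by (simp add: h_simps(3)[symmetric] R.a_assoc R.l_neg)
   thus "h (?d i) \<otimes> up i \<oplus> h (g i) \<otimes> up i = h (f i) \<otimes> up i" using c by (simp add: l_distr[symmetric])
  qed (use c in auto)
  finally have "(\<Oplus>i\<in>?S. h (?d i) \<otimes> up i) \<oplus> H g = H g"
   using e H_eq[OF f S] H_eq[OF g S] by simp
  moreover have "(\<Oplus>i\<in>?S. h (?d i) \<otimes> up i) .: D" by (rule finsum_closed) (use c in auto)
  moreover have "H g .: D" using H_P'[OF g] P'_sub by blast
  ultimately have z: "(\<Oplus>i\<in>?S. h (?d i) \<otimes> up i) = \<zero>" using add.r_cancel_one by blast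
  have "f i = g i" for i
  proof (cases "i : ?S")
   case True
   have "h (?d i) = \<zero>" by (rule direct[OF S _ z[unfolded up_def] True]) (use c h_simps(1) in auto)
   hence "?d i = \<zero>\<^sub>R" using h_inj[of "?d i" "\<zero>\<^sub>R"] c by simp
   thus ?thesis using R.a_minus_eq_zero_iff[of "f i" "g i"] c by (simp add: a_minus_def)
  qed auto
  thus "f = g" by blast
 qed
 have "P' <= H ` car L"
 proof (rule P'_least)
  show "\<zero> : H ` car L" using H_zero by (intro image_eqI[of _ _ "\<zero>\<^sub>L"]) simp_all
  fix a x and i :: int assume a: "a : P" and "x : H ` car L"
  then obtain f where f: "f .: L" "x = H f" by blast
  let ?s = "%k. if k = i then inv_into (car R) h a else \<zero>\<^sub>R"
  note s = H_single[OF h_surj(1)[OF a], of i]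
  have "a \<otimes> (u [^]\<^bsub>units_of D\<^esub> i) \<oplus> x = H (?s \<oplus>\<^sub>L f)"
   using L_add[OF s(1) f(1)] s(2) f(2) h_surj(2)[OF a] by (simp add: up_def)
  thus "a \<otimes> (u [^]\<^bsub>units_of D\<^esub> i) \<oplus> x : H ` car L" using L_add[OF s(1) f(1)] by blast
 qed
 thus "H ` car L = P'" using H_P' by blast
qed

lemma L_one: "\<one>\<^sub>L .: L" "H \<one>\<^sub>L = \<one>"
 using H_single[OF R.one_closed, of 0] by (simp_all add: skew_laurent_simps(4) h_simps)

theorem ring_L: "ring L" and H_iso: "H : ring_iso L (D on P')"
proof -
 have "bij_betw H (car L) (car (D on P'))" using H_bij by simp
 from ring_of_bij_hom[OF P'_ring this] L_add L_mult H_zero L_one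
 show "ring L" "H : ring_iso L (D on P')" by simp_all
qed

end

section \<open>Iteration over the free generators\<close>

lemma uncurry_exponent_inj: "inj uncurry_exponent"
proof (rule injI)
 fix f g :: "int => int list => 'a" assume e: "uncurry_exponent f = uncurry_exponent g"
 have "f i is = g i is" for i "is" using fun_cong[OF e, of "i # is"] by (simp add: uncurry_exponent_def)
 thus "f = g" by blast
qed

text \<open>A stage depends on earlier twists only, so the twist acting on it can be defined once
  the stage has been built.\<close>

lemma iterated_skew_laurent_cong:
 "(!!m. m < n ==> sigma m = sigma' m) ==> iterated_skew_laurent Gamma sigma n = iterated_skew_laurent Gamma sigma' n"
 by (induction n) auto

lemma iterated_skew_laurent_const_cong:
 "(!!m. m < n ==> sigma m = sigma' m) ==> iterated_skew_laurent_const Gamma sigma n = iterated_skew_laurent_const Gamma sigma' n"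
proof (induction n)
 case (Suc n)
 have "iterated_skew_laurent_const Gamma sigma n = iterated_skew_laurent_const Gamma sigma' n"
  "iterated_skew_laurent Gamma sigma n = iterated_skew_laurent Gamma sigma' n"
  using Suc iterated_skew_laurent_cong[of n sigma sigma' Gamma] by auto
 thus ?case by (intro ext) (simp cong: if_cong)
qed (auto intro!: ext)

lemma (in comm_group) gprod_extend:
 assumes "finite J" "I <= J" "!!i. i : J ==> g i .: G"
 shows "gprod I g k = gprod J g (%i. if i : I then k i else 0)"
 unfolding gprod_def using assms by (intro finprod_mono_neutral_cong_left) auto

context graded begin

lemma comp_sum:
 assumes "finite I" "!!i. i : I ==> x i : gsum (car W)" "mu .: W"
 shows "comp mu (\<Oplus>i\<in>I. x i) = (\<Oplus>i\<in>I. comp mu (x i)) & (\<Oplus>i\<in>I. x i) : gsum (car W)"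
 using assms(1,2)
proof (induction I rule: finite_induct)
 case empty
 show ?case using comp_finsum[of "{}" _ mu] gsum_zero by simp
next
 case (insert i I)
 have "x j .: D" "comp mu (x j) .: D" if "j : insert i I" for j
  using gsum_closed[OF subset_refl insert.prems[OF that]] Vc[OF comp_closed[OF insert.prems[OF that] assms(3)]] by auto
 hence "(\<Oplus>i\<in>insert i I. x i) = x i \<oplus> (\<Oplus>i\<in>I. x i)"
   "(\<Oplus>i\<in>insert i I. comp mu (x i)) = comp mu (x i) \<oplus> (\<Oplus>i\<in>I. comp mu (x i))"
  using insert(1,2) by (auto intro!: M.finsum_insert)
 thus ?case using insert assms(3) comp_add gsum_add[OF subset_refl] by simp
qed

lemma V_int_pow:
 assumes n: "nu : Ev" and v: "v : V nu" "v ~= \<zero>"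
 shows "v [^]\<^bsub>units_of D\<^esub> (i::int) : V (nu [^]\<^bsub>W on Ev\<^esub> i)" "v [^]\<^bsub>units_of D\<^esub> (i::int) ~= \<zero>"
proof -
 interpret U: group "units_of D" by (rule A.units_group)
 interpret G: comm_group "W on Ev" by (rule W.comm_subgroup[OF subgroup_Ev])
 have vU: "v .: (units_of D)" using v Vc by (simp add: units_of_carrier Units_eq)
 have nz: "v [^]\<^bsub>units_of D\<^esub> (i::int) ~= \<zero>" "v [^]\<^bsub>units_of D\<^esub> (i::int) .: D" for i
  using U.int_pow_closed[OF vU, of i] by (auto simp: units_of_carrier Units_eq)
 thus "v [^]\<^bsub>units_of D\<^esub> i ~= \<zero>" by blast
 have Wc: "nu [^]\<^bsub>W on Ev\<^esub> (i::int) : Ev" for i using G.int_pow_closed[of nu i] n by simp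
 note mem = subgroup.mem_carrier[OF subgroup_Ev]
 have nat: "v [^]\<^bsub>units_of D\<^esub> int m : V (nu [^]\<^bsub>W on Ev\<^esub> int m)" for m
 proof (induction m)
  case 0 thus ?case using V_one by (simp add: units_of_one)
 next
  case (Suc m)
  have "v [^]\<^bsub>units_of D\<^esub> int (Suc m) = v [^]\<^bsub>units_of D\<^esub> int m \<otimes> v" by (simp only: int_pow_int U.nat_pow_Suc units_of_mult)
  moreover have "nu [^]\<^bsub>W on Ev\<^esub> int (Suc m) = nu [^]\<^bsub>W on Ev\<^esub> int m \<otimes>\<^sub>W nu" by (simp only: int_pow_int G.nat_pow_Suc) simp
  ultimately show ?case using V_mult[OF mem[OF Wc] mem[OF n] Suc v(1)] by (simp only:)
 qed
 show "v [^]\<^bsub>units_of D\<^esub> i : V (nu [^]\<^bsub>W on Ev\<^esub> i)"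
 proof (cases "0 <= i")
  case True thus ?thesis using nat[of "nat i"] by simp
 next
  case False
  let ?m = "nat (- i)"
  have i: "i = - int ?m" using False by simp
  have "v [^]\<^bsub>units_of D\<^esub> i = inv (v [^]\<^bsub>units_of D\<^esub> int ?m)"
   by (subst i, subst U.int_pow_neg[OF vU], rule A.units_of_inv) (use U.int_pow_closed[OF vU, of "int ?m"] in "simp add: units_of_carrier")
  moreover have "nu [^]\<^bsub>W on Ev\<^esub> i = inv\<^bsub>W\<^esub> (nu [^]\<^bsub>W on Ev\<^esub> int ?m)"
   by (subst i, subst G.int_pow_neg) (use n Wc W.m_inv_consistent[OF subgroup_Ev] in auto)
  ultimately show ?thesis using V_inv[OF mem[OF Wc] nat[of ?m] nz(1)] by (simp only:)
 qed
qed

text \<open>Stage \<open>n\<close> is modelled by the sum of the eigenspaces over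
  \<open>S n\<close>, the group generated by the torsion and the first \<open>n\<close> free
  generators. The next generator contributes an eigenvector; it normalizes the stage, and its powers
  are independent because no nonzero power of the generator lies in \<open>S n\<close>.\<close>

theorem iterated_laurent:
 fixes r :: nat and g kappa
 defines "G == (W on Ev)" and "Gamma == (D on gsum (torsion_part (W\<lparr>carrier := Ev\<rparr>)))"
 assumes g: "!!i. i < r ==> g i .: G"
  and kappa: "!!x. x .: G ==> EX tau:torsion_part G. x = tau \<otimes>\<^sub>G comm_group.gprod G {..<r} g (kappa x)"
  and kappau: "!!tau k i. tau : torsion_part G ==> i < r ==> kappa (tau \<otimes>\<^sub>G comm_group.gprod G {..<r} g k) i = k i"
 shows "EX sigma. (ALL n<r. sigma n : ring_iso (iterated_skew_laurent Gamma sigma n) (iterated_skew_laurent Gamma sigma n)) &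
  (EX h:ring_iso (iterated_skew_laurent Gamma sigma r) (D on gsum Ev).
   ALL a:car Gamma. h (iterated_skew_laurent_const Gamma sigma r a) = a)"
proof -
 interpret G: comm_group G unfolding G_def by (rule W.comm_subgroup[OF subgroup_Ev])
 have Gs [simp]: "car G = Ev" "x \<otimes>\<^sub>G y = x \<otimes>\<^sub>W y" "\<one>\<^sub>G = \<one>\<^sub>W" for x y by (simp_all add: G_def)
 have Evc: "x .: W" if "x : Ev" for x using that by (simp add: Ev_def)
 have Gi [simp]: "inv\<^bsub>G\<^esub> x = inv\<^bsub>W\<^esub> x" if "x : Ev" for x unfolding G_def by (rule W.m_inv_consistent[OF subgroup_Ev that])
 have TE: "x : Ev" if "x : G.TT" for x using that G.torsion_subset by auto
 have gE: "g i : Ev" if "i < r" for i using g that by simp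
 have gp: "G.gprod {..<n} g k : Ev" if "n <= r" for n k using G.gprod_closed[of "{..<n}" g k] gE that by simp
 define S where "S n = {tau \<otimes>\<^sub>W G.gprod {..<n} g k | tau k. tau : G.TT}" for n
 have Em: "x \<otimes>\<^sub>W y : Ev" if "x : Ev" "y : Ev" for x y using subgroup.m_closed[OF subgroup_Ev that] .
 have SE: "S n <= Ev" if "n <= r" for n using TE gp[OF that] Em by (auto simp: S_def)
 have S_sub: "subgroup (S n) W" if n: "n <= r" for n
 proof (rule W.subgroupI)
  show "S n <= car W" using SE[OF n] Evc by blast
  show "S n ~= {}" using G.torsion_one unfolding S_def by blast
  fix x assume "x : S n" then obtain tau k where x: "tau : G.TT" "x = tau \<otimes>\<^sub>W G.gprod {..<n} g k" by (auto simp: S_def)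
  have "inv\<^bsub>W\<^esub> x = inv\<^bsub>W\<^esub> tau \<otimes>\<^sub>W inv\<^bsub>W\<^esub> G.gprod {..<n} g k" unfolding x(2) using Evc TE[OF x(1)] gp[OF n] by (simp add: W.inv_mult)
  also have "inv\<^bsub>W\<^esub> G.gprod {..<n} g k = G.gprod {..<n} g (%i. - k i)" using G.gprod_neg[of "{..<n}" g k] gE n gp[OF n] by simp
  finally show "inv\<^bsub>W\<^esub> x : S n" using G.torsion_inv[OF x(1)] TE[OF x(1)] unfolding S_def by auto
  fix y assume "y : S n" then obtain sigma l where y: "sigma : G.TT" "y = sigma \<otimes>\<^sub>W G.gprod {..<n} g l" by (auto simp: S_def)
  have "x \<otimes>\<^sub>W y = (tau \<otimes>\<^sub>W sigma) \<otimes>\<^sub>W (G.gprod {..<n} g k \<otimes>\<^sub>W G.gprod {..<n} g l)"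
   unfolding x(2) y(2) using Evc TE[OF x(1)] TE[OF y(1)] gp[OF n] by (simp add: W.m_ac)
  also have "G.gprod {..<n} g k \<otimes>\<^sub>W G.gprod {..<n} g l = G.gprod {..<n} g (%i. k i + l i)" using G.gprod_add[of "{..<n}" g k l] gE n by simp
  finally show "x \<otimes>\<^sub>W y : S n" using G.torsion_mult[OF x(1) y(1)] unfolding S_def by auto
 qed
 have S0: "S 0 = G.TT"
 proof -
  have e: "tau \<otimes>\<^sub>W G.gprod {..<0} g k = tau" if "tau : G.TT" for tau k using Evc[OF TE[OF that]] by (simp add: G.gprod_def)
  hence "S 0 <= G.TT" by (auto simp: S_def)
  moreover have "G.TT <= S 0" using e[symmetric] unfolding S_def by blast
  ultimately show ?thesis by blast
 qed
 have Sr: "S r = Ev"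
 proof
  show "Ev <= S r" using kappa unfolding S_def by fastforce
 qed (rule SE[OF order_refl])
 have pw: "g n [^]\<^sub>G (k::int) : Ev" if "n < r" for n k using G.int_pow_closed[of "g n" k] gE[OF that] by simp
 have S_Suc: "EX mu:S n. EX k::int. x = mu \<otimes>\<^sub>W g n [^]\<^sub>G k" if xS: "x : S (Suc n)" and n: "n < r" for x n
 proof -
  obtain tau k where x: "tau : G.TT" "x = tau \<otimes>\<^sub>W G.gprod {..<Suc n} g k" using xS by (auto simp: S_def)
  have "G.gprod {..<Suc n} g k = g n [^]\<^sub>G k n \<otimes>\<^sub>W G.gprod ({..<Suc n} - {n}) g k"
   using G.gprod_remove[of "{..<Suc n}" n g k] gE n by auto
  also have "{..<Suc n} - {n} = {..<n}" by auto
  finally have "x = (tau \<otimes>\<^sub>W G.gprod {..<n} g k) \<otimes>\<^sub>W g n [^]\<^sub>G k n"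
   unfolding x(2) using Evc TE[OF x(1)] gp[of n k] pw[OF n] n by (simp add: W.m_ac)
  thus ?thesis using x(1) unfolding S_def by blast
 qed
 have S_mono: "S n <= S (Suc n)" and g_S: "g n [^]\<^sub>G (k::int) : S (Suc n)" if n: "n < r" for n k
 proof -
  show "S n <= S (Suc n)"
  proof
   fix x assume "x : S n"
   then obtain tau l where x: "tau : G.TT" "x = tau \<otimes>\<^sub>W G.gprod {..<n} g l" by (auto simp: S_def)
   have "G.gprod {..<n} g l = G.gprod {..<Suc n} g (%i. if i : {..<n} then l i else 0)"
    using gE n by (intro G.gprod_extend) auto
   thus "x : S (Suc n)" using x unfolding S_def by auto
  qed
  have "G.gprod {..<Suc n} g (%i. if i = n then k else 0) = g n [^]\<^sub>G k" using gE n by (intro G.gprod_single) auto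
  hence "g n [^]\<^sub>G k = \<one>\<^sub>W \<otimes>\<^sub>W G.gprod {..<Suc n} g (%i. if i = n then k else 0)" using Evc[OF pw[OF n]] by simp
  thus "g n [^]\<^sub>G k : S (Suc n)" using G.torsion_one unfolding S_def by auto
 qed
 have indep: "k = 0" if n: "n < r" and k: "g n [^]\<^sub>G (k::int) : S n" for n k
 proof -
  obtain tau l where t: "tau : G.TT" "g n [^]\<^sub>G k = tau \<otimes>\<^sub>W G.gprod {..<n} g l" using k by (auto simp: S_def)
  have "G.gprod {..<n} g l = G.gprod {..<r} g (%i. if i : {..<n} then l i else 0)"
   using gE n by (intro G.gprod_extend) auto
  hence "kappa (g n [^]\<^sub>G k) n = 0" using kappau[OF t(1) n, of "%i. if i : {..<n} then l i else 0"] t(2) by simp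
  moreover have "G.gprod {..<r} g (%i. if i = n then k else 0) = g n [^]\<^sub>G k" using gE n by (intro G.gprod_single) auto
  hence "kappa (g n [^]\<^sub>G k) n = k" using kappau[OF G.torsion_one n, of "%i. if i = n then k else 0"] Evc[OF pw[OF n]] by simp
  ultimately show ?thesis by simp
 qed
 have alg: "unital_subalgebra K D (gsum (S n))" if "n <= r" for n by (rule gsum_subalgebra[OF S_sub[OF that]])
 have Sring: "ring (D on gsum (S n))" if "n <= r" for n
  using assoc_algebra.axioms(3)[OF unital_subalgebra_algebra[OF alg[OF that]]] .
 have Sc: "S n <= car W" if "n <= r" for n using SE[OF that] Evc by blast
 have Gamma: "Gamma = (D on gsum (S 0))" "car Gamma = gsum (S 0)" by (simp_all add: Gamma_def S0 G_def)
 let ?L = "iterated_skew_laurent Gamma" and ?c = "iterated_skew_laurent_const Gamma"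
 \<comment> \<open>Twists and models are built together, since \<open>sigma n\<close> is conjugation
   carried over by the model of stage \<open>n\<close>.\<close>
 have "EX sigma h. (ALL m<n. sigma m : ring_iso (?L sigma m) (?L sigma m)) & ring (?L sigma n) &
   h : ring_iso (?L sigma n) (D on gsum (S n)) & (ALL a:gsum (S 0). ?c sigma n a .: (?L sigma n) & h (?c sigma n a) = a)" if "n <= r" for n
  using that
 proof (induction n)
  case 0
  interpret Gamma: ring Gamma unfolding Gamma by (rule Sring) simp
  let ?i = "%a (l::int list). a"
  have inj: "inj_on ?i (car Gamma)" by (auto simp: inj_on_def dest: fun_cong)
  note i = inj_imp_image_ring_iso[OF inj]
  have "inv_into (car Gamma) ?i : ring_iso (?L sigma 0) Gamma" for sigma using ring_iso_set_sym[OF Gamma.ring_axioms i] by simp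
  moreover have "ring (?L sigma 0)" for sigma using Gamma.inj_imp_image_ring_is_ring[OF inj] by simp
  moreover have "?c sigma 0 a .: (?L sigma 0)" "inv_into (car Gamma) ?i (?c sigma 0 a) = a" if "a : gsum (S 0)" for a sigma
   using ring_iso_memE(1)[OF i] inv_into_f_f[OF inj] that by (simp_all add: Gamma(2))
  ultimately show ?case unfolding Gamma(1)[symmetric] by (intro exI[of _ undefined] exI[of _ "inv_into (car Gamma) ?i"]) auto
 next
  case (Suc n)
  hence n: "n < r" "n <= r" by auto
  obtain sigma h where IH: "ALL m<n. sigma m : ring_iso (?L sigma m) (?L sigma m)" "ring (?L sigma n)"
   "h : ring_iso (?L sigma n) (D on gsum (S n))" "!!a. a : gsum (S 0) ==> ?c sigma n a .: (?L sigma n) & h (?c sigma n a) = a"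
   using Suc.IH[OF n(2)] by blast
  let ?u = "ev (g n)"
  let ?w = "%i::int. ?u [^]\<^bsub>units_of D\<^esub> i"
  note u = ev[OF gE[OF n(1)]]
  have gW: "g n .: W" using Evc[OF gE[OF n(1)]] .
  have upV: "?w i : V (g n [^]\<^sub>G i)" "?w i ~= \<zero>" for i
   unfolding G_def by (rule V_int_pow[OF gE[OF n(1)] u(1,2)])+
  interpret U: group "units_of D" by (rule A.units_group)
  have uU: "?u .: (units_of D)" using u by (simp add: units_of_carrier Units_eq)
  have up_add: "?w (i + j) = ?w i \<otimes> ?w j" for i j :: int
   using U.int_pow_mult[OF uU, of i j] by (simp add: units_of_mult)
  have gpw: "g n [^]\<^sub>G (i + j) = g n [^]\<^sub>G i \<otimes>\<^sub>W g n [^]\<^sub>G j" for i j :: int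
   using G.int_pow_mult[of "g n" i j] gE[OF n(1)] by simp
  interpret LR: ring "?L sigma n" by (rule IH(2))
  interpret X: skew_laurent_model D "?L sigma n" "gsum (S n)" "gsum (S (Suc n))" h ?u
  proof (intro skew_laurent_model.intro skew_field_axioms LR.ring_axioms skew_laurent_model_axioms.intro)
   show "?u .: D" "?u ~= \<zero>" by (rule u)+
   show "gsum (S n) <= car D" "gsum (S (Suc n)) <= car D" using gsum_closed[OF Sc] n Suc.prems by blast+
   show "h : ring_iso (?L sigma n) (D on gsum (S n))" by (rule IH(3))
   show "ring (D on gsum (S (Suc n)))" by (rule Sring[OF Suc.prems])
   fix a assume a: "a : gsum (S n)"
   show "?u \<otimes> a \<otimes> inv ?u : gsum (S n)" by (rule gsum_conj[OF Sc[OF n(2)] gW u(1,2) a])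
   have "inv ?u \<otimes> a \<otimes> inv (inv ?u) : gsum (S n)"
    by (rule gsum_conj[OF Sc[OF n(2)] _ V_inv[OF gW u(1,2)] _ a]) (use u gW in auto)
   thus "inv ?u \<otimes> a \<otimes> ?u : gsum (S n)" using inv_unique'[of "inv ?u" ?u] u by simp
  next
   fix a x and i :: int assume a: "a : gsum (S n)" and x: "x : gsum (S (Suc n))"
   have "?w i : gsum (S (Suc n))" by (rule gsum_V[OF Sc[OF Suc.prems] g_S[OF n(1)] upV(1)])
   thus "a \<otimes> ?w i \<oplus> x : gsum (S (Suc n))"
    using gsum_add[OF Sc[OF Suc.prems] gsum_mult[OF S_sub[OF Suc.prems] gsum_mono[OF a S_mono[OF n(1)]]] x] by blast
  next
   fix Z assume Z: "\<zero> : Z" "!!a i x. a : gsum (S n) ==> x : Z ==> a \<otimes> ?w i \<oplus> x : Z"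
   show "gsum (S (Suc n)) <= Z"
   proof
    fix x assume "x : gsum (S (Suc n))"
    with Sc[OF Suc.prems] show "x : Z"
    proof (induction rule: gsum_induct)
     case (step mu v x)
     obtain mu' k where m: "mu' : S n" "mu = mu' \<otimes>\<^sub>W g n [^]\<^sub>G (k::int)" using S_Suc[OF step(1) n(1)] by blast
     have mW: "mu' .: W" using m Sc[OF n(2)] by blast
     \<comment> \<open>The power of the eigenvector that matches the last generator is split off;
       what remains has weight in \<open>S n\<close> and is a coefficient.\<close>
     let ?a = "v \<otimes> ?w (- k)"
     have "?a : V (mu \<otimes>\<^sub>W g n [^]\<^sub>G (- k))" using V_mult[OF _ _ step(2) upV(1)] step(1) Sc[OF Suc.prems] Evc[OF pw[OF n(1)]] by blast
     also have "mu \<otimes>\<^sub>W g n [^]\<^sub>G (- k) = mu'"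
      unfolding m(2) using gpw[of k "- k"] mW Evc[OF pw[OF n(1)]] by (simp add: W.m_assoc)
     finally have a: "?a : gsum (S n)" by (rule gsum_V[OF Sc[OF n(2)] m(1)])
     have "?a \<otimes> ?w k = v" using up_add[of "- k" k, symmetric] Vc[OF step(2)] Vc[OF upV(1)] by (simp add: A.m_assoc units_of_one)
     thus ?case using Z(2)[OF a step(4), of k] by simp
    qed (rule Z)
   qed
  next
   fix I a and j :: int assume I: "finite I" "!!i. i : I ==> a i : gsum (S n)" "(\<Oplus>i\<in>I. a i \<otimes> ?w i) = \<zero>" and j: "j : I"
   have aW: "a i : gsum (car W)" if "i : I" for i using gsum_mono[OF I(2)[OF that] Sc[OF n(2)]] .
   have upW: "?w i : gsum (car W)" for i :: int by (rule gsum_V[OF subset_refl Evc[OF pw[OF n(1)]] upV(1)])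
   show "a j = \<zero>"
   proof (rule comp_eq_zero[OF aW[OF j]])
    fix mu assume m: "mu .: W"
    show "comp mu (a j) = \<zero>"
    proof (cases "mu : S n")
     case True
     \<comment> \<open>Only the summand with exponent \<open>j\<close> can contribute to this
       weight: another \<open>i\<close> would put the power \<open>j - i\<close> of the generator
       into \<open>S n\<close>.\<close>
     let ?nu = "mu \<otimes>\<^sub>W g n [^]\<^sub>G j"
     have gc: "g n [^]\<^sub>G i .: W" for i :: int using Evc[OF pw[OF n(1)]] .
     have t: "comp ?nu (a i \<otimes> ?w i) = (if i = j then comp mu (a j) \<otimes> ?w j else \<zero>)" if i: "i : I" for i
     proof -
      let ?rho = "mu \<otimes>\<^sub>W g n [^]\<^sub>G (j - i)"
      have "?nu = ?rho \<otimes>\<^sub>W g n [^]\<^sub>G i" using gpw[of "j - i" i] m gc by (simp add: W.m_assoc)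
      hence e: "comp ?nu (a i \<otimes> ?w i) = comp ?rho (a i) \<otimes> ?w i"
       using comp_rmult[OF gc upV(1) _ aW[OF i], of ?rho i] m gc by simp
      show ?thesis
      proof (cases "i = j")
       case True thus ?thesis using e m by simp
      next
       case False
       have "?rho ~: S n"
       proof
        assume "?rho : S n"
        hence "inv\<^bsub>W\<^esub> mu \<otimes>\<^sub>W ?rho : S n" using \<open>mu : S n\<close> S_sub[OF n(2)] subgroup.m_closed subgroup.m_inv_closed by metis
        hence "g n [^]\<^sub>G (j - i) : S n" using m gc by (simp add: W.m_assoc[symmetric])
        thus False using indep[OF n(1)] False by force
       qed
       thus ?thesis using e False comp_outside[OF Sc[OF n(2)] I(2)[OF i]] Vc[OF upV(1)] by simp
      qed
     qed
     have cc: "comp mu (a j) .: D" using Vc[OF comp_closed[OF aW[OF j] m]] .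
     have "\<zero> = comp ?nu (\<Oplus>i\<in>I. a i \<otimes> ?w i)" unfolding I(3) using comp_finsum[of "{}" _ ?nu] by simp
     also have "... = (\<Oplus>i\<in>I. comp ?nu (a i \<otimes> ?w i))"
      using comp_sum[OF I(1), of "%i. a i \<otimes> ?w i" ?nu] gsum_mult[OF W.subgroup_self aW upW] m gc by blast
     also have "... = (\<Oplus>i\<in>I. if i = j then comp mu (a j) \<otimes> ?w j else \<zero>)"
      using t cc Vc[OF upV(1)] by (intro M.finsum_cong') auto
     also have "... = comp mu (a j) \<otimes> ?w j"
      using M.finsum_singleton[OF j I(1), of "%_. comp mu (a j) \<otimes> ?w j"] cc Vc[OF upV(1)] by (simp add: eq_commute)
     finally show ?thesis using cc Vc[OF upV(1)] upV(2) by (metis no_zero_div)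
    qed (rule comp_outside[OF Sc[OF n(2)] I(2)[OF j]])
   qed
  qed
  define sigma' where "sigma' = sigma(n := X.tw)"
  have L: "?L sigma' m = ?L sigma m" "?c sigma' m = ?c sigma m" if "m <= n" for m
   using that iterated_skew_laurent_cong[of m sigma' sigma Gamma] iterated_skew_laurent_const_cong[of m sigma' sigma Gamma] by (auto simp: sigma'_def)
  have L': "?L sigma' (Suc n) = image_ring uncurry_exponent X.L" by (simp add: L) (simp add: sigma'_def)
  interpret XL: ring X.L by (rule X.ring_L)
  have inj: "inj_on uncurry_exponent (car X.L)" using inj_on_subset[OF uncurry_exponent_inj] by blast
  note i = inj_imp_image_ring_iso[OF inj]
  let ?h = "X.H \<circ> inv_into (car X.L) uncurry_exponent"
  have h': "?h : ring_iso (?L sigma' (Suc n)) (D on gsum (S (Suc n)))"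
   unfolding L' by (rule ring_iso_set_trans[OF ring_iso_set_sym[OF XL.ring_axioms i] X.H_iso])
  have c': "?c sigma' (Suc n) a .: (?L sigma' (Suc n)) & ?h (?c sigma' (Suc n) a) = a" if a: "a : gsum (S 0)" for a
  proof -
   let ?f = "%k::int. if k = 0 then ?c sigma n a else \<zero>\<^bsub>?L sigma n\<^esub>"
   have c: "?c sigma' (Suc n) a = uncurry_exponent ?f" using L[of n] by (simp cong: if_cong)
   note f = X.H_single[of "?c sigma n a" 0]
   have aD: "a .: D" using gsum_closed[OF Sc a] by simp
   have "?h (uncurry_exponent ?f) = X.H ?f" using inv_into_f_f[OF inj] f(1) IH(4)[OF a] by simp
   thus ?thesis unfolding c L' using f IH(4)[OF a] ring_iso_memE(1)[OF i] aD by simp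
  qed
  have "sigma' m : ring_iso (?L sigma' m) (?L sigma' m)" if "m < Suc n" for m
   using that IH(1) X.tw_iso L(1)[of m] by (cases "m = n") (auto simp: sigma'_def)
  moreover have "ring (?L sigma' (Suc n))" unfolding L' by (rule XL.inj_imp_image_ring_is_ring[OF inj])
  ultimately show ?case using h' c' by blast
 qed
 from this[OF order_refl] show ?thesis unfolding Sr Gamma(2) by blast
qed

end

section \<open>Eigenspaces of derivations and automorphisms\<close>

lemma comm_group_product:
 assumes "!!i. i : I ==> comm_group (G i)"
 shows "comm_group (product_group I G)"
proof (rule group.group_comm_groupI)
 show "Group.group (product_group I G)" using assms by (intro product_group comm_group.axioms(2))
 fix x y assume "x .: (product_group I G)" "y .: (product_group I G)"
 thus "x \<otimes>\<^bsub>product_group I G\<^esub> y = y \<otimes>\<^bsub>product_group I G\<^esub> x"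
  using comm_monoid.m_comm[OF comm_group.axioms(1)[OF assms]] by (auto simp: PiE_iff)
qed

text \<open>Derivations and automorphisms differ only in how eigenvalues of products and inverses
  combine, which is delegated to \<open>mult\<close> and \<open>inv\<close>. Weights are extensional
  on \<open>{..<t}\<close>, so two distinct ones are told apart by some operator; this gives
  independence of the eigenspaces.\<close>

lemma graded_eigenspaces:
 fixes D :: "('k, 'd, 'e) module_scheme" (structure) and K :: "('k, 'r) ring_scheme" and W :: "(nat => 'k) monoid"
 assumes "division_algebra K D" and "comm_group W" and W: "car W <= {..<t} \<rightarrow>\<^sub>E car K"
  and add: "!!i x y. i < t ==> x .: D ==> y .: D ==> delta i (x \<oplus> y) = delta i x \<oplus> delta i y"
  and smult: "!!i c x. i < t ==> c .: K ==> x .: D ==> delta i (c \<odot> x) = c \<odot> delta i x"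
  and one: "!!i. i < t ==> delta i \<one> = \<one>\<^sub>W i \<odot> \<one>"
  and mult: "!!i x y mu nu. i < t ==> x .: D ==> y .: D ==> mu .: W ==> nu .: W ==>
    delta i x = mu i \<odot> x ==> delta i y = nu i \<odot> y ==> delta i (x \<otimes> y) = (mu \<otimes>\<^sub>W nu) i \<odot> (x \<otimes> y)"
  and inv: "!!i x mu. i < t ==> x .: D ==> x ~= \<zero> ==> mu .: W ==>
    delta i x = mu i \<odot> x ==> delta i (inv x) = (inv\<^bsub>W\<^esub> mu) i \<odot> inv x"
 shows "graded D K W (eigenspace D t delta (car D))"
proof -
 interpret D: division_algebra K D by fact
 interpret W: comm_group W by fact
 let ?V = "eigenspace D t delta (car D)"
 have V: "x : ?V mu \<longleftrightarrow> x .: D & (ALL i<t. delta i x = mu i \<odot> x)" for x mu by (auto simp: eigenspace_def)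
 have mK: "mu i .: K" if "mu .: W" "i < t" for mu i using W that by auto
 have zero: "delta i \<zero> = \<zero>" if "i < t" for i
  using smult[OF that D.R.zero_closed D.M.zero_closed] add[OF that D.M.zero_closed D.M.zero_closed] one[OF that] smult[OF that _ D.A.one_closed, of "\<zero>\<^sub>K"]
   mK[OF W.one_closed that] by (simp add: D.smult_assoc1[symmetric])
 have Vs: "c \<odot> x : ?V mu" if "mu .: W" "c .: K" "x : ?V mu" for c x mu
  using that smult mK by (simp add: V D.smult_assoc1[symmetric] D.R.m_comm)
 have Va: "x \<oplus> y : ?V mu" if "mu .: W" "x : ?V mu" "y : ?V mu" for x y mu
  using that add mK by (simp add: V D.smult_r_distr)
 have direct: "ALL mu:A. f mu = \<zero>" if "finite A" "A <= car W" "!!mu. mu : A ==> f mu : ?V mu" "(\<Oplus>mu\<in>A. f mu) = \<zero>" for A f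
  using that
 proof (induction A arbitrary: f rule: finite_induct)
  case (insert nu A)
  have fc: "f mu .: D" if "mu : insert nu A" for mu using insert.prems(2)[OF that] V by blast
  have AW: "mu .: W" if "mu : insert nu A" for mu using insert.prems(1) that by blast
  have s: "(\<Oplus>mu\<in>insert nu A. f mu) = f nu \<oplus> (\<Oplus>mu\<in>A. f mu)" using insert(1,2) fc by (intro D.M.finsum_insert) auto
  have "f mu = \<zero>" if m: "mu : A" for mu
  proof -
   have "mu ~= nu" using m insert(2) by blast
   then obtain i where i: "i < t" "mu i ~= nu i"
    using AW[of mu] AW[of nu] m W PiE_ext[of mu "{..<t}" "%_. car K" nu] by auto
   \<comment> \<open>Applying \<open>delta i\<close> to the relation and subtracting
     \<open>nu i\<close> times it eliminates \<open>f nu\<close> and scales the other terms by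
     \<open>mu i - nu i\<close>, which is nonzero at the \<open>mu\<close> in question.\<close>
   let ?c = "%mu. mu i \<oplus>\<^sub>K \<ominus>\<^sub>K nu i"
   have nK: "nu i .: K" using mK[OF AW i(1)] by simp
   have cK: "?c mu .: K" "mu i .: K" if "mu : A" for mu using mK[OF AW i(1)] that nK by auto
   have d: "delta i (\<Oplus>mu\<in>B. f mu) = (\<Oplus>mu\<in>B. mu i \<odot> f mu)" if "B <= A" for B
    using finite_subset[OF that insert(1)] that
   proof (induction B rule: finite_induct)
    case (insert mu B)
    hence "delta i (f mu) = mu i \<odot> f mu" using insert.prems \<open>!!mu. mu : insert nu A ==> f mu : ?V mu\<close>[of mu] i by (auto simp: V)
    moreover have "f kappa .: D" "kappa i \<odot> f kappa .: D" if "kappa : insert mu B" for kappa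
     using insert.prems that fc cK(2) by (auto simp: subset_iff)
    ultimately show ?case using insert add[OF i(1)] by (simp add: Pi_def D.M.finsum_closed)
   qed (simp add: zero i)
   let ?S = "\<Oplus>mu\<in>A. f mu"
   have Sc: "?S .: D" using fc by (intro D.M.finsum_closed) auto
   have S: "?S = \<ominus> f nu" using insert.prems(3) s Sc fc D.M.minus_equality[of ?S "f nu"] D.M.a_comm by (metis insertI1)
   have "delta i ?S = nu i \<odot> ?S"
   proof -
    have "?S = (\<ominus>\<^sub>K \<one>\<^sub>K) \<odot> f nu" unfolding S using fc by (simp add: D.smult_l_minus)
    hence "?S : ?V nu" using Vs[OF AW _ insert.prems(2)] by simp
    thus ?thesis using i V by blast
   qed
   hence "(\<Oplus>mu\<in>A. mu i \<odot> f mu) \<oplus> (\<ominus>\<^sub>K nu i) \<odot> ?S = \<zero>"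
    using d[OF subset_refl] Sc nK by (simp add: D.smult_l_minus D.M.r_neg)
   also have "(\<ominus>\<^sub>K nu i) \<odot> ?S = (\<Oplus>mu\<in>A. (\<ominus>\<^sub>K nu i) \<odot> f mu)"
    using insert(1) nK fc by (intro D.finsum_smult_ldistr) auto
   also have "(\<Oplus>mu\<in>A. mu i \<odot> f mu) \<oplus> (\<Oplus>mu\<in>A. (\<ominus>\<^sub>K nu i) \<odot> f mu) = (\<Oplus>mu\<in>A. mu i \<odot> f mu \<oplus> (\<ominus>\<^sub>K nu i) \<odot> f mu)"
    using cK nK fc by (intro D.M.finsum_addf[symmetric]) auto
   also have "... = (\<Oplus>mu\<in>A. ?c mu \<odot> f mu)"
    using cK nK fc by (intro D.M.finsum_cong') (auto simp: D.smult_l_distr)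
   finally have "(\<Oplus>mu\<in>A. ?c mu \<odot> f mu) = \<zero>" .
   moreover have fV: "?c kappa \<odot> f kappa : ?V kappa" if "kappa : A" for kappa
    using Vs[OF AW cK(1)[OF that] insert.prems(2)] that by simp
   ultimately have "?c mu \<odot> f mu = \<zero>"
    using insert.IH[OF _ fV] insert.prems(1) m by blast
   moreover have "?c mu ~= \<zero>\<^sub>K" using i(2) cK[OF m] nK D.R.a_minus_eq_zero_iff[of "mu i" "nu i"] by (simp add: a_minus_def)
   hence "?c mu : Units K" using cK[OF m] D.R.field_Units by auto
   ultimately have "inv\<^bsub>K\<^esub> ?c mu \<odot> (?c mu \<odot> f mu) = \<zero>" by simp
   thus "f mu = \<zero>" using \<open>?c mu : Units K\<close> cK[OF m] fc[of mu] m by (simp add: D.smult_assoc1[symmetric])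
  qed
  moreover from this have "(\<Oplus>mu\<in>A. f mu) = (\<Oplus>mu\<in>A. \<zero>)" by (intro D.M.finsum_cong') auto
  hence "f nu = \<zero>" using insert.prems(3) s fc by simp
  ultimately show ?case by blast
 qed simp
 show ?thesis
 proof
  show "\<zero> : ?V mu" if "mu .: W" for mu using zero mK[OF that] by (simp add: V)
  show "\<ominus> x : ?V mu" if "mu .: W" "x : ?V mu" for x mu
   using Vs[OF that(1) _ that(2), of "\<ominus>\<^sub>K \<one>\<^sub>K"] that by (simp add: D.smult_l_minus V)
  show "\<one> : ?V \<one>\<^sub>W" using one by (simp add: V)
  show "x \<otimes> y : ?V (mu \<otimes>\<^sub>W nu)" if "mu .: W" "nu .: W" "x : ?V mu" "y : ?V nu" for x y mu nu
   using that mult by (simp add: V)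
  show "inv x : ?V (inv\<^bsub>W\<^esub> mu)" if "mu .: W" "x : ?V mu" "x ~= \<zero>" for x mu
   using that inv by (simp add: V)
  show "f mu = \<zero>" if "finite A" "A <= car W" "!!mu. mu : A ==> f mu : ?V mu" "(\<Oplus>mu\<in>A. f mu) = \<zero>" "mu : A" for A f mu
   using direct[OF that(1-4)] that(5) by blast
 qed (use Vs Va V in auto)
qed

lemma graded_derivations:
 fixes D :: "('k, 'd, 'e) module_scheme" (structure) and K :: "('k, 'r) ring_scheme"
 assumes "division_algebra K D" and delta: "!!i. i < t ==> K_derivation K D (delta i)"
 shows "graded D K (additive_weights K t) (eigenspace D t delta (car D))"
proof -
 interpret D: division_algebra K D by fact
 have W: "comm_group (additive_weights K t)" unfolding additive_weights_def
  by (rule comm_group_product) (rule D.R.a_comm_group)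
 have iW: "(inv\<^bsub>additive_weights K t\<^esub> mu) i = \<ominus>\<^sub>K mu i" if "mu .: (additive_weights K t)" "i < t" for mu i
  using that D.R.a_comm_group unfolding additive_weights_def by (subst inv_product_group) (auto simp: a_inv_def comm_group_def)
 have dc: "delta i x .: D" if "i < t" "x .: D" for i x using delta[OF that(1)] that by (auto simp: K_derivation_def)
 have leib: "delta i (x \<otimes> y) = delta i x \<otimes> y \<oplus> x \<otimes> delta i y" if "i < t" "x .: D" "y .: D" for i x y
  using delta[OF that(1)] that by (simp add: K_derivation_def)
 have mK: "mu i .: K" if "mu .: (additive_weights K t)" "i < t" for mu i
  using that by (auto simp: additive_weights_def)
 have one: "delta i \<one> = \<zero>" if "i < t" for i
  using leib[OF that, of "\<one>" "\<one>"] dc[OF that, of "\<one>"] D.M.add.l_cancel_one[of "delta i \<one>" "delta i \<one>"] by simp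
 show ?thesis
 proof (rule graded_eigenspaces[OF assms(1) W])
  fix i x y mu nu assume a: "i < t" "x .: D" "y .: D" "mu .: (additive_weights K t)" "nu .: (additive_weights K t)"
   "delta i x = mu i \<odot> x" "delta i y = nu i \<odot> y"
  thus "delta i (x \<otimes> y) = (mu \<otimes>\<^bsub>additive_weights K t\<^esub> nu) i \<odot> (x \<otimes> y)"
   using mK by (simp add: leib additive_weights_def D.smult_mult_left[symmetric] D.smult_mult_right[symmetric] D.smult_l_distr)
 next
  fix i x mu assume a: "i < t" "x .: D" "x ~= \<zero>" "mu .: (additive_weights K t)" "delta i x = mu i \<odot> x"
  let ?y = "inv x"
  have y: "?y .: D" "x \<otimes> ?y = \<one>" using a by auto
  have c: "mu i .: K" using mK a by simp
  have "delta i x \<otimes> ?y \<oplus> x \<otimes> delta i ?y = \<zero>" using leib[OF a(1,2) y(1)] y one[OF a(1)] by simp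
  hence "mu i \<odot> \<one> \<oplus> x \<otimes> delta i ?y = \<zero>" using a y c by (simp add: D.smult_mult_left[symmetric])
  hence e: "x \<otimes> delta i ?y = \<ominus> (mu i \<odot> \<one>)"
   using c a dc[OF a(1) y(1)] D.M.minus_equality[of "x \<otimes> delta i ?y" "mu i \<odot> \<one>"] by (simp add: D.M.a_comm)
  have "delta i ?y = ?y \<otimes> (x \<otimes> delta i ?y)" using a dc[OF a(1) y(1)] by simp
  also have "... = (\<ominus>\<^sub>K mu i) \<odot> ?y" unfolding e using c y by (simp add: D.smult_l_minus D.A.r_minus D.smult_mult_right[symmetric])
  finally show "delta i ?y = (inv\<^bsub>additive_weights K t\<^esub> mu) i \<odot> ?y" using iW[OF a(4,1)] by simp
 qed (use delta one in "auto simp: K_derivation_def additive_weights_def")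
qed

lemma graded_automorphisms:
 fixes D :: "('k, 'd, 'e) module_scheme" (structure) and K :: "('k, 'r) ring_scheme"
 assumes "division_algebra K D" and delta: "!!i. i < t ==> delta i : alg_iso K D D"
 shows "graded D K (multiplicative_weights K t) (eigenspace D t delta (car D))"
proof -
 interpret D: division_algebra K D by fact
 have U: "comm_group (units_of K)" by (rule D.R.units_comm_group)
 have W: "comm_group (multiplicative_weights K t)" unfolding multiplicative_weights_def
  by (rule comm_group_product) (rule U)
 have mU: "mu i : Units K" if "mu .: (multiplicative_weights K t)" "i < t" for mu i
  using that by (auto simp: multiplicative_weights_def units_of_carrier)
 have iW: "(inv\<^bsub>multiplicative_weights K t\<^esub> mu) i = inv\<^bsub>K\<^esub> mu i" if "mu .: (multiplicative_weights K t)" "i < t" for mu i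
  using that U mU[OF that] unfolding multiplicative_weights_def by (subst inv_product_group) (auto simp: D.R.units_of_inv comm_group_def)
 note h = alg_homD[of "delta _" K D D]
 have hom: "delta i : alg_hom K D D" if "i < t" for i using delta[OF that] by (simp add: alg_iso_def)
 show ?thesis
 proof (rule graded_eigenspaces[OF assms(1) W])
  fix i x y mu nu assume a: "i < t" "x .: D" "y .: D" "mu .: (multiplicative_weights K t)" "nu .: (multiplicative_weights K t)"
   "delta i x = mu i \<odot> x" "delta i y = nu i \<odot> y"
  have c: "mu i .: K" "nu i .: K" using mU[OF a(4,1)] mU[OF a(5,1)] by auto
  have "delta i (x \<otimes> y) = (mu i \<odot> x) \<otimes> (nu i \<odot> y)" using h(3)[OF hom[OF a(1)] a(2,3)] a by simp
  also have "... = (mu i \<otimes>\<^sub>K nu i) \<odot> (x \<otimes> y)" using a c by (simp add: D.smult_mult_left[symmetric] D.smult_mult_right[symmetric] D.smult_assoc1[symmetric] D.R.m_comm)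
  finally show "delta i (x \<otimes> y) = (mu \<otimes>\<^bsub>multiplicative_weights K t\<^esub> nu) i \<odot> (x \<otimes> y)"
   using a(1) by (simp add: multiplicative_weights_def units_of_mult)
 next
  fix i x mu assume a: "i < t" "x .: D" "x ~= \<zero>" "mu .: (multiplicative_weights K t)" "delta i x = mu i \<odot> x"
  let ?y = "inv x"
  have y: "?y .: D" "x \<otimes> ?y = \<one>" using a by auto
  have c: "mu i : Units K" "mu i .: K" "inv\<^bsub>K\<^esub> mu i .: K" using mU[OF a(4,1)] by auto
  have dy: "delta i ?y .: D" using h(1)[OF hom[OF a(1)] y(1)] .
  have "(mu i \<odot> x) \<otimes> delta i ?y = \<one>" using h(3)[OF hom[OF a(1)] a(2) y(1)] h(4)[OF hom[OF a(1)]] y a(5) by simp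
  hence "inv\<^bsub>K\<^esub> mu i \<odot> (mu i \<odot> (x \<otimes> delta i ?y)) = inv\<^bsub>K\<^esub> mu i \<odot> \<one>" using a c dy by (simp add: D.smult_mult_left[symmetric])
  hence e: "x \<otimes> delta i ?y = inv\<^bsub>K\<^esub> mu i \<odot> \<one>" using a c dy by (simp add: D.smult_assoc1[symmetric])
  have "delta i ?y = ?y \<otimes> (x \<otimes> delta i ?y)" using a dy by simp
  also have "... = inv\<^bsub>K\<^esub> mu i \<odot> ?y" unfolding e using c y by (simp add: D.smult_mult_right[symmetric])
  finally show "delta i ?y = (inv\<^bsub>multiplicative_weights K t\<^esub> mu) i \<odot> ?y" using iW[OF a(4,1)] by simp
 next
  show "car (multiplicative_weights K t) <= {..<t} \<rightarrow>\<^sub>E car K"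
   by (auto simp: multiplicative_weights_def units_of_carrier PiE_iff)
 qed (use h[OF hom] in "auto simp: multiplicative_weights_def units_of_one")
qed

section \<open>Invariance of the fractions under the operators\<close>

context graded begin

lemma gsum_invariant:
 assumes F: "subgroup F W" and add: "!!x y. x .: D ==> y .: D ==> d (x \<oplus> y) = d x \<oplus> d y"
  and V: "!!mu v. mu : F ==> v : V mu ==> d v : V mu" and x: "x : gsum F"
 shows "d x : gsum F"
 using subgroup.subset[OF F] x
proof (induction rule: gsum_induct)
 case zero
 have "d \<zero> .: D" using V[OF subgroup.one_closed[OF F] V_zero[OF W.one_closed]] Vc by blast
 thus ?case using add[of \<zero> \<zero>] gsum_zero M.add.r_cancel_one[of "d \<zero>" "d \<zero>"] by simp
qed (use V gsum_step gsum_closed subgroup.subset[OF F] in "simp add: add Vc")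

end

text \<open>The Leibniz rule for \<open>u q\<close> expresses \<open>d q\<close> through
  \<open>u^-1\<close>, \<open>d u\<close>, \<open>q\<close> and \<open>d (u q)\<close>, all of which
  are fractions.\<close>

lemma (in division_algebra) derivation_fractions:
 assumes R: "unital_subalgebra K A R" and noeth: "noeth_domain (A on R)"
  and d: "K_derivation K A d" and inv: "!!x. x : R ==> d x : R" and q: "q : fractions_in A R"
 shows "d q : fractions_in A R"
proof -
 let ?Q = "fractions_in A R"
 note Q = fractions_division_subalgebra[OF R noeth]
 note QD = div_subringD[OF conjunct1[OF Q[unfolded division_subalgebra_iff]]]
 have sub: "R <= ?Q" by (rule unital_subset_fractions[OF R])
 obtain u where u: "q .: A" "u : R" "u ~= \<zero>\<^sub>A" "u \<otimes>\<^sub>A q : R" using q unfolding fractions_in_iff[OF R] by blast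
 have c: "u .: A" "d u .: A" "d q .: A" using u unital_subalgebraD(1)[OF R] d by (auto simp: K_derivation_def)
 have "d (u \<otimes>\<^sub>A q) = d u \<otimes>\<^sub>A q \<oplus>\<^sub>A u \<otimes>\<^sub>A d q" using d u c by (simp add: K_derivation_def)
 hence "\<ominus>\<^sub>A (d u \<otimes>\<^sub>A q) \<oplus>\<^sub>A d (u \<otimes>\<^sub>A q) = u \<otimes>\<^sub>A d q" using c u by (simp add: M.r_neg1)
 hence "d q = inv\<^bsub>A\<^esub> u \<otimes>\<^sub>A (\<ominus>\<^sub>A (d u \<otimes>\<^sub>A q) \<oplus>\<^sub>A d (u \<otimes>\<^sub>A q))" using c u by simp
 also have "... : ?Q"
  by (rule QD(5)[OF division_subalgebra_inv(1)[OF Q subsetD[OF sub u(2)] u(3)]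
   QD(4)[OF QD(6)[OF QD(5)[OF subsetD[OF sub inv[OF u(2)]] q]] subsetD[OF sub inv[OF u(4)]]]])
 finally show ?thesis .
qed

text \<open>\<open>d u\<close> is a denominator of \<open>d q\<close>; it is nonzero because
  \<open>d\<close> preserves the relation between \<open>u\<close> and its inverse.\<close>

lemma (in division_algebra) automorphism_fractions:
 assumes R: "unital_subalgebra K A R"
  and d: "d : alg_iso K A A" and inv: "!!x. x : R ==> d x : R" and q: "q : fractions_in A R"
 shows "d q : fractions_in A R"
proof -
 have h: "d : alg_hom K A A" and b: "bij_betw d (car A) (car A)" using d by (auto simp: alg_iso_def ring_iso_def)
 obtain u where u: "q .: A" "u : R" "u ~= \<zero>\<^sub>A" "u \<otimes>\<^sub>A q : R" using q unfolding fractions_in_iff[OF R] by blast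
 have c: "u .: A" using u unital_subalgebraD(1)[OF R] by blast
 have "d u \<otimes>\<^sub>A d (inv\<^bsub>A\<^esub> u) = \<one>\<^sub>A" using alg_homD(3)[OF h c, of "inv\<^bsub>A\<^esub> u"] alg_homD(4)[OF h] c u by simp
 hence "d u ~= \<zero>\<^sub>A" using alg_homD(1)[OF h, of "inv\<^bsub>A\<^esub> u"] c u one_nonzero by (metis A.l_null inv_nz(1))
 moreover have "d u \<otimes>\<^sub>A d q : R" using inv[OF u(4)] alg_homD(3)[OF h c u(1)] by simp
 ultimately show ?thesis unfolding fractions_in_iff[OF R] using alg_homD(1)[OF h u(1)] inv[OF u(2)] by blast
qed

theorem corollary3p4:
  fixes K :: "('k, 'r) ring_scheme"
    and \<gg> :: "('k, 'g, 'c) module_scheme"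
    and br :: "'g \<Rightarrow> 'g \<Rightarrow> 'g"
    and D :: "('k, 'd, 'e) module_scheme"
    and \<iota> :: "('g list \<Rightarrow> 'k) set set \<Rightarrow> 'd"
  assumes "lie_algebra K \<gg> br"
    and "\<exists>n. has_dim (carrier K) (\<odot>\<^bsub>\<gg>\<^esub>) \<gg> n"
    and "quotient_division_algebra K (enveloping_algebra K \<gg> br) D \<iota>"
  shows
    "alg_iso K (tensor_product K D (opposite_algebra D)) (tensor_product K D D) \<noteq> {} \<and>
     noeth_domain (tensor_product K D (opposite_algebra D)) \<and>
     ascending_chain_condition (division_subalgebra K D) \<and>
     (\<forall>E. division_subalgebra K D E \<longrightarrow> fin_gen_division_algebra K (D\<lparr>carrier := E\<rparr>)) \<and>
     (\<forall>(t::nat) \<delta> W.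
        (\<forall>i<t. \<forall>j<t. \<forall>x\<in>carrier D. \<delta> i (\<delta> j x) = \<delta> j (\<delta> i x)) \<and>
        ((\<forall>i<t. K_derivation K D (\<delta> i)) \<and> W = additive_weights K t \<or>
         (\<forall>i<t. \<delta> i \<in> alg_iso K D D) \<and> W = multiplicative_weights K t) \<longrightarrow>
        (let Ev = eigenvalues D t \<delta> W (carrier D);
             G = W\<lparr>carrier := Ev\<rparr>;
             T = torsion_part G;
             D\<^sub>0 = eigenspace D t \<delta> (carrier D) \<one>\<^bsub>W\<^esub>;
             D\<^sub>T = eigen_sum D t \<delta> T;
             \<Gamma> = D\<lparr>carrier := D\<^sub>T\<rparr>;
             D\<^sub>\<Delta> = D\<lparr>carrier := eigen_sum D t \<delta> Ev\<rparr>
         in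
           comm_group G \<and> fin_gen_group G \<and>
           subgroup T G \<and> finite T \<and>
           (\<exists>r. has_rank G r \<and>
             (\<exists>\<phi>\<in>iso ((G\<lparr>carrier := T\<rparr>) \<times>\<times> product_group {..<r} (\<lambda>_. integer_group)) G.
                \<forall>\<tau>\<in>T. \<phi> (\<tau>, \<one>\<^bsub>product_group {..<r} (\<lambda>_. integer_group)\<^esub>) = \<tau>) \<and>
             (\<exists>\<sigma>. (\<forall>n<r. \<sigma> n \<in> ring_iso (iterated_skew_laurent \<Gamma> \<sigma> n) (iterated_skew_laurent \<Gamma> \<sigma> n)) \<and>
                (\<exists>h\<in>ring_iso (iterated_skew_laurent \<Gamma> \<sigma> r) D\<^sub>\<Delta>.
                   \<forall>a\<in>D\<^sub>T. h (iterated_skew_laurent_const \<Gamma> \<sigma> r a) = a))) \<and>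
           eigen_sum_direct D t \<delta> Ev \<and>
           noeth_domain D\<^sub>\<Delta> \<and>
           division_subalgebra K D D\<^sub>0 \<and>
           division_subalgebra K D D\<^sub>T \<and>
           has_dim D\<^sub>0 (\<lambda>a x. a \<otimes>\<^bsub>D\<^esub> x) \<Gamma> (card T) \<and>
           has_dim D\<^sub>0 (\<lambda>a x. x \<otimes>\<^bsub>D\<^esub> a) \<Gamma> (card T) \<and>
           (\<forall>F. subgroup F G \<longrightarrow>
             (let R = eigen_sum D t \<delta> F; Q = fractions_in D R in
                noeth_domain (D\<lparr>carrier := R\<rparr>) \<and>
                division_subalgebra K D Q \<and>
                quotient_division_algebra K (D\<lparr>carrier := R\<rparr>) (D\<lparr>carrier := Q\<rparr>) id \<and>
                (\<forall>i<t. \<delta> i ` Q \<subseteq> Q) \<and>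
                eigenvalues D t \<delta> W Q = F \<and>
                (\<forall>\<nu>\<in>carrier W. \<forall>v\<in>eigenspace D t \<delta> Q \<nu>. v \<noteq> \<zero>\<^bsub>D\<^esub> \<longrightarrow>
                   \<nu> \<in> F \<and>
                   (\<exists>\<mu>\<in>F. \<exists>u\<in>eigenspace D t \<delta> (carrier D) \<mu>.
                      \<exists>w\<in>eigenspace D t \<delta> (carrier D) (\<nu> \<otimes>\<^bsub>W\<^esub> \<mu>).
                        u \<noteq> \<zero>\<^bsub>D\<^esub> \<and> v = inv\<^bsub>D\<^esub> u \<otimes>\<^bsub>D\<^esub> w))))))"
proof -
 interpret L: lie_algebra K \<gg> br by fact
 obtain n where n: "has_dim (car K) (\<odot>\<^bsub>\<gg>\<^esub>) \<gg> n" using assms(2) by blast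
 obtain b coord where lb: "lie_basis K \<gg> br n b coord" by (rule L.lie_basis_exists[OF n])
 have div: "division_algebra K D" using assms(3) by (simp add: quotient_division_algebra_def)
 have "env_fractions K \<gg> br n b coord D \<iota>"
  by (intro env_fractions.intro lb fraction_algebra.intro div fraction_algebra_axioms.intro assms(3) L.UU.assoc_algebra_axioms)
 then interpret E: env_fractions K \<gg> br n b coord D \<iota> .
 note acc = E.acc_division_subalgebras
 show ?thesis
 proof (intro conjI allI impI, goal_cases)
  case (4 E)
  thus ?case by (rule division_algebra.acc_imp_fin_gen[OF div acc])
 next
  case (5 t \<delta> W)
  note a = 5
  let ?V = "eigenspace D t \<delta> (car D)"
  \<comment> \<open>From here on both kinds of operators are treated through the grading; they are
    told apart again only for the invariance of the fractions.\<close>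
  have g: "graded D K W ?V"
   using a graded_derivations[OF div, of t \<delta>] graded_automorphisms[OF div, of t \<delta>] by blast
  interpret graded D K W ?V by (rule g)
  have geq: "eigen_sum D t \<delta> F = gsum F" for F by (simp add: eigen_sum_def gsum_def)
  have inv: "ALL i<t. \<delta> i ` fractions_in D (gsum F) <= fractions_in D (gsum F)"
   if F: "subgroup F W" and noeth: "noeth_domain (D on gsum F)" for F
  proof (intro allI impI image_subsetI)
   fix i q assume i: "i < t" and q: "q : fractions_in D (gsum F)"
   note R = gsum_subalgebra[OF F] and Fc = subgroup.subset[OF F]
   have V: "\<delta> i v : ?V \<mu>" if "\<mu> : F" "v : ?V \<mu>" for \<mu> v
   proof -
    have m: "\<mu> .: W" using that Fc by blast
    hence "\<mu> i .: K"
     using a i by (auto simp: additive_weights_def multiplicative_weights_def units_of_carrier PiE_iff Units_def)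
    thus ?thesis using V_smult[OF m _ that(2)] that(2) i by (simp add: eigenspace_def)
   qed
   from a show "\<delta> i q : fractions_in D (gsum F)"
   proof (elim conjE disjE)
    assume "ALL i<t. K_derivation K D (\<delta> i)"
    hence d: "K_derivation K D (\<delta> i)" using i by blast
    have "\<delta> i x : gsum F" if "x : gsum F" for x
     by (rule gsum_invariant[of F "\<delta> i" x, OF F _ V that]) (use d in "auto simp: K_derivation_def")
    thus ?thesis by (rule division_algebra.derivation_fractions[OF div R noeth d _ q])
   next
    assume "ALL i<t. \<delta> i : alg_iso K D D"
    hence d: "\<delta> i : alg_iso K D D" using i by blast
    hence h: "\<delta> i : alg_hom K D D" by (simp add: alg_iso_def)
    have "\<delta> i x : gsum F" if "x : gsum F" for x
     by (rule gsum_invariant[of F "\<delta> i" x, OF F alg_homD(2)[OF h] V that])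
    thus ?thesis by (rule division_algebra.automorphism_fractions[OF div R d _ q])
   qed
  qed
  let ?G = "W on Ev"
  have Eeq: "eigenvalues D t \<delta> W (car D) = Ev" by (simp add: eigenvalues_def Ev_def)
  interpret G: comm_group ?G by (rule W.comm_subgroup[OF subgroup_Ev])
  have fg: "fin_gen_group (W on F)" if "subgroup F W" "F <= Ev" for F by (rule subgroup_fin_gen[OF acc that])
  have fgG: "fin_gen_group ?G" by (rule fg[OF subgroup_Ev subset_refl])
  obtain r g \<kappa> where dec: "finite G.TT" "ALL i<r. g i .: ?G"
    "ALL x:car ?G. EX \<tau>:G.TT. x = \<tau> \<otimes>\<^sub>?G G.gprod {..<r} g (\<kappa> x)"
    "ALL \<tau>:G.TT. ALL k. ALL i<r. \<kappa> (\<tau> \<otimes>\<^sub>?G G.gprod {..<r} g k) i = k i" and rank: "has_rank ?G r"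
    and iso: "EX \<phi>:iso ((?G on G.TT) \<times>\<times> product_group {..<r} (%_. integer_group)) ?G.
    ALL \<tau>:G.TT. \<phi> (\<tau>, \<one>\<^bsub>product_group {..<r} (%_. integer_group)\<^esub>) = \<tau>"
   using G.fin_gen_decomposition[OF fgG] by blast
  have T: "subgroup G.TT W" by (rule W.incl_subgroup[OF subgroup_Ev G.subgroup_torsion])
  have TE: "G.TT <= Ev" using G.torsion_subset by simp
  have laurent: "EX \<sigma>. (ALL n<r. \<sigma> n : ring_iso (iterated_skew_laurent (D on gsum G.TT) \<sigma> n) (iterated_skew_laurent (D on gsum G.TT) \<sigma> n)) &
   (EX h:ring_iso (iterated_skew_laurent (D on gsum G.TT) \<sigma> r) (D on gsum Ev).
    ALL a:gsum G.TT. h (iterated_skew_laurent_const (D on gsum G.TT) \<sigma> r a) = a)"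
   using iterated_laurent[of r g \<kappa>] dec by simp
  have direct: "eigen_sum_direct D t \<delta> Ev" unfolding eigen_sum_direct_def
   using V_direct subgroup.subset[OF subgroup_Ev] by (meson subset_trans)
  have part4: "noeth_domain (D on gsum F)" "division_subalgebra K D (fractions_in D (gsum F))"
    "quotient_division_algebra K (D on gsum F) (D on fractions_in D (gsum F)) id"
    "ALL i<t. \<delta> i ` fractions_in D (gsum F) <= fractions_in D (gsum F)"
    "eigenvalues D t \<delta> W (fractions_in D (gsum F)) = F"
    "ALL \<nu>:car W. ALL v:eigenspace D t \<delta> (fractions_in D (gsum F)) \<nu>. v ~= \<zero>\<^sub>D -->
     \<nu> : F & (EX \<mu>:F. EX u:?V \<mu>. EX w:?V (\<nu> \<otimes>\<^sub>W \<mu>). u ~= \<zero>\<^sub>D & v = inv\<^bsub>D\<^esub> u \<otimes>\<^sub>D w)"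
   if FG: "subgroup F ?G" for F
  proof -
   have F: "subgroup F W" "F <= Ev" using W.incl_subgroup[OF subgroup_Ev FG] subgroup.subset[OF FG] by auto
   note R = gsum_subalgebra[OF F(1)]
   show noeth: "noeth_domain (D on gsum F)" by (rule gsum_noeth[OF F fg[OF F]])
   let ?Q = "fractions_in D (gsum F)"
   show "division_subalgebra K D ?Q" by (rule E.FD.fractions_division_subalgebra[OF R noeth])
   show "quotient_division_algebra K (D on gsum F) (D on ?Q) id" by (rule E.FD.fractions_quotient[OF R noeth])
   show "ALL i<t. \<delta> i ` ?Q <= ?Q" by (rule inv[OF F(1) noeth])
   have Qc: "?Q <= car D" using E.FD.fractions_in_iff[OF R] by blast
   have QV: "v : eigenspace D t \<delta> ?Q \<nu> \<longleftrightarrow> v : ?Q & v : ?V \<nu>" for v \<nu> using Qc by (auto simp: eigenspace_def)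
   have inF: "\<nu> : F" if "\<nu> .: W" "v : eigenspace D t \<delta> ?Q \<nu>" "v ~= \<zero>\<^sub>D" for v \<nu>
    using fraction_eigenvalue[OF F(1) _ _ that(1,3)] that(2) QV by blast
   have "\<mu> : eigenvalues D t \<delta> W ?Q" if "\<mu> : F" for \<mu>
   proof -
    have m: "\<mu> : Ev" "\<mu> .: W" using that F subgroup.mem_carrier[OF F(1)] by auto
    hence "ev \<mu> : ?Q" using gsum_V[OF subgroup.subset[OF F(1)] that] ev E.FD.unital_subset_fractions[OF R] by blast
    thus ?thesis using ev[OF m(1)] m(2) QV unfolding eigenvalues_def by blast
   qed
   thus "eigenvalues D t \<delta> W ?Q = F" using inF unfolding eigenvalues_def by blast
   show "ALL \<nu>:car W. ALL v:eigenspace D t \<delta> ?Q \<nu>. v ~= \<zero>\<^sub>D -->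
     \<nu> : F & (EX \<mu>:F. EX u:?V \<mu>. EX w:?V (\<nu> \<otimes>\<^sub>W \<mu>). u ~= \<zero>\<^sub>D & v = inv\<^bsub>D\<^esub> u \<otimes>\<^sub>D w)"
   proof (intro ballI impI conjI)
    fix \<nu> v assume n: "\<nu> .: W" and v: "v : eigenspace D t \<delta> ?Q \<nu>" "v ~= \<zero>\<^sub>D"
    show "\<nu> : F" by (rule inF[OF n v])
    \<comment> \<open>An eigenvector among the fractions already lies in the eigenspace of
      \<open>D\<close> for a weight in \<open>F\<close>, so the denominator 1, of trivial weight,
      serves.\<close>
    have "v : ?V (\<nu> \<otimes>\<^sub>W \<one>\<^sub>W)" "v .: D" using v QV n Vc by auto
    moreover have "inv\<^bsub>D\<^esub> \<one>\<^sub>D \<otimes>\<^sub>D v = v" using \<open>v .: D\<close> E.FD.inv_unique'[of "\<one>\<^sub>D" "\<one>\<^sub>D"] by simp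
    ultimately show "EX \<mu>:F. EX u:?V \<mu>. EX w:?V (\<nu> \<otimes>\<^sub>W \<mu>). u ~= \<zero>\<^sub>D & v = inv\<^bsub>D\<^esub> u \<otimes>\<^sub>D w"
     using V_one subgroup.one_closed[OF F(1)] E.FD.one_nonzero by metis
   qed
  qed
  show ?case unfolding Let_def Eeq geq
   by (intro conjI exI[of _ r] rank iso laurent G.comm_group_axioms fgG G.subgroup_torsion dec(1) direct
     gsum_noeth[OF subgroup_Ev subset_refl fgG] V_one_division_subalgebra
     finite_sum_division[OF T dec(1) TE] finite_sum_dim[OF T dec(1) TE] finite_sum_dim_right[OF T dec(1) TE])
    (rule allI, rule impI, intro conjI, (rule part4, assumption)+)
 qed (rule E.tensor_iso E.noeth_domain_tensor acc)+
qed

end
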